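(* In $\mathsf{THS}$: (1) There exists a thin class which is a field of real numbers. (2) In every field of real numbers the prime subfield (which is isomorphic to the field $\mathbb{SQ}$ of standard rationals) is dense. (3) Any two fields of real numbers are isomorphic.
   Context: $\mathsf{THS}$ is a first-order theory in the language with the single binary predicate $\in$; its objects are classes; sets are classes that are members of classes. Axioms: (Ext) extensionality for classes; (Class) comprehension $\exists Y\forall y(y\in Y\leftrightarrow\Phi(y,\vec X))$ for arbitrary formulas $\Phi$, $y$ ranging over sets; (Set) $\emptyset$ and $x\cup\{y\}$ are sets; (Ind) induction $\varphi(\emptyset)\wedge\forall x,y(\varphi(x)\wedge\varphi(y)\to\varphi(x\cup\{y\}))\to\forall x\varphi(x)$ for set formulas $\varphi$ (formulas with quantifiers over sets only and no class variables). A class $X$ is small iff every subclass of it is a set; thin iff each of its subsets is small. (Thin) thin classes are subclasses of sets; (Comp) for thin $X$ and a set $u\subseteq\bigcup X$ there is a set $x\subseteq X$ with $u\subseteq\bigcup x$; (Exp) for every thin $X$ there is thin $P$ with $\forall y\exists p\in P(y\cap X=p\cap X)$; (Choice) a class with thin domain has a function subclass with the same domain; (DC) dependent choices along the class $\mathbb{SN}$ (the smallest class containing $\emptyset$ closed under $n\mapsto n\cup\{n\}$) for arbitrary formulas; (T) transfer of set formulas to the class $\mathbb{S}$ of standard sets (the smallest class containing $\emptyset$ closed under $(a,b)\mapsto a\cup\{b\}$). Natural numbers are transitive sets linearly ordered by $\in$; $\mathbb{Q}$ is the field of rationals built from them (as reduced fractions of integers), and $\mathbb{SQ}=\mathbb{Q}\cap\mathbb{S}$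 is its subfield of standard elements. A field of real numbers is a class $\langle R;+,\cdot,\le\rangle$ satisfying the axioms of a linearly ordered field and the completeness property: every bounded above subclass of $R$ has a supremum. *)

theory Defs
  imports "HOL-Algebra.Subrings" "HOL-Algebra.QuotRing"
begin

(* Formulas of the first-order language with the single binary predicate "in" and equality,
   with named variables. *)
datatype fm =
    Mem nat nat
  | Eq nat nat
  | Neg fm
  | Conj fm fm
  | Exists nat fm

(* A structure for this language: the type 'c is the universe of classes. *)
locale class_structure =
  fixes mem :: "'c \<Rightarrow> 'c \<Rightarrow> bool"
begin

definition elts :: "'c \<Rightarrow> 'c set" where
  "elts X = {x. mem x X}"

definition V :: "'c set" where
  "V = {x. \<exists>X. x \<in> elts X}"

(* Satisfaction with the quantifiers ranging over D.  With D = UNIV this is satisfaction of class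
   formulas; with D = V and parameters in V, of set formulas; with D = S and parameters in S, of
   set formulas relativized to S. *)
primrec sat :: "'c set \<Rightarrow> fm \<Rightarrow> (nat \<Rightarrow> 'c) \<Rightarrow> bool" where
  "sat D (Mem i j) s \<longleftrightarrow> s i \<in> elts (s j)"
| "sat D (Eq i j) s \<longleftrightarrow> s i = s j"
| "sat D (Neg \<phi>) s \<longleftrightarrow> \<not> sat D \<phi> s"
| "sat D (Conj \<phi> \<psi>) s \<longleftrightarrow> sat D \<phi> s \<and> sat D \<psi> s"
| "sat D (Exists i \<phi>) s \<longleftrightarrow> (\<exists>a\<in>D. sat D \<phi> (s(i := a)))"

(* The values of the descriptions (THE) matter only where extensionality, comprehension and the
   set axioms guarantee a unique value; adjoin and pair are meant for sets, app F for the domain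
   of a function F. *)

definition emp :: 'c where
  "emp = (THE e. elts e = {})"

definition adjoin :: "'c \<Rightarrow> 'c \<Rightarrow> 'c" where
  "adjoin x y = (THE w. elts w = insert y (elts x))"

definition succ :: "'c \<Rightarrow> 'c" where
  "succ n = adjoin n n"

definition upair :: "'c \<Rightarrow> 'c \<Rightarrow> 'c" where
  "upair x y = (THE w. elts w = {x, y})"

definition pair :: "'c \<Rightarrow> 'c \<Rightarrow> 'c" where
  "pair x y = upair (upair x x) (upair x y)"

definition graph :: "'c \<Rightarrow> ('c \<times> 'c) set" where
  "graph F = {(x, y). x \<in> V \<and> y \<in> V \<and> pair x y \<in> elts F}"

definition is_relation :: "'c \<Rightarrow> bool" where
  "is_relation F \<longleftrightarrow> elts F = (\<lambda>(x, y). pair x y) ` graph F"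

definition is_function :: "'c \<Rightarrow> bool" where
  "is_function F \<longleftrightarrow> is_relation F \<and> single_valued (graph F)"

definition app :: "'c \<Rightarrow> 'c \<Rightarrow> 'c" where
  "app F x = (THE y. (x, y) \<in> graph F)"

definition small :: "'c \<Rightarrow> bool" where
  "small X \<longleftrightarrow> (\<forall>Y. elts Y \<subseteq> elts X \<longrightarrow> Y \<in> V)"

definition thin :: "'c \<Rightarrow> bool" where
  "thin X \<longleftrightarrow> (\<forall>u\<in>V. elts u \<subseteq> elts X \<longrightarrow> small u)"

definition SN :: "'c set" where
  "SN = \<Inter> {elts X | X. emp \<in> elts X \<and> (\<forall>n\<in>elts X. succ n \<in> elts X)}"

definition S :: "'c set" where
  "S = \<Inter> {elts X | X. emp \<in> elts X \<and> (\<forall>a\<in>elts X. \<forall>b\<in>elts X. adjoin a b \<in> elts X)}"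

end

(* Models of THS.  The schemata range over the formulas of the language, with arbitrary parameters
   given by the assignment s; "mem" need not satisfy the full second-order schemata. *)
locale THS = class_structure mem for mem :: "'c \<Rightarrow> 'c \<Rightarrow> bool" +
  assumes Ext: "\<And>X Y. (\<forall>z. z \<in> elts X \<longleftrightarrow> z \<in> elts Y) \<Longrightarrow> X = Y"
    and Class: "\<And>\<Phi> s. \<exists>Y. \<forall>y\<in>V. y \<in> elts Y \<longleftrightarrow> sat UNIV \<Phi> (s(0 := y))"
    and Set_emp: "emp \<in> V"
    and Set_adjoin: "\<And>x y. x \<in> V \<Longrightarrow> y \<in> V \<Longrightarrow> adjoin x y \<in> V"
    and Ind: "\<And>\<phi> s. range s \<subseteq> V \<Longrightarrow> sat V \<phi> (s(0 := emp)) \<Longrightarrow>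
      (\<forall>x\<in>V. \<forall>y\<in>V. sat V \<phi> (s(0 := x)) \<and> sat V \<phi> (s(0 := y)) \<longrightarrow> sat V \<phi> (s(0 := adjoin x y))) \<Longrightarrow>
      \<forall>x\<in>V. sat V \<phi> (s(0 := x))"
    and Thin: "\<And>X. thin X \<Longrightarrow> \<exists>u\<in>V. elts X \<subseteq> elts u"
    and Comp: "\<And>X u. thin X \<Longrightarrow> u \<in> V \<Longrightarrow> elts u \<subseteq> (\<Union>y\<in>elts X. elts y) \<Longrightarrow>
      \<exists>x\<in>V. elts x \<subseteq> elts X \<and> elts u \<subseteq> (\<Union>y\<in>elts x. elts y)"
    and Exp: "\<And>X. thin X \<Longrightarrow>
      \<exists>P. thin P \<and> (\<forall>y\<in>V. \<exists>p\<in>elts P. elts y \<inter> elts X = elts p \<inter> elts X)"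
    and Choice: "\<And>X D. elts D = Domain (graph X) \<Longrightarrow> thin D \<Longrightarrow>
      \<exists>F. is_function F \<and> elts F \<subseteq> elts X \<and> Domain (graph F) = Domain (graph X)"
    and DC: "\<And>\<Phi> s. \<forall>x\<in>V. \<exists>y\<in>V. sat UNIV \<Phi> (s(0 := x, 1 := y)) \<Longrightarrow>
      \<forall>x\<in>V. \<exists>F. is_function F \<and> Domain (graph F) = SN \<and> app F emp = x \<and>
        (\<forall>n\<in>SN. sat UNIV \<Phi> (s(0 := app F n, 1 := app F (succ n))))"
    and Transfer: "\<And>\<phi> s. range s \<subseteq> S \<Longrightarrow> sat V \<phi> s \<longleftrightarrow> sat S \<phi> s"

context class_structure
begin

definition NN :: "'c set" where
  "NN = {n \<in> V. (\<forall>x\<in>elts n. elts x \<subseteq> elts n) \<and>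
     strict_linear_order_on (elts n) {(x, y). x \<in> elts n \<and> y \<in> elts n \<and> x \<in> elts y}}"

(* Value at n of the function with f 0 = a and f (k + 1) = h (f k), computed by a set. *)
definition nat_rec :: "'c \<Rightarrow> ('c \<Rightarrow> 'c) \<Rightarrow> 'c \<Rightarrow> 'c" where
  "nat_rec a h n = (THE k. \<exists>f\<in>V. is_function f \<and> Domain (graph f) = elts (succ n) \<and>
     app f emp = a \<and> (\<forall>i\<in>elts n. app f (succ i) = h (app f i)) \<and> app f n = k)"

definition nat_add :: "'c \<Rightarrow> 'c \<Rightarrow> 'c" where
  "nat_add m n = nat_rec m succ n"

definition nat_mult :: "'c \<Rightarrow> 'c \<Rightarrow> 'c" where
  "nat_mult m n = nat_rec emp (\<lambda>k. nat_add k m) n"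

definition fst_of :: "'c \<Rightarrow> 'c" where
  "fst_of p = (THE x. x \<in> V \<and> (\<exists>y\<in>V. p = pair x y))"

definition snd_of :: "'c \<Rightarrow> 'c" where
  "snd_of p = (THE y. y \<in> V \<and> (\<exists>x\<in>V. p = pair x y))"

(* The pair (m, n) with m = 0 or n = 0 stands for the integer m - n. *)
definition ZZ :: "'c set" where
  "ZZ = {pair m n | m n. m \<in> NN \<and> n \<in> NN \<and> (m = emp \<or> n = emp)}"

definition int_diff :: "'c \<Rightarrow> 'c \<Rightarrow> 'c" where
  "int_diff m n = (THE z. z \<in> ZZ \<and> nat_add m (snd_of z) = nat_add n (fst_of z))"

definition int_add :: "'c \<Rightarrow> 'c \<Rightarrow> 'c" where
  "int_add z w = int_diff (nat_add (fst_of z) (fst_of w)) (nat_add (snd_of z) (snd_of w))"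

definition int_mult :: "'c \<Rightarrow> 'c \<Rightarrow> 'c" where
  "int_mult z w =
     int_diff (nat_add (nat_mult (fst_of z) (fst_of w)) (nat_mult (snd_of z) (snd_of w)))
              (nat_add (nat_mult (fst_of z) (snd_of w)) (nat_mult (snd_of z) (fst_of w)))"

definition nat_dvd :: "'c \<Rightarrow> 'c \<Rightarrow> bool" where
  "nat_dvd c n \<longleftrightarrow> (\<exists>k\<in>NN. nat_mult c k = n)"

(* The pair (z, d) stands for the reduced fraction z / d; nat_add (fst_of z) (snd_of z) is |z|. *)
definition QQ :: "'c set" where
  "QQ = {pair z d | z d. z \<in> ZZ \<and> d \<in> NN \<and> d \<noteq> emp \<and>
     (\<forall>c\<in>NN. nat_dvd c (nat_add (fst_of z) (snd_of z)) \<and> nat_dvd c d \<longrightarrow> c = succ emp)}"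

(* The reduced form of z / d. *)
definition frac :: "'c \<Rightarrow> 'c \<Rightarrow> 'c" where
  "frac z d = (THE q. q \<in> QQ \<and>
     int_mult (fst_of q) (pair d emp) = int_mult z (pair (snd_of q) emp))"

definition rat_add :: "'c \<Rightarrow> 'c \<Rightarrow> 'c" where
  "rat_add q r = frac (int_add (int_mult (fst_of q) (pair (snd_of r) emp))
                               (int_mult (fst_of r) (pair (snd_of q) emp)))
                      (nat_mult (snd_of q) (snd_of r))"

definition rat_mult :: "'c \<Rightarrow> 'c \<Rightarrow> 'c" where
  "rat_mult q r = frac (int_mult (fst_of q) (fst_of r)) (nat_mult (snd_of q) (snd_of r))"

definition SQ :: "'c ring" where
  "SQ = \<lparr>carrier = QQ \<inter> S, mult = rat_mult, one = pair (pair (succ emp) emp) (succ emp),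
         zero = pair (pair emp emp) (succ emp), add = rat_add\<rparr>"

definition binary_op_on :: "'c \<Rightarrow> 'c \<Rightarrow> bool" where
  "binary_op_on R F \<longleftrightarrow> is_function F \<and> Domain (graph F) = {pair x y | x y. x \<in> elts R \<and> y \<in> elts R} \<and>
     Range (graph F) \<subseteq> elts R"

definition neutral :: "'c \<Rightarrow> 'c \<Rightarrow> 'c" where
  "neutral R F = (THE e. e \<in> elts R \<and> (\<forall>x\<in>elts R. app F (pair e x) = x \<and> app F (pair x e) = x))"

(* The ring given by the classes R (carrier), A (addition) and M (multiplication). *)
definition ring_of :: "'c \<Rightarrow> 'c \<Rightarrow> 'c \<Rightarrow> 'c ring" where
  "ring_of R A M = \<lparr>carrier = elts R, mult = (\<lambda>x y. app M (pair x y)), one = neutral R M,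
                    zero = neutral R A, add = (\<lambda>x y. app A (pair x y))\<rparr>"

definition linearly_ordered_field :: "'c \<Rightarrow> 'c \<Rightarrow> 'c \<Rightarrow> 'c \<Rightarrow> bool" where
  "linearly_ordered_field R A M L \<longleftrightarrow>
     binary_op_on R A \<and> binary_op_on R M \<and> field (ring_of R A M) \<and>
     is_relation L \<and> linear_order_on (elts R) (graph L) \<and>
     (\<forall>x\<in>elts R. \<forall>y\<in>elts R. \<forall>z\<in>elts R. (x, y) \<in> graph L \<longrightarrow>
        (x \<oplus>\<^bsub>ring_of R A M\<^esub> z, y \<oplus>\<^bsub>ring_of R A M\<^esub> z) \<in> graph L) \<and>
     (\<forall>x\<in>elts R. \<forall>y\<in>elts R.
        (\<zero>\<^bsub>ring_of R A M\<^esub>, x) \<in> graph L \<and> (\<zero>\<^bsub>ring_of R A M\<^esub>, y) \<in> graph L \<longrightarrow>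
        (\<zero>\<^bsub>ring_of R A M\<^esub>, x \<otimes>\<^bsub>ring_of R A M\<^esub> y) \<in> graph L)"

definition upper_bounds :: "'c \<Rightarrow> 'c \<Rightarrow> 'c \<Rightarrow> 'c set" where
  "upper_bounds R L X = {b \<in> elts R. \<forall>x\<in>elts X. (x, b) \<in> graph L}"

(* Only nonempty subclasses are required to have a supremum: the empty one has none. *)
definition order_complete :: "'c \<Rightarrow> 'c \<Rightarrow> bool" where
  "order_complete R L \<longleftrightarrow>
     (\<forall>X. elts X \<subseteq> elts R \<and> elts X \<noteq> {} \<and> upper_bounds R L X \<noteq> {} \<longrightarrow>
        (\<exists>s\<in>upper_bounds R L X. \<forall>b\<in>upper_bounds R L X. (s, b) \<in> graph L))"

definition real_number_field :: "'c \<Rightarrow> 'c \<Rightarrow> 'c \<Rightarrow> 'c \<Rightarrow> bool" where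
  "real_number_field R A M L \<longleftrightarrow> linearly_ordered_field R A M L \<and> order_complete R L"

definition prime_subfield :: "'c \<Rightarrow> 'c ring \<Rightarrow> bool" where
  "prime_subfield K F \<longleftrightarrow> subfield (elts K) F \<and> (\<forall>K'. subfield (elts K') F \<longrightarrow> elts K \<subseteq> elts K')"

definition dense_in :: "'c \<Rightarrow> 'c \<Rightarrow> 'c \<Rightarrow> bool" where
  "dense_in K R L \<longleftrightarrow> (\<forall>x\<in>elts R. \<forall>y\<in>elts R. (x, y) \<in> graph L \<and> x \<noteq> y \<longrightarrow>
     (\<exists>q\<in>elts K. (x, q) \<in> graph L \<and> x \<noteq> q \<and> (q, y) \<in> graph L \<and> q \<noteq> y))"

(* Isomorphisms are classes of the structure, not arbitrary functions on 'c. *)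
definition class_ring_iso :: "'c \<Rightarrow> 'c ring \<Rightarrow> 'c ring \<Rightarrow> bool" where
  "class_ring_iso H F G \<longleftrightarrow> is_function H \<and> Domain (graph H) = carrier F \<and> app H \<in> ring_iso F G"

definition isomorphic_ordered_fields ::
    "'c \<Rightarrow> 'c \<Rightarrow> 'c \<Rightarrow> 'c \<Rightarrow> 'c \<Rightarrow> 'c \<Rightarrow> 'c \<Rightarrow> 'c \<Rightarrow> bool" where
  "isomorphic_ordered_fields R A M L R' A' M' L' \<longleftrightarrow>
     (\<exists>H. class_ring_iso H (ring_of R A M) (ring_of R' A' M') \<and>
        (\<forall>x\<in>elts R. \<forall>y\<in>elts R. (x, y) \<in> graph L \<longleftrightarrow> (app H x, app H y) \<in> graph L'))"

end

end

(*
  The real numbers are the finite hyperrationals modulo infinitesimals.  Standard natural numbers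
  n : SN form a thin proper initial segment of NN; fixing an infinite number M, a real number is
  coded by an integer k, read as the hyperrational k / M, and is determined by its cut, the class of
  standard fractions below it.  The cuts are traces of sets on a thin class, so (Exp) provides a thin
  class of representatives.  Completeness is saturation: a bounded union of cuts is realized by one
  k, because every small part of it is (induction over small sets, then (Comp) and (Exp) applied to
  the class of conditions).  In an arbitrary field of real numbers (DC) gives the embedding of SN,
  completeness makes it Archimedean, so the fractions of standard numbers are dense; an element is
  determined by the fractions below it, which yields the isomorphism of two such fields.
*)
theory Submission
  imports Defs "HOL-Computational_Algebra.Fraction_Field"
begin

text \<open>The schemata range over formulas only, so a predicate can enter comprehension, an
  induction or (DC) only after it has been shown definable. \<open>Def D P\<close> and
  \<open>DT D f\<close> turn this into syntax-directed rules, collected in \<open>defn\<close>; set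
  formulas are the case \<open>D = V\<close>, class formulas the case \<open>D = UNIV\<close>. This
  yields two kinds of induction: over sets and \<open>NN\<close> for set formulas, over small sets
  and \<open>SN\<close> for all formulas. A subclass of a set need not be a set, so each collection
  has to be placed as a class, a set or a small set. A second obstacle is that real numbers must be
  members of a class, hence sets. The codes infinitely close to a given one have no greatest element
  and so form no set; a real number is instead represented by a set whose trace is its cut, and
  these sets have to be made unique. Computations take place in HOL types with type class
  arithmetic. Their results return to the model as formulas about natural numbers, by clearing
  denominators and moving negative terms across; this is the origin of the long
  inequalities.\<close>

primrec ren :: "(nat \<Rightarrow> nat) \<Rightarrow> fm \<Rightarrow> fm" where
  "ren f (Mem i j) = Mem (f i) (f j)"
| "ren f (Eq i j) = Eq (f i) (f j)"
| "ren f (Neg \<phi>) = Neg (ren f \<phi>)"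
| "ren f (Conj \<phi> \<psi>) = Conj (ren f \<phi>) (ren f \<psi>)"
| "ren f (Exists i \<phi>) = Exists (f i) (ren f \<phi>)"

definition join :: "(nat \<Rightarrow> 'a) \<Rightarrow> (nat \<Rightarrow> 'a) \<Rightarrow> nat \<Rightarrow> 'a" where
  "join s t i = (if even i then s (i div 2) else t (i div 2))"

lemma join_even [simp]: "join s t (2 * i) = s i"
  and join_odd [simp]: "join s t (Suc (2 * i)) = t i"
  by (auto simp: join_def)

lemma join_0 [simp]: "join s t 0 = s 0"
  by (simp add: join_def)

lemma join_upd: "(join s t)(0 := y) = join (s(0 := y)) t"
proof
  fix i show "((join s t)(0 := y)) i = join (s(0 := y)) t i"
    by (cases "i = 0") (auto simp: join_def)
qed

lemma range_join: "range s \<subseteq> D \<Longrightarrow> range t \<subseteq> D \<Longrightarrow> range (join s t) \<subseteq> D"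
  by (auto simp: join_def image_subset_iff)

text \<open>Odd positions carry parameters. Sending \<open>2 * k + 1\<close> to
  \<open>4 * k + 1\<close> here, and to \<open>4 * k + 3\<close> in the next lemma, lets two
  formulas share one joined parameter list without a clash, while the even positions, the common
  variables, stay fixed.\<close>

lemma inj_left: "inj (\<lambda>n::nat. if even n then n else 2 * n - 1)"
  by (rule injI, simp split: if_splits, presburger+)

lemma inj_right: "inj (\<lambda>n::nat. if even n then n else 2 * n + 1)"
  by (rule injI, simp split: if_splits, presburger+)

text \<open>Prepares quantification over variable 0: it moves to position 1, every other variable
  moves down by one variable, and the parameters move up by two positions to keep position 1
  free.\<close>

lemma inj_bind: "inj (\<lambda>n::nat. if n = 0 then 1 else if even n then n - 2 else n + 2)"
  by (rule injI, simp split: if_splits, presburger+)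

lemma inj_skip: "inj (\<lambda>n::nat. if n = 0 then 0 else if even n then n + 2 else n)"
  by (rule injI, simp split: if_splits, presburger+)

lemma inj_shift: "inj (\<lambda>n::nat. if even n then n + 2 else n)"
  by (rule injI, simp split: if_splits, presburger+)

lemma join_left: "join s (join t u) \<circ> (\<lambda>n. if even n then n else 2 * n - 1) = join s t"
proof
  fix n :: nat
  show "(join s (join t u) \<circ> (\<lambda>n. if even n then n else 2 * n - 1)) n = join s t n"
  proof (cases "even n")
    case False
    then obtain k where n: "n = 2 * k + 1" by (rule oddE)
    show ?thesis unfolding n join_def by simp
  qed (simp add: join_def)
qed

lemma join_right: "join s (join t u) \<circ> (\<lambda>n. if even n then n else 2 * n + 1) = join s u"
proof
  fix n :: nat
  show "(join s (join t u) \<circ> (\<lambda>n. if even n then n else 2 * n + 1)) n = join s u n"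
  proof (cases "even n")
    case False
    then obtain k where n: "n = 2 * k + 1" by (rule oddE)
    show ?thesis unfolding n join_def by simp
  qed (simp add: join_def)
qed

section \<open>Definable predicates and terms\<close>

context class_structure
begin

text \<open>Bound variables are renamed along with the free ones. Injectivity is the capture
  condition: an update at \<open>f i\<close> must not touch any other renamed variable.\<close>

lemma sat_ren: "inj f \<Longrightarrow> sat D (ren f \<phi>) s \<longleftrightarrow> sat D \<phi> (s \<circ> f)"
proof (induction \<phi> arbitrary: s)
  case (Exists i \<phi>)
  have "s(f i := a) \<circ> f = (s \<circ> f)(i := a)" for a
    using Exists.prems by (auto simp: fun_eq_iff inj_eq)
  then have "sat D (ren f \<phi>) (s(f i := a)) \<longleftrightarrow> sat D \<phi> ((s \<circ> f)(i := a))" for a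
    using Exists.IH[OF Exists.prems, of "s(f i := a)"] by (simp only:)
  then show ?case by (simp only: ren.simps sat.simps)
qed (simp_all only: ren.simps sat.simps comp_apply)

text \<open>Variables of the formula sit at the even positions of the assignment, parameters at the
  odd ones; so a predicate on assignments may mention any number of constants.\<close>

definition Def :: "'c set \<Rightarrow> ((nat \<Rightarrow> 'c) \<Rightarrow> bool) \<Rightarrow> bool" where
  "Def D P \<longleftrightarrow> (\<exists>\<phi> t. range t \<subseteq> D \<and> (\<forall>s. range s \<subseteq> D \<longrightarrow> (P s \<longleftrightarrow> sat D \<phi> (join s t))))"

text \<open>The language has no function symbols, so a term is given by its graph, with the value in
  variable 0 and the arguments shifted up by one as for de Bruijn indices. Closure of
  \<open>D\<close> under \<open>f\<close> is included because terms are substituted by means of a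
  quantifier over \<open>D\<close>.\<close>

definition DT :: "'c set \<Rightarrow> ((nat \<Rightarrow> 'c) \<Rightarrow> 'c) \<Rightarrow> bool" where
  "DT D f \<longleftrightarrow> (\<forall>s. range s \<subseteq> D \<longrightarrow> f s \<in> D) \<and> Def D (\<lambda>s. s 0 = f (\<lambda>n. s (Suc n)))"

named_theorems defn

lemma Def_cong: "Def D P \<Longrightarrow> (\<And>s. range s \<subseteq> D \<Longrightarrow> Q s = P s) \<Longrightarrow> Def D Q"
  unfolding Def_def by metis

lemma Def_intro:
  "range t \<subseteq> D \<Longrightarrow> (\<And>s. range s \<subseteq> D \<Longrightarrow> P s \<longleftrightarrow> sat D \<phi> (join s t)) \<Longrightarrow> Def D P"
  unfolding Def_def by (rule exI[of _ \<phi>], rule exI[of _ t]) simp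

lemma Def_elim:
  assumes "Def D P"
  obtains \<phi> t where "range t \<subseteq> D" "\<And>s. range s \<subseteq> D \<Longrightarrow> P s \<longleftrightarrow> sat D \<phi> (join s t)"
  using assms unfolding Def_def by (elim exE conjE) simp

lemma Def_not [defn]: "Def D P \<Longrightarrow> Def D (\<lambda>s. \<not> P s)"
proof -
  assume "Def D P"
  then obtain \<phi> t where "range t \<subseteq> D" "\<And>s. range s \<subseteq> D \<Longrightarrow> P s \<longleftrightarrow> sat D \<phi> (join s t)"
    by (rule Def_elim) blast
  then show ?thesis by (intro Def_intro[of t D _ "Neg \<phi>"]) simp_all
qed

lemma Def_conj [defn]:
  assumes "Def D P" "Def D Q"
  shows "Def D (\<lambda>s. P s \<and> Q s)"
proof -
  obtain \<phi> t where P: "range t \<subseteq> D" "\<And>s. range s \<subseteq> D \<Longrightarrow> P s \<longleftrightarrow> sat D \<phi> (join s t)"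
    by (rule Def_elim[OF assms(1)]) blast
  obtain \<psi> u where Q: "range u \<subseteq> D" "\<And>s. range s \<subseteq> D \<Longrightarrow> Q s \<longleftrightarrow> sat D \<psi> (join s u)"
    by (rule Def_elim[OF assms(2)]) blast
  let ?f = "\<lambda>n. if even n then n else 2 * n - 1" and ?g = "\<lambda>n. if even n then n else 2 * n + (1::nat)"
  show ?thesis
  proof (rule Def_intro)
    show "range (join t u) \<subseteq> D" using P(1) Q(1) by (rule range_join)
    fix s :: "nat \<Rightarrow> 'c" assume "range s \<subseteq> D"
    then show "P s \<and> Q s \<longleftrightarrow> sat D (Conj (ren ?f \<phi>) (ren ?g \<psi>)) (join s (join t u))"
      unfolding sat.simps sat_ren[OF inj_left] sat_ren[OF inj_right] join_left join_right
      by (simp only: P(2) Q(2))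
  qed
qed

lemma Def_disj [defn]: "Def D P \<Longrightarrow> Def D Q \<Longrightarrow> Def D (\<lambda>s. P s \<or> Q s)"
  using Def_not[OF Def_conj[OF Def_not Def_not]] by simp

lemma Def_imp [defn]: "Def D P \<Longrightarrow> Def D Q \<Longrightarrow> Def D (\<lambda>s. P s \<longrightarrow> Q s)"
  using Def_not[OF Def_conj[OF _ Def_not], of D P Q] by simp

lemma Def_iff [defn]: "Def D P \<Longrightarrow> Def D Q \<Longrightarrow> Def D (\<lambda>s. P s = Q s)"
  using Def_conj[OF Def_imp[of D P Q] Def_imp[of D Q P]] by (simp add: iff_conv_conj_imp)

lemma Def_exD:
  assumes "Def D (\<lambda>s. P (s 0) (\<lambda>n. s (Suc n)))"
  shows "Def D (\<lambda>s. \<exists>a\<in>D. P a s)"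
proof -
  obtain \<phi> t where t: "range t \<subseteq> D"
    "\<And>s. range s \<subseteq> D \<Longrightarrow> P (s 0) (\<lambda>n. s (Suc n)) \<longleftrightarrow> sat D \<phi> (join s t)"
    by (rule Def_elim[OF assms]) blast
  let ?f = "\<lambda>n::nat. if n = 0 then 1 else if even n then n - 2 else n + 2"
  \<comment> \<open>Position 1 is about to be bound, so any element of \<open>D\<close> may stand
    there; \<open>t 0\<close> is one.\<close>
  let ?u = "case_nat (t 0) t"
  note inj = inj_bind
  have u: "range ?u \<subseteq> D" using t(1) by (auto split: nat.splits)
  have eq: "(join s ?u)(1 := a) \<circ> ?f = join (case_nat a s) t" for a s
  proof
    fix n show "((join s ?u)(1 := a) \<circ> ?f) n = join (case_nat a s) t n"
    proof (cases "even n")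
      case True
      then obtain k where "n = 2 * k" by (auto elim: evenE)
      then show ?thesis by (cases k) (auto simp: join_def)
    next
      case False
      then obtain k where "n = 2 * k + 1" by (auto elim: oddE)
      then show ?thesis by (auto simp: join_def)
    qed
  qed
  have "sat D (Exists 1 (ren ?f \<phi>)) (join s ?u) \<longleftrightarrow> (\<exists>a\<in>D. P a s)" if s: "range s \<subseteq> D" for s
  proof -
    have "range (case_nat a s) \<subseteq> D" if "a \<in> D" for a
      using s that by (auto split: nat.splits simp: image_subset_iff)
    then have "P a s \<longleftrightarrow> sat D \<phi> (join (case_nat a s) t)" if "a \<in> D" for a
      using t(2)[of "case_nat a s"] that by simp
    moreover have "sat D (ren ?f \<phi>) ((join s ?u)(1 := a)) \<longleftrightarrow> sat D \<phi> (join (case_nat a s) t)" for a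
      unfolding sat_ren[OF inj] eq ..
    ultimately show ?thesis by (simp del: One_nat_def)
  qed
  with u show ?thesis by (intro Def_intro[of ?u D _ "Exists 1 (ren ?f \<phi>)"]) simp_all
qed

lemma Def_ex [defn]: "Def UNIV (\<lambda>s. P (s 0) (\<lambda>n. s (Suc n))) \<Longrightarrow> Def UNIV (\<lambda>s. \<exists>a. P a s)"
  using Def_exD[of UNIV P] by simp

lemma Def_all [defn]:
  "Def UNIV (\<lambda>s. P (s 0) (\<lambda>n. s (Suc n))) \<Longrightarrow> Def UNIV (\<lambda>s. \<forall>a. P a s)"
  using Def_not[OF Def_ex[OF Def_not], of P] by simp

lemma DefI: "t \<in> D \<Longrightarrow> (\<And>s. P s \<longleftrightarrow> sat D \<phi> (join s (\<lambda>_. t))) \<Longrightarrow> Def D P"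
  unfolding Def_def by (rule exI[of _ \<phi>], rule exI[of _ "\<lambda>_. t"]) auto

lemma Def_mem_var: "D \<noteq> {} \<Longrightarrow> Def D (\<lambda>s. s i \<in> elts (s j))"
  by (auto intro: DefI[where \<phi> = "Mem (2 * i) (2 * j)"])

lemma Def_eq_var: "D \<noteq> {} \<Longrightarrow> Def D (\<lambda>s. s i = s j)"
  by (auto intro: DefI[where \<phi> = "Eq (2 * i) (2 * j)"])

lemma Def_eq_const: "c \<in> D \<Longrightarrow> Def D (\<lambda>s. s i = c)"
  by (rule DefI[where \<phi> = "Eq (2 * i) 1"]) (auto simp: join_def)

lemma Def_const: "D \<noteq> {} \<Longrightarrow> Def D (\<lambda>s. c)"
  using Def_eq_var[of D 0 0] Def_not[OF Def_eq_var[of D 0 0]] by (cases c) auto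

lemma Def_ne: "Def D P \<Longrightarrow> D \<noteq> {}"
  unfolding Def_def by auto

lemma DT_var: "D \<noteq> {} \<Longrightarrow> DT D (\<lambda>s. s i)"
  unfolding DT_def by (auto intro: Def_eq_var)

lemma DT_const: "c \<in> D \<Longrightarrow> DT D (\<lambda>s. c)"
  unfolding DT_def by (auto intro: Def_eq_const)

text \<open>A term is eliminated by reading \<open>P (f s) s\<close> as
  \<open>\<exists>a\<in>D. a = f s \<and> P a s\<close>; closure of \<open>D\<close> under
  \<open>f\<close> supplies the witness.\<close>

lemma Def_subst:
  assumes "DT D f" "Def D (\<lambda>s. P (s 0) (\<lambda>n. s (Suc n)))"
  shows "Def D (\<lambda>s. P (f s) s)"
proof -
  have "Def D (\<lambda>s. \<exists>a\<in>D. a = f s \<and> P a s)"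
    using assms unfolding DT_def by (intro Def_exD Def_conj) auto
  then show ?thesis by (rule Def_cong) (use assms in \<open>auto simp: DT_def\<close>)
qed

lemma Def_subst1: "Def D (\<lambda>s. P (s 0)) \<Longrightarrow> DT D f \<Longrightarrow> Def D (\<lambda>s. P (f s))"
  by (rule Def_subst[where P = "\<lambda>x _. P x"])

text \<open>Weakening under a new binder: the formula for the graph keeps its value variable and
  reads the arguments one place further on, skipping variable 1.\<close>

lemma DT_shift: 
  assumes "DT D f" shows "DT D (\<lambda>s. f (\<lambda>n. s (Suc n)))"
proof -
  obtain \<phi> t where t: "range t \<subseteq> D"
    "\<And>s. range s \<subseteq> D \<Longrightarrow> (s 0 = f (\<lambda>n. s (Suc n))) \<longleftrightarrow> sat D \<phi> (join s t)"
    by (rule Def_elim[OF conjunct2[OF assms[unfolded DT_def]]]) blast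
  let ?f = "\<lambda>n::nat. if n = 0 then 0 else if even n then n + 2 else n"
  note inj = inj_skip
  have eq: "join s t \<circ> ?f = join (case_nat (s 0) (\<lambda>n. s (Suc (Suc n)))) t" for s
  proof
    fix n show "(join s t \<circ> ?f) n = join (case_nat (s 0) (\<lambda>n. s (Suc (Suc n)))) t n"
    proof (cases "even n")
      case True
      then obtain k where "n = 2 * k" by (auto elim: evenE)
      then show ?thesis by (cases k) (auto simp: join_def)
    next
      case False
      then obtain k where "n = 2 * k + 1" by (auto elim: oddE)
      then show ?thesis by (auto simp: join_def)
    qed
  qed
  have "sat D (ren ?f \<phi>) (join s t) = sat D \<phi> (join (case_nat (s 0) (\<lambda>n. s (Suc (Suc n)))) t)" for s
    unfolding sat_ren[OF inj] eq ..
  moreover have "(s 0 = f (\<lambda>n. s (Suc (Suc n)))) \<longleftrightarrow> sat D \<phi> (join (case_nat (s 0) (\<lambda>n. s (Suc (Suc n)))) t)"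
    if "range s \<subseteq> D" for s
    using t(2)[of "case_nat (s 0) (\<lambda>n. s (Suc (Suc n)))"] that
    by (auto split: nat.splits simp: image_subset_iff)
  ultimately have "Def D (\<lambda>s. s 0 = f (\<lambda>n. s (Suc (Suc n))))"
    using t(1) by (intro Def_intro[of t D _ "ren ?f \<phi>"]) simp_all
  then show ?thesis using assms unfolding DT_def by (auto simp: image_subset_iff)
qed

lemma Def_subst2:
  assumes P: "Def D (\<lambda>s. P (s 0) (s (Suc 0)))" and f: "DT D f" and g: "DT D g"
  shows "Def D (\<lambda>s. P (f s) (g s))"
  by (rule Def_subst[OF g, where P = "\<lambda>b s. P (f s) b"],
      rule Def_subst[OF DT_shift[OF f], where P = "\<lambda>b s. P b (s 0)"], rule P)

lemma Def_subst3:
  assumes P: "Def D (\<lambda>s. P (s 0) (s (Suc 0)) (s (Suc (Suc 0))))" and f: "DT D f" and g: "DT D g" and h: "DT D h"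
  shows "Def D (\<lambda>s. P (f s) (g s) (h s))"
  by (rule Def_subst[OF h, where P = "\<lambda>b s. P (f s) (g s) b"],
      rule Def_subst[OF DT_shift[OF g], where P = "\<lambda>b s. P (f (\<lambda>n. s (Suc n))) b (s 0)"],
      rule Def_subst[OF DT_shift[OF DT_shift[OF f]], where P = "\<lambda>b s. P b (s 0) (s (Suc 0))"], rule P)

lemma DT_ne: "DT D f \<Longrightarrow> D \<noteq> {}"
  unfolding DT_def using Def_ne by blast

lemma DT_in: "DT D f \<Longrightarrow> range s \<subseteq> D \<Longrightarrow> f s \<in> D"
  by (simp add: DT_def)

lemma DT_comp1: "DT D (\<lambda>s. F (s 0)) \<Longrightarrow> DT D f \<Longrightarrow> DT D (\<lambda>s. F (f s))"
proof -
  assume F: "DT D (\<lambda>s. F (s 0))" and f: "DT D f"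
  have "Def D (\<lambda>s. s (Suc 0) = F (s 0))"
    by (rule Def_subst[OF F, where P = "\<lambda>b s. s (Suc 0) = b"]) (rule Def_eq_var[OF DT_ne[OF F]])
  then have "Def D (\<lambda>s. s 0 = F (f (\<lambda>n. s (Suc n))))"
    by (rule Def_subst[OF DT_shift[OF f], where P = "\<lambda>b s. s 0 = F b"])
  moreover have "F (f s) \<in> D" if "range s \<subseteq> D" for s
    using DT_in[OF F, of "\<lambda>_. f s"] DT_in[OF f that] by auto
  ultimately show ?thesis unfolding DT_def by auto
qed

lemma DT_comp2:
  assumes F: "DT D (\<lambda>s. F (s 0) (s (Suc 0)))" and f: "DT D f" and g: "DT D g"
  shows "DT D (\<lambda>s. F (f s) (g s))"
proof -
  have "Def D (\<lambda>s. s (Suc (Suc 0)) = F (s 0) (s (Suc 0)))"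
    by (rule Def_subst[OF F, where P = "\<lambda>b s. s (Suc (Suc 0)) = b"]) (rule Def_eq_var[OF DT_ne[OF F]])
  then have "Def D (\<lambda>s. s (Suc 0) = F (f (\<lambda>n. s (Suc (Suc n)))) (s 0))"
    by (rule Def_subst[OF DT_shift[OF DT_shift[OF f]], where P = "\<lambda>b s. s (Suc 0) = F b (s 0)"])
  then have "Def D (\<lambda>s. s 0 = F (f (\<lambda>n. s (Suc n))) (g (\<lambda>n. s (Suc n))))"
    by (rule Def_subst[OF DT_shift[OF g], where P = "\<lambda>b s. s 0 = F (f (\<lambda>n. s (Suc n))) b"])
  moreover have "F (f s) (g s) \<in> D" if "range s \<subseteq> D" for s
    using DT_in[OF F, of "case_nat (f s) (\<lambda>_. g s)"] DT_in[OF f that] DT_in[OF g that]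
    by (simp add: image_subset_iff split: nat.splits)
  ultimately show ?thesis unfolding DT_def by auto
qed

lemma Def_mem: "DT D f \<Longrightarrow> DT D g \<Longrightarrow> Def D (\<lambda>s. f s \<in> elts (g s))"
  by (rule Def_subst2[of D "\<lambda>x y. x \<in> elts y"], rule Def_mem_var[OF DT_ne])

lemma Def_eq: "DT D f \<Longrightarrow> DT D g \<Longrightarrow> Def D (\<lambda>s. f s = g s)"
  by (rule Def_subst2[of D "(=)"], rule Def_eq_var[OF DT_ne])

lemma DT_Def: "DT D f \<Longrightarrow> Def D (\<lambda>s. s 0 = f (\<lambda>n. s (Suc n)))"
  by (simp add: DT_def)

lemma Def_shift:
  assumes "Def D P" shows "Def D (\<lambda>s. P (\<lambda>n. s (Suc n)))"
proof -
  obtain \<phi> t where t: "range t \<subseteq> D" "\<And>s. range s \<subseteq> D \<Longrightarrow> P s \<longleftrightarrow> sat D \<phi> (join s t)"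
    by (rule Def_elim[OF assms]) blast
  let ?f = "\<lambda>n::nat. if even n then n + 2 else n"
  note inj = inj_shift
  have eq: "join s t \<circ> ?f = join (\<lambda>n. s (Suc n)) t" for s
    by (auto simp: fun_eq_iff join_def)
  have "sat D (ren ?f \<phi>) (join s t) = sat D \<phi> (join (\<lambda>n. s (Suc n)) t)" for s
    unfolding sat_ren[OF inj] eq ..
  moreover have "range (\<lambda>n. s (Suc n)) \<subseteq> D" if "range s \<subseteq> D" for s :: "nat \<Rightarrow> 'c" using that by auto
  ultimately have "\<forall>s. range s \<subseteq> D \<longrightarrow> P (\<lambda>n. s (Suc n)) = sat D (ren ?f \<phi>) (join s t)"
    using t(2)[of "\<lambda>n. s (Suc n)" for s] by simp
  with t(1) show ?thesis by (intro Def_intro[of t D _ "ren ?f \<phi>"]) simp_all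
qed

lemma DT_if [defn]:
  assumes "Def D P" "DT D f" "DT D g" shows "DT D (\<lambda>s. if P s then f s else g s)"
proof -
  have "Def D (\<lambda>s. (P (\<lambda>n. s (Suc n)) \<longrightarrow> s 0 = f (\<lambda>n. s (Suc n))) \<and> (\<not> P (\<lambda>n. s (Suc n)) \<longrightarrow> s 0 = g (\<lambda>n. s (Suc n))))"
    by (intro Def_conj Def_imp Def_not Def_shift[OF assms(1)] DT_Def assms)
  then have "Def D (\<lambda>s. s 0 = (if P (\<lambda>n. s (Suc n)) then f (\<lambda>n. s (Suc n)) else g (\<lambda>n. s (Suc n))))"
    by (rule Def_cong) auto
  then show ?thesis using assms unfolding DT_def by auto
qed

end

section \<open>Quantification over classes and over sets\<close>

context class_structure
begin

lemma elts_sub_V: "elts x \<subseteq> V"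
  unfolding V_def by auto

lemma elts_V: "y \<in> elts x \<Longrightarrow> y \<in> V"
  using elts_sub_V by blast

text \<open>The two ranges of quantification in use. Both contain all elements of their members, so
  quantifiers bounded by a term can be treated uniformly. They have to be nonempty because
  \<open>Def\<close> asks for a parameter assignment with values in \<open>D\<close>.\<close>

definition transp :: "'c set \<Rightarrow> bool" where
  "transp D \<longleftrightarrow> D = UNIV \<or> D = V \<and> V \<noteq> {}"

lemma transp_UNIV [defn]: "transp UNIV"
  by (simp add: transp_def)

lemma transp_ne: "transp D \<Longrightarrow> D \<noteq> {}"
  by (auto simp: transp_def)

lemma in_V_iff: "x \<in> V \<longleftrightarrow> (\<exists>X. x \<in> elts X)"
  by (auto simp: V_def)

lemmas DT_varT [defn] = DT_var[OF transp_ne]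

lemma Def_in_V [defn]: "transp D \<Longrightarrow> DT D f \<Longrightarrow> Def D (\<lambda>s. f s \<in> V)"
proof -
  assume D: "transp D" and f: "DT D f"
  have "Def D (\<lambda>s. s 0 \<in> V)"
  proof (cases "D = UNIV")
    case True
    then show ?thesis unfolding in_V_iff by (simp, intro Def_ex Def_mem_var) auto
  next
    case False
    then have "D = V" "V \<noteq> {}" using D by (auto simp: transp_def)
    then show ?thesis using Def_cong[OF Def_const[of V True]] by (auto simp: image_subset_iff)
  qed
  then show ?thesis using f by (rule Def_subst1)
qed

lemma Def_bexV [defn]:
  assumes D: "transp D" and P: "Def D (\<lambda>s. P (s 0) (\<lambda>n. s (Suc n)))"
  shows "Def D (\<lambda>s. \<exists>a\<in>V. P a s)"
proof (cases "D = V")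
  case True then show ?thesis using Def_exD P by simp
next
  case False
  then have D: "D = UNIV" using D by (auto simp: transp_def)
  show ?thesis unfolding D Bex_def
    using P unfolding D by (intro Def_ex Def_conj Def_in_V DT_var transp_UNIV) auto
qed

lemma Def_ballV [defn]:
  assumes "transp D" and "Def D (\<lambda>s. P (s 0) (\<lambda>n. s (Suc n)))"
  shows "Def D (\<lambda>s. \<forall>a\<in>V. P a s)"
  using Def_not[OF Def_bexV[OF assms(1) Def_not[OF assms(2)]]] by simp

lemma Def_bex [defn]:
  assumes "transp D" "DT D f" "Def D (\<lambda>s. P (s 0) (\<lambda>n. s (Suc n)))"
  shows "Def D (\<lambda>s. \<exists>a\<in>elts (f s). P a s)"
proof -
  have "Def D (\<lambda>s. \<exists>a\<in>V. a \<in> elts (f s) \<and> P a s)"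
    using assms by (intro Def_bexV Def_conj Def_mem DT_shift DT_var transp_ne)
  then show ?thesis by (rule Def_cong) (auto intro: elts_V)
qed

lemma Def_ball [defn]:
  assumes "transp D" "DT D f" "Def D (\<lambda>s. P (s 0) (\<lambda>n. s (Suc n)))"
  shows "Def D (\<lambda>s. \<forall>a\<in>elts (f s). P a s)"
  using Def_not[OF Def_bex[OF assms(1,2) Def_not[OF assms(3)]]] by simp

lemma Def_subset [defn]:
  assumes "transp D" "DT D f" "DT D g" shows "Def D (\<lambda>s. elts (f s) \<subseteq> elts (g s))"
  unfolding subset_iff Ball_def[symmetric]
  using assms by (intro Def_ball Def_mem DT_shift DT_var transp_ne)

declare Def_mem [defn] Def_eq [defn]

lemma Def_constU [defn]: "Def UNIV (\<lambda>s. c)"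
  by (rule Def_const) auto

lemma DT_constU [defn]: "DT UNIV (\<lambda>s. c)"
  by (rule DT_const) auto

lemma The_False: "(THE x. P x) = (THE x. False)" if "\<And>x. \<not> P x"
  using that by simp

text \<open>A description without a witness denotes the fixed object \<open>THE x. False\<close>,
  which can enter the formula as a parameter. Hence uniqueness alone makes the description
  definable, existence being settled by a case distinction inside the formula.\<close>

lemma DT_The:
  assumes P: "Def UNIV (\<lambda>s. P (s 0) (\<lambda>n. s (Suc n)))"
    and unique: "\<And>s x y. P x s \<Longrightarrow> P y s \<Longrightarrow> x = y"
  shows "DT UNIV (\<lambda>s. THE x. P x s)"
proof -
  have eq: "y = (THE x. P x s) \<longleftrightarrow> P y s \<or> (\<forall>x. \<not> P x s) \<and> y = (THE x. False)" for y s
  proof (cases "\<exists>x. P x s")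
    case True
    then show ?thesis using unique by (metis the_equality)
  next
    case False
    then show ?thesis using The_False[of "\<lambda>x. P x s"] by auto
  qed
  have "Def UNIV (\<lambda>s. \<forall>x. \<not> P x (\<lambda>n. s (Suc n)))"
    using Def_shift[OF Def_all[OF Def_not[OF P]]] .
  then have "Def UNIV (\<lambda>s. P (s 0) (\<lambda>n. s (Suc n)) \<or> (\<forall>x. \<not> P x (\<lambda>n. s (Suc n))) \<and> s 0 = (THE x. False))"
    using P by (intro Def_disj Def_conj Def_eq DT_var DT_constU) auto
  then show ?thesis unfolding DT_def eq by auto
qed

end

section \<open>Comprehension, pairs and induction over sets\<close>

context THS
begin

lemma elts_inject: "elts X = elts Y \<longleftrightarrow> X = Y"
  using Ext[of X Y] by auto

lemma comprehension:
  assumes "Def UNIV (\<lambda>s. P (s 0))" shows "\<exists>Y. elts Y = {y \<in> V. P y}"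
proof -
  obtain \<phi> t where t: "\<And>s. range s \<subseteq> UNIV \<Longrightarrow> P (s 0) \<longleftrightarrow> sat UNIV \<phi> (join s t)"
    by (rule Def_elim[OF assms]) blast
  obtain Y where Y: "\<forall>y\<in>V. y \<in> elts Y \<longleftrightarrow> sat UNIV \<phi> ((join (\<lambda>_. emp) t)(0 := y))"
    using Class[of \<phi> "join (\<lambda>_. emp) t"] by (elim exE) simp
  have "y \<in> elts Y \<longleftrightarrow> P y" if "y \<in> V" for y
    using Y that t[of "(\<lambda>_. emp)(0 := y)"] by (simp add: join_upd)
  then show ?thesis by (intro exI[of _ Y]) (auto intro: elts_V)
qed

lemma the_elts: "elts Y = A \<Longrightarrow> (THE Z. elts Z = A) = Y"
  using elts_inject by (intro the_equality) auto

lemma elts_emp [simp]: "elts emp = {}"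
proof -
  obtain Y where Y: "elts Y = {}" using comprehension[of "\<lambda>_. False"] Def_constU by auto
  then show ?thesis unfolding emp_def by (simp add: the_elts)
qed

lemma emp_V [simp, defn]: "emp \<in> V"
  by (rule Set_emp)

lemma V_ne: "V \<noteq> {}"
  using emp_V by blast

lemma transp_V [defn]: "transp V"
  using V_ne by (simp add: transp_def)

lemma DT_constV [defn]: "c \<in> V \<Longrightarrow> DT V (\<lambda>s. c)"
  by (rule DT_const)

lemma Def_constV [defn]: "Def V (\<lambda>s. c)"
  by (rule Def_const[OF V_ne])

lemma elts_adjoin [simp]:
  assumes "y \<in> V" shows "elts (adjoin x y) = insert y (elts x)"
proof -
  have "Def UNIV (\<lambda>s. s 0 = y \<or> s 0 \<in> elts x)" by (intro defn)
  moreover have "{z \<in> V. z = y \<or> z \<in> elts x} = insert y (elts x)" using assms by (auto intro: elts_V)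
  ultimately obtain w where w: "elts w = insert y (elts x)" using comprehension[of "\<lambda>z. z = y \<or> z \<in> elts x"] by auto
  then show ?thesis unfolding adjoin_def by (simp add: the_elts)
qed

lemma adjoin_V [simp, defn]: "x \<in> V \<Longrightarrow> y \<in> V \<Longrightarrow> adjoin x y \<in> V"
  by (rule Set_adjoin)

lemma elts_upair [simp]:
  assumes "x \<in> V" "y \<in> V" shows "elts (upair x y) = {x, y}"
proof -
  have "elts (adjoin (adjoin emp x) y) = {x, y}" using assms by auto
  then show ?thesis unfolding upair_def by (simp add: the_elts)
qed

lemma upair_V [simp, defn]: assumes "x \<in> V" "y \<in> V" shows "upair x y \<in> V"
proof -
  have "upair x y = adjoin (adjoin emp x) y" unfolding elts_inject[symmetric] using assms by auto
  then show ?thesis using assms by simp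
qed

lemma pair_V [simp, defn]: "x \<in> V \<Longrightarrow> y \<in> V \<Longrightarrow> pair x y \<in> V"
  by (simp add: pair_def)

lemma pair_inject [simp]:
  assumes "x \<in> V" "y \<in> V" "x' \<in> V" "y' \<in> V"
  shows "pair x y = pair x' y' \<longleftrightarrow> x = x' \<and> y = y'"
proof -
  have "upair a b = upair c d \<longleftrightarrow> {a, b} = {c, d}" if "a \<in> V" "b \<in> V" "c \<in> V" "d \<in> V" for a b c d
    using that by (simp flip: elts_inject)
  then show ?thesis using assms unfolding pair_def by (auto simp: doubleton_eq_iff)
qed

text \<open>Definability over \<open>V\<close> makes \<open>P\<close> a set formula with set
  parameters, which is all that (Ind) covers. A property that mentions \<open>SN\<close>, for
  instance, is out of reach of this rule.\<close>

lemma set_induct: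
  assumes P: "Def V (\<lambda>s. P (s 0))" and "P emp"
    and step: "\<And>x y. x \<in> V \<Longrightarrow> y \<in> V \<Longrightarrow> P x \<Longrightarrow> P y \<Longrightarrow> P (adjoin x y)" and "x \<in> V"
  shows "P x"
proof -
  obtain \<phi> t where r: "range t \<subseteq> V" and t: "\<And>s. range s \<subseteq> V \<Longrightarrow> P (s 0) \<longleftrightarrow> sat V \<phi> (join s t)"
    by (rule Def_elim[OF P]) blast
  let ?s = "join (\<lambda>_. emp) t"
  have eq: "sat V \<phi> (?s(0 := y)) \<longleftrightarrow> P y" if "y \<in> V" for y
    using t[of "(\<lambda>_. emp)(0 := y)"] that by (simp add: join_upd image_subset_iff)
  have "range ?s \<subseteq> V" using r by (intro range_join) auto
  from Ind[OF this, of \<phi>] have "\<forall>x\<in>V. sat V \<phi> (?s(0 := x))"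
    using assms(2) step eq by simp
  then show ?thesis using eq assms(4) by simp
qed

end

section \<open>Operations on sets and foundation\<close>

context THS
begin

lemma set_eq_iff_elts: "x = y \<longleftrightarrow> (\<forall>z\<in>V. z \<in> elts x \<longleftrightarrow> z \<in> elts y)"
  unfolding elts_inject[symmetric] by (auto intro: elts_V)

lemma DT_intro:
  assumes "\<And>s. range s \<subseteq> D \<Longrightarrow> f s \<in> D" "Def D (\<lambda>s. P (s 0) (\<lambda>n. s (Suc n)))"
    "\<And>w s. w \<in> D \<Longrightarrow> range s \<subseteq> D \<Longrightarrow> w = f s \<longleftrightarrow> P w s"
  shows "DT D f"
proof -
  have "Def D (\<lambda>s. s 0 = f (\<lambda>n. s (Suc n)))"
    by (rule Def_cong[OF assms(2)]) (use assms(3) in \<open>auto simp: image_subset_iff\<close>)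
  with assms(1) show ?thesis by (simp add: DT_def)
qed

text \<open>Over all classes the description may lack a value, which \<open>DT_The\<close> takes
  care of; over sets it always has one, and the value is determined by its elements, that is by a
  formula quantifying over sets only.\<close>

lemma DT_adjoin [defn]:
  assumes "transp D" "DT D f" "DT D g" shows "DT D (\<lambda>s. adjoin (f s) (g s))"
proof -
  have "DT D (\<lambda>s. adjoin (s 0) (s (Suc 0)))"
  proof (cases "D = UNIV")
    case True
    have "Def UNIV (\<lambda>s. \<forall>z. z \<in> elts (s 0) \<longleftrightarrow> z = s (Suc (Suc 0)) \<or> z \<in> elts (s (Suc 0)))"
      by (intro defn)
    then have "Def UNIV (\<lambda>s. elts (s 0) = insert (s (Suc (Suc 0))) (elts (s (Suc 0))))"
      by (rule Def_cong) auto
    then show ?thesis unfolding True adjoin_def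
      by (rule DT_The) (simp flip: elts_inject)
  next
    case False
    then have D: "D = V" using assms(1) by (auto simp: transp_def)
    show ?thesis unfolding D
      by (rule DT_intro[where P = "\<lambda>w s. \<forall>z\<in>V. z \<in> elts w \<longleftrightarrow> z = s (Suc 0) \<or> z \<in> elts (s 0)"], simp add: image_subset_iff, intro defn)
         (auto simp: image_subset_iff set_eq_iff_elts)
  qed
  then show ?thesis using assms(2,3) by (rule DT_comp2)
qed

lemma DT_upair [defn]:
  assumes "transp D" "DT D f" "DT D g" shows "DT D (\<lambda>s. upair (f s) (g s))"
proof -
  have "DT D (\<lambda>s. upair (s 0) (s (Suc 0)))"
  proof (cases "D = UNIV")
    case True
    have "Def UNIV (\<lambda>s. \<forall>z. z \<in> elts (s 0) \<longleftrightarrow> z = s (Suc 0) \<or> z = s (Suc (Suc 0)))"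
      by (intro defn)
    then have "Def UNIV (\<lambda>s. elts (s 0) = {s (Suc 0), s (Suc (Suc 0))})"
      by (rule Def_cong) auto
    then show ?thesis unfolding True upair_def
      by (rule DT_The) (simp flip: elts_inject)
  next
    case False
    then have D: "D = V" using assms(1) by (auto simp: transp_def)
    show ?thesis unfolding D
      by (rule DT_intro[where P = "\<lambda>w s. \<forall>z\<in>V. z \<in> elts w \<longleftrightarrow> z = s 0 \<or> z = s (Suc 0)"], simp add: image_subset_iff, intro defn)
         (auto simp: image_subset_iff set_eq_iff_elts)
  qed
  then show ?thesis using assms(2,3) by (rule DT_comp2)
qed

lemma DT_pair [defn]:
  assumes "transp D" "DT D f" "DT D g" shows "DT D (\<lambda>s. pair (f s) (g s))"
  unfolding pair_def by (intro defn assms)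

lemma DT_succ [defn]:
  assumes "transp D" "DT D f" shows "DT D (\<lambda>s. succ (f s))"
  unfolding succ_def by (intro defn assms)

lemma succ_V [simp, defn]: "x \<in> V \<Longrightarrow> succ x \<in> V"
  by (simp add: succ_def)

lemma elts_succ [simp]: "x \<in> V \<Longrightarrow> elts (succ x) = insert x (elts x)"
  by (simp add: succ_def)

text \<open>Speaking of extents rather than of objects of the model allows unions, images and
  comprehensions to be written as HOL sets; \<open>code\<close> leads back to the object.\<close>

definition isset :: "'c set \<Rightarrow> bool" where
  "isset A \<longleftrightarrow> (\<exists>z\<in>V. elts z = A)"

definition isclass :: "'c set \<Rightarrow> bool" where
  "isclass A \<longleftrightarrow> (\<exists>Z. elts Z = A)"

definition code :: "'c set \<Rightarrow> 'c" where
  "code A = (THE z. elts z = A)"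

lemma isset_class: "isset A \<Longrightarrow> isclass A"
  by (auto simp: isset_def isclass_def)

lemma elts_code: "isclass A \<Longrightarrow> elts (code A) = A"
  by (auto simp: isclass_def code_def the_elts)

lemma code_elts [simp]: "code (elts x) = x"
  by (simp add: code_def the_elts)

lemma elts_code_set [simp]: "isset A \<Longrightarrow> elts (code A) = A"
  by (simp add: elts_code isset_class)

lemma code_V [simp]: "isset A \<Longrightarrow> code A \<in> V"
  by (auto simp: isset_def)

lemma isset_elts [simp]: "x \<in> V \<Longrightarrow> isset (elts x)"
  by (auto simp: isset_def)

lemma isset_elts_iff: "isset (elts x) \<longleftrightarrow> x \<in> V"
  using elts_inject by (auto simp: isset_def)

lemma isclass_elts [simp]: "isclass (elts x)"
  by (auto simp: isclass_def)

lemma isset_sub_V: "isset A \<Longrightarrow> A \<subseteq> V"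
  using elts_sub_V by (auto simp: isset_def)

lemma isclass_sub_V: "isclass A \<Longrightarrow> A \<subseteq> V"
  using elts_sub_V by (auto simp: isclass_def)

lemma isclassI: "Def UNIV (\<lambda>s. P (s 0)) \<Longrightarrow> isclass {y \<in> V. P y}"
  unfolding isclass_def by (rule comprehension)

lemma isclass_Collect: "isclass A \<Longrightarrow> Def UNIV (\<lambda>s. P (s 0)) \<Longrightarrow> isclass {y \<in> A. P y}"
proof -
  assume A: "isclass A" and P: "Def UNIV (\<lambda>s. P (s 0))"
  then obtain Z where Z: "A = elts Z" by (auto simp: isclass_def)
  have "Def UNIV (\<lambda>s. s 0 \<in> elts Z \<and> P (s 0))" by (intro defn P)
  from isclassI[OF this] show ?thesis
    unfolding Z by (rule back_subst[of isclass]) (auto intro: elts_V)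
qed

lemma isset_empty [simp]: "isset {}"
  unfolding isset_def by (rule bexI[of _ emp]) auto

lemma isset_insert [simp]: "isset A \<Longrightarrow> y \<in> V \<Longrightarrow> isset (insert y A)"
  unfolding isset_def using elts_adjoin adjoin_V by metis

lemma isset_induct:
  assumes "isset A" and P: "Def V (\<lambda>s. P (elts (s 0)))"
    and "P {}" and step: "\<And>A y. isset A \<Longrightarrow> y \<in> V \<Longrightarrow> P A \<Longrightarrow> P (insert y A)"
  shows "P A"
proof -
  obtain z where z: "z \<in> V" "elts z = A" using assms(1) by (auto simp: isset_def)
  have "P (elts z)"
    by (rule set_induct[OF P _ _ z(1)]) (use assms(3) step in auto)
  with z show ?thesis by simp
qed

lemma isset_iff_V: "isset A \<longleftrightarrow> (\<exists>z\<in>V. \<forall>y\<in>V. y \<in> elts z \<longleftrightarrow> y \<in> A) \<and> A \<subseteq> V"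
  unfolding isset_def using elts_sub_V by blast

text \<open>Comprehension would only yield a class here, and a subclass of a set need not be a set.
  Separation is therefore an induction on the set, adjoining each new element or leaving it out, and
  it holds for set formulas only.\<close>

lemma isset_Collect:
  assumes A: "isset A" and P: "Def V (\<lambda>s. P (s 0))"
  shows "isset {y \<in> A. P y}"
proof -
  have "\<exists>z\<in>V. \<forall>y\<in>V. y \<in> elts z \<longleftrightarrow> y \<in> A \<and> P y"
  proof (rule isset_induct[OF A])
    show "Def V (\<lambda>s. \<exists>z\<in>V. \<forall>y\<in>V. (y \<in> elts z) = (y \<in> elts (s 0) \<and> P y))"
      by (intro defn Def_subst1[OF P])
    show "\<exists>z\<in>V. \<forall>y\<in>V. (y \<in> elts z) = (y \<in> {} \<and> P y)" by (intro bexI[of _ emp]) auto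
    fix A y assume y: "y \<in> V" and "\<exists>z\<in>V. \<forall>y\<in>V. (y \<in> elts z) = (y \<in> A \<and> P y)"
    then obtain z where "z \<in> V" "\<forall>y\<in>V. (y \<in> elts z) = (y \<in> A \<and> P y)" by blast
    then show "\<exists>z\<in>V. \<forall>ya\<in>V. (ya \<in> elts z) = (ya \<in> insert y A \<and> P ya)"
      using y by (intro bexI[of _ "if P y then adjoin z y else z"]) auto
  qed
  then show ?thesis unfolding isset_iff_V using isset_sub_V[OF A] by auto
qed

lemma isset_Un [simp]:
  assumes A: "isset A" and B: "isset B" shows "isset (A \<union> B)"
proof -
  obtain b where b: "b \<in> V" "B = elts b" using B by (auto simp: isset_def)
  have "\<exists>z\<in>V. \<forall>y\<in>V. y \<in> elts z \<longleftrightarrow> y \<in> A \<or> y \<in> elts b"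
  proof (rule isset_induct[OF A])
    show "Def V (\<lambda>s. \<exists>z\<in>V. \<forall>y\<in>V. (y \<in> elts z) = (y \<in> elts (s 0) \<or> y \<in> elts b))"
      by (intro defn b)
    show "\<exists>z\<in>V. \<forall>y\<in>V. (y \<in> elts z) = (y \<in> {} \<or> y \<in> elts b)" using b by (intro bexI[of _ b]) auto
    fix A y assume y: "y \<in> V" and "\<exists>z\<in>V. \<forall>y\<in>V. (y \<in> elts z) = (y \<in> A \<or> y \<in> elts b)"
    then obtain z where "z \<in> V" "\<forall>y\<in>V. (y \<in> elts z) = (y \<in> A \<or> y \<in> elts b)" by blast
    then show "\<exists>z\<in>V. \<forall>ya\<in>V. (ya \<in> elts z) = (ya \<in> insert y A \<or> ya \<in> elts b)"
      using y by (intro bexI[of _ "adjoin z y"]) auto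
  qed
  then show ?thesis unfolding isset_iff_V using isset_sub_V[OF A] isset_sub_V[OF B] b by auto
qed

lemma isset_image:
  assumes A: "isset A" and F: "DT V (\<lambda>s. F (s 0))" shows "isset (F ` A)"
proof -
  have FV: "F x \<in> V" if "x \<in> V" for x using DT_in[OF F, of "\<lambda>_. x"] that by auto
  have "\<exists>z\<in>V. \<forall>y\<in>V. y \<in> elts z \<longleftrightarrow> (\<exists>x\<in>A. y = F x)"
  proof (rule isset_induct[OF A])
    show "Def V (\<lambda>s. \<exists>z\<in>V. \<forall>y\<in>V. (y \<in> elts z) = (\<exists>x\<in>elts (s 0). y = F x))"
      by (intro defn DT_comp1[OF F])
    show "\<exists>z\<in>V. \<forall>y\<in>V. (y \<in> elts z) = (\<exists>x\<in>{}. y = F x)" by (intro bexI[of _ emp]) auto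
    fix A y assume y: "y \<in> V" and "\<exists>z\<in>V. \<forall>y\<in>V. (y \<in> elts z) = (\<exists>x\<in>A. y = F x)"
    then obtain z where "z \<in> V" "\<forall>y\<in>V. (y \<in> elts z) = (\<exists>x\<in>A. y = F x)" by blast
    then show "\<exists>z\<in>V. \<forall>ya\<in>V. (ya \<in> elts z) = (\<exists>x\<in>insert y A. ya = F x)"
      using y FV by (intro bexI[of _ "adjoin z (F y)"]) auto
  qed
  then show ?thesis unfolding isset_iff_V using isset_sub_V[OF A] FV by (auto simp: image_iff)
qed

lemma isset_Union:
  assumes A: "isset A" shows "isset (\<Union>x\<in>A. elts x)"
proof -
  have "\<exists>z\<in>V. \<forall>y\<in>V. y \<in> elts z \<longleftrightarrow> (\<exists>x\<in>A. y \<in> elts x)"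
  proof (rule isset_induct[OF A])
    show "Def V (\<lambda>s. \<exists>z\<in>V. \<forall>y\<in>V. (y \<in> elts z) = (\<exists>x\<in>elts (s 0). y \<in> elts x))"
      by (intro defn)
    show "\<exists>z\<in>V. \<forall>y\<in>V. (y \<in> elts z) = (\<exists>x\<in>{}. y \<in> elts x)" by (intro bexI[of _ emp]) auto
    fix A y assume y: "y \<in> V" and "\<exists>z\<in>V. \<forall>y\<in>V. (y \<in> elts z) = (\<exists>x\<in>A. y \<in> elts x)"
    then obtain z where z: "z \<in> V" "\<forall>y\<in>V. (y \<in> elts z) = (\<exists>x\<in>A. y \<in> elts x)" by blast
    then have "isset (elts z \<union> elts y)" using y by simp
    then obtain w where "w \<in> V" "elts w = elts z \<union> elts y" unfolding isset_def by blast
    then show "\<exists>z\<in>V. \<forall>ya\<in>V. (ya \<in> elts z) = (\<exists>x\<in>insert y A. ya \<in> elts x)"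
      using z by (intro bexI[of _ w]) auto
  qed
  then show ?thesis unfolding isset_iff_V using elts_sub_V by auto
qed

text \<open>Adjoining \<open>y\<close> to \<open>A\<close> doubles the power set: a subset of
  \<open>insert y A\<close> that contains \<open>y\<close> arises by adjoining \<open>y\<close> to a
  subset of \<open>A\<close>, which separation provides.\<close>

lemma isset_Pow:
  assumes A: "isset A" shows "isset {z \<in> V. elts z \<subseteq> A}"
proof -
  have "\<exists>p\<in>V. \<forall>z\<in>V. z \<in> elts p \<longleftrightarrow> (\<forall>y\<in>elts z. y \<in> A)"
  proof (rule isset_induct[OF A])
    show "Def V (\<lambda>s. \<exists>p\<in>V. \<forall>z\<in>V. z \<in> elts p \<longleftrightarrow> (\<forall>y\<in>elts z. y \<in> elts (s 0)))"
      by (intro defn)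
    show "\<exists>p\<in>V. \<forall>z\<in>V. z \<in> elts p \<longleftrightarrow> (\<forall>y\<in>elts z. y \<in> {})"
      by (intro bexI[of _ "adjoin emp emp"]) (auto simp flip: elts_inject)
    fix A y assume A: "isset A" and y: "y \<in> V" and "\<exists>p\<in>V. \<forall>z\<in>V. z \<in> elts p \<longleftrightarrow> (\<forall>y\<in>elts z. y \<in> A)"
    then obtain p where p: "p \<in> V" "\<And>z. z \<in> V \<Longrightarrow> z \<in> elts p \<longleftrightarrow> elts z \<subseteq> A" by blast
    let ?B = "elts p \<union> (\<lambda>z. adjoin z y) ` elts p"
    have "isset ?B" using p y by (intro isset_Un isset_image isset_elts DT_adjoin transp_V DT_varT DT_constV)
    then obtain w where w: "w \<in> V" "elts w = ?B" unfolding isset_def by blast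
    have "z \<in> ?B \<longleftrightarrow> elts z \<subseteq> insert y A" if z: "z \<in> V" for z
    proof
      have pe: "elts z' \<subseteq> A" if "z' \<in> elts p" for z' using p(2) that elts_V by blast
      assume "z \<in> ?B" then show "elts z \<subseteq> insert y A"
        using y by (auto dest!: subsetD[OF pe])
    next
      assume s: "elts z \<subseteq> insert y A"
      show "z \<in> ?B"
      proof (cases "y \<in> elts z")
        case True
        have "isset {x \<in> elts z. x \<noteq> y}" by (intro isset_Collect isset_elts z defn y)
        then obtain z' where z': "z' \<in> V" "elts z' = {x \<in> elts z. x \<noteq> y}" unfolding isset_def by blast
        then have "z' \<in> elts p" using p(2) s by auto
        moreover have "z = adjoin z' y" using True z' y by (auto simp flip: elts_inject)
        ultimately show ?thesis by blast
      next
        case False then show ?thesis using p(2)[OF z] s by blast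
      qed
    qed
    then show "\<exists>p\<in>V. \<forall>z\<in>V. (z \<in> elts p) = (\<forall>ya\<in>elts z. ya \<in> insert y A)"
      using w by (intro bexI[of _ w]) auto
  qed
  then show ?thesis unfolding isset_iff_V by (simp add: subset_eq)
qed

text \<open>The induction on \<open>adjoin\<close> is strengthened to a set together with all its
  elements. The elements of \<open>adjoin x y\<close> are \<open>y\<close> and those of
  \<open>x\<close>, for which \<open>P\<close> is already known, so \<open>step\<close> applies to
  \<open>adjoin x y\<close>.\<close>

lemma mem_induct:
  assumes P: "Def V (\<lambda>s. P (s 0))" and step: "\<And>x. x \<in> V \<Longrightarrow> \<forall>y\<in>elts x. P y \<Longrightarrow> P x" and "x \<in> V"
  shows "P x"
proof -
  have "(\<forall>y\<in>elts x. P y) \<and> P x"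
    by (rule set_induct[where P = "\<lambda>x. (\<forall>y\<in>elts x. P y) \<and> P x"], intro defn Def_subst1[OF P])
       (use step \<open>x \<in> V\<close> in auto)
  then show ?thesis ..
qed

text \<open>Foundation is not an axiom but follows from (Ind): without a minimal element,
  non-membership in \<open>A\<close> is inherited from the elements of a set to the set itself.
  \<open>A\<close> must be a set in order to serve as a parameter of that formula.\<close>

lemma foundation:
  assumes A: "isset A" and "A \<noteq> {}" shows "\<exists>y\<in>A. elts y \<inter> A = {}"
proof (rule ccontr)
  assume no: "\<not> ?thesis"
  obtain a where a: "a \<in> V" "A = elts a" using A by (auto simp: isset_def)
  have "x \<notin> elts a" if "x \<in> V" for x
  proof (rule mem_induct[OF _ _ that])
    show "Def V (\<lambda>s. s 0 \<notin> elts a)" by (intro defn a)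
    show "x \<notin> elts a" if "\<forall>y\<in>elts x. y \<notin> elts a" for x
      using no that unfolding a by blast
  qed
  then show False using \<open>A \<noteq> {}\<close> a elts_V by blast
qed

lemma mem_irrefl: "x \<notin> elts x"
proof
  assume x: "x \<in> elts x"
  then have "isset {x}" using elts_V by simp
  from foundation[OF this] x show False by auto
qed

lemma mem_asym: "x \<in> elts y \<Longrightarrow> y \<notin> elts x"
proof
  assume x: "x \<in> elts y" "y \<in> elts x"
  then have "isset {x, y}" using elts_V by simp
  from foundation[OF this] x show False by auto
qed

end

section \<open>Natural numbers and recursion\<close>

context THS
begin

text \<open>Foundation makes membership irreflexive, and what remains of the strict linear order is
  a formula with bounded quantifiers, from which definability of \<open>NN\<close> is read
  off.\<close>

lemma NN_iff:
  "n \<in> NN \<longleftrightarrow> n \<in> V \<and> (\<forall>x\<in>elts n. elts x \<subseteq> elts n) \<and>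
    (\<forall>x\<in>elts n. \<forall>y\<in>elts n. \<forall>z\<in>elts n. x \<in> elts y \<longrightarrow> y \<in> elts z \<longrightarrow> x \<in> elts z) \<and>
    (\<forall>x\<in>elts n. \<forall>y\<in>elts n. x \<in> elts y \<or> x = y \<or> y \<in> elts x)"
proof -
  have "strict_linear_order_on (elts n) {(x, y). x \<in> elts n \<and> y \<in> elts n \<and> x \<in> elts y} \<longleftrightarrow>
    (\<forall>x\<in>elts n. \<forall>y\<in>elts n. \<forall>z\<in>elts n. x \<in> elts y \<longrightarrow> y \<in> elts z \<longrightarrow> x \<in> elts z) \<and>
    (\<forall>x\<in>elts n. \<forall>y\<in>elts n. x \<in> elts y \<or> x = y \<or> y \<in> elts x)"
    unfolding strict_linear_order_on_def trans_def irrefl_def total_on_def using mem_irrefl by auto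
  then show ?thesis unfolding NN_def by simp
qed

lemma Def_NN [defn]: "transp D \<Longrightarrow> DT D f \<Longrightarrow> Def D (\<lambda>s. f s \<in> NN)"
proof (rule Def_subst1)
  show "transp D \<Longrightarrow> Def D (\<lambda>s. s 0 \<in> NN)" unfolding NN_iff by (intro defn)
qed

lemma NN_V [simp, defn]: "n \<in> NN \<Longrightarrow> n \<in> V"
  by (simp add: NN_iff)

lemma NN_I:
  assumes "n \<in> V" "\<And>x. x \<in> elts n \<Longrightarrow> elts x \<subseteq> elts n"
    "\<And>x y z. x \<in> elts n \<Longrightarrow> y \<in> elts n \<Longrightarrow> z \<in> elts n \<Longrightarrow> x \<in> elts y \<Longrightarrow> y \<in> elts z \<Longrightarrow> x \<in> elts z"
    "\<And>x y. x \<in> elts n \<Longrightarrow> y \<in> elts n \<Longrightarrow> x \<in> elts y \<or> x = y \<or> y \<in> elts x"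
  shows "n \<in> NN"
  unfolding NN_iff
  by (intro conjI ballI impI, rule assms(1), erule assms(2), rule assms(3), assumption+, rule assms(4), assumption+)

lemma NN_rel_trans:
  assumes "n \<in> NN" "x \<in> elts n" "y \<in> elts n" "z \<in> elts n" "x \<in> elts y" "y \<in> elts z"
  shows "x \<in> elts z"
proof -
  from assms(1) have "\<forall>x\<in>elts n. \<forall>y\<in>elts n. \<forall>z\<in>elts n. x \<in> elts y \<longrightarrow> y \<in> elts z \<longrightarrow> x \<in> elts z"
    unfolding NN_iff by (elim conjE)
  from this[THEN bspec, THEN bspec, THEN bspec, OF assms(2-4)] assms(5,6) show ?thesis by simp
qed

lemma NN_rel_total:
  assumes "n \<in> NN" "x \<in> elts n" "y \<in> elts n" shows "x \<in> elts y \<or> x = y \<or> y \<in> elts x"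
proof -
  from assms(1) have "\<forall>x\<in>elts n. \<forall>y\<in>elts n. x \<in> elts y \<or> x = y \<or> y \<in> elts x"
    unfolding NN_iff by (elim conjE)
  from this[THEN bspec, THEN bspec, OF assms(2,3)] show ?thesis .
qed

lemma NN_trans: "n \<in> NN \<Longrightarrow> m \<in> elts n \<Longrightarrow> k \<in> elts m \<Longrightarrow> k \<in> elts n"
  by (auto simp: NN_iff)

lemma NN_mem: assumes "n \<in> NN" "m \<in> elts n" shows "m \<in> NN"
proof -
  have sub: "x \<in> elts n" if "x \<in> elts m" for x using NN_trans assms that by blast
  have "elts x \<subseteq> elts m" if x: "x \<in> elts m" for x
  proof
    fix y assume y: "y \<in> elts x"
    then have "y \<in> elts n" using NN_trans[OF assms(1) sub[OF x]] by blast
    then show "y \<in> elts m" using NN_rel_trans[OF assms(1) _ sub[OF x] assms(2) y x] by simp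
  qed
  moreover have "m \<in> V" using assms(2) elts_V by blast
  ultimately show ?thesis
    using NN_rel_trans[OF assms(1) sub sub sub] NN_rel_total[OF assms(1) sub sub] by (rule_tac NN_I) assumption+
qed

lemma emp_NN [simp]: "emp \<in> NN"
  by (simp add: NN_iff)

lemma succ_NN [simp]: assumes "n \<in> NN" shows "succ n \<in> NN"
proof -
  have n: "n \<in> V" using assms by simp
  have e: "elts (succ n) = insert n (elts n)" using n by simp
  show ?thesis
  proof (rule NN_I)
    show "succ n \<in> V" using n by simp
    show "elts x \<subseteq> elts (succ n)" if "x \<in> elts (succ n)" for x
      using that NN_trans[OF assms] unfolding e by blast
    show "x \<in> elts z" if "x \<in> elts (succ n)" "y \<in> elts (succ n)" "z \<in> elts (succ n)" "x \<in> elts y" "y \<in> elts z" for x y z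
    proof -
      have "y \<noteq> n" using that(3,5) mem_irrefl mem_asym unfolding e by blast
      then have y: "y \<in> elts n" using that(2) unfolding e by blast
      then have x: "x \<in> elts n" using NN_trans[OF assms y] that(4) by blast
      show ?thesis
      proof (cases "z = n")
        case False
        then show ?thesis using NN_rel_trans[OF assms x y _ that(4,5)] that(3) unfolding e by blast
      qed (simp add: x)
    qed
    show "x \<in> elts y \<or> x = y \<or> y \<in> elts x" if "x \<in> elts (succ n)" "y \<in> elts (succ n)" for x y
      using that NN_rel_total[OF assms] unfolding e by blast
  qed
qed

text \<open>If the intersection of \<open>m\<close> and \<open>n\<close> is not all of
  \<open>m\<close>, it equals a membership-minimal element of \<open>m\<close> outside
  \<open>n\<close> and thus is an element of \<open>m\<close>. If it differed from both
  \<open>m\<close> and \<open>n\<close>, it would be an element of itself.\<close>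

lemma NN_linear:
  assumes m: "m \<in> NN" and n: "n \<in> NN" shows "m \<in> elts n \<or> m = n \<or> n \<in> elts m"
proof -
  have iss: "isset (elts m \<inter> elts n)" if "m \<in> NN" "n \<in> NN" for m n
    using isset_Collect[of "elts m" "\<lambda>x. x \<in> elts n"] that by (simp add: Int_def Def_mem DT_varT DT_constV transp_V)
  have *: "code (elts m \<inter> elts n) \<in> elts m" if m: "m \<in> NN" and n: "n \<in> NN" and ne: "elts m \<inter> elts n \<noteq> elts m" for m n
  proof -
    let ?B = "{x \<in> elts m. x \<notin> elts n}"
    have "isset ?B" by (intro isset_Collect isset_elts defn NN_V m n)
    moreover have "?B \<noteq> {}" using ne by auto
    ultimately obtain x where x: "x \<in> elts m" "x \<notin> elts n" "elts x \<inter> ?B = {}" using foundation by blast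
    have "elts x \<subseteq> elts m \<inter> elts n" using x m NN_trans by blast
    moreover have "elts m \<inter> elts n \<subseteq> elts x"
    proof
      fix a assume "a \<in> elts m \<inter> elts n"
      then have am: "a \<in> elts m" and an: "a \<in> elts n" by auto
      have "a \<in> elts x \<or> a = x \<or> x \<in> elts a" using NN_rel_total[OF m am x(1)] .
      then show "a \<in> elts x" using x an NN_trans[OF n] by blast
    qed
    ultimately have "elts m \<inter> elts n = elts x" by blast
    then show ?thesis using x by simp
  qed
  have 1: "elts m \<inter> elts n \<noteq> elts m \<Longrightarrow> code (elts m \<inter> elts n) \<in> elts m" using *[OF m n] .
  have 2: "elts m \<inter> elts n \<noteq> elts n \<Longrightarrow> code (elts m \<inter> elts n) \<in> elts n"
    using *[OF n m] by (simp add: Int_commute)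
  have "code (elts m \<inter> elts n) \<notin> elts m \<inter> elts n"
    using mem_irrefl[of "code (elts m \<inter> elts n)"] iss[OF m n] by simp
  then consider "elts m \<inter> elts n = elts m" | "elts m \<inter> elts n = elts n" using 1 2 by blast
  then show ?thesis
  proof cases
    case 1 then show ?thesis using 2 elts_inject[of m n] by auto
  next
    case 2 then show ?thesis using 1 elts_inject[of m n] by auto
  qed
qed

lemma NN_min:
  assumes A: "isset A" "A \<noteq> {}" "A \<subseteq> NN" shows "\<exists>m\<in>A. \<forall>y\<in>A. m = y \<or> m \<in> elts y"
proof -
  obtain m where m: "m \<in> A" "elts m \<inter> A = {}" using foundation[OF A(1,2)] by blast
  then have "m = y \<or> m \<in> elts y" if "y \<in> A" for y using NN_linear[of m y] that A(3) by blast
  with m(1) show ?thesis by blast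
qed

text \<open>Induction over sets makes every set look finite from inside. Conversely, a class of
  numbers without a maximum, such as \<open>SN\<close>, is thereby seen not to be a set.\<close>

lemma NN_max:
  assumes A: "isset A" "A \<noteq> {}" "A \<subseteq> NN" shows "\<exists>m\<in>A. \<forall>y\<in>A. y = m \<or> y \<in> elts m"
proof -
  have "(\<forall>x\<in>A. x \<in> NN) \<longrightarrow> (\<exists>x\<in>A. x = x) \<longrightarrow> (\<exists>m\<in>A. \<forall>y\<in>A. y = m \<or> y \<in> elts m)"
  proof (rule isset_induct[OF A(1)])
    show "Def V (\<lambda>s. (\<forall>x\<in>elts (s 0). x \<in> NN) \<longrightarrow> (\<exists>x\<in>elts (s 0). x = x) \<longrightarrow>
        (\<exists>m\<in>elts (s 0). \<forall>y\<in>elts (s 0). y = m \<or> y \<in> elts m))"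
      by (intro defn)
    fix A y assume IH: "(\<forall>x\<in>A. x \<in> NN) \<longrightarrow> (\<exists>x\<in>A. x = x) \<longrightarrow> (\<exists>m\<in>A. \<forall>y\<in>A. y = m \<or> y \<in> elts m)"
    show "(\<forall>x\<in>insert y A. x \<in> NN) \<longrightarrow> (\<exists>x\<in>insert y A. x = x) \<longrightarrow> (\<exists>m\<in>insert y A. \<forall>ya\<in>insert y A. ya = m \<or> ya \<in> elts m)"
    proof (intro impI)
      assume NN: "\<forall>x\<in>insert y A. x \<in> NN"
      show "\<exists>m\<in>insert y A. \<forall>ya\<in>insert y A. ya = m \<or> ya \<in> elts m"
      proof (cases "A = {}")
        case False
        then obtain m where m: "m \<in> A" "\<forall>y\<in>A. y = m \<or> y \<in> elts m" using IH NN by auto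
        consider "y \<in> elts m \<or> y = m" | "m \<in> elts y" using NN_linear[of m y] NN m by blast
        then show ?thesis
        proof cases
          case 1 then show ?thesis using m by (intro bexI[of _ m]) auto
        next
          case 2 
          have "\<forall>z\<in>A. z \<in> elts y" using m(2) 2 NN_trans[of y m] NN by auto
          then show ?thesis by (intro bexI[of _ y]) auto
        qed
      qed simp
    qed
  qed simp
  with A show ?thesis by blast
qed

text \<open>The predecessor is the maximum of the number, regarded as a set of smaller numbers; so
  the order-theoretic definition of \<open>NN\<close> admits no limits.\<close>

lemma NN_cases:
  assumes "n \<in> NN" obtains "n = emp" | m where "m \<in> NN" "n = succ m"
proof (cases "elts n = {}")
  case True then show ?thesis using that(1) by (simp flip: elts_inject)
next
  case False
  then obtain m where m: "m \<in> elts n" "\<forall>y\<in>elts n. y = m \<or> y \<in> elts m"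
    using NN_max[of "elts n"] NN_mem[OF assms] assms by auto
  then have "elts n = insert m (elts m)" using NN_trans[OF assms m(1)] by blast
  then have "n = succ m" using elts_V[OF m(1)] by (simp flip: elts_inject)
  then show ?thesis using that(2) NN_mem[OF assms m(1)] by blast
qed

lemma NN_induct:
  assumes P: "Def V (\<lambda>s. P (s 0))" and "P emp" and step: "\<And>n. n \<in> NN \<Longrightarrow> P n \<Longrightarrow> P (succ n)"
    and "n \<in> NN"
  shows "P n"
proof -
  have "n \<in> NN \<longrightarrow> P n"
  proof (rule mem_induct[where P = "\<lambda>n. n \<in> NN \<longrightarrow> P n"])
    show "Def V (\<lambda>s. s 0 \<in> NN \<longrightarrow> P (s 0))" by (intro defn P)
    fix x assume IH: "\<forall>y\<in>elts x. y \<in> NN \<longrightarrow> P y"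
    show "x \<in> NN \<longrightarrow> P x"
    proof
      assume "x \<in> NN" then show "P x"
      proof (cases rule: NN_cases)
        case (2 m) then show ?thesis using IH step by simp
      qed (use assms(2) in simp)
    qed
  qed (use assms(4) in simp)
  with assms(4) show ?thesis by simp
qed

lemma emp_mem_succ: "n \<in> NN \<Longrightarrow> emp \<in> elts (succ n)"
  by (rule NN_induct[where P = "\<lambda>n. emp \<in> elts (succ n)"], intro defn) auto

lemma emp_not_succ [simp]: "n \<in> V \<Longrightarrow> succ n \<noteq> emp"
  by (auto simp flip: elts_inject)

lemma succ_mem_succ: "m \<in> NN \<Longrightarrow> n \<in> NN \<Longrightarrow> succ m \<in> elts (succ n) \<longleftrightarrow> m \<in> elts n"
proof
  assume m: "m \<in> NN" and n: "n \<in> NN"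
  show "m \<in> elts n" if "succ m \<in> elts (succ n)"
  proof -
    have "succ m = n \<or> succ m \<in> elts n" using that n by auto
    then show ?thesis using NN_trans[OF n, of "succ m" m] m by auto
  qed
  show "succ m \<in> elts (succ n)" if "m \<in> elts n"
  proof -
    have "n \<notin> elts (succ m)" using that mem_irrefl[of n] mem_asym[OF that] m by auto
    then show ?thesis using NN_linear[of "succ m" n] m n by auto
  qed
qed

lemma succ_inject [simp]: "m \<in> V \<Longrightarrow> n \<in> V \<Longrightarrow> succ m = succ n \<longleftrightarrow> m = n"
proof
  assume "m \<in> V" "n \<in> V" "succ m = succ n"
  then have "insert m (elts m) = insert n (elts n)" by (metis elts_succ)
  then have "m \<in> insert n (elts n)" "n \<in> insert m (elts m)" by (metis insertI1)+
  then show "m = n" using mem_asym[of m n] by auto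
qed simp

lemma graph_iff: "(x, y) \<in> graph F \<longleftrightarrow> x \<in> V \<and> y \<in> V \<and> pair x y \<in> elts F"
  by (simp add: graph_def)

lemma app_eq: "is_function F \<Longrightarrow> x \<in> V \<Longrightarrow> y \<in> V \<Longrightarrow> pair x y \<in> elts F \<Longrightarrow> app F x = y"
  unfolding app_def is_function_def single_valued_def by (rule the_equality) (auto simp: graph_iff)

lemma app_mem: "is_function F \<Longrightarrow> x \<in> Domain (graph F) \<Longrightarrow> app F x \<in> V \<and> pair x (app F x) \<in> elts F"
  using app_eq by (auto simp: graph_iff)

lemma is_relation_iff: "is_relation F \<longleftrightarrow> (\<forall>p\<in>elts F. \<exists>x\<in>V. \<exists>y\<in>V. p = pair x y)"
proof
  assume F: "is_relation F"
  show "\<forall>p\<in>elts F. \<exists>x\<in>V. \<exists>y\<in>V. p = pair x y"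
  proof
    fix p assume "p \<in> elts F"
    then have "p \<in> (\<lambda>(x, y). pair x y) ` graph F" using F by (simp add: is_relation_def)
    then show "\<exists>x\<in>V. \<exists>y\<in>V. p = pair x y" by (auto simp: graph_iff)
  qed
next
  assume F: "\<forall>p\<in>elts F. \<exists>x\<in>V. \<exists>y\<in>V. p = pair x y"
  show "is_relation F" unfolding is_relation_def
  proof
    show "elts F \<subseteq> (\<lambda>(x, y). pair x y) ` graph F"
    proof
      fix p assume p: "p \<in> elts F"
      with F obtain x y where "x \<in> V" "y \<in> V" "p = pair x y" by blast
      then show "p \<in> (\<lambda>(x, y). pair x y) ` graph F"
        using p by (intro image_eqI[of _ _ "(x, y)"]) (auto simp: graph_iff)
    qed
  qed (auto simp: graph_iff)
qed

lemma is_function_iff: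
  "is_function F \<longleftrightarrow> (\<forall>p\<in>elts F. \<exists>x\<in>V. \<exists>y\<in>V. p = pair x y) \<and>
     (\<forall>x\<in>V. \<forall>y\<in>V. \<forall>z\<in>V. pair x y \<in> elts F \<longrightarrow> pair x z \<in> elts F \<longrightarrow> y = z)"
  unfolding is_function_def is_relation_iff single_valued_def by (simp add: graph_iff Ball_def) blast

text \<open>The table of the values at \<open>0, ..., n\<close>, expressed without
  \<open>app\<close> by quantifiers over sets, so that induction applies to it. The next definition
  is the shape that occurs in \<open>nat_rec\<close>.\<close>

definition recp :: "'c \<Rightarrow> ('c \<Rightarrow> 'c) \<Rightarrow> 'c \<Rightarrow> 'c \<Rightarrow> bool" where
  "recp a H f n \<longleftrightarrow> (\<forall>p\<in>elts f. \<exists>i\<in>elts (succ n). \<exists>y\<in>V. p = pair i y) \<and>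
     (\<forall>i\<in>elts (succ n). \<exists>y\<in>V. y \<in> NN \<and> pair i y \<in> elts f \<and> (\<forall>z\<in>V. pair i z \<in> elts f \<longrightarrow> z = y)) \<and>
     pair emp a \<in> elts f \<and>
     (\<forall>i\<in>elts n. \<forall>y\<in>V. pair i y \<in> elts f \<longrightarrow> pair (succ i) (H y) \<in> elts f)"

definition recf :: "'c \<Rightarrow> ('c \<Rightarrow> 'c) \<Rightarrow> 'c \<Rightarrow> 'c \<Rightarrow> bool" where
  "recf a h f n \<longleftrightarrow> is_function f \<and> Domain (graph f) = elts (succ n) \<and> app f emp = a \<and>
     (\<forall>i\<in>elts n. app f (succ i) = h (app f i))"

context
  fixes a H h
  assumes a: "a \<in> NN" and H: "DT V (\<lambda>s. H (s 0))" and HN: "\<And>k. k \<in> NN \<Longrightarrow> H k \<in> NN"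
    and hH: "\<And>k. k \<in> NN \<Longrightarrow> h k = H k"
begin

text \<open>The step function \<open>h\<close> of \<open>nat_rec\<close> need not be definable
  outside \<open>NN\<close>. Since the entries of a table stay in \<open>NN\<close>, where
  \<open>h\<close> agrees with the definable \<open>H\<close>, both describe the same
  recursion.\<close>

lemma recp_recf:
  assumes n: "n \<in> NN" and f: "recp a H f n" shows "recf a h f n"
proof -
  have nV: "x \<in> V" if "x \<in> elts (succ n)" for x using that elts_V by blast
  have fn: "is_function f"
    unfolding is_function_iff
  proof (intro conjI ballI impI)
    fix p assume "p \<in> elts f"
    then show "\<exists>x\<in>V. \<exists>y\<in>V. p = pair x y" using f nV unfolding recp_def by blast
  next
    fix x y z assume *: "x \<in> V" "y \<in> V" "z \<in> V" "pair x y \<in> elts f" "pair x z \<in> elts f"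
    then obtain i y' where i: "i \<in> elts (succ n)" "y' \<in> V" "pair x y = pair i y'" using f unfolding recp_def by metis
    then have "x \<in> elts (succ n)" using * nV by simp
    then show "y = z" using f * unfolding recp_def by metis
  qed
  have "x \<in> elts (succ n)" if "(x, y) \<in> graph f" for x y
  proof -
    have "pair x y \<in> elts f" "x \<in> V" "y \<in> V" using that by (auto simp: graph_iff)
    then obtain i y' where i: "i \<in> elts (succ n)" "y' \<in> V" "pair x y = pair i y'" using f unfolding recp_def by metis
    then show ?thesis using \<open>x \<in> V\<close> \<open>y \<in> V\<close> nV by simp
  qed
  moreover have "\<exists>y. (x, y) \<in> graph f" if "x \<in> elts (succ n)" for x
    using f nV[OF that] that unfolding recp_def graph_iff by metis
  ultimately have dom: "Domain (graph f) = elts (succ n)" by blast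
  have "app f emp = a" using app_eq[OF fn, of emp a] f a unfolding recp_def by simp
  moreover have "app f (succ i) = h (app f i)" if "i \<in> elts n" for i
  proof -
    have i: "i \<in> NN" "i \<in> elts (succ n)" using NN_mem[OF n that] that n by auto
    then obtain y where y: "y \<in> NN" "pair i y \<in> elts f" using f unfolding recp_def by metis
    then have "pair (succ i) (H y) \<in> elts f" using f that unfolding recp_def by simp
    then show ?thesis
      using app_eq[OF fn, of "succ i" "H y"] app_eq[OF fn, of i y] y i HN hH by simp
  qed
  ultimately show ?thesis using fn dom unfolding recf_def by simp
qed

lemma recf_unique:
  assumes n: "n \<in> NN" "m \<in> NN" and f: "f \<in> V" "recf a h f n" and g: "g \<in> V" "recf a h g m"
    and i: "i \<in> elts (succ n)" "i \<in> elts (succ m)"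
  shows "app f i \<in> NN \<and> app g i = app f i"
proof -
  have ff: "is_function f" "is_function g" using f g by (auto simp: recf_def)
  have iN: "i \<in> NN" using i n NN_mem succ_NN by blast
  have mem: "pair x (app f x) \<in> elts f" if "x \<in> elts (succ n)" for x
    using app_mem[OF ff(1)] that f(2) unfolding recf_def by simp
  have mem': "pair x (app g x) \<in> elts g" if "x \<in> elts (succ m)" for x
    using app_mem[OF ff(2)] that g(2) unfolding recf_def by simp
  have "i \<in> elts (succ n) \<and> i \<in> elts (succ m) \<longrightarrow> (\<exists>y\<in>V. y \<in> NN \<and> pair i y \<in> elts f \<and> pair i y \<in> elts g)"
  proof (rule NN_induct[OF _ _ _ iN])
    show "Def V (\<lambda>s. s 0 \<in> elts (succ n) \<and> s 0 \<in> elts (succ m) \<longrightarrow>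
      (\<exists>y\<in>V. y \<in> NN \<and> pair (s 0) y \<in> elts f \<and> pair (s 0) y \<in> elts g))" 
      by (intro defn f g n)
    show "emp \<in> elts (succ n) \<and> emp \<in> elts (succ m) \<longrightarrow> (\<exists>y\<in>V. y \<in> NN \<and> pair emp y \<in> elts f \<and> pair emp y \<in> elts g)"
      using mem[of emp] mem'[of emp] f g a unfolding recf_def by auto
    fix i assume i: "i \<in> NN" and IH: "i \<in> elts (succ n) \<and> i \<in> elts (succ m) \<longrightarrow>
      (\<exists>y\<in>V. y \<in> NN \<and> pair i y \<in> elts f \<and> pair i y \<in> elts g)"
    show "succ i \<in> elts (succ n) \<and> succ i \<in> elts (succ m) \<longrightarrow>
      (\<exists>y\<in>V. y \<in> NN \<and> pair (succ i) y \<in> elts f \<and> pair (succ i) y \<in> elts g)"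
    proof
      assume s: "succ i \<in> elts (succ n) \<and> succ i \<in> elts (succ m)"
      then have im: "i \<in> elts n" "i \<in> elts m" using succ_mem_succ i n by auto
      then obtain y where y: "y \<in> NN" "pair i y \<in> elts f" "pair i y \<in> elts g" using IH n by auto
      then have "app f i = y" "app g i = y" using app_eq ff i by simp_all
      then have "app f (succ i) = H y" "app g (succ i) = H y"
        using f(2) g(2) im hH[OF y(1)] unfolding recf_def by auto
      then show "\<exists>y\<in>V. y \<in> NN \<and> pair (succ i) y \<in> elts f \<and> pair (succ i) y \<in> elts g"
        using mem[of "succ i"] mem'[of "succ i"] s HN[OF y(1)] by (intro bexI[of _ "H y"]) auto
    qed
  qed
  then obtain y where "y \<in> NN" "pair i y \<in> elts f" "pair i y \<in> elts g" using i by blast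
  then have "app f i = y" "app g i = y" using app_eq ff iN by simp_all
  with \<open>y \<in> NN\<close> show ?thesis by simp
qed

text \<open>A table for \<open>n\<close> is extended by one pair. Single-valuedness survives because
  the arguments so far are elements of \<open>succ n\<close>, and \<open>succ n\<close> is not an
  element of itself.\<close>

lemma recp_exists: assumes n: "n \<in> NN" shows "\<exists>f\<in>V. recp a H f n"
proof (rule NN_induct[OF _ _ _ n])
  show "Def V (\<lambda>s. \<exists>f\<in>V. recp a H f (s 0))" unfolding recp_def by (intro defn DT_comp1[OF H] NN_V a)
  show "\<exists>f\<in>V. recp a H f emp"
    using a by (intro bexI[of _ "adjoin emp (pair emp a)"]) (auto simp: recp_def)
  fix n assume n: "n \<in> NN" and "\<exists>f\<in>V. recp a H f n"
  then obtain f where fV: "f \<in> V" and f: "recp a H f n" by blast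
  have nn: "n \<in> elts (succ n)" "n \<in> V" using n by auto
  then obtain y where y: "y \<in> NN" "pair n y \<in> elts f" and yu: "\<And>z. z \<in> V \<Longrightarrow> pair n z \<in> elts f \<Longrightarrow> z = y"
    using f unfolding recp_def by metis
  let ?g = "adjoin f (pair (succ n) (H y))"
  have Hy: "H y \<in> NN" using HN y by simp
  have g: "elts ?g = insert (pair (succ n) (H y)) (elts f)" using n Hy by simp
  have new: "pair (succ n) z \<notin> elts f" if "z \<in> V" for z
  proof
    assume "pair (succ n) z \<in> elts f"
    then obtain i y' where "i \<in> elts (succ n)" "y' \<in> V" "pair (succ n) z = pair i y'" using f unfolding recp_def by metis
    then have "succ n \<in> elts (succ n)" using that nn elts_V by (metis pair_inject succ_V)
    then show False using mem_irrefl by blast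
  qed
  have old: "pair i z \<in> elts ?g \<longleftrightarrow> pair i z \<in> elts f" if "i \<in> elts (succ n)" "z \<in> V" for i z
    using that nn Hy elts_V[of i "succ n"] mem_irrefl[of "succ n"] unfolding g by auto
  have "recp a H ?g (succ n)"
    unfolding recp_def
  proof (intro conjI ballI impI)
    fix p assume "p \<in> elts ?g"
    then show "\<exists>i\<in>elts (succ (succ n)). \<exists>y\<in>V. p = pair i y"
    proof (cases "p \<in> elts f")
      case True then show ?thesis using f nn unfolding recp_def by fastforce
    next
      case False then show ?thesis using \<open>p \<in> elts ?g\<close> g nn Hy by auto
    qed
  next
    fix i assume "i \<in> elts (succ (succ n))"
    then consider "i \<in> elts (succ n)" | "i = succ n" using nn by auto
    then show "\<exists>y\<in>V. y \<in> NN \<and> pair i y \<in> elts ?g \<and> (\<forall>z\<in>V. pair i z \<in> elts ?g \<longrightarrow> z = y)"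
    proof cases
      case 1
      then show ?thesis using f old unfolding recp_def by simp
    next
      case 2
      then show ?thesis using g new Hy nn by (intro bexI[of _ "H y"]) auto
    qed
  next
    show "pair emp a \<in> elts ?g" using f g unfolding recp_def by simp
  next
    fix i z assume i: "i \<in> elts (succ n)" and z: "z \<in> V" and p: "pair i z \<in> elts ?g"
    then have p: "pair i z \<in> elts f" using old by simp
    consider "i \<in> elts n" | "i = n" using i nn by auto
    then show "pair (succ i) (H z) \<in> elts ?g"
    proof cases
      case 1 then show ?thesis using f p z g unfolding recp_def by simp
    next
      case 2 then show ?thesis using yu[OF z] p g by simp
    qed
  qed
  moreover have "?g \<in> V" using fV nn Hy by simp
  ultimately show "\<exists>f\<in>V. recp a H f (succ n)" by blast
qed

lemma nat_rec_eq: 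
  assumes n: "n \<in> NN" and f: "f \<in> V" "recf a h f n" shows "nat_rec a h n = app f n"
proof -
  have "n \<in> elts (succ n)" using n by simp
  then have "app g n = app f n" if "g \<in> V" "recf a h g n" for g
    using recf_unique[OF n n f that] by blast
  then show ?thesis unfolding nat_rec_def using f unfolding recf_def
    by (intro the_equality) blast+
qed

lemma nat_rec_NN: assumes n: "n \<in> NN" shows "nat_rec a h n \<in> NN"
proof -
  obtain f where f: "f \<in> V" "recf a h f n" using recp_exists[OF n] recp_recf[OF n] by blast
  then show ?thesis using nat_rec_eq[OF n f] recf_unique[OF n n f f, of n] n by simp
qed

lemma nat_rec_emp: "nat_rec a h emp = a"
proof -
  obtain f where f: "f \<in> V" "recf a h f emp" using recp_exists[of emp] recp_recf[of emp] by auto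
  then show ?thesis using nat_rec_eq[of emp f] by (simp add: recf_def)
qed

lemma nat_rec_succ: assumes n: "n \<in> NN" shows "nat_rec a h (succ n) = h (nat_rec a h n)"
proof -
  obtain f where f: "f \<in> V" "recf a h f (succ n)" using recp_exists[of "succ n"] recp_recf[of "succ n"] n by auto
  obtain g where g: "g \<in> V" "recf a h g n" using recp_exists[OF n] recp_recf[OF n] by blast
  have "app f n = app g n" using recf_unique[OF _ _ g f, of n] n by simp
  then show ?thesis using nat_rec_eq[OF _ f] nat_rec_eq[OF n g] n f(2) unfolding recf_def by simp
qed

text \<open>Replaces the description by the existence of a table, a set formula, whence addition and
  multiplication become definable over \<open>V\<close>.\<close>

lemma nat_rec_iff:
  assumes n: "n \<in> NN"
  shows "k = nat_rec a h n \<longleftrightarrow> k \<in> V \<and> (\<exists>f\<in>V. recp a H f n \<and> pair n k \<in> elts f)"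
proof
  assume k: "k = nat_rec a h n"
  obtain f where f: "f \<in> V" "recp a H f n" using recp_exists[OF n] by blast
  note rf = recp_recf[OF n f(2)]
  then have "k = app f n" using nat_rec_eq[OF n f(1)] k by simp
  then have "k \<in> V \<and> pair n k \<in> elts f" using app_mem[of f n] rf n unfolding recf_def by simp
  with f show "k \<in> V \<and> (\<exists>f\<in>V. recp a H f n \<and> pair n k \<in> elts f)" by blast
next
  assume "k \<in> V \<and> (\<exists>f\<in>V. recp a H f n \<and> pair n k \<in> elts f)"
  then obtain f where k: "k \<in> V" and f: "f \<in> V" "recp a H f n" "pair n k \<in> elts f" by blast
  note rf = recp_recf[OF n f(2)]
  have "app f n = k" using app_eq[of f n k] rf k f n unfolding recf_def by simp
  then show "k = nat_rec a h n" using nat_rec_eq[OF n f(1) rf] by simp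
qed

end

text \<open>Outside \<open>NN\<close> the description behind \<open>nat_add\<close> is uncontrolled.
  The default \<open>emp\<close> makes the operation total with values in \<open>NN\<close>, hence a
  definable term over sets as well as over classes.\<close>

definition nadd :: "'c \<Rightarrow> 'c \<Rightarrow> 'c" where
  "nadd m n = (if m \<in> NN \<and> n \<in> NN then nat_add m n else emp)"

definition nmult :: "'c \<Rightarrow> 'c \<Rightarrow> 'c" where
  "nmult m n = (if m \<in> NN \<and> n \<in> NN then nat_mult m n else emp)"

lemma DT_succ0: "DT V (\<lambda>s. succ (s 0))"
  by (intro defn)

context
  fixes m assumes m: "m \<in> NN"
begin

lemmas nat_add_rec = m DT_succ0 succ_NN refl

lemma nadd_NN' : "n \<in> NN \<Longrightarrow> nadd m n \<in> NN"
  using nat_rec_NN[OF nat_add_rec, of n] m unfolding nadd_def nat_add_def by simp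

lemma nadd_iff: "n \<in> NN \<Longrightarrow> k = nadd m n \<longleftrightarrow> k \<in> V \<and> (\<exists>f\<in>V. recp m succ f n \<and> pair n k \<in> elts f)"
  using nat_rec_iff[OF nat_add_rec, of n k] m unfolding nadd_def nat_add_def by simp

lemma nadd_emp [simp]: "nadd m emp = m"
  using nat_rec_emp[OF nat_add_rec] m unfolding nadd_def nat_add_def by simp

lemma nadd_succ [simp]: "n \<in> NN \<Longrightarrow> nadd m (succ n) = succ (nadd m n)"
  using nat_rec_succ[OF nat_add_rec, of n] m unfolding nadd_def nat_add_def by simp

end

lemma nadd_NN [simp]: "nadd m n \<in> NN"
  using nadd_NN'[of m n] by (cases "m \<in> NN \<and> n \<in> NN") (auto simp: nadd_def)

lemma DT_nadd [defn]:
  assumes "transp D" "DT D f" "DT D g" shows "DT D (\<lambda>s. nadd (f s) (g s))"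
proof (rule DT_comp2[OF _ assms(2,3)], rule DT_intro[where P = "\<lambda>k s. (s 0 \<in> NN \<and> s (Suc 0) \<in> NN \<longrightarrow>
      k \<in> V \<and> (\<exists>f\<in>V. recp (s 0) succ f (s (Suc 0)) \<and> pair (s (Suc 0)) k \<in> elts f)) \<and>
      (\<not> (s 0 \<in> NN \<and> s (Suc 0) \<in> NN) \<longrightarrow> k = emp)"])
  have "V \<subseteq> D" using assms(1) by (auto simp: transp_def)
  then show "nadd (s 0) (s (Suc 0)) \<in> D" for s using nadd_NN NN_V by blast
  have "emp \<in> D" using \<open>V \<subseteq> D\<close> by auto
  then show "Def D (\<lambda>s. (s (Suc 0) \<in> NN \<and> s (Suc (Suc 0)) \<in> NN \<longrightarrow>
      s 0 \<in> V \<and> (\<exists>f\<in>V. recp (s (Suc 0)) succ f (s (Suc (Suc 0))) \<and> pair (s (Suc (Suc 0))) (s 0) \<in> elts f)) \<and>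
      (\<not> (s (Suc 0) \<in> NN \<and> s (Suc (Suc 0)) \<in> NN) \<longrightarrow> s 0 = emp))"
    unfolding recp_def by (intro defn assms(1) DT_const)
  fix w and s :: "nat \<Rightarrow> 'c"
  show "(w = nadd (s 0) (s (Suc 0))) \<longleftrightarrow> ((s 0 \<in> NN \<and> s (Suc 0) \<in> NN \<longrightarrow>
      w \<in> V \<and> (\<exists>f\<in>V. recp (s 0) succ f (s (Suc 0)) \<and> pair (s (Suc 0)) w \<in> elts f)) \<and>
      (\<not> (s 0 \<in> NN \<and> s (Suc 0) \<in> NN) \<longrightarrow> w = emp))"
    using nadd_iff[of "s 0" "s (Suc 0)" w]
    by (cases "s 0 \<in> NN"; cases "s (Suc 0) \<in> NN") (simp_all add: nadd_def)
qed

lemma DT_nadd0: "m \<in> NN \<Longrightarrow> DT V (\<lambda>s. nadd (s 0) m)"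
  by (intro defn)

context
  fixes m assumes m: "m \<in> NN"
begin

lemma nat_add_nadd: "k \<in> NN \<Longrightarrow> nat_add k m = nadd k m"
  using m by (simp add: nadd_def)

lemmas nat_mult_rec = emp_NN DT_nadd0[OF m] nadd_NN nat_add_nadd

lemma nmult_NN' : "n \<in> NN \<Longrightarrow> nmult m n \<in> NN"
  using nat_rec_NN[OF nat_mult_rec, of n] m unfolding nmult_def nat_mult_def by simp

lemma nmult_iff:
  "n \<in> NN \<Longrightarrow> k = nmult m n \<longleftrightarrow> k \<in> V \<and> (\<exists>f\<in>V. recp emp (\<lambda>k. nadd k m) f n \<and> pair n k \<in> elts f)"
  using nat_rec_iff[OF nat_mult_rec, of n k] m unfolding nmult_def nat_mult_def by simp

lemma nmult_emp [simp]: "nmult m emp = emp"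
  using nat_rec_emp[OF nat_mult_rec] m unfolding nmult_def nat_mult_def by simp

lemma nmult_succ [simp]: assumes n: "n \<in> NN" shows "nmult m (succ n) = nadd (nmult m n) m"
proof -
  have "nmult m (succ n) = nat_add (nmult m n) m"
    using nat_rec_succ[OF nat_mult_rec n] m n unfolding nmult_def nat_mult_def by simp
  then show ?thesis using nat_add_nadd[OF nmult_NN'[OF n]] by simp
qed

end

lemma nmult_NN [simp]: "nmult m n \<in> NN"
  using nmult_NN'[of m n] by (cases "m \<in> NN \<and> n \<in> NN") (auto simp: nmult_def)

lemma DT_nmult [defn]:
  assumes "transp D" "DT D f" "DT D g" shows "DT D (\<lambda>s. nmult (f s) (g s))"
proof (rule DT_comp2[OF _ assms(2,3)], rule DT_intro[where P = "\<lambda>k s. (s 0 \<in> NN \<and> s (Suc 0) \<in> NN \<longrightarrow>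
      k \<in> V \<and> (\<exists>f\<in>V. recp emp (\<lambda>k. nadd k (s 0)) f (s (Suc 0)) \<and> pair (s (Suc 0)) k \<in> elts f)) \<and>
      (\<not> (s 0 \<in> NN \<and> s (Suc 0) \<in> NN) \<longrightarrow> k = emp)"])
  have "V \<subseteq> D" using assms(1) by (auto simp: transp_def)
  then show "nmult (s 0) (s (Suc 0)) \<in> D" for s using nmult_NN NN_V by blast
  have "emp \<in> D" using \<open>V \<subseteq> D\<close> by auto
  then show "Def D (\<lambda>s. (s (Suc 0) \<in> NN \<and> s (Suc (Suc 0)) \<in> NN \<longrightarrow>
      s 0 \<in> V \<and> (\<exists>f\<in>V. recp emp (\<lambda>k. nadd k (s (Suc 0))) f (s (Suc (Suc 0))) \<and> pair (s (Suc (Suc 0))) (s 0) \<in> elts f)) \<and>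
      (\<not> (s (Suc 0) \<in> NN \<and> s (Suc (Suc 0)) \<in> NN) \<longrightarrow> s 0 = emp))"
    unfolding recp_def by (intro defn assms(1) DT_const)
  fix w and s :: "nat \<Rightarrow> 'c"
  show "(w = nmult (s 0) (s (Suc 0))) \<longleftrightarrow> ((s 0 \<in> NN \<and> s (Suc 0) \<in> NN \<longrightarrow>
      w \<in> V \<and> (\<exists>f\<in>V. recp emp (\<lambda>k. nadd k (s 0)) f (s (Suc 0)) \<and> pair (s (Suc 0)) w \<in> elts f)) \<and>
      (\<not> (s 0 \<in> NN \<and> s (Suc 0) \<in> NN) \<longrightarrow> w = emp))"
    using nmult_iff[of "s 0" "s (Suc 0)" w]
    by (cases "s 0 \<in> NN"; cases "s (Suc 0) \<in> NN") (simp_all add: nmult_def)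
qed

end

section \<open>Arithmetic of the natural and the standard numbers\<close>

context THS
begin

lemma nadd_emp_left [simp]: "m \<in> NN \<Longrightarrow> nadd emp m = m"
  by (rule NN_induct[where P = "\<lambda>m. nadd emp m = m"], intro defn) auto

lemma nadd_succ_left: "m \<in> NN \<Longrightarrow> n \<in> NN \<Longrightarrow> nadd (succ m) n = succ (nadd m n)"
  by (rule NN_induct[where P = "\<lambda>n. nadd (succ m) n = succ (nadd m n)"], intro defn NN_V) auto

lemma nadd_commute: "m \<in> NN \<Longrightarrow> n \<in> NN \<Longrightarrow> nadd m n = nadd n m"
  by (rule NN_induct[where P = "\<lambda>n. nadd m n = nadd n m"], intro defn NN_V) (auto simp: nadd_succ_left)

lemma nadd_assoc: "m \<in> NN \<Longrightarrow> n \<in> NN \<Longrightarrow> k \<in> NN \<Longrightarrow> nadd (nadd m n) k = nadd m (nadd n k)"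
  by (rule NN_induct[where P = "\<lambda>k. nadd (nadd m n) k = nadd m (nadd n k)"], intro defn NN_V) auto

lemma nmult_emp_left [simp]: "m \<in> NN \<Longrightarrow> nmult emp m = emp"
  by (rule NN_induct[where P = "\<lambda>m. nmult emp m = emp"], intro defn) auto

lemma nmult_succ_left: "m \<in> NN \<Longrightarrow> n \<in> NN \<Longrightarrow> nmult (succ m) n = nadd (nmult m n) n"
proof (rule NN_induct[where P = "\<lambda>n. nmult (succ m) n = nadd (nmult m n) n"])
  assume "m \<in> NN" then show "Def V (\<lambda>s. nmult (succ m) (s 0) = nadd (nmult m (s 0)) (s 0))"
    by (intro defn NN_V)
  fix n assume n: "n \<in> NN" "nmult (succ m) n = nadd (nmult m n) n" and m: "m \<in> NN"
  then show "nmult (succ m) (succ n) = nadd (nmult m (succ n)) (succ n)"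
    by (simp add: nadd_assoc nadd_commute[of n m])
qed auto

lemma nmult_commute: "m \<in> NN \<Longrightarrow> n \<in> NN \<Longrightarrow> nmult m n = nmult n m"
  by (rule NN_induct[where P = "\<lambda>n. nmult m n = nmult n m"], intro defn NN_V) (auto simp: nmult_succ_left)

lemma nmult_nadd: "m \<in> NN \<Longrightarrow> n \<in> NN \<Longrightarrow> k \<in> NN \<Longrightarrow> nmult m (nadd n k) = nadd (nmult m n) (nmult m k)"
  by (rule NN_induct[where P = "\<lambda>k. nmult m (nadd n k) = nadd (nmult m n) (nmult m k)"], intro defn NN_V)
     (auto simp: nadd_assoc)

lemma nmult_assoc: "m \<in> NN \<Longrightarrow> n \<in> NN \<Longrightarrow> k \<in> NN \<Longrightarrow> nmult (nmult m n) k = nmult m (nmult n k)"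
  by (rule NN_induct[where P = "\<lambda>k. nmult (nmult m n) k = nmult m (nmult n k)"], intro defn NN_V)
     (auto simp: nmult_nadd)

lemma nadd_mem: "m \<in> NN \<Longrightarrow> n \<in> NN \<Longrightarrow> k \<in> NN \<Longrightarrow> nadd m k \<in> elts (nadd n k) \<longleftrightarrow> m \<in> elts n"
  by (rule NN_induct[where P = "\<lambda>k. nadd m k \<in> elts (nadd n k) \<longleftrightarrow> m \<in> elts n"], intro defn NN_V)
     (auto simp: succ_mem_succ simp del: elts_succ)

lemma mem_nadd: "m \<in> NN \<Longrightarrow> n \<in> NN \<Longrightarrow> m \<in> elts (nadd m (succ n))"
  by (rule NN_induct[where P = "\<lambda>n. m \<in> elts (nadd m (succ n))"], intro defn NN_V) auto

lemma mem_iff_nadd: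
  assumes m: "m \<in> NN" and n: "n \<in> NN" shows "m \<in> elts n \<longleftrightarrow> (\<exists>k\<in>NN. n = nadd m (succ k))"
proof
  assume "m \<in> elts n"
  moreover have "m \<in> elts n \<longrightarrow> (\<exists>k\<in>V. k \<in> NN \<and> n = nadd m (succ k))"
  proof (rule NN_induct[OF _ _ _ n])
    show "Def V (\<lambda>s. m \<in> elts (s 0) \<longrightarrow> (\<exists>k\<in>V. k \<in> NN \<and> s 0 = nadd m (succ k)))" by (intro defn NN_V m)
    fix n assume n: "n \<in> NN" and IH: "m \<in> elts n \<longrightarrow> (\<exists>k\<in>V. k \<in> NN \<and> n = nadd m (succ k))"
    show "m \<in> elts (succ n) \<longrightarrow> (\<exists>k\<in>V. k \<in> NN \<and> succ n = nadd m (succ k))"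
    proof
      assume "m \<in> elts (succ n)"
      then consider "m = n" | "m \<in> elts n" using n by auto
      then show "\<exists>k\<in>V. k \<in> NN \<and> succ n = nadd m (succ k)"
      proof cases
        case 1 then show ?thesis using m by (intro bexI[of _ emp]) auto
      next
        case 2 
        then obtain k where "k \<in> NN" "n = nadd m (succ k)" using IH by blast
        then show ?thesis using m by (intro bexI[of _ "succ k"]) auto
      qed
    qed
  qed simp
  ultimately show "\<exists>k\<in>NN. n = nadd m (succ k)" by blast
next
  assume "\<exists>k\<in>NN. n = nadd m (succ k)" then show "m \<in> elts n" using mem_nadd[OF m] by auto
qed

lemma nmult_mem: "m \<in> elts n \<Longrightarrow> n \<in> NN \<Longrightarrow> k \<in> NN \<Longrightarrow> k \<noteq> emp \<Longrightarrow> nmult k m \<in> elts (nmult k n)"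
proof -
  assume mn: "m \<in> elts n" and n: "n \<in> NN" and k: "k \<in> NN" "k \<noteq> emp"
  have m: "m \<in> NN" using NN_mem mn n by blast
  obtain j where j: "j \<in> NN" "n = nadd m (succ j)" using mem_iff_nadd[OF m n] mn by blast
  obtain l where l: "l \<in> NN" "k = succ l" using k(1) k(2) by (cases rule: NN_cases) auto
  have "nmult k n = nadd (nmult k m) (succ (nadd (nmult k j) l))"
    using j l m k by (simp add: nmult_nadd nadd_assoc)
  then show ?thesis using mem_nadd[of "nmult k m" "nadd (nmult k j) l"] by simp
qed

lemma NN_division:
  assumes d: "d \<in> NN" "d \<noteq> emp" and n: "n \<in> NN"
  shows "\<exists>q\<in>NN. \<exists>r\<in>elts d. n = nadd (nmult d q) r"
proof -
  have "\<exists>q\<in>V. q \<in> NN \<and> (\<exists>r\<in>elts d. n = nadd (nmult d q) r)"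
  proof (rule NN_induct[OF _ _ _ n])
    show "Def V (\<lambda>s. \<exists>q\<in>V. q \<in> NN \<and> (\<exists>r\<in>elts d. s 0 = nadd (nmult d q) r))" by (intro defn NN_V d)
    obtain l where l: "l \<in> NN" "d = succ l" using d(1) d(2) by (cases rule: NN_cases) auto
    then have e: "emp \<in> elts d" using emp_mem_succ by simp
    have "emp = nadd (nmult d emp) emp" using d by simp
    with e show "\<exists>q\<in>V. q \<in> NN \<and> (\<exists>r\<in>elts d. emp = nadd (nmult d q) r)"
      using emp_NN emp_V by blast
    fix n assume "n \<in> NN" "\<exists>q\<in>V. q \<in> NN \<and> (\<exists>r\<in>elts d. n = nadd (nmult d q) r)"
    then obtain q r where q: "q \<in> NN" and r: "r \<in> elts d" and n: "n = nadd (nmult d q) r" by blast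
    have rN: "r \<in> NN" using NN_mem r d by blast
    have "succ r \<in> elts d \<or> succ r = d"
      using NN_linear[of "succ r" d] rN d(1) mem_irrefl[of d] mem_asym[OF r] r by auto
    then show "\<exists>q\<in>V. q \<in> NN \<and> (\<exists>r\<in>elts d. succ n = nadd (nmult d q) r)"
    proof
      assume "succ r \<in> elts d"
      moreover have "succ n = nadd (nmult d q) (succ r)" using n rN by simp
      ultimately show ?thesis using q NN_V by blast
    next
      assume "succ r = d"
      then have "succ n = nadd (nmult d (succ q)) emp" using n rN q d nadd_succ[of "nmult d q" r] by simp
      then show ?thesis using e q NN_V succ_NN by blast
    qed
  qed
  then show ?thesis by blast
qed

text \<open>The least positive multiple of the denominator clearing \<open>x / d\<close>, found by foundation.\<close>

lemma least_clearing:
  assumes x: "x \<in> NN" and d: "d \<in> NN" "d \<noteq> emp"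
  shows "\<exists>t\<in>NN. \<exists>j\<in>NN. t \<noteq> emp \<and> nmult x t = nmult d j \<and>
    (\<forall>t'\<in>NN. \<forall>j'\<in>NN. t' \<noteq> emp \<longrightarrow> nmult x t' = nmult d j' \<longrightarrow> t = t' \<or> t \<in> elts t')"
proof -
  let ?P = "\<lambda>t. t \<noteq> emp \<and> (\<exists>j\<in>V. j \<in> NN \<and> nmult x t = nmult d j)"
  \<comment> \<open>The search is bounded by \<open>d\<close>, which clears the fraction itself with
    cofactor \<open>x\<close>; the bound makes the candidates a set, so that a least one
    exists.\<close>
  let ?A = "{t \<in> elts (succ d). ?P t}"
  have "isset ?A" using x d by (intro isset_Collect isset_elts defn NN_V succ_V)
  moreover have dA: "d \<in> ?A" using d x nmult_commute[of d x] by auto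
  moreover have "?A \<subseteq> NN" using NN_mem[OF succ_NN[OF d(1)]] by blast
  ultimately obtain t where t: "t \<in> ?A" and min: "\<forall>y\<in>?A. t = y \<or> t \<in> elts y" using NN_min[of ?A] by blast
  have tN: "t \<in> NN" using t \<open>?A \<subseteq> NN\<close> by blast
  have "t = t' \<or> t \<in> elts t'" if t': "t' \<in> NN" "j' \<in> NN" "t' \<noteq> emp" "nmult x t' = nmult d j'" for t' j'
  proof (cases "t' \<in> elts (succ d)")
    case True
    then have "t' \<in> ?A" using t' by (auto intro!: bexI[of _ j'])
    then show ?thesis using min by blast
  next
    case False
    then have "d \<in> elts t'" using NN_linear[of t' d] t' d by auto
    moreover have "t = d \<or> t \<in> elts d" using min dA by blast
    ultimately show ?thesis using NN_trans[OF t'(1)] by blast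
  qed
  with tN t show ?thesis by blast
qed

lemma SN_emp [simp]: "emp \<in> SN" and SN_succ [simp]: "n \<in> SN \<Longrightarrow> succ n \<in> SN"
  unfolding SN_def by auto

text \<open>In contrast to \<open>NN_induct\<close> the formula may quantify over classes:
  comprehension turns it into an inductive class, and \<open>SN\<close> lies in every such class.
  Intersecting that class with \<open>NN\<close> first gives \<open>n \<in> NN\<close> in the
  step.\<close>

lemma SN_induct:
  assumes P: "Def UNIV (\<lambda>s. P (s 0))" and "P emp" and step: "\<And>n. n \<in> NN \<Longrightarrow> P n \<Longrightarrow> P (succ n)"
    and n: "n \<in> SN"
  shows "P n"
proof -
  have "isclass {y \<in> V. y \<in> NN \<and> P y}" by (intro isclassI defn P)
  then obtain Z where Z: "elts Z = {y \<in> V. y \<in> NN \<and> P y}" unfolding isclass_def by blast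
  have "n \<in> elts Z"
    using n unfolding SN_def by (rule InterD) (use Z assms(2) step in auto)
  then show ?thesis using Z by simp
qed

lemma SN_NN: assumes "n \<in> SN" shows "n \<in> NN"
  by (rule SN_induct[OF _ _ _ assms], intro defn) auto

lemma isclass_SN: "isclass SN"
proof -
  have "Def UNIV (\<lambda>s. \<forall>X. (emp \<in> elts X \<and> (\<forall>n\<in>elts X. succ n \<in> elts X)) \<longrightarrow> s 0 \<in> elts X)"
    by (intro defn)
  then have "isclass {y \<in> V. \<forall>X. (emp \<in> elts X \<and> (\<forall>n\<in>elts X. succ n \<in> elts X)) \<longrightarrow> y \<in> elts X}"
    by (rule isclassI)
  moreover have "SN = {y \<in> V. \<forall>X. (emp \<in> elts X \<and> (\<forall>n\<in>elts X. succ n \<in> elts X)) \<longrightarrow> y \<in> elts X}"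
    using SN_NN NN_V by (auto simp: SN_def)
  ultimately show ?thesis by simp
qed

lemma Def_isclass: "isclass A \<Longrightarrow> DT UNIV f \<Longrightarrow> Def UNIV (\<lambda>s. f s \<in> A)"
  unfolding isclass_def by (elim exE) (clarify, intro defn)

lemmas Def_SN [defn] = Def_isclass[OF isclass_SN]

lemma SN_mem: assumes n: "n \<in> SN" and "m \<in> elts n" shows "m \<in> SN"
proof -
  have "n \<in> SN \<and> (\<forall>m\<in>elts n. m \<in> SN)"
    by (rule SN_induct[where P = "\<lambda>n. n \<in> SN \<and> (\<forall>m\<in>elts n. m \<in> SN)", OF _ _ _ n], intro defn) auto
  then show ?thesis using assms(2) by blast
qed

lemma SN_V: "n \<in> SN \<Longrightarrow> n \<in> V"
  using SN_NN by simp

lemma SN_nadd: "\<lbrakk>a \<in> SN; b \<in> SN\<rbrakk> \<Longrightarrow> nadd a b \<in> SN"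
  by (rule SN_induct[where P = "\<lambda>b. nadd a b \<in> SN"], intro defn) (auto simp: SN_NN)

lemma SN_nmult: "\<lbrakk>a \<in> SN; b \<in> SN\<rbrakk> \<Longrightarrow> nmult a b \<in> SN"
  by (rule SN_induct[where P = "\<lambda>b. nmult a b \<in> SN"], intro defn) (auto simp: SN_NN SN_nadd)

end

section \<open>Small and thin classes, saturation\<close>

context THS
begin

text \<open>Smallness and thinness for extents. The test runs over the subclasses present in the
  model, not over all HOL subsets.\<close>

definition sml :: "'c set \<Rightarrow> bool" where
  "sml A \<longleftrightarrow> (\<forall>B. isclass B \<longrightarrow> B \<subseteq> A \<longrightarrow> isset B)"

definition thn :: "'c set \<Rightarrow> bool" where
  "thn A \<longleftrightarrow> (\<forall>B. isset B \<longrightarrow> B \<subseteq> A \<longrightarrow> sml B)"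

lemma small_sml: "small X \<longleftrightarrow> sml (elts X)"
  unfolding small_def sml_def isclass_def by (auto simp flip: isset_elts_iff)

lemma thin_thn: "thin X \<longleftrightarrow> thn (elts X)"
  unfolding thin_def thn_def isset_def by (auto simp: small_sml)

lemma sml_subset: "sml A \<Longrightarrow> B \<subseteq> A \<Longrightarrow> sml B"
  unfolding sml_def by (meson subset_trans)

lemma thn_subset: "thn A \<Longrightarrow> B \<subseteq> A \<Longrightarrow> thn B"
  unfolding thn_def by (meson subset_trans)

lemma isclass_Int: "isclass A \<Longrightarrow> isclass B \<Longrightarrow> isclass (A \<inter> B)"
  using isclass_Collect[of A "\<lambda>x. x \<in> B"] Def_isclass[of B "\<lambda>s. s 0"] DT_varT[OF transp_UNIV] by (simp add: Int_def)

lemma sml_Un: "isclass A \<Longrightarrow> isclass B \<Longrightarrow> sml A \<Longrightarrow> sml B \<Longrightarrow> sml (A \<union> B)"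
  unfolding sml_def
proof (intro allI impI)
  fix C assume *: "isclass A" "isclass B" "\<forall>C. isclass C \<longrightarrow> C \<subseteq> A \<longrightarrow> isset C" "\<forall>C. isclass C \<longrightarrow> C \<subseteq> B \<longrightarrow> isset C"
    "isclass C" "C \<subseteq> A \<union> B"
  then have "isset (C \<inter> A)" "isset (C \<inter> B)" using isclass_Int by simp_all
  then have "isset (C \<inter> A \<union> C \<inter> B)" by simp
  moreover have "C \<inter> A \<union> C \<inter> B = C" using *(6) by blast
  ultimately show "isset C" by simp
qed

lemma sml_empty [simp]: "sml {}"
  by (simp add: sml_def)

lemma sml_single: "y \<in> V \<Longrightarrow> sml {y}"
  unfolding sml_def by (auto simp: subset_singleton_iff)

lemma sml_insert: "isset A \<Longrightarrow> sml A \<Longrightarrow> y \<in> V \<Longrightarrow> sml (insert y A)"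
  using sml_Un[of "{y}" A] sml_single isset_class by simp

lemma Def_small [defn]: "DT UNIV f \<Longrightarrow> Def UNIV (\<lambda>s. small (f s))"
proof (rule Def_subst1)
  show "Def UNIV (\<lambda>s. small (s 0))" unfolding small_def by (intro defn)
qed

lemma sml_SN: assumes n: "n \<in> SN" shows "sml (elts n)"
proof -
  have "small n"
    by (rule SN_induct[OF _ _ _ n], intro defn) (auto simp: small_sml intro: sml_insert)
  then show ?thesis by (simp add: small_sml)
qed

text \<open>A nonempty set of standard numbers has a standard maximum and so lies inside a single
  standard number, which is small.\<close>

lemma thn_SN: "thn SN"
  unfolding thn_def
proof (intro allI impI)
  fix B assume B: "isset B" "B \<subseteq> SN"
  show "sml B"
  proof (cases "B = {}")
    case False
    then obtain m where m: "m \<in> B" "\<forall>y\<in>B. y = m \<or> y \<in> elts m" using NN_max[OF B(1)] B(2) SN_NN by blast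
    then have "succ m \<in> SN" "B \<subseteq> elts (succ m)" using B(2) SN_NN[of m] by auto
    then show ?thesis using sml_SN sml_subset by blast
  qed simp
qed

lemma succ_not_le: "m \<in> V \<Longrightarrow> succ m \<noteq> m \<and> succ m \<notin> elts m"
  using mem_irrefl[of m] mem_asym[of m "succ m"] elts_succ[of m] by (metis insertI1)

lemma not_isset_SN: "\<not> isset SN"
proof
  assume "isset SN"
  moreover have "SN \<noteq> {}" using SN_emp by blast
  ultimately obtain m where m: "m \<in> SN" "\<forall>y\<in>SN. y = m \<or> y \<in> elts m" using NN_max[of SN] SN_NN by blast
  then have "succ m = m \<or> succ m \<in> elts m" by simp
  then show False using succ_not_le[of m] m(1) SN_NN[of m] by simp
qed

lemma SN_initial: "n \<in> NN \<Longrightarrow> n \<notin> SN \<Longrightarrow> SN \<subseteq> elts n"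
  using NN_linear[of _ n] SN_NN SN_mem by blast

text \<open>(Thin) encloses \<open>SN\<close> in a set. The natural numbers in that set have a
  maximum, and a standard maximum would be exceeded by its own successor.\<close>

lemma ex_infinite: "\<exists>M\<in>NN. M \<notin> SN"
proof -
  have "thin (code SN)" using thn_SN by (simp add: thin_thn elts_code isclass_SN)
  from Thin[OF this] obtain u where u: "u \<in> V" "SN \<subseteq> elts u" by (auto simp: elts_code isclass_SN)
  let ?A = "{x \<in> elts u. x \<in> NN}"
  have "isset ?A" by (intro isset_Collect isset_elts u defn)
  moreover have *: "SN \<subseteq> ?A" using u SN_NN by auto
  then have "?A \<noteq> {}" using SN_emp by blast
  ultimately obtain m where m: "m \<in> ?A" "\<forall>y\<in>?A. y = m \<or> y \<in> elts m" using NN_max[of ?A] by blast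
  then have mN: "m \<in> NN" by blast
  have "m \<notin> SN"
  proof
    assume "m \<in> SN"
    then have "succ m \<in> ?A" using * SN_succ by blast
    then have "succ m = m \<or> succ m \<in> elts m" using m(2) by blast
    then show False using succ_not_le[of m] mN by simp
  qed
  then show ?thesis using mN by blast
qed

lemma sml_in_SN: assumes n: "n \<in> NN" and "sml (elts n)" shows "n \<in> SN"
proof (rule ccontr)
  assume "n \<notin> SN"
  then have "isset SN" using SN_initial[OF n] assms(2) isclass_SN unfolding sml_def by blast
  then show False using not_isset_SN by simp
qed

text \<open>The bijection \<open>g\<close> between \<open>n\<close> and \<open>b\<close> is spelled
  out with bounded quantifiers so that set induction applies to its existence. It serves to replace
  a small set by a standard number in the next lemma.\<close>

lemma enumeration:
  assumes b: "b \<in> V"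
  shows "\<exists>n\<in>V. \<exists>g\<in>V. n \<in> NN \<and> (\<forall>i\<in>elts n. \<exists>y\<in>elts b. pair i y \<in> elts g) \<and>
    (\<forall>y\<in>elts b. \<exists>i\<in>elts n. pair i y \<in> elts g) \<and>
    (\<forall>i\<in>elts n. \<forall>j\<in>elts n. \<forall>y\<in>elts b. pair i y \<in> elts g \<longrightarrow> pair j y \<in> elts g \<longrightarrow> i = j) \<and>
    (\<forall>i\<in>elts n. \<forall>y\<in>elts b. \<forall>z\<in>elts b. pair i y \<in> elts g \<longrightarrow> pair i z \<in> elts g \<longrightarrow> y = z) \<and>
    (\<forall>p\<in>elts g. \<exists>i\<in>elts n. \<exists>y\<in>elts b. p = pair i y)"
    (is "\<exists>n\<in>V. \<exists>g\<in>V. ?E n g b")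
proof (rule set_induct[where P = "\<lambda>b. \<exists>n\<in>V. \<exists>g\<in>V. ?E n g b", OF _ _ _ b])
  show "Def V (\<lambda>s. \<exists>n\<in>V. \<exists>g\<in>V. ?E n g (s 0))" by (intro defn)
  show "\<exists>n\<in>V. \<exists>g\<in>V. ?E n g emp" by (intro bexI[of _ emp]) auto
  fix b y assume b: "b \<in> V" and y: "y \<in> V" and "\<exists>n\<in>V. \<exists>g\<in>V. ?E n g b"
  then obtain n g where g: "g \<in> V" and E: "?E n g b" by blast
  have n: "n \<in> NN" using E by blast
  show "\<exists>n\<in>V. \<exists>g\<in>V. ?E n g (adjoin b y)"
  proof (cases "y \<in> elts b")
    case True
    then have "adjoin b y = b" using y by (auto simp flip: elts_inject)
    then show ?thesis using E g n NN_V by (intro bexI[of _ n] bexI[of _ g]) simp_all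
  next
    case False
    let ?g = "adjoin g (pair n y)"
    have eg: "elts ?g = insert (pair n y) (elts g)" using n y by simp
    have eb: "elts (adjoin b y) = insert y (elts b)" using y by simp
    have en: "elts (succ n) = insert n (elts n)" using n by simp
    have nn: "n \<notin> elts n" by (rule mem_irrefl)
    have iV: "i \<in> V" if "i \<in> elts n" for i using that elts_V by blast
    have zV: "z \<in> V" if "z \<in> elts b" for z using that elts_V by blast
    have old: "i \<in> elts n \<and> z \<in> elts b" if "pair i z \<in> elts g" "i \<in> V" "z \<in> V" for i z
    proof -
      have "\<exists>j\<in>elts n. \<exists>y\<in>elts b. pair i z = pair j y" using E that(1) by (elim conjE) (erule bspec)
      then obtain j w where "j \<in> elts n" "w \<in> elts b" "pair i z = pair j w" by blast
      then show ?thesis using that iV zV by simp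
    qed
    have mem: "pair i z \<in> elts ?g \<longleftrightarrow> i = n \<and> z = y \<or> i \<in> elts n \<and> z \<in> elts b \<and> pair i z \<in> elts g" if "i \<in> V" "z \<in> V" for i z
      using old[OF _ that] that n y unfolding eg by auto
    have 1: "\<forall>i\<in>elts (succ n). \<exists>z\<in>elts (adjoin b y). pair i z \<in> elts ?g"
      unfolding eg eb en using E by auto
    have 2: "\<forall>z\<in>elts (adjoin b y). \<exists>i\<in>elts (succ n). pair i z \<in> elts ?g"
      unfolding eg eb en using E by auto
    have V: "i \<in> V" if "i \<in> elts (succ n)" for i using that elts_V by blast
    have V': "z \<in> V" if "z \<in> elts (adjoin b y)" for z using that elts_V by blast
    have inj: "i = j" if "pair i z \<in> elts g" "pair j z \<in> elts g" "i \<in> elts n" "j \<in> elts n" "z \<in> elts b" for i j z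
      using E that by (elim conjE) meson
    have fn: "z = w" if "pair i z \<in> elts g" "pair i w \<in> elts g" "i \<in> elts n" "w \<in> elts b" "z \<in> elts b" for i w z
      using E that by (elim conjE) meson
    have 3: "\<forall>i\<in>elts (succ n). \<forall>j\<in>elts (succ n). \<forall>z\<in>elts (adjoin b y). pair i z \<in> elts ?g \<longrightarrow> pair j z \<in> elts ?g \<longrightarrow> i = j"
      using mem V V' False inj by (metis (no_types, lifting))
    have 4: "\<forall>i\<in>elts (succ n). \<forall>z\<in>elts (adjoin b y). \<forall>w\<in>elts (adjoin b y). pair i z \<in> elts ?g \<longrightarrow> pair i w \<in> elts ?g \<longrightarrow> z = w"
      using mem V V' nn fn by (metis (no_types, lifting))
    have 5: "\<forall>p\<in>elts ?g. \<exists>i\<in>elts (succ n). \<exists>z\<in>elts (adjoin b y). p = pair i z"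
    proof
      fix p assume "p \<in> elts ?g"
      then consider "p = pair n y" | "p \<in> elts g" unfolding eg by blast
      then show "\<exists>i\<in>elts (succ n). \<exists>z\<in>elts (adjoin b y). p = pair i z"
      proof cases
        case 2
        have "\<forall>p\<in>elts g. \<exists>i\<in>elts n. \<exists>y\<in>elts b. p = pair i y" using E by (elim conjE)
        with 2 show ?thesis unfolding eb en by blast
      qed (unfold eb en, blast)
    qed
    have "?E (succ n) ?g (adjoin b y)" by (intro conjI succ_NN n 1 2 3 4 5)
    moreover have "succ n \<in> V" "?g \<in> V" using n g y by auto
    ultimately show ?thesis by blast
  qed
qed

text \<open>Here \<open>P\<close> may be any formula, where \<open>isset_induct\<close> admits set
  formulas only. Subclasses of the counting number \<open>n\<close> correspond under
  \<open>g\<close> to subclasses of \<open>A\<close>, which are sets because \<open>A\<close> is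
  small; so \<open>n\<close> is small, hence standard, and induction along \<open>SN\<close> runs
  through the initial segments of the enumeration.\<close>

lemma small_induct:
  assumes A: "isset A" "sml A" and P: "Def UNIV (\<lambda>s. P (elts (s 0)))" and "P {}"
    and step: "\<And>B y. isset B \<Longrightarrow> sml B \<Longrightarrow> B \<subseteq> A \<Longrightarrow> y \<in> A \<Longrightarrow> P B \<Longrightarrow> P (insert y B)"
  shows "P A"
proof -
  obtain b where b: "b \<in> V" "A = elts b" using A(1) by (auto simp: isset_def)
  obtain n g where n: "n \<in> NN" and g: "g \<in> V"
    and tot: "\<forall>i\<in>elts n. \<exists>y\<in>elts b. pair i y \<in> elts g" and surj: "\<forall>y\<in>elts b. \<exists>i\<in>elts n. pair i y \<in> elts g"
    and inj: "\<forall>i\<in>elts n. \<forall>j\<in>elts n. \<forall>y\<in>elts b. pair i y \<in> elts g \<longrightarrow> pair j y \<in> elts g \<longrightarrow> i = j"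
    and fn: "\<forall>i\<in>elts n. \<forall>y\<in>elts b. \<forall>z\<in>elts b. pair i y \<in> elts g \<longrightarrow> pair i z \<in> elts g \<longrightarrow> y = z"
    using enumeration[OF b(1)] by (elim bexE conjE)
  have "isset Z" if Z: "isclass Z" "Z \<subseteq> elts n" for Z
  proof -
    have "isclass {y \<in> elts b. \<exists>i\<in>elts n. i \<in> Z \<and> pair i y \<in> elts g}"
      by (intro isclass_Collect isclass_elts defn Def_isclass Z)
    then have "isset {y \<in> elts b. \<exists>i\<in>elts n. i \<in> Z \<and> pair i y \<in> elts g}" using A(2) unfolding sml_def b by simp
    then obtain w where w: "w \<in> V" "elts w = {y \<in> elts b. \<exists>i\<in>elts n. i \<in> Z \<and> pair i y \<in> elts g}" unfolding isset_def by blast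
    have "isset {i \<in> elts n. \<exists>y\<in>elts w. pair i y \<in> elts g}" by (intro isset_Collect isset_elts defn w g NN_V n)
    moreover have "i \<in> Z \<longleftrightarrow> (\<exists>y\<in>elts w. pair i y \<in> elts g)" if i: "i \<in> elts n" for i
    proof
      assume "i \<in> Z" then show "\<exists>y\<in>elts w. pair i y \<in> elts g" using tot i unfolding w by blast
    next
      assume "\<exists>y\<in>elts w. pair i y \<in> elts g"
      then obtain y j where "y \<in> elts b" "j \<in> elts n" "j \<in> Z" "pair j y \<in> elts g" "pair i y \<in> elts g" unfolding w by blast
      then show "i \<in> Z" using inj i by blast
    qed
    then have "{i \<in> elts n. \<exists>y\<in>elts w. pair i y \<in> elts g} = Z" using Z(2) by blast
    ultimately show ?thesis by simp
  qed
  then have nS: "n \<in> SN" using sml_in_SN[OF n] unfolding sml_def by blast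
  let ?B = "\<lambda>k. {y \<in> elts b. \<exists>i\<in>elts k. pair i y \<in> elts g}"
  have B: "isset (?B k)" if "k \<in> NN" for k by (intro isset_Collect isset_elts defn g b NN_V that)
  have "(n = k \<or> k \<in> elts n) \<longrightarrow> P (?B k)" if "k \<in> SN" for k
  proof -
    \<comment> \<open>\<open>P (?B k)\<close> is no formula in \<open>k\<close> as it stands;
      quantifying over every set \<open>z\<close> with the elements of \<open>?B k\<close> makes it
      one.\<close>
    have "(n = k \<or> k \<in> elts n) \<longrightarrow> (\<forall>z\<in>V. (\<forall>y\<in>V. y \<in> elts z \<longleftrightarrow> y \<in> elts b \<and> (\<exists>i\<in>elts k. pair i y \<in> elts g)) \<longrightarrow> P (elts z))"
    proof (rule SN_induct[OF _ _ _ that])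
      show "Def UNIV (\<lambda>s. (n = s 0 \<or> s 0 \<in> elts n) \<longrightarrow> 
        (\<forall>z\<in>V. (\<forall>y\<in>V. y \<in> elts z \<longleftrightarrow> y \<in> elts b \<and> (\<exists>i\<in>elts (s 0). pair i y \<in> elts g)) \<longrightarrow> P (elts z)))"
        by (intro defn Def_subst1[OF P])
      show "(n = emp \<or> emp \<in> elts n) \<longrightarrow>
        (\<forall>z\<in>V. (\<forall>y\<in>V. y \<in> elts z \<longleftrightarrow> y \<in> elts b \<and> (\<exists>i\<in>elts emp. pair i y \<in> elts g)) \<longrightarrow> P (elts z))"
      proof (intro impI ballI)
        fix z assume "\<forall>y\<in>V. y \<in> elts z \<longleftrightarrow> y \<in> elts b \<and> (\<exists>i\<in>elts emp. pair i y \<in> elts g)"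
        then have "elts z = {}" using elts_V by auto
        then show "P (elts z)" using \<open>P {}\<close> by simp
      qed
      fix k assume k: "k \<in> NN" and IH: "(n = k \<or> k \<in> elts n) \<longrightarrow>
        (\<forall>z\<in>V. (\<forall>y\<in>V. y \<in> elts z \<longleftrightarrow> y \<in> elts b \<and> (\<exists>i\<in>elts k. pair i y \<in> elts g)) \<longrightarrow> P (elts z))"
      show "(n = succ k \<or> succ k \<in> elts n) \<longrightarrow>
        (\<forall>z\<in>V. (\<forall>y\<in>V. y \<in> elts z \<longleftrightarrow> y \<in> elts b \<and> (\<exists>i\<in>elts (succ k). pair i y \<in> elts g)) \<longrightarrow> P (elts z))"
      proof (intro impI ballI)
        fix z assume s: "n = succ k \<or> succ k \<in> elts n" and z: "z \<in> V"
          "\<forall>y\<in>V. y \<in> elts z \<longleftrightarrow> y \<in> elts b \<and> (\<exists>i\<in>elts (succ k). pair i y \<in> elts g)"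
        have kn: "k \<in> elts n" using s NN_trans[OF n, of "succ k" k] k by auto
        have "P (elts (code (?B k)))"
          by (rule IH[THEN mp, OF disjI2[OF kn], THEN bspec, OF code_V[OF B[OF k]], THEN mp]) (simp add: B[OF k])
        then have PB: "P (?B k)" using B[OF k] by simp
        obtain y where y: "y \<in> elts b" "pair k y \<in> elts g" using tot kn by blast
        have ze: "elts z = {y \<in> elts b. \<exists>i\<in>elts (succ k). pair i y \<in> elts g}" using z elts_V by blast
        have "elts z = insert y (?B k)" unfolding ze using y fn kn k by auto
        moreover have "sml (?B k)" using A(2) b by (auto intro: sml_subset)
        ultimately show "P (elts z)" using step[OF B[OF k] _ _ _ PB, of y] y b by simp
      qed
    qed
    note H = this
    show ?thesis
    proof
      assume nk: "n = k \<or> k \<in> elts n"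
      note Bk = B[OF SN_NN[OF that]]
      have "P (elts (code (?B k)))"
        by (rule H[THEN mp, OF nk, THEN bspec, OF code_V[OF Bk], THEN mp]) (simp add: Bk)
      then show "P (?B k)" using Bk by simp
    qed
  qed
  then have "P (?B n)" using nS by blast
  moreover have "?B n = A" using surj b by blast
  ultimately show ?thesis by simp
qed

text \<open>Otherwise \<open>u\<close>, its singleton and \<open>pair u x\<close> would form a
  membership cycle. So \<open>pair u x\<close> is a mark that can be added to a subset of
  \<open>u\<close> and recognised afterwards.\<close>

lemma pair_self_notin: assumes "u \<in> V" "x \<in> V" shows "pair u x \<notin> elts u"
proof
  assume p: "pair u x \<in> elts u"
  let ?A = "{u, upair u u, pair u x}"
  have "isset ?A" using assms by simp
  from foundation[OF this] obtain y where y: "y \<in> ?A" "elts y \<inter> ?A = {}" by blast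
  have "upair u u \<in> elts (pair u x)" "u \<in> elts (upair u u)" using assms by (auto simp: pair_def)
  with y p show False by blast
qed

text \<open>Suppose no \<open>y\<close> meets all conditions. Then the sets of failures, the parts
  of \<open>U\<close> where \<open>Q x\<close> is false, cover \<open>U\<close>. They form a thin
  class, so by (Comp) a set of them already covers \<open>U\<close>. Its indices form a set inside
  the thin class \<open>X\<close>, which is therefore small, and \<open>fin\<close> produces an
  element of \<open>U\<close> that the cover misses.\<close>

lemma saturation:
  assumes X: "isclass X" "thn X" and U: "isset U" and Q: "Def UNIV (\<lambda>s. Q (s 0) (s (Suc 0)))"
    and QU: "\<And>x. x \<in> X \<Longrightarrow> isset {y \<in> U. Q x y}"
    and fin: "\<And>A. isset A \<Longrightarrow> A \<subseteq> X \<Longrightarrow> sml A \<Longrightarrow> \<exists>y\<in>U. \<forall>x\<in>A. Q x y"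
  shows "\<exists>y\<in>U. \<forall>x\<in>X. Q x y"
proof (rule ccontr)
  assume contra: "\<not> ?thesis"
  obtain u where u: "u \<in> V" "elts u = U" using U by (auto simp: isset_def)
  have "thin (code X)" using X by (simp add: thin_thn elts_code)
  from Thin[OF this] obtain w where w: "w \<in> V" "X \<subseteq> elts w" using X by (auto simp: elts_code)
  have XV: "x \<in> V" if "x \<in> X" for x using that w elts_V by blast
  let ?D = "\<lambda>x. {y \<in> U. \<not> Q x y}"
  \<comment> \<open>Different conditions may fail at the same places. The mark
    \<open>pair u x\<close> makes the assignment injective and lets the index be recovered by a set
    formula.\<close>
  let ?c = "\<lambda>x. code (insert (pair u x) (?D x))"
  have D: "isset (?D x)" if "x \<in> X" for x
  proof -
    have "isset {y \<in> elts u. y \<notin> elts (code {y \<in> U. Q x y})}"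
      by (intro isset_Collect isset_elts defn u code_V QU that)
    moreover have "{y \<in> elts u. y \<notin> elts (code {y \<in> U. Q x y})} = ?D x"
      using QU[OF that] u by auto
    ultimately show ?thesis by simp
  qed
  have cs: "isset (insert (pair u x) (?D x))" if "x \<in> X" for x using D[OF that] XV[OF that] u by simp
  have c: "?c x \<in> V" "elts (?c x) = insert (pair u x) (?D x)" if "x \<in> X" for x using cs[OF that] by simp_all
  have tag: "pair u x \<in> elts (?c x') \<longleftrightarrow> x = x'" if "x \<in> V" "x' \<in> X" for x x'
    using c(2)[OF that(2)] pair_self_notin[OF u(1) that(1)] u(1) that(1) XV[OF that(2)] unfolding u(2) by simp
  let ?C = "{z \<in> V. \<exists>x\<in>V. x \<in> X \<and> (\<forall>y\<in>V. y \<in> elts z \<longleftrightarrow> y = pair u x \<or> y \<in> elts u \<and> \<not> Q x y)}"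
  have C: "isclass ?C"
    by (intro isclassI defn Def_isclass X Def_subst2[OF Q])
  have Ceq: "?C = ?c ` X"
  proof (intro equalityI subsetI)
    fix z assume "z \<in> ?C"
    then obtain x where z: "x \<in> X" "\<forall>y\<in>V. y \<in> elts z \<longleftrightarrow> y = pair u x \<or> y \<in> elts u \<and> \<not> Q x y" by blast
    then have "z = ?c x" by (subst set_eq_iff_elts) (simp add: c(2)[OF z(1)] u(2))
    then show "z \<in> ?c ` X" using z by blast
  next
    fix z assume "z \<in> ?c ` X"
    then obtain x where x: "x \<in> X" "z = ?c x" by blast
    have "\<forall>y\<in>V. y \<in> elts (?c x) \<longleftrightarrow> y = pair u x \<or> y \<in> elts u \<and> \<not> Q x y"
      unfolding c(2)[OF x(1)] u(2) by auto
    then show "z \<in> ?C" using x XV[OF x(1)] c(1)[OF x(1)] by blast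
  qed
  \<comment> \<open>The indices of a set \<open>v\<close> of conditions are separated, by their
    marks, from a set \<open>w\<close> that encloses the thin class \<open>X\<close>; thus they form
    a set, and thinness of \<open>X\<close> makes it small.\<close>
  have idx: "isset {x \<in> elts w. \<exists>z\<in>elts v. pair u x \<in> elts z} \<and> {x \<in> elts w. \<exists>z\<in>elts v. pair u x \<in> elts z} \<subseteq> X \<and>
      sml {x \<in> elts w. \<exists>z\<in>elts v. pair u x \<in> elts z}" if v: "v \<in> V" "elts v \<subseteq> ?c ` X" for v
  proof -
    let ?A = "{x \<in> elts w. \<exists>z\<in>elts v. pair u x \<in> elts z}"
    have A: "isset ?A" by (intro isset_Collect isset_elts defn v w u)
    have "?A \<subseteq> X"
    proof
      fix x assume x: "x \<in> ?A"
      then obtain z where z: "z \<in> elts v" "pair u x \<in> elts z" by blast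
      then obtain x' where "x' \<in> X" "z = ?c x'" using v(2) by blast
      then show "x \<in> X" using tag[of x x'] z x elts_V[of x w] by auto
    qed
    with A show ?thesis using X(2) unfolding thn_def by blast
  qed
  \<comment> \<open>A subclass \<open>Z\<close> of a set of conditions is carried to a subclass of
    its small index set. That subclass is a set, and separating along the marks brings it back to
    \<open>Z\<close>.\<close>
  have "thn ?C"
    unfolding thn_def sml_def
  proof (intro allI impI)
    fix B Z assume B: "isset B" "B \<subseteq> ?C" and Z: "isclass Z" "Z \<subseteq> B"
    obtain v where v: "v \<in> V" "elts v = B" using B(1) by (auto simp: isset_def)
    have vX: "elts v \<subseteq> ?c ` X" using B v Ceq by simp
    let ?A = "{x \<in> elts w. \<exists>z\<in>elts v. pair u x \<in> elts z}"
    have A: "isset ?A" "?A \<subseteq> X" "sml ?A" using idx[OF v(1) vX] by auto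
    have "isclass {x \<in> ?A. \<exists>z\<in>elts v. z \<in> Z \<and> pair u x \<in> elts z}"
      by (intro isclass_Collect[OF isset_class[OF A(1)]] defn Def_isclass Z)
    then have "isset {x \<in> ?A. \<exists>z\<in>elts v. z \<in> Z \<and> pair u x \<in> elts z}"
      using A(3) unfolding sml_def by blast
    then obtain a where a: "a \<in> V" "elts a = {x \<in> ?A. \<exists>z\<in>elts v. z \<in> Z \<and> pair u x \<in> elts z}" unfolding isset_def by blast
    have "isset {z \<in> elts v. \<exists>x\<in>elts a. pair u x \<in> elts z}" by (intro isset_Collect isset_elts defn v u a)
    moreover have "z \<in> Z \<longleftrightarrow> (\<exists>x\<in>elts a. pair u x \<in> elts z)" if z: "z \<in> elts v" for z
    proof -
      obtain x where x: "x \<in> X" "z = ?c x" using z vX by blast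
      have xz: "pair u x \<in> elts z" using tag[OF XV[OF x(1)] x(1)] x(2) by simp
      show ?thesis
      proof
        assume "z \<in> Z"
        then have "x \<in> elts a" unfolding a using xz z x(1) w(2) by blast
        then show "\<exists>x\<in>elts a. pair u x \<in> elts z" using xz by blast
      next
        assume "\<exists>x\<in>elts a. pair u x \<in> elts z"
        then obtain x' where x': "x' \<in> elts a" "pair u x' \<in> elts z" by blast
        then have "x' = x" using tag[of x' x] x elts_V by auto
        then obtain z' where z': "z' \<in> elts v" "z' \<in> Z" "pair u x \<in> elts z'" using x'(1) unfolding a by blast
        then obtain x'' where "x'' \<in> X" "z' = ?c x''" using vX by blast
        then have "z' = z" using tag[of x x''] z' XV[OF x(1)] x(2) by simp
        then show "z \<in> Z" using z' by simp
      qed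
    qed
    then have "{z \<in> elts v. \<exists>x\<in>elts a. pair u x \<in> elts z} = Z" using Z(2) v(2) by blast
    ultimately show "isset Z" by simp
  qed
  then have "thin (code ?C)" using C by (simp add: thin_thn elts_code)
  moreover have "elts u \<subseteq> (\<Union>y\<in>elts (code ?C). elts y)"
  proof
    fix y assume y: "y \<in> elts u"
    then obtain x where "x \<in> X" "\<not> Q x y" using contra u(2) by blast
    then have "?c x \<in> ?C" "y \<in> elts (?c x)" using Ceq c(2) y u(2) by auto
    then show "y \<in> (\<Union>y\<in>elts (code ?C). elts y)" unfolding elts_code[OF C] by blast
  qed
  ultimately obtain v where v: "v \<in> V" "elts v \<subseteq> elts (code ?C)" "elts u \<subseteq> (\<Union>y\<in>elts v. elts y)"
    using Comp[OF _ u(1)] by blast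
  have vX: "elts v \<subseteq> ?c ` X" using v(2) trans[OF elts_code[OF C] Ceq] by (rule ord_le_eq_trans)
  let ?A = "{x \<in> elts w. \<exists>z\<in>elts v. pair u x \<in> elts z}"
  have A: "isset ?A" "?A \<subseteq> X" "sml ?A" using idx[OF v(1) vX] by auto
  obtain y where y: "y \<in> U" "\<forall>x\<in>?A. Q x y" using fin[OF A] by blast
  then obtain z where z: "z \<in> elts v" "y \<in> elts z" using v(3) u(2) by blast
  then obtain x where x: "x \<in> X" "z = ?c x" using vX by blast
  have "pair u x \<in> elts z" using tag[OF XV[OF x(1)] x(1)] x(2) by simp
  then have "x \<in> ?A" using z(1) x(1) w(2) by blast
  then have "Q x y" using y by blast
  moreover have "y = pair u x \<or> \<not> Q x y" using z(2) unfolding x(2) c(2)[OF x(1)] by blast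
  moreover have "y \<noteq> pair u x" using y(1) u pair_self_notin[OF u(1) XV[OF x(1)]] by auto
  ultimately show False by blast
qed

lemma isclass_image:
  assumes X: "isclass X" and F: "DT UNIV (\<lambda>s. F (s 0))" and FV: "\<And>x. x \<in> X \<Longrightarrow> F x \<in> V"
  shows "isclass (F ` X)"
proof -
  have "isclass {y \<in> V. \<exists>x. x \<in> X \<and> y = F x}" by (intro isclassI defn Def_isclass X DT_comp1[OF F])
  moreover have "{y \<in> V. \<exists>x. x \<in> X \<and> y = F x} = F ` X" using FV by auto
  ultimately show ?thesis by simp
qed

lemma isset_sml_iff: "isset A \<and> sml A \<longleftrightarrow> (\<exists>z\<in>V. elts z = A \<and> small z)"
proof
  assume A: "isset A \<and> sml A"
  then obtain z where "z \<in> V" "elts z = A" by (auto simp: isset_def)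
  with A show "\<exists>z\<in>V. elts z = A \<and> small z" by (intro bexI[of _ z]) (simp_all add: small_sml)
qed (auto simp: small_sml)

text \<open>\<open>F\<close> is definable over classes only, so \<open>isset_image\<close> does not
  apply; adding the arguments one at a time in a small induction does.\<close>

lemma sml_image:
  assumes A: "isset A" "sml A" and F: "DT UNIV (\<lambda>s. F (s 0))" and FV: "\<And>x. x \<in> A \<Longrightarrow> F x \<in> V"
  shows "isset (F ` A) \<and> sml (F ` A)"
proof (rule small_induct[OF A, where P = "\<lambda>A. isset (F ` A) \<and> sml (F ` A)"])
  have "Def UNIV (\<lambda>s. \<exists>z\<in>V. (\<forall>y. y \<in> elts z \<longleftrightarrow> (\<exists>x\<in>elts (s 0). y = F x)) \<and> small z)"
    by (intro defn DT_comp1[OF F])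
  moreover have "isset (F ` elts a) \<and> sml (F ` elts a) \<longleftrightarrow>
      (\<exists>z\<in>V. (\<forall>y. y \<in> elts z \<longleftrightarrow> (\<exists>x\<in>elts a. y = F x)) \<and> small z)" for a
  proof -
    have eq: "elts z = F ` elts a \<longleftrightarrow> (\<forall>y. y \<in> elts z \<longleftrightarrow> (\<exists>x\<in>elts a. y = F x))" for z by (auto simp: set_eq_iff)
    show ?thesis unfolding isset_sml_iff eq ..
  qed
  ultimately show "Def UNIV (\<lambda>s. isset (F ` elts (s 0)) \<and> sml (F ` elts (s 0)))" by simp
qed (use FV in \<open>auto intro!: sml_insert\<close>)

lemma thn_image:
  assumes X: "isclass X" "thn X" and F: "DT UNIV (\<lambda>s. F (s 0))" and FV: "\<And>x. x \<in> X \<Longrightarrow> F x \<in> V"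
  shows "thn (F ` X)"
  unfolding thn_def
proof (intro allI impI)
  fix B assume B: "isset B" "B \<subseteq> F ` X"
  have "\<exists>A. isset A \<and> A \<subseteq> X \<and> sml A \<and> (\<forall>y\<in>B. \<exists>x\<in>A. y = F x)"
  proof (rule ccontr)
    assume no: "\<not> ?thesis"
    have "\<exists>y\<in>B. \<forall>x\<in>X. y \<noteq> F x"
    proof (rule saturation[OF X B(1), where Q = "\<lambda>x y. y \<noteq> F x"])
      show "Def UNIV (\<lambda>s. s (Suc 0) \<noteq> F (s 0))" by (intro defn F)
      show "isset {y \<in> B. y \<noteq> F x}" if "x \<in> X" for x by (intro isset_Collect B defn FV that)
      show "\<exists>y\<in>B. \<forall>x\<in>A. y \<noteq> F x" if "isset A" "A \<subseteq> X" "sml A" for A using no that by blast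
    qed
    then show False using B(2) by blast
  qed
  then obtain A where A: "isset A" "A \<subseteq> X" "sml A" "B \<subseteq> F ` A" by blast
  then have "sml (F ` A)" using sml_image[OF A(1,3) F] FV by blast
  then show "sml B" using A(4) sml_subset by blast
qed

lemma sml_Times:
  assumes A: "isset A" "sml A" and B: "isset B" "sml B"
  shows "sml {pair x y | x y. x \<in> A \<and> y \<in> B}"
proof -
  obtain b where b: "b \<in> V" "B = elts b" using B(1) by (auto simp: isset_def)
  have "isset {pair x y | x y. x \<in> A \<and> y \<in> B} \<and> sml {pair x y | x y. x \<in> A \<and> y \<in> B}"
  proof (rule small_induct[OF A, where P = "\<lambda>A. isset {pair x y | x y. x \<in> A \<and> y \<in> B} \<and> sml {pair x y | x y. x \<in> A \<and> y \<in> B}"])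
    have "Def UNIV (\<lambda>s. \<exists>z\<in>V. (\<forall>p. p \<in> elts z \<longleftrightarrow> (\<exists>x\<in>elts (s 0). \<exists>y\<in>elts b. p = pair x y)) \<and> small z)"
      by (intro defn)
    moreover have "isset {pair x y | x y. x \<in> elts a \<and> y \<in> B} \<and> sml {pair x y | x y. x \<in> elts a \<and> y \<in> B} \<longleftrightarrow>
      (\<exists>z\<in>V. (\<forall>p. p \<in> elts z \<longleftrightarrow> (\<exists>x\<in>elts a. \<exists>y\<in>elts b. p = pair x y)) \<and> small z)" for a
    proof -
      have eq: "elts z = {pair x y | x y. x \<in> elts a \<and> y \<in> B} \<longleftrightarrow> (\<forall>p. p \<in> elts z \<longleftrightarrow> (\<exists>x\<in>elts a. \<exists>y\<in>elts b. p = pair x y))" for z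
        unfolding b set_eq_iff by blast
      show ?thesis unfolding isset_sml_iff eq ..
    qed
    ultimately show "Def UNIV (\<lambda>s. isset {pair x y | x y. x \<in> elts (s 0) \<and> y \<in> B} \<and> sml {pair x y | x y. x \<in> elts (s 0) \<and> y \<in> B})"
      by simp
    fix C a assume C: "isset {pair x y | x y. x \<in> C \<and> y \<in> B} \<and> sml {pair x y | x y. x \<in> C \<and> y \<in> B}" and a: "a \<in> A"
    have aV: "a \<in> V" using isset_sub_V[OF A(1)] a by blast
    have "isset (pair a ` B) \<and> sml (pair a ` B)"
      by (rule sml_image[OF B], intro defn) (use aV isset_sub_V[OF B(1)] in auto)
    moreover have "{pair x y | x y. x \<in> insert a C \<and> y \<in> B} = pair a ` B \<union> {pair x y | x y. x \<in> C \<and> y \<in> B}" by blast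
    ultimately show "isset {pair x y | x y. x \<in> insert a C \<and> y \<in> B} \<and> sml {pair x y | x y. x \<in> insert a C \<and> y \<in> B}"
      using C by (simp add: sml_Un isset_class)
  qed simp
  then show ?thesis ..
qed

lemma isclass_Times:
  assumes X: "isclass X" and Y: "isclass Y" shows "isclass {pair x y | x y. x \<in> X \<and> y \<in> Y}"
proof -
  have "isclass {p \<in> V. \<exists>x\<in>V. \<exists>y\<in>V. x \<in> X \<and> y \<in> Y \<and> p = pair x y}" by (intro isclassI defn Def_isclass X Y)
  moreover have "{p \<in> V. \<exists>x\<in>V. \<exists>y\<in>V. x \<in> X \<and> y \<in> Y \<and> p = pair x y} = {pair x y | x y. x \<in> X \<and> y \<in> Y}"
    using subsetD[OF isclass_sub_V[OF X]] subsetD[OF isclass_sub_V[OF Y]] by auto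
  ultimately show ?thesis by simp
qed

lemma thn_Times:
  assumes X: "isclass X" "thn X" and Y: "isclass Y" "thn Y" shows "thn {pair x y | x y. x \<in> X \<and> y \<in> Y}"
  unfolding thn_def
proof (intro allI impI)
  fix B assume B: "isset B" "B \<subseteq> {pair x y | x y. x \<in> X \<and> y \<in> Y}"
  obtain b where b: "b \<in> V" "elts b = B" using B(1) by (auto simp: isset_def)
  \<comment> \<open>For Kuratowski pairs the twofold union contains both coordinates, which provides
    a set from which the projections can be separated.\<close>
  let ?W = "\<Union>q\<in>(\<Union>p\<in>B. elts p). elts q"
  have W: "isset ?W" by (rule isset_Union[OF isset_Union[OF B(1)]])
  have XV: "x \<in> V" if "x \<in> X" for x using isclass_sub_V[OF X(1)] that by blast
  have YV: "y \<in> V" if "y \<in> Y" for y using isclass_sub_V[OF Y(1)] that by blast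
  obtain w where w: "w \<in> V" "elts w = ?W" using W unfolding isset_def by blast
  have inW: "x \<in> ?W \<and> y \<in> ?W" if "pair x y \<in> B" "x \<in> V" "y \<in> V" for x y
  proof -
    have "upair x y \<in> elts (pair x y)" using that by (simp add: pair_def)
    then have "upair x y \<in> (\<Union>p\<in>B. elts p)" using that(1) by blast
    moreover have "x \<in> elts (upair x y)" "y \<in> elts (upair x y)" using that(2,3) by auto
    ultimately show ?thesis by blast
  qed
  have inB: "x \<in> X \<and> y \<in> Y" if "pair x y \<in> B" "x \<in> V" "y \<in> V" for x y
  proof -
    obtain x' y' where "pair x y = pair x' y'" "x' \<in> X" "y' \<in> Y" using B(2) \<open>pair x y \<in> B\<close> by blast
    then show ?thesis using that XV YV by simp
  qed
  have A1: "isset {x \<in> elts w. \<exists>y\<in>elts w. pair x y \<in> elts b}" by (intro isset_Collect isset_elts defn b w)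
  have A2: "isset {y \<in> elts w. \<exists>x\<in>elts w. pair x y \<in> elts b}" by (intro isset_Collect isset_elts defn b w)
  have "{x \<in> elts w. \<exists>y\<in>elts w. pair x y \<in> elts b} \<subseteq> X" "{y \<in> elts w. \<exists>x\<in>elts w. pair x y \<in> elts b} \<subseteq> Y"
    using inB elts_V unfolding b by blast+
  then have "sml {x \<in> elts w. \<exists>y\<in>elts w. pair x y \<in> elts b}" "sml {y \<in> elts w. \<exists>x\<in>elts w. pair x y \<in> elts b}"
    using A1 A2 X(2) Y(2) unfolding thn_def by simp_all
  from sml_Times[OF A1 this(1) A2 this(2)] show "sml B"
  proof (rule sml_subset)
    show "B \<subseteq> {pair x y |x y. x \<in> {x \<in> elts w. \<exists>y\<in>elts w. pair x y \<in> elts b} \<and> y \<in> {y \<in> elts w. \<exists>x\<in>elts w. pair x y \<in> elts b}}"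
    proof
      fix p assume p: "p \<in> B"
      then obtain x y where xy: "p = pair x y" "x \<in> X" "y \<in> Y" using B(2) by blast
      then have "x \<in> elts w" "y \<in> elts w" using inW[of x y] p XV YV unfolding w by blast+
      then show "p \<in> {pair x y |x y. x \<in> {x \<in> elts w. \<exists>y\<in>elts w. pair x y \<in> elts b} \<and> y \<in> {y \<in> elts w. \<exists>x\<in>elts w. pair x y \<in> elts b}}"
        using xy p b(2) by blast
    qed
  qed
qed

text \<open>Saturation over the subsets of a set enclosing \<open>X\<close>, the condition at
  \<open>x\<close> being that \<open>s\<close> and \<open>C\<close> agree there. On a small set
  \<open>A\<close> of conditions the class \<open>A \<inter> C\<close> is itself a set and meets
  them.\<close>

lemma trace_of_set:
  assumes X: "isclass X" "thn X" and C: "isclass C" "C \<subseteq> X" shows "\<exists>s\<in>V. elts s \<inter> X = C"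
proof -
  have "thin (code X)" using X by (simp add: thin_thn elts_code)
  from Thin[OF this] obtain w where w: "w \<in> V" "X \<subseteq> elts w" using X by (auto simp: elts_code)
  let ?U = "{s \<in> V. elts s \<subseteq> elts w}"
  have U: "isset ?U" using isset_Pow w by simp
  have XV: "x \<in> V" if "x \<in> X" for x using that w elts_V by blast
  have "\<exists>s\<in>?U. \<forall>x\<in>X. x \<in> elts s \<longleftrightarrow> x \<in> C"
  proof (rule saturation[OF X U, where Q = "\<lambda>x s. x \<in> elts s \<longleftrightarrow> x \<in> C"])
    show "Def UNIV (\<lambda>s. (s 0 \<in> elts (s (Suc 0))) = (s 0 \<in> C))" by (intro defn Def_isclass C)
    show "isset {s \<in> ?U. (x \<in> elts s) = (x \<in> C)}" if "x \<in> X" for x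
      by (intro isset_Collect[OF U] defn XV that)
    show "\<exists>s\<in>?U. \<forall>x\<in>A. (x \<in> elts s) = (x \<in> C)" if A: "isset A" "A \<subseteq> X" "sml A" for A
    proof -
      have "isset (A \<inter> C)" using A(3) isclass_Int[OF isset_class[OF A(1)] C(1)] unfolding sml_def by blast
      then show ?thesis using A(2) w(2) by (intro bexI[of _ "code (A \<inter> C)"]) auto
    qed
  qed
  then show ?thesis using C(2) by blast
qed

end

section \<open>Finite hyperrationals modulo infinitesimals, over an abstract semiring with standard
  elements\<close>

class nat_semiring = comm_semiring_1 + linorder +
  fixes st :: "'a \<Rightarrow> bool"
  assumes add_strict: "a < b \<Longrightarrow> a + c < b + c"
    and mult_strict: "a < b \<Longrightarrow> 0 < c \<Longrightarrow> c * a < c * b"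
    and le_ex: "a \<le> b \<Longrightarrow> \<exists>c. b = a + c"
    and zero_least: "0 \<le> a"
    and division: "b \<noteq> 0 \<Longrightarrow> \<exists>q r. r < b \<and> a = b * q + r"
    and no_between: "b \<noteq> 0 \<Longrightarrow> 1 \<le> b"
    and st_0: "st 0" and st_1: "st 1"
    and st_add: "st a \<Longrightarrow> st b \<Longrightarrow> st (a + b)"
    and st_mult: "st a \<Longrightarrow> st b \<Longrightarrow> st (a * b)"
    and st_le: "st b \<Longrightarrow> a \<le> b \<Longrightarrow> st a"
begin

lemma add_strict_iff: "a + c < b + c \<longleftrightarrow> a < b"
  using add_strict[of a b c] add_strict[of b a c] less_linear[of a b] less_asym by auto

lemma add_eq_iff: "a + c = b + c \<longleftrightarrow> a = b"
  using add_strict_iff[of a c b] add_strict_iff[of b c a] less_linear[of a b] by auto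

lemma add_le_iff: "a + c \<le> b + c \<longleftrightarrow> a \<le> b"
  using add_strict_iff[of b c a] by (simp flip: not_less)

lemma pos_iff: "0 < a \<longleftrightarrow> a \<noteq> 0"
  using zero_least[of a] by (auto simp: le_less)

end

text \<open>The pair \<open>(a, b)\<close> stands for the difference \<open>a - b\<close>.\<close>

quotient_type (overloaded) 'a diff = "'a::nat_semiring \<times> 'a" / "\<lambda>(a, b) (c, d). a + d = c + b"
  morphisms Rep_diff Abs_diff
proof (rule equivpI)
  show "transp (\<lambda>(a, b) (c, d). a + d = c + (b::'a))"
  proof (rule transpI, clarify)
    fix a b c d e f :: 'a assume "a + d = c + b" "c + f = e + d"
    then have "(a + f) + (d + c) = (e + b) + (d + c)" by (metis add.assoc add.commute)
    then show "a + f = e + b" by (simp add: add_eq_iff)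
  qed
qed (auto simp: reflp_def symp_def)

instantiation diff :: (nat_semiring) comm_ring_1
begin

lift_definition zero_diff :: "'a diff" is "(0, 0)" .
lift_definition one_diff :: "'a diff" is "(1, 0)" .
lift_definition uminus_diff :: "'a diff \<Rightarrow> 'a diff" is "\<lambda>(a, b). (b, a)"
  by (auto simp: add.commute)
lift_definition plus_diff :: "'a diff \<Rightarrow> 'a diff \<Rightarrow> 'a diff" is "\<lambda>(a, b) (c, d). (a + c, b + d)"
proof clarify
  fix a b a' b' c d c' d' :: 'a assume "a + b' = a' + b" "c + d' = c' + d"
  then show "a + c + (b' + d') = a' + c' + (b + d)" by (metis add.assoc add.left_commute)
qed
lift_definition times_diff :: "'a diff \<Rightarrow> 'a diff \<Rightarrow> 'a diff" is "\<lambda>(a, b) (c, d). (a * c + b * d, a * d + b * c)"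
proof clarify
  fix a b a' b' c d c' d' :: 'a assume 1: "a + b' = a' + b" and 2: "c + d' = c' + d"
  \<comment> \<open>There is no subtraction in the semiring. The same four products are added on
    both sides so that the two hypotheses can be substituted, and are cancelled at the end.\<close>
  have "(a * c + b * d + (a' * d' + b' * c')) + (b' * c + b' * d + a' * c + a' * d)
      = (a + b') * c + (a' + b) * d + a' * (c + d') + b' * (c' + d)"
    by (simp add: algebra_simps)
  also have "\<dots> = (a' + b) * c + (a + b') * d + a' * (c' + d) + b' * (c + d')"
    by (simp only: 1 2)
  also have "\<dots> = (a' * c' + b' * d' + (a * d + b * c)) + (b' * c + b' * d + a' * c + a' * d)"
    by (simp add: algebra_simps)
  finally show "a * c + b * d + (a' * d' + b' * c') = a' * c' + b' * d' + (a * d + b * c)"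
    by (simp add: add_eq_iff)
qed
definition minus_diff :: "'a diff \<Rightarrow> 'a diff \<Rightarrow> 'a diff" where "minus_diff x y = x + - y"

instance
proof
  show "(0::'a diff) \<noteq> 1" by transfer simp
qed (transfer; auto simp: minus_diff_def algebra_simps; fail | simp add: minus_diff_def)+

end

instantiation diff :: (nat_semiring) linordered_idom
begin

lift_definition less_eq_diff :: "'a diff \<Rightarrow> 'a diff \<Rightarrow> bool" is "\<lambda>(a, b) (c, d). a + d \<le> c + b"
proof clarify
  fix a b a' b' c d c' d' :: 'a assume 1: "a + b' = a' + b" and 2: "c + d' = c' + d"
  have "a + d \<le> c + b \<longleftrightarrow> (a + d) + (b' + d') \<le> (c + b) + (b' + d')" by (simp only: add_le_iff)
  also have "(a + d) + (b' + d') = (a + b') + (d + d')" by (simp add: algebra_simps)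
  also have "\<dots> = (a' + d') + (b + d)" by (simp only: 1) (simp add: algebra_simps)
  also have "(c + b) + (b' + d') = (c + d') + (b + b')" by (simp add: algebra_simps)
  also have "\<dots> = (c' + b') + (b + d)" by (simp only: 2) (simp add: algebra_simps)
  finally show "a + d \<le> c + b \<longleftrightarrow> a' + d' \<le> c' + b'" by (simp only: add_le_iff)
qed
definition less_diff :: "'a diff \<Rightarrow> 'a diff \<Rightarrow> bool" where "less_diff x y \<longleftrightarrow> x \<le> y \<and> \<not> y \<le> x"
definition abs_diff :: "'a diff \<Rightarrow> 'a diff" where "abs_diff x = (if x < 0 then - x else x)"
definition sgn_diff :: "'a diff \<Rightarrow> 'a diff" where "sgn_diff x = (if x = 0 then 0 else if 0 < x then 1 else - 1)"

instance
proof
  fix x y z :: "'a diff"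
  show "x < y \<longleftrightarrow> x \<le> y \<and> \<not> y \<le> x" by (rule less_diff_def)
  show "x \<le> x" by transfer auto
  show "x \<le> y \<Longrightarrow> y \<le> z \<Longrightarrow> x \<le> z"
  proof (transfer, clarify)
    fix a b c d e f :: 'a assume "a + d \<le> c + b" "c + f \<le> e + d"
    then have "a + d + f \<le> c + b + f" "c + f + b \<le> e + d + b" by (simp_all only: add_le_iff)
    moreover have "c + b + f = c + f + b" by (simp add: algebra_simps)
    ultimately have "a + d + f \<le> e + d + b" by (metis order_trans)
    moreover have "a + d + f = a + f + d" "e + d + b = e + b + d" by (simp_all add: algebra_simps)
    ultimately show "a + f \<le> e + b" using add_le_iff by metis
  qed
  show "x \<le> y \<Longrightarrow> y \<le> x \<Longrightarrow> x = y" by transfer auto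
  show "x \<le> y \<or> y \<le> x" by transfer auto
  show "x \<le> y \<Longrightarrow> z + x \<le> z + y"
  proof (transfer, clarify)
    fix a b c d e f :: 'a assume "a + d \<le> c + b"
    then have "a + d + (e + f) \<le> c + b + (e + f)" by (simp only: add_le_iff)
    then show "e + a + (f + d) \<le> e + c + (f + b)" by (simp add: algebra_simps)
  qed
  have pos: "0 \<le> u * w \<and> \<not> u * w \<le> 0" if "\<not> u \<le> 0" "\<not> w \<le> 0" for u w :: "'a diff"
    using that
  proof (transfer, clarsimp)
    fix a b c d :: 'a assume "\<not> a \<le> b" "\<not> c \<le> d"
    then have "b \<le> a" "d \<le> c" "a \<noteq> b" "c \<noteq> d" by auto
    then obtain e f where e: "a = b + e" "e \<noteq> 0" and f: "c = d + f" "f \<noteq> 0" using le_ex by (metis add_0_right)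
    then have "0 < e * f" using mult_strict[of 0 f e] by (simp add: pos_iff)
    then have "0 + (b * d + e * d + (b * d + b * f)) < e * f + (b * d + e * d + (b * d + b * f))"
      by (simp only: add_strict_iff)
    moreover have "a * d + b * c = 0 + (b * d + e * d + (b * d + b * f))"
      "a * c + b * d = e * f + (b * d + e * d + (b * d + b * f))"
      using e f by (simp_all add: algebra_simps)
    ultimately show "a * d + b * c \<le> a * c + b * d \<and> \<not> a * c + b * d \<le> a * d + b * c" by auto
  qed
  have gt0: "\<not> w \<le> u \<longleftrightarrow> \<not> w - u \<le> 0" for u w :: "'a diff"
    unfolding minus_diff_def by transfer (auto simp: add.commute)
  have lt: "u < w \<longleftrightarrow> \<not> w \<le> u" for u w :: "'a diff"
    unfolding less_diff_def by transfer auto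
  show "x < y \<Longrightarrow> 0 < z \<Longrightarrow> z * x < z * y"
    unfolding lt using gt0[of y x] pos[of z "y - x"] gt0[of "z * y" "z * x"] by (simp add: right_diff_distrib)
  show "\<bar>x\<bar> = (if x < 0 then - x else x)" by (rule abs_diff_def)
  show "sgn x = (if x = 0 then 0 else if 0 < x then 1 else - 1)" by (rule sgn_diff_def)
qed
end

lift_definition emb :: "'a \<Rightarrow> 'a::nat_semiring diff" is "\<lambda>a. (a, 0)" .

lemma emb_0: "emb 0 = 0" and emb_1: "emb 1 = 1"
  and emb_add: "emb (a + b) = emb a + emb b" and emb_mult: "emb (a * b) = emb a * emb b"
  and emb_le: "emb a \<le> emb b \<longleftrightarrow> a \<le> b" and emb_eq: "emb a = emb b \<longleftrightarrow> a = b"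
  by (transfer; simp)+

lemma diff_cases: obtains a b where "x = emb a - emb b"
proof -
  have "\<exists>a b. x = emb a - emb b" unfolding minus_diff_def by transfer (auto intro: add.commute)
  then show ?thesis using that by blast
qed

text \<open>The ordered field of fractions, in which the semiring sits as the numbers \<open>nq n\<close>.\<close>

definition nq :: "'a::nat_semiring \<Rightarrow> 'a diff fract" where "nq a = Fract (emb a) 1"

lemma nq_0 [simp]: "nq 0 = 0" and nq_1 [simp]: "nq 1 = 1"
  by (simp_all add: nq_def emb_0 emb_1 fract_collapse)

lemma nq_add: "nq (a + b) = nq a + nq b" and nq_mult: "nq (a * b) = nq a * nq b"
  by (simp_all add: nq_def emb_add emb_mult)

lemma nq_le [simp]: "nq a \<le> nq b \<longleftrightarrow> a \<le> b"
  by (simp add: nq_def emb_le)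

lemma nq_eq [simp]: "nq a = nq b \<longleftrightarrow> a = b"
  by (simp add: nq_def eq_fract emb_eq)

lemma nq_less [simp]: "nq a < nq b \<longleftrightarrow> a < b"
  by (simp add: less_le)

lemma nq_nonneg [simp]: "0 \<le> nq a"
  using nq_le[of 0 a] zero_least[of a] by simp

lemma nq_eq_0 [simp]: "nq a = 0 \<longleftrightarrow> a = 0"
  using nq_eq[of a 0] by simp

lemma nq_pos: "a \<noteq> 0 \<Longrightarrow> 0 < nq a"
  using nq_nonneg[of a] nq_eq_0[of a] by linarith

text \<open>The denominator is a difference of two elements of the semiring; ordering the two and
  moving the sign to the numerator turns it into a single one.\<close>

lemma frac_cases: obtains a b c where "c \<noteq> 0" "x = (nq a - nq b) / nq c"
proof -
  have e: "Fract p 1 = nq a - nq b" if "p = emb a - emb b" for p :: "'a diff" and a b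
    using that by (simp add: nq_def)
  have "\<exists>a b c. c \<noteq> 0 \<and> x = (nq a - nq b) / nq c"
  proof (cases x)
    case (Fract p q)
    obtain a b where p: "p = emb a - emb b" by (rule diff_cases)
    obtain c d where q: "q = emb c - emb d" by (rule diff_cases)
    have x: "x = Fract p 1 / Fract q 1" using Fract by simp
    have "c \<noteq> d" using q Fract by auto
    then consider "d < c" | "c < d" by force
    then show ?thesis
    proof cases
      case 1
      then obtain f where f: "c = d + f" using le_ex[of d c] less_imp_le by blast
      then have "f \<noteq> 0" using 1 by auto
      with f have "x = (nq a - nq b) / nq f" unfolding x e[OF p] e[OF q] by (simp add: nq_add)
      then show ?thesis using \<open>f \<noteq> 0\<close> by blast
    next
      case 2
      then obtain f where f: "d = c + f" using le_ex[of c d] less_imp_le by blast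
      then have "f \<noteq> 0" using 2 by auto
      with f have "x = (nq b - nq a) / nq f" unfolding x e[OF p] e[OF q] by (simp add: nq_add minus_divide_left)
      then show ?thesis using \<open>f \<noteq> 0\<close> by blast
    qed
  qed
  then show ?thesis using that by blast
qed

text \<open>Division with remainder in the semiring provides integer parts for all nonnegative
  elements, infinite ones included, although the field need not be Archimedean.\<close>

lemma nq_floor: assumes "0 \<le> x" obtains n where "nq n \<le> x" "x < nq n + 1"
proof -
  obtain a b c where c: "c \<noteq> 0" and x: "x = (nq a - nq b) / nq c" by (rule frac_cases)
  have c0: "0 < nq c" using nq_pos[OF c] .
  then have "b \<le> a" using assms unfolding x by (simp add: zero_le_divide_iff)
  then obtain d where d: "a = b + d" using le_ex by blast
  obtain q r where r: "r < c" "d = c * q + r" using division[OF c] by blast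
  have "x = nq q + nq r / nq c" unfolding x d r(2) using c c0 by (simp add: nq_add nq_mult add_divide_distrib)
  moreover have "0 \<le> nq r / nq c" "nq r / nq c < 1" using c0 r(1) by (simp_all add: divide_less_eq)
  ultimately show ?thesis using that[of q] by linarith
qed

definition finite_q :: "'a::nat_semiring diff fract \<Rightarrow> bool" where
  "finite_q x \<longleftrightarrow> (\<exists>c. st c \<and> \<bar>x\<bar> \<le> nq c)"

text \<open>The product form avoids dividing by \<open>nq c\<close>, which may be 0. The weak
  inequality is as good as the strict one because \<open>c\<close> can be doubled.\<close>

definition infinitesimal :: "'a::nat_semiring diff fract \<Rightarrow> bool" where
  "infinitesimal x \<longleftrightarrow> (\<forall>c. st c \<longrightarrow> nq c * \<bar>x\<bar> \<le> 1)"

lemma finite_nq: "st c \<Longrightarrow> finite_q (nq c)"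
  unfolding finite_q_def by (intro exI[of _ c]) simp

lemma finite_0: "finite_q 0" and finite_1: "finite_q 1"
  using finite_nq[OF st_0] finite_nq[OF st_1] by simp_all

lemma finite_add: "finite_q x \<Longrightarrow> finite_q y \<Longrightarrow> finite_q (x + y)"
proof -
  assume "finite_q x" "finite_q y"
  then obtain c d where "st c" "\<bar>x\<bar> \<le> nq c" "st d" "\<bar>y\<bar> \<le> nq d" unfolding finite_q_def by blast
  then show ?thesis unfolding finite_q_def using st_add by (intro exI[of _ "c + d"]) (auto simp: nq_add)
qed

lemma finite_mult: "finite_q x \<Longrightarrow> finite_q y \<Longrightarrow> finite_q (x * y)"
proof -
  assume "finite_q x" "finite_q y"
  then obtain c d where "st c" "\<bar>x\<bar> \<le> nq c" "st d" "\<bar>y\<bar> \<le> nq d" unfolding finite_q_def by blast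
  then show ?thesis unfolding finite_q_def using st_mult
    by (intro exI[of _ "c * d"]) (auto simp: nq_mult abs_mult intro: mult_mono)
qed

lemma finite_minus: "finite_q x \<Longrightarrow> finite_q (- x)"
  by (simp add: finite_q_def)

lemma finite_diff: "finite_q x \<Longrightarrow> finite_q y \<Longrightarrow> finite_q (x - y)"
  using finite_add[of x "- y"] finite_minus[of y] by simp

lemma infinitesimal_0: "infinitesimal 0"
  by (simp add: infinitesimal_def)

lemma infinitesimal_minus: "infinitesimal x \<Longrightarrow> infinitesimal (- x)"
  by (simp add: infinitesimal_def)

lemma infinitesimal_add: assumes "infinitesimal x" "infinitesimal y" shows "infinitesimal (x + y)"
  unfolding infinitesimal_def
proof (intro allI impI)
  fix c :: 'a assume c: "st c"
  then have "st (c + c)" using st_add by blast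
  then have "(nq c + nq c) * \<bar>x\<bar> \<le> 1" "(nq c + nq c) * \<bar>y\<bar> \<le> 1"
    using assms unfolding infinitesimal_def nq_add[symmetric] by blast+
  then have "nq c * (\<bar>x\<bar> + \<bar>y\<bar>) \<le> 1" by (simp add: algebra_simps)
  moreover have "nq c * \<bar>x + y\<bar> \<le> nq c * (\<bar>x\<bar> + \<bar>y\<bar>)" by (intro mult_left_mono) (auto simp: abs_triangle_ineq)
  ultimately show "nq c * \<bar>x + y\<bar> \<le> 1" by linarith
qed

lemma infinitesimal_diff: "infinitesimal x \<Longrightarrow> infinitesimal y \<Longrightarrow> infinitesimal (x - y)"
  using infinitesimal_add[of x "- y"] infinitesimal_minus[of y] by simp

lemma infinitesimal_mult: assumes "infinitesimal x" "finite_q y" shows "infinitesimal (x * y)"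
  unfolding infinitesimal_def
proof (intro allI impI)
  fix c :: 'a assume c: "st c"
  obtain d where d: "st d" "\<bar>y\<bar> \<le> nq d" using assms(2) unfolding finite_q_def by blast
  have "nq (c * d) * \<bar>x\<bar> \<le> 1" using assms(1) st_mult[OF c d(1)] unfolding infinitesimal_def by blast
  moreover have "nq c * \<bar>x * y\<bar> \<le> nq c * (\<bar>x\<bar> * nq d)"
    unfolding abs_mult using d by (intro mult_left_mono) auto
  ultimately show "nq c * \<bar>x * y\<bar> \<le> 1" by (simp add: nq_mult mult.commute mult.left_commute)
qed

lemma infinitesimal_finite: "infinitesimal x \<Longrightarrow> finite_q x"
  unfolding infinitesimal_def finite_q_def using st_1 by (intro exI[of _ 1]) (auto dest: spec[of _ 1])

lemma infinitesimal_le: "infinitesimal y \<Longrightarrow> \<bar>x\<bar> \<le> \<bar>y\<bar> \<Longrightarrow> infinitesimal x"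
  unfolding infinitesimal_def by (meson mult_left_mono nq_nonneg order_trans)

lemma finite_le: "finite_q y \<Longrightarrow> \<bar>x\<bar> \<le> \<bar>y\<bar> \<Longrightarrow> finite_q x"
  unfolding finite_q_def by (meson order_trans)

lemma not_infinitesimal_1: "\<not> infinitesimal 1"
proof
  assume "infinitesimal (1 :: 'a diff fract)"
  then have "nq (1 + 1 :: 'a) * \<bar>1\<bar> \<le> 1" using st_add[OF st_1 st_1] unfolding infinitesimal_def by blast
  then show False unfolding nq_add nq_1 by simp
qed

lemma finite_inverse: assumes "\<not> infinitesimal x" shows "finite_q (inverse x)"
proof -
  obtain c where c: "st c" "\<not> nq c * \<bar>x\<bar> \<le> 1" using assms unfolding infinitesimal_def by blast
  have "x \<noteq> 0" using assms infinitesimal_0 by auto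
  then have "\<bar>inverse x\<bar> \<le> nq c" using c(2) by (simp add: abs_inverse field_simps)
  then show ?thesis using c(1) unfolding finite_q_def by blast
qed

\<comment> \<open>A partial quotient, because only finite elements are related to themselves. They
  form a ring in which the infinitesimals are an ideal; it is maximal by
  \<open>finite_inverse\<close>, which is why the quotient becomes a field.\<close>
quotient_type (overloaded) 'a hreal = "'a::nat_semiring diff fract" / partial: "\<lambda>x y. finite_q x \<and> finite_q y \<and> infinitesimal (x - y)"
  morphisms Rep_hreal Abs_hreal
proof (rule part_equivpI)
  show "\<exists>x::'a diff fract. finite_q x \<and> finite_q x \<and> infinitesimal (x - x)"
    using finite_0 infinitesimal_0 by (intro exI[of _ 0]) auto
  show "symp (\<lambda>x y::'a diff fract. finite_q x \<and> finite_q y \<and> infinitesimal (x - y))"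
    by (rule sympI) (metis infinitesimal_minus minus_diff_eq)
  show "transp (\<lambda>x y::'a diff fract. finite_q x \<and> finite_q y \<and> infinitesimal (x - y))"
  proof (rule transpI, clarify)
    fix x y z :: "'a diff fract" assume "infinitesimal (x - y)" "infinitesimal (y - z)"
    then have "infinitesimal ((x - y) + (y - z))" by (rule infinitesimal_add)
    then show "infinitesimal (x - z)" by simp
  qed
qed

lemma infinitesimal_mult_diff:
  assumes "finite_q x" "finite_q x'" "infinitesimal (x - x')" "finite_q y" "finite_q y'" "infinitesimal (y - y')"
  shows "infinitesimal (x * y - x' * y')"
proof -
  have "infinitesimal ((x - x') * y + (y - y') * x')"
    using assms by (intro infinitesimal_add infinitesimal_mult)
  then show ?thesis by (simp add: algebra_simps)
qed

lemma infinitesimal_inverse_diff: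
  assumes "infinitesimal (x - x')" "\<not> infinitesimal x" "\<not> infinitesimal x'"
  shows "infinitesimal (inverse x - inverse x')"
proof -
  have nz: "x \<noteq> 0" "x' \<noteq> 0" using assms infinitesimal_0 by auto
  have "infinitesimal (((x' - x) * inverse x) * inverse x')"
    using infinitesimal_minus[OF assms(1)] assms(2,3) by (intro infinitesimal_mult finite_inverse) auto
  moreover have "((x' - x) * inverse x) * inverse x' = inverse x - inverse x'"
    using nz by (simp add: field_simps)
  ultimately show ?thesis by simp
qed

lemma infinitesimal_cong: "infinitesimal (x - x') \<Longrightarrow> infinitesimal x \<longleftrightarrow> infinitesimal x'"
  using infinitesimal_add[of "x - x'" x'] infinitesimal_diff[of x "x - x'"] by auto

instantiation hreal :: (nat_semiring) field
begin

lift_definition zero_hreal :: "'a hreal" is 0 by (simp add: finite_0 infinitesimal_0)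
lift_definition one_hreal :: "'a hreal" is 1 by (simp add: finite_1 infinitesimal_0)
lift_definition uminus_hreal :: "'a hreal \<Rightarrow> 'a hreal" is uminus
  by (auto simp: finite_minus dest: infinitesimal_minus)
lift_definition plus_hreal :: "'a hreal \<Rightarrow> 'a hreal \<Rightarrow> 'a hreal" is plus
  by (auto simp: finite_add dest: infinitesimal_add simp: add_diff_add)
lift_definition minus_hreal :: "'a hreal \<Rightarrow> 'a hreal \<Rightarrow> 'a hreal" is minus
  by (auto simp: finite_diff dest: infinitesimal_diff simp: algebra_simps)
lift_definition times_hreal :: "'a hreal \<Rightarrow> 'a hreal \<Rightarrow> 'a hreal" is times
  by (auto simp: finite_mult infinitesimal_mult_diff)
lift_definition inverse_hreal :: "'a hreal \<Rightarrow> 'a hreal" is "\<lambda>x. if infinitesimal x then 0 else inverse x"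
  using infinitesimal_cong by (auto simp: finite_0 infinitesimal_0 finite_inverse infinitesimal_inverse_diff)
definition divide_hreal :: "'a hreal \<Rightarrow> 'a hreal \<Rightarrow> 'a hreal" where "divide_hreal x y = x * inverse y"

instance
proof
  fix x y z :: "'a hreal"
  show "x + y + z = x + (y + z)" by transfer (simp add: finite_add infinitesimal_0 add.assoc)
  show "x + y = y + x" by transfer (simp add: finite_add infinitesimal_0 add.commute)
  show "0 + x = x" by transfer (simp add: infinitesimal_0)
  show "- x + x = 0" by transfer (simp add: infinitesimal_0 finite_0)
  show "x - y = x + - y" by transfer (simp add: infinitesimal_0 finite_diff)
  show "x * y * z = x * (y * z)" by transfer (simp add: infinitesimal_0 finite_mult mult.assoc)
  show "x * y = y * x" by transfer (simp add: infinitesimal_0 finite_mult mult.commute)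
  show "1 * x = x" by transfer (simp add: infinitesimal_0)
  show "(x + y) * z = x * z + y * z" by transfer (simp add: infinitesimal_0 finite_mult finite_add algebra_simps)
  show "(0::'a hreal) \<noteq> 1" by transfer (use infinitesimal_minus not_infinitesimal_1 in force)
  show "x \<noteq> 0 \<Longrightarrow> inverse x * x = 1"
  proof transfer
    fix x :: "'a diff fract" assume "finite_q x \<and> finite_q x \<and> infinitesimal (x - x)" "\<not> (finite_q x \<and> finite_q 0 \<and> infinitesimal (x - 0))"
    then have "\<not> infinitesimal x" by (simp add: finite_0)
    moreover from this have "x \<noteq> 0" using infinitesimal_0 by auto
    ultimately show "finite_q ((if infinitesimal x then 0 else inverse x) * x) \<and> finite_q 1 \<and>
      infinitesimal ((if infinitesimal x then 0 else inverse x) * x - 1)"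
      by (simp add: finite_1 infinitesimal_0)
  qed
  show "inverse (0::'a hreal) = 0" by transfer (simp add: infinitesimal_0 finite_0)
  show "x div y = x * inverse y" by (rule divide_hreal_def)
qed

end

instantiation hreal :: (nat_semiring) linordered_field
begin

text \<open>\<open>x\<close> is at most infinitesimally above \<open>y\<close>.\<close>

lift_definition less_eq_hreal :: "'a hreal \<Rightarrow> 'a hreal \<Rightarrow> bool" is "\<lambda>x y. x \<le> y \<or> infinitesimal (x - y)"
proof -
  have *: "x' \<le> y' \<or> infinitesimal (x' - y')" if i: "infinitesimal (x - x')" "infinitesimal (y - y')" "x \<le> y \<or> infinitesimal (x - y)"
    for x x' y y' :: "'a diff fract"
  proof (cases "x' \<le> y'")
    case False
    consider "x \<le> y" | "infinitesimal (x - y)" using i(3) by blast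
    then show ?thesis
    proof cases
      case 1
      have "infinitesimal ((y - y') - (x - x'))" using i(1,2) infinitesimal_diff by blast
      moreover have "\<bar>x' - y'\<bar> \<le> \<bar>(y - y') - (x - x')\<bar>" using 1 False by simp
      ultimately show ?thesis using infinitesimal_le by blast
    next
      case 2
      have "infinitesimal ((x - y) + ((y - y') - (x - x')))" using i(1,2) 2 infinitesimal_diff infinitesimal_add by blast
      then show ?thesis by simp
    qed
  qed simp
  fix a b c d :: "'a diff fract"
  assume "finite_q a \<and> finite_q b \<and> infinitesimal (a - b)" "finite_q c \<and> finite_q d \<and> infinitesimal (c - d)"
  then show "(a \<le> c \<or> infinitesimal (a - c)) = (b \<le> d \<or> infinitesimal (b - d))"
    using *[of a b c d] *[of b a d c] infinitesimal_minus[of "a - b"] infinitesimal_minus[of "c - d"] by auto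
qed
definition less_hreal :: "'a hreal \<Rightarrow> 'a hreal \<Rightarrow> bool" where "less_hreal x y \<longleftrightarrow> x \<le> y \<and> \<not> y \<le> x"
definition abs_hreal :: "'a hreal \<Rightarrow> 'a hreal" where "abs_hreal x = (if x < 0 then - x else x)"
definition sgn_hreal :: "'a hreal \<Rightarrow> 'a hreal" where "sgn_hreal x = (if x = 0 then 0 else if 0 < x then 1 else - 1)"

instance
proof
  fix x y z :: "'a hreal"
  show "x < y \<longleftrightarrow> x \<le> y \<and> \<not> y \<le> x" by (rule less_hreal_def)
  show "x \<le> x" by transfer simp
  show "x \<le> y \<Longrightarrow> y \<le> z \<Longrightarrow> x \<le> z"
  proof transfer
    fix x y z :: "'a diff fract"
    assume xy: "x \<le> y \<or> infinitesimal (x - y)" and yz: "y \<le> z \<or> infinitesimal (y - z)"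
    show "x \<le> z \<or> infinitesimal (x - z)"
    proof (cases "x \<le> z")
      case False
      have sum: "infinitesimal (x - z)" if "infinitesimal (x - y)" "infinitesimal (y - z)"
        using infinitesimal_add[OF that] by simp
      consider "infinitesimal (x - y)" "infinitesimal (y - z)" | "x \<le> y" "infinitesimal (y - z)" | "infinitesimal (x - y)" "y \<le> z"
        using xy yz False by force
      then show ?thesis
      proof cases
        case 2 then show ?thesis using infinitesimal_le[of "y - z" "x - z"] False by simp
      next
        case 3 then show ?thesis using infinitesimal_le[of "x - y" "x - z"] False by simp
      qed (use sum in blast)
    qed simp
  qed
  show "x \<le> y \<Longrightarrow> y \<le> x \<Longrightarrow> x = y"
  proof transfer
    fix x y :: "'a diff fract" assume xy: "finite_q x \<and> finite_q x \<and> infinitesimal (x - x)"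
      "finite_q y \<and> finite_q y \<and> infinitesimal (y - y)" "x \<le> y \<or> infinitesimal (x - y)" "y \<le> x \<or> infinitesimal (y - x)"
    have "infinitesimal (x - y)" 
      using xy infinitesimal_minus[of "y - x"] by (cases "x = y") (auto simp: infinitesimal_0)
    then show "finite_q x \<and> finite_q y \<and> infinitesimal (x - y)" using xy by blast
  qed
  show "x \<le> y \<or> y \<le> x" by transfer auto
  show "x \<le> y \<Longrightarrow> z + x \<le> z + y" by transfer auto
  have pos: "\<not> u * w \<le> 0" if "\<not> u \<le> 0" "\<not> w \<le> 0" for u w :: "'a hreal"
    using that
  proof (transfer, clarsimp)
    fix u w :: "'a diff fract" assume u: "\<not> u \<le> 0" "\<not> infinitesimal u" and w: "\<not> w \<le> 0" "\<not> infinitesimal w"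
    have "\<not> infinitesimal (u * w)"
    proof
      assume "infinitesimal (u * w)"
      then have "infinitesimal (u * w * inverse u)" using finite_inverse[OF u(2)] by (rule infinitesimal_mult)
      moreover have "u * w * inverse u = w" using u(1) by auto
      ultimately show False using w by simp
    qed
    then show "\<not> u * w \<le> 0 \<and> \<not> infinitesimal (u * w)" using u w by (simp add: mult_le_0_iff)
  qed
  have gt0: "\<not> w \<le> u \<longleftrightarrow> \<not> w - u \<le> 0" for u w :: "'a hreal"
    by transfer simp
  have lt: "u < w \<longleftrightarrow> \<not> w \<le> u" for u w :: "'a hreal"
    unfolding less_hreal_def by transfer auto
  show "x < y \<Longrightarrow> 0 < z \<Longrightarrow> z * x < z * y"
    unfolding lt using gt0[of y x] pos[of z "y - x"] gt0[of "z * y" "z * x"] by (simp add: right_diff_distrib)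
  show "\<bar>x\<bar> = (if x < 0 then - x else x)" by (rule abs_hreal_def)
  show "sgn x = (if x = 0 then 0 else if 0 < x then 1 else - 1)" by (rule sgn_hreal_def)
qed

end

lemma
  assumes "finite_q x" "finite_q y"
  shows hreal_add: "Abs_hreal (x + y) = Abs_hreal x + Abs_hreal y"
    and hreal_mult: "Abs_hreal (x * y) = Abs_hreal x * Abs_hreal y"
    and hreal_diff: "Abs_hreal (x - y) = Abs_hreal x - Abs_hreal y"
    and hreal_le: "Abs_hreal x \<le> Abs_hreal y \<longleftrightarrow> x \<le> y \<or> infinitesimal (x - y)"
  using assms by (simp_all add: plus_hreal.abs_eq times_hreal.abs_eq minus_hreal.abs_eq less_eq_hreal.abs_eq
    eq_onp_def infinitesimal_0)

lemma hreal_eq: "finite_q x \<Longrightarrow> finite_q y \<Longrightarrow> Abs_hreal x = Abs_hreal y \<longleftrightarrow> infinitesimal (x - y)"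
  using Quotient_rel[OF Quotient_hreal, of x y] by (simp add: infinitesimal_0)

text \<open>Strict order means a gap that is not infinitesimal. The existential form, with a
  standard multiplier \<open>c\<close>, can be checked on representatives and later becomes a
  formula of the language.\<close>

lemma hreal_less:
  assumes "finite_q x" "finite_q y"
  shows "Abs_hreal x < Abs_hreal y \<longleftrightarrow> (\<exists>c. st c \<and> 1 < nq c * (y - x))"
proof -
  have "Abs_hreal x < Abs_hreal y \<longleftrightarrow> \<not> (y \<le> x \<or> infinitesimal (y - x))"
    unfolding not_le[symmetric] hreal_le[OF assms(2,1)] ..
  also have "\<dots> \<longleftrightarrow> (\<exists>c. st c \<and> 1 < nq c * (y - x))"
  proof (cases "y \<le> x")
    case True
    have "nq c * (y - x) \<le> 0" for c using True by (intro mult_nonneg_nonpos) auto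
    then have "\<not> 1 < nq c * (y - x)" for c by (meson not_less order_trans zero_le_one)
    with True show ?thesis by simp
  next
    case False
    then show ?thesis unfolding infinitesimal_def by (auto simp: not_le)
  qed
  finally show ?thesis .
qed

lemma hreal_cases: obtains x where "finite_q x" "r = Abs_hreal x"
proof -
  have "r = Abs_hreal (Rep_hreal r)" by (rule Quotient_abs_rep[OF Quotient_hreal, symmetric])
  moreover have "finite_q (Rep_hreal r)" using Quotient_rep_reflp[OF Quotient_hreal, of r] by simp
  ultimately show ?thesis using that by blast
qed

text \<open>Two natural numbers code a fraction of either sign: the shift by \<open>c\<close> makes
  negative numbers available, the further the larger the denominator.\<close>

definition dn :: "'a::nat_semiring \<Rightarrow> 'a \<Rightarrow> 'a diff fract" where
  "dn a c = nq a / nq c - nq c"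

lemma finite_dn: assumes "st a" "st c" "c \<noteq> 0" shows "finite_q (dn a c)"
proof -
  have "1 \<le> nq c" using no_between[OF assms(3)] nq_le[of 1 c] by simp
  then have "nq a / nq c \<le> nq a / 1" by (intro divide_left_mono) auto
  moreover have "0 \<le> nq a / nq c" by simp
  ultimately have "\<bar>dn a c\<bar> \<le> nq a + nq c" unfolding dn_def using nq_nonneg[of a] nq_nonneg[of c] by linarith
  then show ?thesis unfolding finite_q_def using st_add[OF assms(1,2)] by (intro exI[of _ "a + c"]) (simp add: nq_add)
qed

lemma dn_dense:
  fixes r s :: "'a::nat_semiring hreal"
  assumes "r < s" obtains a c where "st a" "st c" "c \<noteq> 0" "r < Abs_hreal (dn a c)" "Abs_hreal (dn a c) < s"
proof -
  obtain x where x: "finite_q x" "r = Abs_hreal x" by (rule hreal_cases)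
  obtain y where y: "finite_q y" "s = Abs_hreal y" by (rule hreal_cases)
  obtain c0 where c0: "st c0" "1 < nq c0 * (y - x)" using assms x y hreal_less by blast
  obtain c1 where c1: "st c1" "\<bar>x\<bar> \<le> nq c1" using x(1) unfolding finite_q_def by blast
  define c where "c = c0 + c0 + c0 + c1 + 1"
  have nc: "nq c = 3 * nq c0 + nq c1 + 1" by (simp add: c_def nq_add)
  then have cpos: "0 < nq c" using nq_nonneg[of c0] nq_nonneg[of c1] by linarith
  then have c: "st c" "c \<noteq> 0" using c0 c1 by (auto simp: c_def intro: st_add st_1)
  have yx: "0 < y - x"
  proof (rule ccontr)
    assume "\<not> 0 < y - x"
    then have "nq c0 * (y - x) \<le> 0" by (intro mult_nonneg_nonpos) auto
    then show False using c0(2) by simp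
  qed
  have "3 * 1 < 3 * (nq c0 * (y - x))" using c0(2) by simp
  also have "\<dots> \<le> 3 * (nq c0 * (y - x)) + (nq c1 + 1) * (y - x)"
    using mult_nonneg_nonneg[of "nq c1 + 1" "y - x"] yx nq_nonneg[of c1] by simp
  also have "\<dots> = nq c * (y - x)" unfolding nc by (simp add: algebra_simps)
  finally have gap: "3 < nq c * (y - x)" by simp
  have "0 \<le> x + nq c" using c1(2) nq_nonneg[of c0] nc by linarith
  then have "0 \<le> nq c * (x + nq c)" using cpos by (intro mult_nonneg_nonneg) auto
  then obtain n where n: "nq n \<le> nq c * (x + nq c)" "nq c * (x + nq c) < nq n + 1" by (rule nq_floor)
  \<comment> \<open>After scaling by \<open>nq c\<close> the target must be more than 1 away from
    both ends, so that its gaps are not infinitesimal. Two steps above the floor exceed the left end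
    by more than 1 and leave more than \<open>3 - 2\<close> on the right.\<close>
  define a where "a = n + 1 + 1"
  have na: "nq a = nq n + 2" by (simp add: a_def nq_add)
  have "nq c * (x + nq c) \<le> nq c * (nq c1 + nq c)" using cpos c1(2) by (intro mult_left_mono) auto
  then have "nq a \<le> nq (c * (c1 + c) + 1 + 1)" using n na by (simp add: nq_add nq_mult)
  then have a: "st a" using c c1 by (intro st_le[of "c * (c1 + c) + 1 + 1" a]) (auto intro: st_add st_mult st_1)
  have d: "nq c * dn a c = nq a - nq c * nq c" unfolding dn_def using c(2) by (simp add: field_simps)
  have f: "finite_q (dn a c)" using a c by (simp add: finite_dn)
  have "1 < nq c * (dn a c - x)" using n(2) na by (simp add: algebra_simps d)
  then have 1: "r < Abs_hreal (dn a c)" unfolding x(2) hreal_less[OF x(1) f] using c by blast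
  have "1 < nq c * (y - dn a c)" using n(1) na gap by (simp add: algebra_simps d)
  then have 2: "Abs_hreal (dn a c) < s" unfolding y(2) hreal_less[OF f y(1)] using c by blast
  show ?thesis using that[OF a c 1 2] .
qed

section \<open>Reduction to one global counterexample; its natural numbers as a type\<close>

definition goal1 :: "('c \<Rightarrow> 'c \<Rightarrow> bool) \<Rightarrow> bool" where
  "goal1 mem \<longleftrightarrow> (\<exists>R A M L. class_structure.thin mem R \<and> class_structure.real_number_field mem R A M L)"

definition goal2 :: "('c \<Rightarrow> 'c \<Rightarrow> bool) \<Rightarrow> 'c \<Rightarrow> 'c \<Rightarrow> 'c \<Rightarrow> 'c \<Rightarrow> bool" where
  "goal2 mem R A M L \<longleftrightarrow> (\<exists>K. class_structure.prime_subfield mem K (class_structure.ring_of mem R A M)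
     \<and> (\<exists>H. class_structure.class_ring_iso mem H (class_structure.SQ mem)
          ((class_structure.ring_of mem R A M)\<lparr>carrier := class_structure.elts mem K\<rparr>))
     \<and> class_structure.dense_in mem K R L)"

type_synonym 'c fstruct = "'c \<times> 'c \<times> 'c \<times> 'c"

text \<open>Both fields are packed into one function on \<open>bool\<close>, so that a single choice
  delivers them. The statement about one field is included for the first of them and is recovered by
  taking both equal.\<close>

definition goal3 :: "('c \<Rightarrow> 'c \<Rightarrow> bool) \<Rightarrow> (bool \<Rightarrow> 'c fstruct) \<Rightarrow> bool" where
  "goal3 mem F = (case F True of (R, A, M, L) \<Rightarrow> case F False of (R', A', M', L') \<Rightarrow>
     goal2 mem R A M L \<and> class_structure.isomorphic_ordered_fields mem R A M L R' A' M' L')"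

definition is_real_field :: "('c \<Rightarrow> 'c \<Rightarrow> bool) \<Rightarrow> 'c fstruct \<Rightarrow> bool" where
  "is_real_field mem = (\<lambda>(R, A, M, L). class_structure.real_number_field mem R A M L)"

text \<open>The theorem has no free parameters besides the type \<open>'c\<close>, so it suffices to refute one
  counterexample chosen globally by Hilbert's choice.  Its natural numbers and its fields of real
  numbers then become types, on which the arithmetic of the type classes is available.  When the
  chosen structure is not a model, the types fall back on \<open>nat\<close> and \<open>rat\<close>.\<close>

definition counterex :: "('c \<Rightarrow> 'c \<Rightarrow> bool) \<times> (bool \<Rightarrow> 'c fstruct) \<Rightarrow> bool" where
  "counterex = (\<lambda>(mem, F). THS mem \<and> (\<not> goal1 mem \<or> (\<forall>i. is_real_field mem (F i)) \<and> \<not> goal3 mem F))"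

definition mem0 :: "'c \<Rightarrow> 'c \<Rightarrow> bool" where "mem0 = fst (SOME x. counterex x)"

definition fields0 :: "bool \<Rightarrow> 'c fstruct" where "fields0 = snd (SOME x. counterex x)"

abbreviation (input) isTHS :: "'c itself \<Rightarrow> bool" where "isTHS _ \<equiv> THS (mem0 :: 'c \<Rightarrow> 'c \<Rightarrow> bool)"

abbreviation "NN0 \<equiv> class_structure.NN mem0"

lemma emp_NN0: "THS (mem0 :: 'c \<Rightarrow> 'c \<Rightarrow> bool) \<Longrightarrow> class_structure.emp mem0 \<in> (NN0 :: 'c set)"
  by (rule THS.emp_NN)

text \<open>A type has to exist, and its class instance has to hold, whatever \<open>mem0\<close>
  is. The sum with \<open>nat\<close> offers a semiring for the case that \<open>mem0\<close> is not
  a model.\<close>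

typedef 'c hn = "{x :: 'c + nat. if THS (mem0 :: 'c \<Rightarrow> 'c \<Rightarrow> bool) then x \<in> Inl ` NN0 else x \<in> range Inr}"
proof (cases "THS (mem0 :: 'c \<Rightarrow> 'c \<Rightarrow> bool)")
  case True
  then show ?thesis using emp_NN0 by (intro exI[of _ "Inl (class_structure.emp mem0)"]) auto
qed auto

definition hN :: "'c \<Rightarrow> 'c hn" where "hN a = Abs_hn (Inl a)"

definition hF :: "nat \<Rightarrow> 'c hn" where "hF n = Abs_hn (Inr n)"

lemma Rep_hN: "THS (mem0 :: 'c \<Rightarrow> 'c \<Rightarrow> bool) \<Longrightarrow> a \<in> NN0 \<Longrightarrow> Rep_hn (hN (a::'c)) = Inl a"
  unfolding hN_def by (rule Abs_hn_inverse) auto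

lemma Rep_hF: "\<not> THS (mem0 :: 'c \<Rightarrow> 'c \<Rightarrow> bool) \<Longrightarrow> Rep_hn (hF n :: 'c hn) = Inr n"
  unfolding hF_def by (rule Abs_hn_inverse) auto

lemma hN_cases:
  assumes "THS (mem0 :: 'c \<Rightarrow> 'c \<Rightarrow> bool)" obtains a where "a \<in> NN0" "(x :: 'c hn) = hN a"
  using assms Rep_hn[of x] Rep_hn_inverse[of x] unfolding hN_def by (metis (no_types, lifting) image_iff mem_Collect_eq)

lemma hF_cases:
  assumes "\<not> THS (mem0 :: 'c \<Rightarrow> 'c \<Rightarrow> bool)" obtains n where "(x :: 'c hn) = hF n"
  using assms Rep_hn[of x] Rep_hn_inverse[of x] unfolding hF_def by (metis (no_types, lifting) image_iff mem_Collect_eq)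

instantiation hn :: (type) "{zero, one, plus, times, ord}"
begin

definition zero_hn :: "'a hn" where
  "zero_hn = (if THS (mem0 :: 'a \<Rightarrow> 'a \<Rightarrow> bool) then hN (class_structure.emp mem0) else hF 0)"
definition one_hn :: "'a hn" where
  "one_hn = (if THS (mem0 :: 'a \<Rightarrow> 'a \<Rightarrow> bool) then hN (class_structure.succ mem0 (class_structure.emp mem0)) else hF 1)"
definition plus_hn :: "'a hn \<Rightarrow> 'a hn \<Rightarrow> 'a hn" where
  "plus_hn x y = (case (Rep_hn x, Rep_hn y) of (Inl a, Inl b) \<Rightarrow> hN (THS.nadd mem0 a b) | (Inr m, Inr n) \<Rightarrow> hF (m + n))"
definition times_hn :: "'a hn \<Rightarrow> 'a hn \<Rightarrow> 'a hn" where
  "times_hn x y = (case (Rep_hn x, Rep_hn y) of (Inl a, Inl b) \<Rightarrow> hN (THS.nmult mem0 a b) | (Inr m, Inr n) \<Rightarrow> hF (m * n))"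
definition less_hn :: "'a hn \<Rightarrow> 'a hn \<Rightarrow> bool" where
  "less_hn x y = (case (Rep_hn x, Rep_hn y) of (Inl a, Inl b) \<Rightarrow> a \<in> class_structure.elts mem0 b | (Inr m, Inr n) \<Rightarrow> m < n)"
definition less_eq_hn :: "'a hn \<Rightarrow> 'a hn \<Rightarrow> bool" where "less_eq_hn x y \<longleftrightarrow> x < y \<or> x = y"

instance ..

end

definition std_hn :: "'c hn \<Rightarrow> bool" where
  "std_hn x = (case Rep_hn x of Inl a \<Rightarrow> a \<in> class_structure.SN mem0 | Inr n \<Rightarrow> True)"

context
  assumes THS: "THS (mem0 :: 'c \<Rightarrow> 'c \<Rightarrow> bool)"
begin

interpretation THS "mem0 :: 'c \<Rightarrow> 'c \<Rightarrow> bool" by (rule THS)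

lemma hN_0: "hN emp = 0"
  and hN_1: "hN (succ emp) = 1"
  and hN_add: "\<lbrakk>a \<in> NN; b \<in> NN\<rbrakk> \<Longrightarrow> hN a + hN b = hN (nadd a b)"
  and hN_mult: "\<lbrakk>a \<in> NN; b \<in> NN\<rbrakk> \<Longrightarrow> hN a * hN b = hN (nmult a b)"
  and hN_less: "\<lbrakk>a \<in> NN; b \<in> NN\<rbrakk> \<Longrightarrow> hN a < hN b \<longleftrightarrow> a \<in> elts b"
  and hN_st: "a \<in> NN \<Longrightarrow> std_hn (hN a) \<longleftrightarrow> a \<in> SN"
  using THS by (simp_all add: zero_hn_def one_hn_def plus_hn_def times_hn_def less_hn_def Rep_hN std_hn_def)

lemma hN_eq: "\<lbrakk>a \<in> NN; b \<in> NN\<rbrakk> \<Longrightarrow> hN a = hN b \<longleftrightarrow> a = b"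
  using Rep_hN[OF THS] by (metis sum.inject(1))

lemma hN_le: "\<lbrakk>a \<in> NN; b \<in> NN\<rbrakk> \<Longrightarrow> hN a \<le> hN b \<longleftrightarrow> a \<in> elts b \<or> a = b"
  unfolding less_eq_hn_def by (simp add: hN_less hN_eq)

lemma hn_ordered_semiring:
  fixes x y z :: "'c hn"
  shows "x + y + z = x + (y + z)" "x + y = y + x" "0 + x = x" "x * y * z = x * (y * z)" "x * y = y * x" "1 * x = x"
    "(x + y) * z = x * z + y * z" "0 * x = 0" "(0::'c hn) \<noteq> 1"
    "x < y \<longleftrightarrow> x \<le> y \<and> \<not> y \<le> x" "x \<le> x" "x \<le> y \<Longrightarrow> y \<le> z \<Longrightarrow> x \<le> z" "x \<le> y \<Longrightarrow> y \<le> x \<Longrightarrow> x = y" "x \<le> y \<or> y \<le> x"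
    "x < y \<Longrightarrow> x + z < y + z" "x < y \<Longrightarrow> 0 < z \<Longrightarrow> z * x < z * y" "x \<le> y \<Longrightarrow> \<exists>w. y = x + w" "0 \<le> x"
    "y \<noteq> 0 \<Longrightarrow> \<exists>q r. r < y \<and> x = y * q + r" "y \<noteq> 0 \<Longrightarrow> 1 \<le> y"
    "std_hn (0::'c hn)" "std_hn (1::'c hn)" "std_hn x \<Longrightarrow> std_hn y \<Longrightarrow> std_hn (x + y)" "std_hn x \<Longrightarrow> std_hn y \<Longrightarrow> std_hn (x * y)"
    "std_hn y \<Longrightarrow> x \<le> y \<Longrightarrow> std_hn x"
proof -
  obtain a where x: "a \<in> NN" "x = hN a" using hN_cases[OF THS] .
  obtain b where y: "b \<in> NN" "y = hN b" using hN_cases[OF THS] .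
  obtain c where z: "c \<in> NN" "z = hN c" using hN_cases[OF THS] .
  note S = x y z hN_0[symmetric] hN_1[symmetric] hN_add hN_mult hN_less hN_le hN_st hN_eq
  have tot: "a \<in> elts b \<or> a = b \<or> b \<in> elts a" using NN_linear x y by blast
  have least: "emp \<in> elts d \<or> emp = d" if "d \<in> NN" for d
    using NN_linear[OF emp_NN that] by auto
  show "x + y + z = x + (y + z)" by (simp add: S nadd_assoc)
  show "x + y = y + x" using nadd_commute by (simp add: S)
  show "0 + x = x" by (simp add: S)
  show "x * y * z = x * (y * z)" by (simp add: S nmult_assoc)
  show "x * y = y * x" using nmult_commute by (simp add: S)
  show "1 * x = x" by (simp add: S nmult_succ_left)
  have d: "nmult (nadd a b) c = nadd (nmult a c) (nmult b c)"
    using nmult_nadd[of c a b] nmult_commute[of c] x y z by simp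
  show "(x + y) * z = x * z + y * z" by (simp add: S d)
  show "0 * x = 0" by (simp add: S)
  show "(0::'c hn) \<noteq> 1" using emp_not_succ[OF emp_V] by (simp add: S eq_commute[of emp])
  show "x < y \<longleftrightarrow> x \<le> y \<and> \<not> y \<le> x" using mem_irrefl[of a] mem_asym[of a b] mem_irrefl[of b] by (auto simp: S)
  show "x \<le> x" by (simp add: S)
  show "x \<le> y \<Longrightarrow> y \<le> z \<Longrightarrow> x \<le> z" using NN_trans[OF z(1), of b a] by (auto simp: S)
  show "x \<le> y \<Longrightarrow> y \<le> x \<Longrightarrow> x = y" using mem_asym[of a b] by (auto simp: S)
  show "x \<le> y \<or> y \<le> x" using tot by (auto simp: S)
  show "x < y \<Longrightarrow> x + z < y + z" by (simp add: S nadd_mem)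
  show "x < y \<Longrightarrow> 0 < z \<Longrightarrow> z * x < z * y" using nmult_mem[of a b c] x y z elts_emp by (cases "c = emp") (auto simp: S)
  show "\<exists>w. y = x + w" if "x \<le> y"
  proof -
    consider "a = b" | "a \<in> elts b" using \<open>x \<le> y\<close> by (auto simp: S)
    then show ?thesis
    proof cases
      case 1 then show ?thesis by (intro exI[of _ 0]) (simp add: S)
    next
      case 2
      then obtain k where "k \<in> NN" "b = nadd a (succ k)" using mem_iff_nadd x y by blast
      then show ?thesis using x y by (intro exI[of _ "hN (succ k)"]) (simp add: S)
    qed
  qed
  show "0 \<le> x" using least[OF x(1)] by (auto simp: S)
  show "\<exists>q r. r < y \<and> x = y * q + r" if "y \<noteq> 0"
  proof -
    have "b \<noteq> emp" using that by (auto simp: S)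
    then obtain q r where q: "q \<in> NN" "r \<in> elts b" "a = nadd (nmult b q) r" using NN_division[OF y(1) _ x(1)] by blast
    then show ?thesis using y(1) NN_mem[OF y(1) q(2)] by (intro exI[of _ "hN q"] exI[of _ "hN r"]) (simp add: S)
  qed
  show "1 \<le> y" if "y \<noteq> 0"
  proof -
    have "b \<noteq> emp" using that by (auto simp: S)
    obtain m where m: "m \<in> NN" "b = succ m" using y(1) \<open>b \<noteq> emp\<close> by (cases rule: NN_cases) auto
    then show ?thesis using least[OF m(1)] by (auto simp: S succ_mem_succ simp del: elts_succ)
  qed
  show "std_hn (0::'c hn)" by (simp add: S)
  show "std_hn (1::'c hn)" by (simp add: S)
  show "std_hn x \<Longrightarrow> std_hn y \<Longrightarrow> std_hn (x + y)" by (simp add: S SN_nadd)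
  show "std_hn x \<Longrightarrow> std_hn y \<Longrightarrow> std_hn (x * y)" by (simp add: S SN_nmult)
  show "std_hn y \<Longrightarrow> x \<le> y \<Longrightarrow> std_hn x" using SN_mem[of b a] by (auto simp: S)
qed

end

context
  assumes THS: "\<not> THS (mem0 :: 'c \<Rightarrow> 'c \<Rightarrow> bool)"
begin

lemma hF_0: "(hF 0 :: 'c hn) = 0"
  and hF_1: "(hF 1 :: 'c hn) = 1"
  and hF_add: "(hF m :: 'c hn) + hF n = hF (m + n)"
  and hF_mult: "(hF m :: 'c hn) * hF n = hF (m * n)"
  and hF_less: "(hF m :: 'c hn) < hF n \<longleftrightarrow> m < n"
  and hF_st: "std_hn (hF m :: 'c hn)"
  using THS by (simp_all add: zero_hn_def one_hn_def plus_hn_def times_hn_def less_hn_def Rep_hF std_hn_def)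

lemma hF_eq: "(hF m :: 'c hn) = hF n \<longleftrightarrow> m = n"
  using Rep_hF[OF THS] by (metis sum.inject(2))

lemma hF_le: "(hF m :: 'c hn) \<le> hF n \<longleftrightarrow> m \<le> n"
  unfolding less_eq_hn_def by (auto simp: hF_less hF_eq)

lemma hn_ordered_semiring_fallback:
  fixes x y z :: "'c hn"
  shows "x + y + z = x + (y + z)" "x + y = y + x" "0 + x = x" "x * y * z = x * (y * z)" "x * y = y * x" "1 * x = x"
    "(x + y) * z = x * z + y * z" "0 * x = 0" "(0::'c hn) \<noteq> 1"
    "x < y \<longleftrightarrow> x \<le> y \<and> \<not> y \<le> x" "x \<le> x" "x \<le> y \<Longrightarrow> y \<le> z \<Longrightarrow> x \<le> z" "x \<le> y \<Longrightarrow> y \<le> x \<Longrightarrow> x = y" "x \<le> y \<or> y \<le> x"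
    "x < y \<Longrightarrow> x + z < y + z" "x < y \<Longrightarrow> 0 < z \<Longrightarrow> z * x < z * y" "x \<le> y \<Longrightarrow> \<exists>w. y = x + w" "0 \<le> x"
    "y \<noteq> 0 \<Longrightarrow> \<exists>q r. r < y \<and> x = y * q + r" "y \<noteq> 0 \<Longrightarrow> 1 \<le> y"
    "std_hn (0::'c hn)" "std_hn (1::'c hn)" "std_hn x \<Longrightarrow> std_hn y \<Longrightarrow> std_hn (x + y)" "std_hn x \<Longrightarrow> std_hn y \<Longrightarrow> std_hn (x * y)"
    "std_hn y \<Longrightarrow> x \<le> y \<Longrightarrow> std_hn x"
proof -
  obtain a where x: "x = hF a" using hF_cases[OF THS] .
  obtain b where y: "y = hF b" using hF_cases[OF THS] .
  obtain c where z: "z = hF c" using hF_cases[OF THS] .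
  note S = x y z hF_0[symmetric] hF_1[symmetric] hF_add hF_mult hF_less hF_le hF_st hF_eq
  show "x + y + z = x + (y + z)" "x + y = y + x" "0 + x = x" "x * y * z = x * (y * z)" "x * y = y * x" "1 * x = x"
    "(x + y) * z = x * z + y * z" "0 * x = 0" "(0::'c hn) \<noteq> 1"
    "x < y \<longleftrightarrow> x \<le> y \<and> \<not> y \<le> x" "x \<le> x" "x \<le> y \<Longrightarrow> y \<le> z \<Longrightarrow> x \<le> z" "x \<le> y \<Longrightarrow> y \<le> x \<Longrightarrow> x = y" "x \<le> y \<or> y \<le> x"
    "x < y \<Longrightarrow> x + z < y + z" "x < y \<Longrightarrow> 0 < z \<Longrightarrow> z * x < z * y" "0 \<le> x" "y \<noteq> 0 \<Longrightarrow> 1 \<le> y"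
    "std_hn (0::'c hn)" "std_hn (1::'c hn)" "std_hn x \<Longrightarrow> std_hn y \<Longrightarrow> std_hn (x + y)" "std_hn x \<Longrightarrow> std_hn y \<Longrightarrow> std_hn (x * y)"
    "std_hn y \<Longrightarrow> x \<le> y \<Longrightarrow> std_hn x"
    by (simp only: S; auto simp: algebra_simps)+
  show "\<exists>w. y = x + w" if "x \<le> y"
    using that by (intro exI[of _ "hF (b - a)"]) (simp add: S)
  show "\<exists>q r. r < y \<and> x = y * q + r" if "y \<noteq> 0"
    using that by (intro exI[of _ "hF (a div b)"] exI[of _ "hF (a mod b)"]) (simp add: S)
qed

end

instantiation hn :: (type) nat_semiring
begin

definition st_hn :: "'a hn \<Rightarrow> bool" where "st_hn = std_hn"

instance
proof
  fix x y z :: "'a hn"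
  show "x + y + z = x + (y + z)"
    by (cases "THS (mem0 :: 'a \<Rightarrow> 'a \<Rightarrow> bool)") (blast intro: hn_ordered_semiring(1) hn_ordered_semiring_fallback(1))+
  show "x + y = y + x"
    by (cases "THS (mem0 :: 'a \<Rightarrow> 'a \<Rightarrow> bool)") (blast intro: hn_ordered_semiring(2) hn_ordered_semiring_fallback(2))+
  show "0 + x = x"
    by (cases "THS (mem0 :: 'a \<Rightarrow> 'a \<Rightarrow> bool)") (blast intro: hn_ordered_semiring(3) hn_ordered_semiring_fallback(3))+
  show "x * y * z = x * (y * z)"
    by (cases "THS (mem0 :: 'a \<Rightarrow> 'a \<Rightarrow> bool)") (blast intro: hn_ordered_semiring(4) hn_ordered_semiring_fallback(4))+
  show "x * y = y * x"
    by (cases "THS (mem0 :: 'a \<Rightarrow> 'a \<Rightarrow> bool)") (blast intro: hn_ordered_semiring(5) hn_ordered_semiring_fallback(5))+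
  show "1 * x = x"
    by (cases "THS (mem0 :: 'a \<Rightarrow> 'a \<Rightarrow> bool)") (blast intro: hn_ordered_semiring(6) hn_ordered_semiring_fallback(6))+
  show "(x + y) * z = x * z + y * z"
    by (cases "THS (mem0 :: 'a \<Rightarrow> 'a \<Rightarrow> bool)") (blast intro: hn_ordered_semiring(7) hn_ordered_semiring_fallback(7))+
  show "0 * x = 0"
    by (cases "THS (mem0 :: 'a \<Rightarrow> 'a \<Rightarrow> bool)") (blast intro: hn_ordered_semiring(8) hn_ordered_semiring_fallback(8))+
  then show "x * 0 = 0"
    by (cases "THS (mem0 :: 'a \<Rightarrow> 'a \<Rightarrow> bool)") (simp_all add: hn_ordered_semiring(5)[of x 0] hn_ordered_semiring_fallback(5)[of x 0])
  show "(0::'a hn) \<noteq> 1"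
    by (cases "THS (mem0 :: 'a \<Rightarrow> 'a \<Rightarrow> bool)") (rule hn_ordered_semiring(9), assumption, rule hn_ordered_semiring_fallback(9), assumption)
  show "x < y \<longleftrightarrow> x \<le> y \<and> \<not> y \<le> x"
    by (cases "THS (mem0 :: 'a \<Rightarrow> 'a \<Rightarrow> bool)") (rule hn_ordered_semiring(10), assumption, rule hn_ordered_semiring_fallback(10), assumption)
  show "x \<le> x"
    by (cases "THS (mem0 :: 'a \<Rightarrow> 'a \<Rightarrow> bool)") (rule hn_ordered_semiring(11), assumption, rule hn_ordered_semiring_fallback(11), assumption)
  show "x \<le> y \<Longrightarrow> y \<le> z \<Longrightarrow> x \<le> z"
    by (cases "THS (mem0 :: 'a \<Rightarrow> 'a \<Rightarrow> bool)") (blast intro: hn_ordered_semiring(12) hn_ordered_semiring_fallback(12))+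
  show "x \<le> y \<Longrightarrow> y \<le> x \<Longrightarrow> x = y"
    by (cases "THS (mem0 :: 'a \<Rightarrow> 'a \<Rightarrow> bool)") (blast intro: hn_ordered_semiring(13) hn_ordered_semiring_fallback(13))+
  show "x \<le> y \<or> y \<le> x"
    by (cases "THS (mem0 :: 'a \<Rightarrow> 'a \<Rightarrow> bool)") (rule hn_ordered_semiring(14), assumption, rule hn_ordered_semiring_fallback(14), assumption)
  show "x < y \<Longrightarrow> x + z < y + z"
    by (cases "THS (mem0 :: 'a \<Rightarrow> 'a \<Rightarrow> bool)") (blast intro: hn_ordered_semiring(15) hn_ordered_semiring_fallback(15))+
  show "x < y \<Longrightarrow> 0 < z \<Longrightarrow> z * x < z * y"
    by (cases "THS (mem0 :: 'a \<Rightarrow> 'a \<Rightarrow> bool)") (blast intro: hn_ordered_semiring(16) hn_ordered_semiring_fallback(16))+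
  show "x \<le> y \<Longrightarrow> \<exists>w. y = x + w"
    by (cases "THS (mem0 :: 'a \<Rightarrow> 'a \<Rightarrow> bool)") (blast intro: hn_ordered_semiring(17) hn_ordered_semiring_fallback(17))+
  show "0 \<le> x"
    by (cases "THS (mem0 :: 'a \<Rightarrow> 'a \<Rightarrow> bool)") (blast intro: hn_ordered_semiring(18) hn_ordered_semiring_fallback(18))+
  show "y \<noteq> 0 \<Longrightarrow> \<exists>q r. r < y \<and> x = y * q + r"
    by (cases "THS (mem0 :: 'a \<Rightarrow> 'a \<Rightarrow> bool)") (blast intro: hn_ordered_semiring(19) hn_ordered_semiring_fallback(19))+
  show "y \<noteq> 0 \<Longrightarrow> 1 \<le> y"
    by (cases "THS (mem0 :: 'a \<Rightarrow> 'a \<Rightarrow> bool)") (blast intro: hn_ordered_semiring(20) hn_ordered_semiring_fallback(20))+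
  show "st (0::'a hn)"
    unfolding st_hn_def by (cases "THS (mem0 :: 'a \<Rightarrow> 'a \<Rightarrow> bool)") (blast intro: hn_ordered_semiring(21) hn_ordered_semiring_fallback(21))+
  show "st (1::'a hn)"
    unfolding st_hn_def by (cases "THS (mem0 :: 'a \<Rightarrow> 'a \<Rightarrow> bool)") (blast intro: hn_ordered_semiring(22) hn_ordered_semiring_fallback(22))+
  show "st x \<Longrightarrow> st y \<Longrightarrow> st (x + y)"
    unfolding st_hn_def by (cases "THS (mem0 :: 'a \<Rightarrow> 'a \<Rightarrow> bool)") (blast intro: hn_ordered_semiring(23) hn_ordered_semiring_fallback(23))+
  show "st x \<Longrightarrow> st y \<Longrightarrow> st (x * y)"
    unfolding st_hn_def by (cases "THS (mem0 :: 'a \<Rightarrow> 'a \<Rightarrow> bool)") (blast intro: hn_ordered_semiring(24) hn_ordered_semiring_fallback(24))+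
  show "st y \<Longrightarrow> x \<le> y \<Longrightarrow> st x"
    unfolding st_hn_def by (cases "THS (mem0 :: 'a \<Rightarrow> 'a \<Rightarrow> bool)") (blast intro: hn_ordered_semiring(25) hn_ordered_semiring_fallback(25))+
qed

end

section \<open>From HOL functions and type class fields back to classes and structures\<close>

lemma field_transfer:
  fixes \<rho> :: "'a \<Rightarrow> 'b::field" and G (structure)
  assumes bij: "bij_betw \<rho> (carrier G) UNIV"
    and closed: "\<And>x y. x \<in> carrier G \<Longrightarrow> y \<in> carrier G \<Longrightarrow> x \<oplus> y \<in> carrier G" "\<And>x y. x \<in> carrier G \<Longrightarrow> y \<in> carrier G \<Longrightarrow> x \<otimes> y \<in> carrier G"
      "\<zero> \<in> carrier G" "\<one> \<in> carrier G"
    and hom: "\<And>x y. x \<in> carrier G \<Longrightarrow> y \<in> carrier G \<Longrightarrow> \<rho> (x \<oplus> y) = \<rho> x + \<rho> y"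
      "\<And>x y. x \<in> carrier G \<Longrightarrow> y \<in> carrier G \<Longrightarrow> \<rho> (x \<otimes> y) = \<rho> x * \<rho> y" "\<rho> \<zero> = 0" "\<rho> \<one> = 1"
  shows "field G"
proof -
  have eq: "x = y \<longleftrightarrow> \<rho> x = \<rho> y" if "x \<in> carrier G" "y \<in> carrier G" for x y
    using bij that unfolding bij_betw_def inj_on_def by blast
  have surj: "\<exists>x\<in>carrier G. \<rho> x = r" for r
    using bij unfolding bij_betw_def by (metis UNIV_I imageE)
  have add: "abelian_group G"
  proof (rule abelian_groupI)
    fix x assume x: "x \<in> carrier G"
    obtain y where "y \<in> carrier G" "\<rho> y = - \<rho> x" using surj by blast
    then show "\<exists>y\<in>carrier G. y \<oplus> x = \<zero>" using x closed hom by (intro bexI[of _ y]) (auto simp: eq)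
  qed (use closed hom in \<open>auto simp: eq algebra_simps\<close>)
  have mult: "comm_monoid G"
    by (rule comm_monoidI) (use closed hom in \<open>auto simp: eq algebra_simps\<close>)
  have "cring G"
    by (rule cringI[OF add mult]) (use closed hom in \<open>auto simp: eq algebra_simps\<close>)
  then interpret cring G .
  show ?thesis
  proof (rule cring_fieldI)
    show "Units G = carrier G - {\<zero>}"
    proof (intro equalityI subsetI)
      fix x assume "x \<in> Units G"
      then obtain y where y: "x \<in> carrier G" "y \<in> carrier G" "y \<otimes> x = \<one>" unfolding Units_def by blast
      then have "\<rho> y * \<rho> x = 1" using hom by metis
      then have "\<rho> x \<noteq> 0" by auto
      then show "x \<in> carrier G - {\<zero>}" using y hom by auto
    next
      fix x assume "x \<in> carrier G - {\<zero>}"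
      then have x: "x \<in> carrier G" "\<rho> x \<noteq> 0" using eq[of x \<zero>] closed hom by auto
      obtain y where y: "y \<in> carrier G" "\<rho> y = inverse (\<rho> x)" using surj by blast
      have "x \<otimes> y = \<one>" "y \<otimes> x = \<one>" using x y closed hom by (simp_all add: eq)
      then show "x \<in> Units G" using x y unfolding Units_def by blast
    qed
  qed
qed

context THS
begin

lemma ex_relation:
  assumes T: "Def UNIV (\<lambda>s. T (s 0) (s (Suc 0)))" and A: "isclass A" and B: "isclass B"
  shows "\<exists>L. is_relation L \<and> graph L = {(x, y). x \<in> A \<and> y \<in> B \<and> T x y}"
proof -
  have "isclass {w \<in> V. \<exists>x\<in>V. \<exists>y\<in>V. x \<in> A \<and> y \<in> B \<and> w = pair x y \<and> T x y}"
    by (intro isclassI defn Def_isclass A B Def_subst2[OF T])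
  then obtain L where L: "elts L = {w \<in> V. \<exists>x\<in>V. \<exists>y\<in>V. x \<in> A \<and> y \<in> B \<and> w = pair x y \<and> T x y}"
    unfolding isclass_def by blast
  have AV: "x \<in> V" if "x \<in> A" for x using isclass_sub_V[OF A] that by blast
  have BV: "x \<in> V" if "x \<in> B" for x using isclass_sub_V[OF B] that by blast
  have "is_relation L" unfolding is_relation_iff L by blast
  moreover have "(x, y) \<in> graph L \<longleftrightarrow> x \<in> A \<and> y \<in> B \<and> T x y" for x y
  proof
    assume "(x, y) \<in> graph L"
    then have "x \<in> V" "y \<in> V" "pair x y \<in> elts L" by (auto simp: graph_iff)
    then obtain x' y' where "x' \<in> V" "y' \<in> V" "x' \<in> A" "y' \<in> B" "pair x y = pair x' y'" "T x' y'" unfolding L by blast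
    then show "x \<in> A \<and> y \<in> B \<and> T x y" using \<open>x \<in> V\<close> \<open>y \<in> V\<close> by simp
  next
    assume xy: "x \<in> A \<and> y \<in> B \<and> T x y"
    then have "x \<in> V" "y \<in> V" using AV BV by blast+
    then show "(x, y) \<in> graph L" unfolding graph_iff L using xy pair_V by blast
  qed
  then have "graph L = {(x, y). x \<in> A \<and> y \<in> B \<and> T x y}" by auto
  ultimately show ?thesis by blast
qed

text \<open>\<open>F\<close> may be any HOL function. What the model needs is a definable relation
  \<open>T\<close> that agrees with the graph of \<open>F\<close> between the classes
  \<open>A\<close> and \<open>B\<close>.\<close>

lemma ex_function:
  assumes T: "Def UNIV (\<lambda>s. T (s 0) (s (Suc 0)))" and A: "isclass A" and B: "isclass B"
    and F: "\<And>x. x \<in> A \<Longrightarrow> F x \<in> B" "\<And>x y. x \<in> A \<Longrightarrow> y \<in> B \<Longrightarrow> T x y \<longleftrightarrow> y = F x"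
  shows "\<exists>H. is_function H \<and> Domain (graph H) = A \<and> Range (graph H) \<subseteq> B \<and> (\<forall>x\<in>A. app H x = F x)"
proof -
  obtain H where H: "is_relation H" "graph H = {(x, y). x \<in> A \<and> y \<in> B \<and> T x y}"
    using ex_relation[OF T A B] by blast
  have fn: "is_function H" unfolding is_function_def single_valued_def using H F by auto
  moreover have TF: "T x (F x)" if "x \<in> A" for x using F that by blast
  have "Domain (graph H) = A" unfolding H(2) using TF F(1) by blast
  moreover have "Range (graph H) \<subseteq> B" using H(2) by auto
  moreover have "app H x = F x" if "x \<in> A" for x
    unfolding app_def by (rule the_equality) (use H(2) F that in auto)
  ultimately show ?thesis by blast
qed

lemma ex_binary_op:
  assumes T: "Def UNIV (\<lambda>s. T (s 0) (s (Suc 0)) (s (Suc (Suc 0))))"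
    and F: "\<And>x y. x \<in> elts R \<Longrightarrow> y \<in> elts R \<Longrightarrow> F x y \<in> elts R"
      "\<And>x y z. x \<in> elts R \<Longrightarrow> y \<in> elts R \<Longrightarrow> z \<in> elts R \<Longrightarrow> T x y z \<longleftrightarrow> z = F x y"
  shows "\<exists>A. binary_op_on R A \<and> (\<forall>x\<in>elts R. \<forall>y\<in>elts R. app A (pair x y) = F x y)"
proof -
  have RV: "x \<in> V" if "x \<in> elts R" for x using that elts_V by blast
  let ?G = "\<lambda>p. THE z. \<exists>x\<in>elts R. \<exists>y\<in>elts R. p = pair x y \<and> z = F x y"
  have G: "?G (pair x y) = F x y" if "x \<in> elts R" "y \<in> elts R" for x y
    by (rule the_equality) (use that RV in auto)
  have "\<exists>H. is_function H \<and> Domain (graph H) = {pair x y | x y. x \<in> elts R \<and> y \<in> elts R} \<and>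
      Range (graph H) \<subseteq> elts R \<and> (\<forall>p\<in>{pair x y | x y. x \<in> elts R \<and> y \<in> elts R}. app H p = ?G p)"
  proof (rule ex_function[where T = "\<lambda>p z. \<exists>x\<in>elts R. \<exists>y\<in>elts R. p = pair x y \<and> T x y z"])
    show "Def UNIV (\<lambda>s. \<exists>x\<in>elts R. \<exists>y\<in>elts R. s 0 = pair x y \<and> T x y (s (Suc 0)))"
      by (intro defn Def_subst3[OF T])
    show "isclass {pair x y | x y. x \<in> elts R \<and> y \<in> elts R}" by (rule isclass_Times) simp_all
    show "?G p \<in> elts R" if p: "p \<in> {pair x y | x y. x \<in> elts R \<and> y \<in> elts R}" for p
    proof -
      obtain x y where xy: "p = pair x y" "x \<in> elts R" "y \<in> elts R" using p by blast
      show ?thesis unfolding xy(1) G[OF xy(2,3)] using F(1) xy(2,3) .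
    qed
    show "(\<exists>x\<in>elts R. \<exists>y\<in>elts R. p = pair x y \<and> T x y z) \<longleftrightarrow> z = ?G p"
      if p: "p \<in> {pair x y | x y. x \<in> elts R \<and> y \<in> elts R}" and z: "z \<in> elts R" for p z
    proof -
      obtain x y where xy: "p = pair x y" "x \<in> elts R" "y \<in> elts R" using p by blast
      have "(\<exists>x'\<in>elts R. \<exists>y'\<in>elts R. p = pair x' y' \<and> T x' y' z) \<longleftrightarrow> T x y z" using xy RV by auto
      also have "\<dots> \<longleftrightarrow> z = ?G p" unfolding xy(1) G[OF xy(2,3)] using F(2)[OF xy(2,3) z] .
      finally show ?thesis .
    qed
  qed simp
  then obtain A where A: "is_function A" "Domain (graph A) = {pair x y | x y. x \<in> elts R \<and> y \<in> elts R}"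
    "Range (graph A) \<subseteq> elts R" "\<forall>p\<in>{pair x y | x y. x \<in> elts R \<and> y \<in> elts R}. app A p = ?G p" by blast
  have "app A (pair x y) = F x y" if "x \<in> elts R" "y \<in> elts R" for x y
  proof -
    have "app A (pair x y) = ?G (pair x y)" using A(4) that by blast
    then show ?thesis unfolding G[OF that] .
  qed
  then show ?thesis using A unfolding binary_op_on_def by blast
qed

end

section \<open>Standard sets and reduced fractions\<close>

context THS
begin

lemma S_emp: "emp \<in> S" and S_adjoin: "a \<in> S \<Longrightarrow> b \<in> S \<Longrightarrow> adjoin a b \<in> S"
  unfolding S_def by auto

lemma S_induct:
  assumes P: "Def UNIV (\<lambda>s. P (s 0))" and "P emp" and step: "\<And>a b. a \<in> V \<Longrightarrow> b \<in> V \<Longrightarrow> P a \<Longrightarrow> P b \<Longrightarrow> P (adjoin a b)"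
    and x: "x \<in> S"
  shows "P x"
proof -
  obtain Z where Z: "elts Z = {y \<in> V. P y}" using isclassI[OF P] unfolding isclass_def by blast
  have "x \<in> elts Z"
    using x unfolding S_def by (rule InterD) (use Z assms(2) step in auto)
  then show ?thesis using Z by simp
qed

lemma isclass_S: "isclass S"
proof -
  have SV: "x \<in> V" if "x \<in> S" for x by (rule S_induct[OF _ _ _ that], intro defn) auto
  have "isclass {y \<in> V. \<forall>X. (emp \<in> elts X \<and> (\<forall>a\<in>elts X. \<forall>b\<in>elts X. adjoin a b \<in> elts X)) \<longrightarrow> y \<in> elts X}"
    by (intro isclassI defn)
  moreover have "S = {y \<in> V. \<forall>X. (emp \<in> elts X \<and> (\<forall>a\<in>elts X. \<forall>b\<in>elts X. adjoin a b \<in> elts X)) \<longrightarrow> y \<in> elts X}"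
    using SV by (auto simp: S_def)
  ultimately show ?thesis by simp
qed

lemmas Def_S [defn] = Def_isclass[OF isclass_S]

lemma S_trans: assumes "x \<in> S" "y \<in> elts x" shows "y \<in> S"
proof -
  have "x \<in> S \<and> (\<forall>y\<in>elts x. y \<in> S)"
    by (rule S_induct[where P = "\<lambda>x. x \<in> S \<and> (\<forall>y\<in>elts x. y \<in> S)", OF _ _ _ assms(1)], intro defn) (auto simp: S_emp S_adjoin)
  then show ?thesis using assms(2) by blast
qed

text \<open>The induction over \<open>S\<close> treats a set together with its elements. If
  \<open>adjoin a b\<close> is a successor, its predecessor is among its elements, so it is standard
  by the claim about elements.\<close>

lemma NN_S: assumes "n \<in> NN" "n \<in> S" shows "n \<in> SN"
proof -
  have "(\<forall>m\<in>elts n. m \<in> NN \<longrightarrow> m \<in> SN) \<and> (n \<in> NN \<longrightarrow> n \<in> SN)"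
  proof (rule S_induct[where P = "\<lambda>n. (\<forall>m\<in>elts n. m \<in> NN \<longrightarrow> m \<in> SN) \<and> (n \<in> NN \<longrightarrow> n \<in> SN)", OF _ _ _ assms(2)])
    show "Def UNIV (\<lambda>s. (\<forall>m\<in>elts (s 0). m \<in> NN \<longrightarrow> m \<in> SN) \<and> (s 0 \<in> NN \<longrightarrow> s 0 \<in> SN))" by (intro defn)
    fix a b assume a: "(\<forall>m\<in>elts a. m \<in> NN \<longrightarrow> m \<in> SN) \<and> (a \<in> NN \<longrightarrow> a \<in> SN)"
      and b: "(\<forall>m\<in>elts b. m \<in> NN \<longrightarrow> m \<in> SN) \<and> (b \<in> NN \<longrightarrow> b \<in> SN)" and V: "a \<in> V" "b \<in> V"
    have el: "\<forall>m\<in>elts (adjoin a b). m \<in> NN \<longrightarrow> m \<in> SN" using a b V by auto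
    moreover have "adjoin a b \<in> SN" if "adjoin a b \<in> NN"
      using that
    proof (cases rule: NN_cases)
      case (2 m)
      then have "m \<in> elts (adjoin a b)" using elts_succ[of m] by simp
      then have "m \<in> SN" using el 2(1) by blast
      then show ?thesis using 2(2) by simp
    qed (simp only: SN_emp)
    ultimately show "(\<forall>m\<in>elts (adjoin a b). m \<in> NN \<longrightarrow> m \<in> SN) \<and> (adjoin a b \<in> NN \<longrightarrow> adjoin a b \<in> SN)" by blast
  qed simp
  then show ?thesis using assms(1) by blast
qed

lemma SN_S: "n \<in> SN \<Longrightarrow> n \<in> S"
  by (rule SN_induct[where P = "\<lambda>n. n \<in> S"], intro defn) (auto simp: S_emp S_adjoin succ_def)

lemma pair_S: assumes "a \<in> V" "b \<in> V" shows "pair a b \<in> S \<longleftrightarrow> a \<in> S \<and> b \<in> S"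
proof
  assume "pair a b \<in> S"
  moreover have "upair a b \<in> elts (pair a b)" using assms by (simp add: pair_def)
  ultimately have "upair a b \<in> S" by (rule S_trans)
  then show "a \<in> S \<and> b \<in> S" using S_trans[of "upair a b"] assms by auto
next
  have u: "upair x y = adjoin (adjoin emp x) y" if "x \<in> V" "y \<in> V" for x y
    using that by (auto simp flip: elts_inject)
  assume "a \<in> S \<and> b \<in> S"
  then show "pair a b \<in> S" unfolding pair_def using assms by (simp add: u S_emp S_adjoin)
qed

lemma fst_of_pair [simp]: "x \<in> V \<Longrightarrow> y \<in> V \<Longrightarrow> fst_of (pair x y) = x"
  and snd_of_pair [simp]: "x \<in> V \<Longrightarrow> y \<in> V \<Longrightarrow> snd_of (pair x y) = y"
  unfolding fst_of_def snd_of_def by (auto intro!: the_equality)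

lemma nat_add_nadd': "m \<in> NN \<Longrightarrow> n \<in> NN \<Longrightarrow> nat_add m n = nadd m n"
  and nat_mult_nmult: "m \<in> NN \<Longrightarrow> n \<in> NN \<Longrightarrow> nat_mult m n = nmult m n"
  by (simp_all add: nadd_def nmult_def)

definition reduced :: "'c \<Rightarrow> 'c \<Rightarrow> bool" where
  "reduced y e \<longleftrightarrow> (\<forall>c\<in>NN. (\<exists>k\<in>NN. nmult c k = y) \<longrightarrow> (\<exists>k\<in>NN. nmult c k = e) \<longrightarrow> c = succ emp)"

lemma QQ_iff:
  assumes "a \<in> NN" "b \<in> NN" "e \<in> NN"
  shows "pair (pair a b) e \<in> QQ \<longleftrightarrow> (a = emp \<or> b = emp) \<and> e \<noteq> emp \<and> reduced (nadd a b) e"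
proof -
  have z: "pair a b \<in> ZZ \<longleftrightarrow> a = emp \<or> b = emp" using assms unfolding ZZ_def by auto
  have r: "(\<forall>c\<in>NN. nat_dvd c (nat_add a b) \<and> nat_dvd c e \<longrightarrow> c = succ emp) \<longleftrightarrow> reduced (nadd a b) e"
    unfolding reduced_def nat_dvd_def using assms by (simp add: nat_add_nadd' nat_mult_nmult imp_conjL)
  have zV: "x \<in> V" if "x \<in> ZZ" for x using that unfolding ZZ_def by auto
  have "pair (pair a b) e \<in> QQ \<longleftrightarrow> pair a b \<in> ZZ \<and> e \<in> NN \<and> e \<noteq> emp \<and>
     (\<forall>c\<in>NN. nat_dvd c (nat_add (fst_of (pair a b)) (snd_of (pair a b))) \<and> nat_dvd c e \<longrightarrow> c = succ emp)" (is "_ \<longleftrightarrow> ?r")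
  proof
    assume "pair (pair a b) e \<in> QQ"
    then obtain y d where h: "pair (pair a b) e = pair y d" "y \<in> ZZ" "d \<in> NN" "d \<noteq> emp"
      "\<forall>c\<in>NN. nat_dvd c (nat_add (fst_of y) (snd_of y)) \<and> nat_dvd c d \<longrightarrow> c = succ emp" unfolding QQ_def by blast
    then have "pair a b = y \<and> e = d" using zV[OF h(2)] assms by simp
    then have e: "y = pair a b" "d = e" by auto
    show ?r using h(2-5) unfolding e by blast
  next
    assume ?r
    then show "pair (pair a b) e \<in> QQ" unfolding QQ_def by blast
  qed
  then show ?thesis using z r assms by simp
qed

lemma QQ_cases:
  assumes "q \<in> QQ"
  obtains a b e where "q = pair (pair a b) e" "a \<in> NN" "b \<in> NN" "e \<in> NN" "a = emp \<or> b = emp" "e \<noteq> emp" "reduced (nadd a b) e"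
proof -
  obtain z d where q: "q = pair z d" "z \<in> ZZ" "d \<in> NN" using assms unfolding QQ_def by blast
  obtain a b where z: "z = pair a b" "a \<in> NN" "b \<in> NN" using q(2) unfolding ZZ_def by blast
  show ?thesis using that[of a b d] QQ_iff[of a b d] assms q z by simp
qed

lemma QQ_S: "a \<in> NN \<Longrightarrow> b \<in> NN \<Longrightarrow> e \<in> NN \<Longrightarrow> pair (pair a b) e \<in> S \<longleftrightarrow> a \<in> SN \<and> b \<in> SN \<and> e \<in> SN"
  using NN_S SN_S by (auto simp: pair_S)

end

section \<open>The thin class of real numbers\<close>

context
  assumes THS: "THS (mem0 :: 'c \<Rightarrow> 'c \<Rightarrow> bool)"
begin

interpretation THS "mem0 :: 'c \<Rightarrow> 'c \<Rightarrow> bool" by (rule THS)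

definition qn :: "'c \<Rightarrow> 'c hn diff fract" where "qn a = nq (hN a)"

lemma qn_nadd: "\<lbrakk>a \<in> NN; b \<in> NN\<rbrakk> \<Longrightarrow> qn (nadd a b) = qn a + qn b"
  and qn_nmult: "\<lbrakk>a \<in> NN; b \<in> NN\<rbrakk> \<Longrightarrow> qn (nmult a b) = qn a * qn b"
  and qn_less: "\<lbrakk>a \<in> NN; b \<in> NN\<rbrakk> \<Longrightarrow> qn a < qn b \<longleftrightarrow> a \<in> elts b"
  and qn_le: "\<lbrakk>a \<in> NN; b \<in> NN\<rbrakk> \<Longrightarrow> qn a \<le> qn b \<longleftrightarrow> a \<in> elts (succ b)"
  and qn_emp: "qn emp = 0"
  using hN_less[OF THS, of a b] hN_le[OF THS, of a b] hN_add[OF THS, of a b] hN_mult[OF THS, of a b] hN_0[OF THS]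
  by (simp_all add: qn_def flip: nq_add nq_mult) auto

lemma qn_nonneg: "0 \<le> qn a" by (simp add: qn_def)

lemma st_SN: "a \<in> NN \<Longrightarrow> st (hN a) \<longleftrightarrow> a \<in> SN"
  using hN_st[OF THS] by (simp add: st_hn_def)

lemma st_cases: assumes "st (x :: 'c hn)" obtains a where "a \<in> SN" "x = hN a"
  using assms hN_cases[OF THS, of x] st_SN by metis

lemma qn_pos: "\<lbrakk>a \<in> NN; a \<noteq> emp\<rbrakk> \<Longrightarrow> 0 < qn a"
  using nq_pos[of "hN a"] hN_eq[OF THS, of a emp] hN_0[OF THS] by (simp add: qn_def)

lemma finite_q_iff: "finite_q x \<longleftrightarrow> (\<exists>c\<in>SN. \<bar>x\<bar> \<le> qn c)"
  unfolding finite_q_def qn_def using st_cases st_SN SN_NN by metis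

lemma infinitesimal_iff: "infinitesimal x \<longleftrightarrow> (\<forall>c\<in>SN. qn c * \<bar>x\<bar> \<le> 1)"
  unfolding infinitesimal_def qn_def using st_cases st_SN SN_NN by metis

definition MM :: 'c where "MM = (SOME M. M \<in> NN \<and> M \<notin> SN)"

lemma MM: "MM \<in> NN" "MM \<notin> SN"
  using someI_ex[of "\<lambda>M. M \<in> NN \<and> M \<notin> SN"] ex_infinite unfolding MM_def by blast+

lemma SN_MM: "SN \<subseteq> elts MM"
  using SN_initial MM by blast

lemma qM: "0 < qn MM"
  using qn_pos[OF MM(1)] MM(2) SN_emp by metis

lemma SN_qM: "c \<in> SN \<Longrightarrow> qn c < qn MM"
  using qn_less[OF SN_NN MM(1)] SN_MM by blast

text \<open>A code \<open>k\<close> is a natural number, and the shift by the infinite number makes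
  negative values possible: for \<open>k\<close> up to \<open>2 * MM * MM\<close> the values form a
  grid of infinitesimal mesh \<open>1 / MM\<close> from \<open>- MM\<close> to
  \<open>MM\<close>.\<close>

definition val :: "'c \<Rightarrow> 'c hn diff fract" where "val k = qn k / qn MM - qn MM"

definition drat :: "'c \<Rightarrow> 'c \<Rightarrow> 'c hn diff fract" where "drat a c = qn a / qn c - qn c"

definition rl :: "'c \<Rightarrow> 'c hn hreal" where "rl k = Abs_hreal (val k)"

definition dr :: "'c \<Rightarrow> 'c \<Rightarrow> 'c hn hreal" where "dr a c = Abs_hreal (drat a c)"

definition Fin :: "'c set" where "Fin = {k \<in> NN. finite_q (val k)}"

lemma finite_drat: "a \<in> SN \<Longrightarrow> c \<in> SN \<Longrightarrow> c \<noteq> emp \<Longrightarrow> finite_q (drat a c)"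
  using finite_dn[of "hN a" "hN c"] hN_eq[OF THS, of c emp] hN_0[OF THS] st_SN SN_NN
  by (simp add: drat_def dn_def qn_def)

lemma dr_dense: assumes "r < s" obtains a c where "a \<in> SN" "c \<in> SN" "c \<noteq> emp" "r < dr a c" "dr a c < s"
proof -
  obtain x y where xy: "st x" "st y" "y \<noteq> 0" "r < Abs_hreal (dn x y)" "Abs_hreal (dn x y) < s"
    using dn_dense[OF assms] .
  obtain a where a: "a \<in> SN" "x = hN a" using st_cases[OF xy(1)] .
  obtain c where c: "c \<in> SN" "y = hN c" using st_cases[OF xy(2)] .
  have "c \<noteq> emp" using xy(3) c hN_0[OF THS] by auto
  then show ?thesis using that a c xy by (simp add: dr_def drat_def qn_def dn_def)
qed

text \<open>\<open>k\<close> is the integer part of \<open>MM * (x + MM)\<close>, which is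
  nonnegative because a finite \<open>x\<close> lies above \<open>- MM\<close>. The bound in the
  last conclusion puts all codes required into one set, the set \<open>U\<close> for which
  saturation asks.\<close>

lemma grid: 
  assumes "finite_q x"
  obtains k where "k \<in> Fin" "val k \<le> x" "x < val k + 1 / qn MM" "rl k = Abs_hreal x"
    "k \<in> elts (nadd (nmult MM MM) (nmult MM MM))"
proof -
  obtain c where c: "c \<in> SN" "\<bar>x\<bar> \<le> qn c" using assms finite_q_iff by blast
  have cM: "qn c < qn MM" using SN_qM c by blast
  have "0 \<le> qn MM * (x + qn MM)" using cM c(2) qM by (intro mult_nonneg_nonneg) linarith+
  then obtain n where n: "nq n \<le> qn MM * (x + qn MM)" "qn MM * (x + qn MM) < nq n + 1" by (rule nq_floor)
  obtain k where k: "k \<in> NN" "n = hN k" using hN_cases[OF THS] .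
  have v: "qn MM * val k = qn k - qn MM * qn MM" unfolding val_def using qM by (simp add: field_simps)
  have "qn MM * val k \<le> qn MM * x" using n(1) k v by (simp add: qn_def algebra_simps)
  then have 1: "val k \<le> x" using qM by simp
  have "qn MM * (val k + 1 / qn MM) = qn MM * val k + 1" using qM by (simp add: distrib_left)
  then have "qn MM * x < qn MM * (val k + 1 / qn MM)" using n(2) k v by (simp add: qn_def distrib_left)
  then have 2: "x < val k + 1 / qn MM" using qM by simp
  have inf: "infinitesimal (1 / qn MM)" unfolding infinitesimal_iff
  proof
    fix c assume "c \<in> SN"
    then have "qn c < qn MM" by (rule SN_qM)
    then show "qn c * \<bar>1 / qn MM\<bar> \<le> 1" using qM by simp
  qed
  have "infinitesimal (val k - x)"
    by (rule infinitesimal_le[OF inf]) (use 1 2 qM in simp)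
  moreover have f: "finite_q (val k)"
    using finite_add[OF infinitesimal_finite[OF \<open>infinitesimal (val k - x)\<close>] assms] by simp
  ultimately have 3: "rl k = Abs_hreal x" unfolding rl_def using hreal_eq assms by blast
  have "qn MM * x < qn MM * qn MM" using cM c(2) qM by (intro mult_strict_left_mono) linarith+
  then have "nq n < qn MM * qn MM + qn MM * qn MM" using n(1) by (simp add: distrib_left)
  then have "qn k < qn (nadd (nmult MM MM) (nmult MM MM))"
    using k MM by (simp add: qn_nadd qn_nmult qn_def[of k])
  then have 4: "k \<in> elts (nadd (nmult MM MM) (nmult MM MM))" using qn_less k by simp
  show ?thesis using that[OF _ 1 2 3 4] k f by (simp add: Fin_def)
qed

lemma rl_surj: obtains k where "k \<in> Fin" "rl k = r"
  by (metis hreal_cases grid)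

lemma qn_cancel: assumes "0 < (y :: 'c hn diff fract)" shows "x < z \<longleftrightarrow> y * x < y * z" "x \<le> z \<longleftrightarrow> y * x \<le> y * z"
  using assms by simp_all

text \<open>The inequality \<open>\<bar>val k\<bar> \<le> qn c\<close> multiplied by
  \<open>MM\<close>, with the negative terms moved across. Membership in a successor expresses the
  weak order of natural numbers.\<close>

lemma Fin_iff: "k \<in> Fin \<longleftrightarrow> k \<in> NN \<and> (\<exists>c\<in>V. c \<in> SN \<and> k \<in> elts (succ (nadd (nmult MM MM) (nmult c MM))) \<and>
    nmult MM MM \<in> elts (succ (nadd k (nmult c MM))))"
proof -
  have "\<bar>val k\<bar> \<le> qn c \<longleftrightarrow> k \<in> elts (succ (nadd (nmult MM MM) (nmult c MM))) \<and> nmult MM MM \<in> elts (succ (nadd k (nmult c MM)))"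
    if k: "k \<in> NN" and c: "c \<in> SN" for c
  proof -
    have v: "qn MM * val k = qn k - qn MM * qn MM" unfolding val_def using qM by (simp add: field_simps)
    have "\<bar>val k\<bar> \<le> qn c \<longleftrightarrow> qn MM * val k \<le> qn MM * qn c \<and> qn MM * (- val k) \<le> qn MM * qn c"
      using qn_cancel(2)[OF qM, of "val k" "qn c"] qn_cancel(2)[OF qM, of "- val k" "qn c"]
      unfolding abs_le_iff by blast
    also have "\<dots> \<longleftrightarrow> qn k \<le> qn MM * qn MM + qn c * qn MM \<and> qn MM * qn MM \<le> qn k + qn c * qn MM"
      unfolding mult_minus_right v by (auto simp: algebra_simps)
    finally show ?thesis using k MM SN_NN[OF c] by (simp add: qn_le[symmetric] qn_nadd qn_nmult del: elts_succ)
  qed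
  then show ?thesis unfolding Fin_def finite_q_iff using SN_NN NN_V by blast
qed

lemma Def_Fin [defn]: "DT UNIV f \<Longrightarrow> Def UNIV (\<lambda>s. f s \<in> Fin)"
proof (rule Def_subst1)
  show "Def UNIV (\<lambda>s. s 0 \<in> Fin)" unfolding Fin_iff by (intro defn)
qed

text \<open>For some standard \<open>e\<close>, the inequality
  \<open>1 < e * (val k - drat a c)\<close> multiplied by \<open>MM * c\<close> and rearranged into
  sums of natural numbers. It expresses that the gap above the fraction is not
  infinitesimal.\<close>

definition below :: "'c \<Rightarrow> 'c \<Rightarrow> 'c \<Rightarrow> bool" where
  "below a c k \<longleftrightarrow> (\<exists>e\<in>V. e \<in> SN \<and> nadd (nmult MM c) (nmult e (nadd (nmult (nmult MM MM) c) (nmult a MM)))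
     \<in> elts (nmult e (nadd (nmult k c) (nmult (nmult c c) MM))))"

lemma below_iff:
  assumes a: "a \<in> SN" and c: "c \<in> SN" "c \<noteq> emp" and k: "k \<in> Fin"
  shows "below a c k \<longleftrightarrow> dr a c < rl k"
proof -
  have N: "a \<in> NN" "c \<in> NN" "k \<in> NN" using a c k SN_NN by (auto simp: Fin_def)
  have c0: "0 < qn c" using qn_pos N c by blast
  have "1 < qn e * (val k - drat a c) \<longleftrightarrow> nadd (nmult MM c) (nmult e (nadd (nmult (nmult MM MM) c) (nmult a MM)))
     \<in> elts (nmult e (nadd (nmult k c) (nmult (nmult c c) MM)))" if e: "e \<in> SN" for e
  proof -
    have "(qn MM * qn c) * (qn e * (val k - drat a c)) = qn e * (qn k * qn c + qn c * qn c * qn MM)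
       - qn e * (qn MM * qn MM * qn c + qn a * qn MM)"
      unfolding val_def drat_def using qM c0 by (simp add: field_simps)
    then have "1 < qn e * (val k - drat a c) \<longleftrightarrow> qn MM * qn c * 1 < qn e * (qn k * qn c + qn c * qn c * qn MM)
       - qn e * (qn MM * qn MM * qn c + qn a * qn MM)"
      using qn_cancel(1)[of "qn MM * qn c" 1 "qn e * (val k - drat a c)"] qM c0 by simp
    then show ?thesis using N MM SN_NN[OF e] 
      by (simp add: qn_less[symmetric] qn_nadd qn_nmult algebra_simps)
  qed
  moreover have "dr a c < rl k \<longleftrightarrow> (\<exists>e\<in>SN. 1 < qn e * (val k - drat a c))"
    unfolding dr_def rl_def using hreal_less[OF finite_drat[OF a c], of "val k"] k st_cases st_SN SN_NN
    unfolding Fin_def qn_def by (metis (no_types, lifting) mem_Collect_eq)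
  ultimately show ?thesis unfolding below_def using SN_NN NN_V by blast
qed

text \<open>Multiplied by \<open>MM\<close>, the error \<open>val k + val l - val m\<close> is
  \<open>k + l - (m + MM * MM)\<close>; the square remains because two shifts stand against one. It
  is infinitesimal iff no standard multiple \<open>e\<close> of this difference exceeds
  \<open>MM\<close> in absolute value.\<close>

lemma rl_add_iff:
  assumes "k \<in> Fin" "l \<in> Fin" "m \<in> Fin"
  shows "rl m = rl k + rl l \<longleftrightarrow> (\<forall>e\<in>V. e \<in> SN \<longrightarrow>
    nmult e (nadd k l) \<in> elts (succ (nadd (nmult e (nadd m (nmult MM MM))) MM)) \<and>
    nmult e (nadd m (nmult MM MM)) \<in> elts (succ (nadd (nmult e (nadd k l)) MM)))"
proof -
  have N: "k \<in> NN" "l \<in> NN" "m \<in> NN" and f: "finite_q (val k)" "finite_q (val l)" "finite_q (val m)"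
    using assms by (auto simp: Fin_def)
  have "rl m = rl k + rl l \<longleftrightarrow> infinitesimal (val k + val l - val m)"
    unfolding rl_def hreal_add[OF f(1,2), symmetric] using hreal_eq[OF finite_add[OF f(1,2)] f(3)] by auto
  also have "\<dots> \<longleftrightarrow> (\<forall>e\<in>SN. qn e * \<bar>val k + val l - val m\<bar> \<le> 1)" by (rule infinitesimal_iff)
  also have "\<dots> \<longleftrightarrow> (\<forall>e\<in>SN. nmult e (nadd k l) \<in> elts (succ (nadd (nmult e (nadd m (nmult MM MM))) MM)) \<and>
    nmult e (nadd m (nmult MM MM)) \<in> elts (succ (nadd (nmult e (nadd k l)) MM)))"
  proof (rule ball_cong[OF refl])
    fix e assume e: "e \<in> SN"
    define d where "d = qn e * (val k + val l - val m)"
    have d: "qn MM * d = qn e * (qn k + qn l) - qn e * (qn m + qn MM * qn MM)"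
      unfolding d_def val_def using qM by (simp add: field_simps)
    have "qn e * \<bar>val k + val l - val m\<bar> = \<bar>d\<bar>" unfolding d_def abs_mult using qn_nonneg by simp
    then have "qn e * \<bar>val k + val l - val m\<bar> \<le> 1 \<longleftrightarrow> qn MM * d \<le> qn MM * 1 \<and> qn MM * (- d) \<le> qn MM * 1"
      using qn_cancel(2)[OF qM, of d 1] qn_cancel(2)[OF qM, of "- d" 1] by (simp add: abs_le_iff)
    then show "qn e * \<bar>val k + val l - val m\<bar> \<le> 1 \<longleftrightarrow> nmult e (nadd k l) \<in> elts (succ (nadd (nmult e (nadd m (nmult MM MM))) MM)) \<and>
      nmult e (nadd m (nmult MM MM)) \<in> elts (succ (nadd (nmult e (nadd k l)) MM))"
      unfolding mult_minus_right d using N MM SN_NN[OF e]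
      by (simp add: qn_le[symmetric] qn_nadd qn_nmult algebra_simps del: elts_succ)
  qed
  finally show ?thesis using SN_NN NN_V by blast
qed

text \<open>Multiplied by \<open>MM * MM\<close>, the error \<open>val k * val l - val m\<close>
  becomes \<open>(k - MM^2) * (l - MM^2) - MM * (m - MM^2)\<close>. Expanding and sorting by sign
  gives the two sides that are compared.\<close>

lemma rl_mult_iff:
  assumes "k \<in> Fin" "l \<in> Fin" "m \<in> Fin"
  shows "rl m = rl k * rl l \<longleftrightarrow> (\<forall>e\<in>V. e \<in> SN \<longrightarrow>
    nmult e (nadd (nmult k l) (nadd (nmult (nmult MM MM) (nmult MM MM)) (nmult (nmult MM MM) MM))) \<in>
      elts (succ (nadd (nmult e (nadd (nmult (nmult MM MM) (nadd k l)) (nmult m MM))) (nmult MM MM))) \<and>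
    nmult e (nadd (nmult (nmult MM MM) (nadd k l)) (nmult m MM)) \<in>
      elts (succ (nadd (nmult e (nadd (nmult k l) (nadd (nmult (nmult MM MM) (nmult MM MM)) (nmult (nmult MM MM) MM)))) (nmult MM MM))))"
    (is "_ \<longleftrightarrow> (\<forall>e\<in>V. e \<in> SN \<longrightarrow> ?L e \<in> elts (succ (nadd (?R e) _)) \<and> _)")
proof -
  have N: "k \<in> NN" "l \<in> NN" "m \<in> NN" and f: "finite_q (val k)" "finite_q (val l)" "finite_q (val m)"
    using assms by (auto simp: Fin_def)
  have "rl m = rl k * rl l \<longleftrightarrow> infinitesimal (val k * val l - val m)"
    unfolding rl_def hreal_mult[OF f(1,2), symmetric] using hreal_eq[OF finite_mult[OF f(1,2)] f(3)] by auto
  also have "\<dots> \<longleftrightarrow> (\<forall>e\<in>SN. qn e * \<bar>val k * val l - val m\<bar> \<le> 1)" by (rule infinitesimal_iff)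
  also have "\<dots> \<longleftrightarrow> (\<forall>e\<in>SN. ?L e \<in> elts (succ (nadd (?R e) (nmult MM MM))) \<and> ?R e \<in> elts (succ (nadd (?L e) (nmult MM MM))))"
  proof (rule ball_cong[OF refl])
    fix e assume e: "e \<in> SN"
    define d where "d = qn e * (val k * val l - val m)"
    have "(qn MM * qn MM) * (val k * val l - val m) =
        (qn MM * val k) * (qn MM * val l) - qn MM * (qn MM * val m)" by (simp add: algebra_simps)
    also have "\<dots> = (qn k - qn MM * qn MM) * (qn l - qn MM * qn MM) - qn MM * (qn m - qn MM * qn MM)"
      unfolding val_def using qM by (simp add: right_diff_distrib)
    finally have f1: "(qn MM * qn MM) * (val k * val l - val m) =
        (qn k - qn MM * qn MM) * (qn l - qn MM * qn MM) - qn MM * (qn m - qn MM * qn MM)" .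
    have "(qn MM * qn MM) * d = qn e * ((qn MM * qn MM) * (val k * val l - val m))"
      unfolding d_def by (rule mult.left_commute)
    then have d: "(qn MM * qn MM) * d = qn e * (qn k * qn l + (qn MM * qn MM * (qn MM * qn MM) + qn MM * qn MM * qn MM))
        - qn e * (qn MM * qn MM * (qn k + qn l) + qn m * qn MM)"
      unfolding f1 by (simp add: algebra_simps)
    have MM0: "0 < qn MM * qn MM" using qM by simp
    have "qn e * \<bar>val k * val l - val m\<bar> = \<bar>d\<bar>" unfolding d_def abs_mult using qn_nonneg by simp
    then have "qn e * \<bar>val k * val l - val m\<bar> \<le> 1 \<longleftrightarrow> (qn MM * qn MM) * d \<le> (qn MM * qn MM) * 1 \<and> (qn MM * qn MM) * (- d) \<le> (qn MM * qn MM) * 1"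
      using qn_cancel(2)[OF MM0, of d 1] qn_cancel(2)[OF MM0, of "- d" 1] by (simp add: abs_le_iff)
    then show "qn e * \<bar>val k * val l - val m\<bar> \<le> 1 \<longleftrightarrow> ?L e \<in> elts (succ (nadd (?R e) (nmult MM MM))) \<and> ?R e \<in> elts (succ (nadd (?L e) (nmult MM MM)))"
      unfolding mult_minus_right d using N MM SN_NN[OF e]
      by (simp add: qn_le[symmetric] qn_nadd qn_nmult algebra_simps del: elts_succ)
  qed
  finally show ?thesis using SN_NN NN_V by blast
qed

text \<open>The thin index class on which cuts live. Pairs with second component \<open>emp\<close>,
  which denote no fraction, belong to it but to no cut.\<close>

definition XX :: "'c set" where "XX = {pair a c | a c. a \<in> SN \<and> c \<in> SN}"

lemma isclass_XX: "isclass XX"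
  unfolding XX_def by (rule isclass_Times[OF isclass_SN isclass_SN])

lemma thn_XX: "thn XX"
  unfolding XX_def by (rule thn_Times[OF isclass_SN thn_SN isclass_SN thn_SN])

lemma XX_iff: "a \<in> V \<Longrightarrow> c \<in> V \<Longrightarrow> pair a c \<in> XX \<longleftrightarrow> a \<in> SN \<and> c \<in> SN"
  unfolding XX_def using SN_V by auto

definition cut :: "'c hn hreal \<Rightarrow> 'c set" where
  "cut r = {pair a c | a c. a \<in> SN \<and> c \<in> SN \<and> c \<noteq> emp \<and> dr a c < r}"

lemma cut_iff: "a \<in> V \<Longrightarrow> c \<in> V \<Longrightarrow> pair a c \<in> cut r \<longleftrightarrow> a \<in> SN \<and> c \<in> SN \<and> c \<noteq> emp \<and> dr a c < r"
  unfolding cut_def using SN_V by auto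

lemma cut_XX: "cut r \<subseteq> XX"
  unfolding cut_def XX_def by blast

lemma cut_mono: "cut r \<subseteq> cut s \<longleftrightarrow> r \<le> s"
proof
  assume sub: "cut r \<subseteq> cut s"
  show "r \<le> s"
  proof (rule ccontr)
    assume "\<not> r \<le> s"
    then have "s < r" by simp
    then obtain a c where ac: "a \<in> SN" "c \<in> SN" "c \<noteq> emp" "s < dr a c" "dr a c < r" using dr_dense by metis
    then have "pair a c \<in> cut r" using SN_V by (simp add: cut_iff)
    then have "pair a c \<in> cut s" using sub by blast
    then show False using ac SN_V by (simp add: cut_iff)
  qed
next
  assume "r \<le> s" then show "cut r \<subseteq> cut s" unfolding cut_def by (blast intro: order_less_le_trans)
qed

lemma cut_eq: "cut r = cut s \<longleftrightarrow> r = s"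
  using cut_mono[of r s] cut_mono[of s r] by auto

text \<open>A formula saying that the trace of \<open>x\<close> on \<open>XX\<close> is the cut of
  \<open>rl k\<close>, as \<open>cod_iff\<close> confirms. Elements of \<open>x\<close> outside
  \<open>XX\<close> are left open.\<close>

definition cod :: "'c \<Rightarrow> 'c \<Rightarrow> bool" where
  "cod x k \<longleftrightarrow> k \<in> Fin \<and> (\<forall>a\<in>V. \<forall>c\<in>V. a \<in> SN \<longrightarrow> c \<in> SN \<longrightarrow> (pair a c \<in> elts x \<longleftrightarrow> c \<noteq> emp \<and> below a c k))"

lemma Def_cod [defn]: "DT UNIV f \<Longrightarrow> DT UNIV g \<Longrightarrow> Def UNIV (\<lambda>s. cod (f s) (g s))"
proof (rule Def_subst2)
  show "Def UNIV (\<lambda>s. cod (s 0) (s (Suc 0)))" unfolding cod_def below_def by (intro defn)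
qed

lemma XX_eqI: 
  assumes "A \<subseteq> XX" "B \<subseteq> XX" "\<And>a c. a \<in> SN \<Longrightarrow> c \<in> SN \<Longrightarrow> pair a c \<in> A \<longleftrightarrow> pair a c \<in> B" shows "A = B"
proof (intro equalityI subsetI)
  fix w assume w: "w \<in> A"
  then obtain a c where "w = pair a c" "a \<in> SN" "c \<in> SN" using assms(1) unfolding XX_def by blast
  then show "w \<in> B" using assms(3) w by blast
next
  fix w assume w: "w \<in> B"
  then obtain a c where "w = pair a c" "a \<in> SN" "c \<in> SN" using assms(2) unfolding XX_def by blast
  then show "w \<in> A" using assms(3) w by blast
qed

lemma cod_iff: assumes k: "k \<in> Fin" shows "cod x k \<longleftrightarrow> elts x \<inter> XX = cut (rl k)"
proof -
  have b: "c \<noteq> emp \<and> below a c k \<longleftrightarrow> pair a c \<in> cut (rl k)" if "a \<in> SN" "c \<in> SN" for a c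
    using below_iff[OF that _ k] that SN_V by (auto simp: cut_iff)
  have m: "pair a c \<in> elts x \<longleftrightarrow> pair a c \<in> elts x \<inter> XX" if "a \<in> SN" "c \<in> SN" for a c
    using that SN_V by (simp add: XX_iff)
  have "cod x k \<longleftrightarrow> (\<forall>a\<in>SN. \<forall>c\<in>SN. pair a c \<in> elts x \<inter> XX \<longleftrightarrow> pair a c \<in> cut (rl k))"
    unfolding cod_def using k b m SN_V by blast
  also have "\<dots> \<longleftrightarrow> elts x \<inter> XX = cut (rl k)" using XX_eqI[of "elts x \<inter> XX" "cut (rl k)"] cut_XX by blast
  finally show ?thesis .
qed

lemma isclass_cut: "isclass (cut r)"
proof -
  obtain k where k: "k \<in> Fin" "rl k = r" by (rule rl_surj)
  have "isclass {w \<in> XX. \<exists>a\<in>V. \<exists>c\<in>V. w = pair a c \<and> c \<noteq> emp \<and> below a c k}"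
    unfolding below_def by (intro isclass_Collect isclass_XX defn)
  moreover have "{w \<in> XX. \<exists>a\<in>V. \<exists>c\<in>V. w = pair a c \<and> c \<noteq> emp \<and> below a c k} = cut r"
  proof (rule XX_eqI)
    fix a c assume ac: "a \<in> SN" "c \<in> SN"
    then have "(\<exists>a'\<in>V. \<exists>c'\<in>V. pair a c = pair a' c' \<and> c' \<noteq> emp \<and> below a' c' k) \<longleftrightarrow> c \<noteq> emp \<and> below a c k" using SN_V by auto
    then show "pair a c \<in> {w \<in> XX. \<exists>a\<in>V. \<exists>c\<in>V. w = pair a c \<and> c \<noteq> emp \<and> below a c k} \<longleftrightarrow> pair a c \<in> cut r"
      using ac below_iff[OF ac _ k(1)] k(2) SN_V by (auto simp: cut_iff XX_iff)
  qed (auto simp: cut_XX)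
  ultimately show ?thesis by simp
qed

definition PP :: 'c where
  "PP = (SOME P. thin P \<and> (\<forall>y\<in>V. \<exists>p\<in>elts P. elts y \<inter> XX = elts p \<inter> XX))"

lemma PP: "thin PP" "\<And>y. y \<in> V \<Longrightarrow> \<exists>p\<in>elts PP. elts y \<inter> XX = elts p \<inter> XX"
proof -
  have "thin (code XX)" using thn_XX by (simp add: thin_thn elts_code isclass_XX)
  from Exp[OF this] have "\<exists>P. thin P \<and> (\<forall>y\<in>V. \<exists>p\<in>elts P. elts y \<inter> XX = elts p \<inter> XX)"
    by (simp add: elts_code isclass_XX)
  from someI_ex[OF this] show "thin PP" "\<And>y. y \<in> V \<Longrightarrow> \<exists>p\<in>elts PP. elts y \<inter> XX = elts p \<inter> XX"
    unfolding PP_def by blast+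
qed

text \<open>Those sets provided by (Exp) whose trace is a cut. Every cut occurs among the traces,
  but possibly for several sets that differ outside \<open>XX\<close>; hence the cutting off that
  follows.\<close>

definition P1 :: "'c set" where "P1 = {p \<in> elts PP. \<exists>k. cod p k}"

lemma isclass_P1: "isclass P1"
  unfolding P1_def by (intro isclass_Collect isclass_elts defn)

lemma thn_P1: "thn P1"
  by (rule thn_subset[of "elts PP"]) (use PP(1) thin_thn in \<open>auto simp: P1_def\<close>)

lemma P1_V: "p \<in> P1 \<Longrightarrow> p \<in> V"
  unfolding P1_def using elts_V by blast

lemma P1_cut: "p \<in> P1 \<Longrightarrow> \<exists>r. elts p \<inter> XX = cut r"
  unfolding P1_def using cod_iff cod_def by blast

lemma P1_surj: "\<exists>p\<in>P1. elts p \<inter> XX = cut r"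
proof -
  obtain k where k: "k \<in> Fin" "rl k = r" by (rule rl_surj)
  obtain s where s: "s \<in> V" "elts s \<inter> XX = cut r" using trace_of_set[OF isclass_XX thn_XX isclass_cut cut_XX] by blast
  obtain p where p: "p \<in> elts PP" "elts s \<inter> XX = elts p \<inter> XX" using PP(2)[OF s(1)] by blast
  then have "cod p k" using cod_iff[OF k(1)] k s by simp
  then show ?thesis using p s unfolding P1_def by blast
qed

definition same :: "'c \<Rightarrow> 'c \<Rightarrow> bool" where
  "same p q \<longleftrightarrow> (\<forall>a\<in>V. \<forall>c\<in>V. a \<in> SN \<longrightarrow> c \<in> SN \<longrightarrow> (pair a c \<in> elts p \<longleftrightarrow> pair a c \<in> elts q))"

lemma same_iff: "same p q \<longleftrightarrow> elts p \<inter> XX = elts q \<inter> XX"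
proof
  assume "same p q"
  then show "elts p \<inter> XX = elts q \<inter> XX" unfolding same_def using SN_V by (intro XX_eqI) (auto simp: XX_iff)
next
  assume e: "elts p \<inter> XX = elts q \<inter> XX"
  have "pair a c \<in> elts p \<longleftrightarrow> pair a c \<in> elts q" if "a \<in> SN" "c \<in> SN" for a c
  proof -
    have "pair a c \<in> XX" using that SN_V by (simp add: XX_iff)
    then show ?thesis using e by blast
  qed
  then show "same p q" unfolding same_def by blast
qed

text \<open>Codes in \<open>P1\<close> with the same standard part agree up to a common infinite number, by saturation;
  cutting them off there makes the code of a real unique.\<close>

lemma ex_common_cutoff:
  "\<exists>n\<in>NN. SN \<subseteq> elts n \<and> (\<forall>p\<in>P1. \<forall>q\<in>P1. same p q \<longrightarrow> (\<forall>a\<in>elts n. \<forall>c\<in>elts n. pair a c \<in> elts p \<longleftrightarrow> pair a c \<in> elts q))"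
proof -
  let ?PQ = "{pair p q | p q. p \<in> P1 \<and> q \<in> P1}"
  \<comment> \<open>The condition with index \<open>((p, q), k)\<close> asks two things of
    \<open>n\<close>: to lie above \<open>k\<close>, which in total drives \<open>n\<close> beyond
    all standard numbers, and to be a bound below which \<open>p\<close> and \<open>q\<close> agree
    if they have the same trace.\<close>
  let ?Y = "{pair w k | w k. w \<in> ?PQ \<and> k \<in> SN}"
  have PQ: "isclass ?PQ" "thn ?PQ" by (rule isclass_Times thn_Times isclass_P1 thn_P1)+
  have Y: "isclass ?Y" "thn ?Y" by (rule isclass_Times thn_Times PQ isclass_SN thn_SN)+
  let ?Q = "\<lambda>x n. \<exists>p\<in>V. \<exists>q\<in>V. \<exists>k\<in>V. x = pair (pair p q) k \<and> k \<in> elts n \<and>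
    (same p q \<longrightarrow> (\<forall>a\<in>elts n. \<forall>c\<in>elts n. pair a c \<in> elts p \<longleftrightarrow> pair a c \<in> elts q))"
  have Qeq: "?Q (pair (pair p q) k) n \<longleftrightarrow> k \<in> elts n \<and>
    (same p q \<longrightarrow> (\<forall>a\<in>elts n. \<forall>c\<in>elts n. pair a c \<in> elts p \<longleftrightarrow> pair a c \<in> elts q))" if "p \<in> V" "q \<in> V" "k \<in> V" for p q k n
    using that by auto
  have "\<exists>n\<in>elts MM. \<forall>x\<in>?Y. ?Q x n"
  proof (rule saturation[OF Y])
    show "isset (elts MM)" using MM by simp
    show "Def UNIV (\<lambda>s. ?Q (s 0) (s (Suc 0)))" unfolding same_def by (intro defn)
    show "isset {n \<in> elts MM. ?Q x n}" if xY: "x \<in> ?Y" for x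
    proof -
      obtain p q k where x: "x = pair (pair p q) k" and P: "p \<in> P1" "q \<in> P1" and k: "k \<in> SN" using xY by blast
      note V = P1_V[OF P(1)] P1_V[OF P(2)] SN_V[OF k]
      show ?thesis
      proof (cases "same p q")
        case True
        have "isset {n \<in> elts MM. k \<in> elts n \<and> (\<forall>a\<in>elts n. \<forall>c\<in>elts n. pair a c \<in> elts p \<longleftrightarrow> pair a c \<in> elts q)}"
          by (intro isset_Collect isset_elts defn V NN_V MM)
        then show ?thesis unfolding x Qeq[OF V] using True by simp
      next
        case False
        have "isset {n \<in> elts MM. k \<in> elts n}" by (intro isset_Collect isset_elts defn V NN_V MM)
        then show ?thesis unfolding x Qeq[OF V] using False by simp
      qed
    qed
    show "\<exists>n\<in>elts MM. \<forall>x\<in>A. ?Q x n" if A: "isset A" "A \<subseteq> ?Y" "sml A" for A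
    proof -
      obtain a0 where a0: "a0 \<in> V" "elts a0 = A" using A(1) by (auto simp: isset_def)
      \<comment> \<open>The numbers \<open>k\<close> in a small set of conditions form a set of
        standard numbers, so some standard \<open>n\<close> exceeds them all. Below a standard
        \<open>n\<close> agreement is nothing but equality of traces.\<close>
      let ?K = "{k \<in> elts MM. \<exists>w\<in>V. pair w k \<in> elts a0}"
      have K: "isset ?K" by (intro isset_Collect isset_elts defn a0 NN_V MM)
      have PQV: "w \<in> V" if "w \<in> ?PQ" for w using isclass_sub_V[OF PQ(1)] that by blast
      have KS: "k \<in> SN" if kK: "k \<in> ?K" for k
      proof -
        obtain w where w: "w \<in> V" "pair w k \<in> A" "k \<in> V" using kK a0 elts_V by blast
        then obtain w' k' where "w' \<in> ?PQ" "k' \<in> SN" "pair w k = pair w' k'" using A(2) by blast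
        then show ?thesis using w PQV[of w'] SN_V[of k'] by simp
      qed
      have "\<exists>n\<in>SN. \<forall>k\<in>?K. k \<in> elts n"
      proof (cases "?K = {}")
        case False
        then obtain m where m: "m \<in> ?K" "\<forall>y\<in>?K. y = m \<or> y \<in> elts m" using NN_max[OF K] KS SN_NN by blast
        then have "succ m \<in> SN" "\<forall>k\<in>?K. k \<in> elts (succ m)" using KS[OF m(1)] SN_V[OF KS[OF m(1)]] by auto
        then show ?thesis by blast
      qed (use SN_emp in blast)
      then obtain n where n: "n \<in> SN" "\<forall>k\<in>?K. k \<in> elts n" by blast
      have "?Q x n" if xA: "x \<in> A" for x
      proof -
        obtain p q k where x: "x = pair (pair p q) k" and P: "p \<in> P1" "q \<in> P1" and k: "k \<in> SN" using xA A(2) by blast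
        note V = P1_V[OF P(1)] P1_V[OF P(2)] SN_V[OF k]
        have "pair p q \<in> V" using V by simp
        then have "k \<in> ?K" using xA x k SN_MM a0 by blast
        then have kn: "k \<in> elts n" using n by blast
        have "pair a c \<in> elts p \<longleftrightarrow> pair a c \<in> elts q" if "same p q" "a \<in> elts n" "c \<in> elts n" for a c
          using that SN_mem[OF n(1)] SN_V unfolding same_def by blast
        then show ?thesis unfolding x Qeq[OF V] using kn by blast
      qed
      then show ?thesis using n SN_MM by blast
    qed
  qed
  then obtain n where n: "n \<in> elts MM" "\<forall>x\<in>?Y. ?Q x n" by blast
  have Qn: "k \<in> elts n \<and> (same p q \<longrightarrow> (\<forall>a\<in>elts n. \<forall>c\<in>elts n. pair a c \<in> elts p \<longleftrightarrow> pair a c \<in> elts q))"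
    if "p \<in> P1" "q \<in> P1" "k \<in> SN" for p q k
  proof -
    have "pair (pair p q) k \<in> ?Y" using that by blast
    then have "?Q (pair (pair p q) k) n" using n(2) by blast
    then show ?thesis unfolding Qeq[OF P1_V[OF that(1)] P1_V[OF that(2)] SN_V[OF that(3)]] .
  qed
  obtain p where p: "p \<in> P1" using P1_surj by blast
  have "n \<in> NN" using NN_mem MM(1) n(1) by blast
  moreover have "SN \<subseteq> elts n" using Qn[OF p p] by blast
  ultimately show ?thesis using Qn SN_emp by blast
qed

definition nc :: 'c where
  "nc = (SOME n. n \<in> NN \<and> SN \<subseteq> elts n \<and> (\<forall>p\<in>P1. \<forall>q\<in>P1. same p q \<longrightarrow> (\<forall>a\<in>elts n. \<forall>c\<in>elts n. pair a c \<in> elts p \<longleftrightarrow> pair a c \<in> elts q)))"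

lemma nc: "nc \<in> NN" "SN \<subseteq> elts nc"
  "\<And>p q a c. \<lbrakk>p \<in> P1; q \<in> P1; same p q; a \<in> elts nc; c \<in> elts nc\<rbrakk> \<Longrightarrow> pair a c \<in> elts p \<longleftrightarrow> pair a c \<in> elts q"
proof -
  have "\<exists>n. n \<in> NN \<and> SN \<subseteq> elts n \<and> (\<forall>p\<in>P1. \<forall>q\<in>P1. same p q \<longrightarrow> (\<forall>a\<in>elts n. \<forall>c\<in>elts n. pair a c \<in> elts p \<longleftrightarrow> pair a c \<in> elts q))"
    using ex_common_cutoff by blast
  from someI_ex[OF this] show "nc \<in> NN" "SN \<subseteq> elts nc"
    "\<And>p q a c. \<lbrakk>p \<in> P1; q \<in> P1; same p q; a \<in> elts nc; c \<in> elts nc\<rbrakk> \<Longrightarrow> pair a c \<in> elts p \<longleftrightarrow> pair a c \<in> elts q"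
    unfolding nc_def[symmetric] by blast+
qed

definition rep :: "'c \<Rightarrow> 'c" where
  "rep p = (THE z. elts z = {w \<in> elts p. \<exists>a\<in>elts nc. \<exists>c\<in>elts nc. w = pair a c})"

lemma rep: assumes p: "p \<in> V" shows "rep p \<in> V" "elts (rep p) = {w \<in> elts p. \<exists>a\<in>elts nc. \<exists>c\<in>elts nc. w = pair a c}"
proof -
  have "isset {w \<in> elts p. \<exists>a\<in>elts nc. \<exists>c\<in>elts nc. w = pair a c}"
    by (intro isset_Collect isset_elts defn p NN_V nc)
  then obtain z where z: "z \<in> V" "elts z = {w \<in> elts p. \<exists>a\<in>elts nc. \<exists>c\<in>elts nc. w = pair a c}" unfolding isset_def by blast
  then have "rep p = z" unfolding rep_def by (simp add: the_elts)
  with z show "rep p \<in> V" "elts (rep p) = {w \<in> elts p. \<exists>a\<in>elts nc. \<exists>c\<in>elts nc. w = pair a c}" by simp_all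
qed

lemma DT_rep: "DT UNIV (\<lambda>s. rep (s 0))"
  unfolding rep_def
proof (rule DT_The)
  have "Def UNIV (\<lambda>s. \<forall>w. w \<in> elts (s 0) \<longleftrightarrow> w \<in> elts (s (Suc 0)) \<and> (\<exists>a\<in>elts nc. \<exists>c\<in>elts nc. w = pair a c))"
    by (intro defn)
  then show "Def UNIV (\<lambda>s. elts (s 0) = {w \<in> elts (s (Suc 0)). \<exists>a\<in>elts nc. \<exists>c\<in>elts nc. w = pair a c})"
    by (rule Def_cong) (simp add: set_eq_iff)
qed (simp flip: elts_inject)

lemma rep_XX: assumes p: "p \<in> V" shows "elts (rep p) \<inter> XX = elts p \<inter> XX"
proof (rule XX_eqI)
  fix a c assume "a \<in> SN" "c \<in> SN"
  then have "a \<in> elts nc" "c \<in> elts nc" using nc(2) by auto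
  then have "pair a c \<in> elts (rep p) \<longleftrightarrow> pair a c \<in> elts p" unfolding rep(2)[OF p] by blast
  then show "pair a c \<in> elts (rep p) \<inter> XX \<longleftrightarrow> pair a c \<in> elts p \<inter> XX" by simp
qed auto

lemma rep_same: assumes "p \<in> P1" "q \<in> P1" "elts p \<inter> XX = elts q \<inter> XX" shows "rep p = rep q"
proof -
  have e: "pair a c \<in> elts p \<longleftrightarrow> pair a c \<in> elts q" if "a \<in> elts nc" "c \<in> elts nc" for a c
    using nc(3)[OF assms(1,2) _ that] same_iff assms(3) by simp
  have "elts (rep p) = elts (rep q)"
    unfolding rep(2)[OF P1_V[OF assms(1)]] rep(2)[OF P1_V[OF assms(2)]]
    by (rule Collect_cong) (use e in metis)
  then show ?thesis by (simp add: elts_inject)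
qed

definition RR :: 'c where "RR = code (rep ` P1)"

lemma elts_RR: "elts RR = rep ` P1"
  unfolding RR_def by (rule elts_code, rule isclass_image[OF isclass_P1 DT_rep]) (simp add: rep P1_V)

lemma thin_RR: "thin RR"
  unfolding thin_thn elts_RR by (rule thn_image[OF isclass_P1 thn_P1 DT_rep]) (simp add: rep P1_V)

definition rho :: "'c \<Rightarrow> 'c hn hreal" where "rho x = (THE r. elts x \<inter> XX = cut r)"

lemma rho_eq: "elts x \<inter> XX = cut r \<Longrightarrow> rho x = r"
  unfolding rho_def by (rule the_equality) (auto simp: cut_eq)

lemma RR_trace: assumes "x \<in> elts RR" shows "elts x \<inter> XX = cut (rho x)"
proof -
  obtain p where p: "p \<in> P1" "x = rep p" using assms elts_RR by blast
  obtain r where "elts p \<inter> XX = cut r" using P1_cut[OF p(1)] by blast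
  then have "elts x \<inter> XX = cut r" using rep_XX[OF P1_V[OF p(1)]] p by simp
  then show ?thesis using rho_eq by simp
qed

lemma rho_inj: assumes "x \<in> elts RR" "y \<in> elts RR" shows "rho x = rho y \<longleftrightarrow> x = y"
proof
  assume e: "rho x = rho y"
  obtain p q where p: "p \<in> P1" "x = rep p" and q: "q \<in> P1" "y = rep q" using assms elts_RR by blast
  have "elts p \<inter> XX = elts x \<inter> XX" using rep_XX[OF P1_V[OF p(1)]] p(2) by simp
  also have "\<dots> = elts y \<inter> XX" unfolding RR_trace[OF assms(1)] RR_trace[OF assms(2)] e ..
  also have "\<dots> = elts q \<inter> XX" using rep_XX[OF P1_V[OF q(1)]] q(2) by simp
  finally have "elts p \<inter> XX = elts q \<inter> XX" .
  then have "rep p = rep q" by (rule rep_same[OF p(1) q(1)])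
  then show "x = y" unfolding p(2) q(2) .
next
  assume "x = y" then show "rho x = rho y" by (rule arg_cong)
qed

lemma rho_surj: "\<exists>x\<in>elts RR. rho x = r"
proof -
  obtain p where p: "p \<in> P1" "elts p \<inter> XX = cut r" using P1_surj by blast
  then have "rho (rep p) = r" using rep_XX[OF P1_V[OF p(1)]] rho_eq by simp
  then show ?thesis using p elts_RR by blast
qed

lemma rho_bij: "bij_betw rho (elts RR) UNIV"
proof (rule bij_betw_imageI)
  show "inj_on rho (elts RR)" by (rule inj_onI) (simp add: rho_inj)
  have "r \<in> rho ` elts RR" for r using rho_surj[of r] by auto
  then show "rho ` elts RR = UNIV" by blast
qed

definition ir :: "'c hn hreal \<Rightarrow> 'c" where "ir r = (SOME x. x \<in> elts RR \<and> rho x = r)"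

lemma ir [simp]: "ir r \<in> elts RR" "rho (ir r) = r"
  using someI_ex[of "\<lambda>x. x \<in> elts RR \<and> rho x = r"] rho_surj[of r] unfolding ir_def by blast+

lemma rho_ir: "x \<in> elts RR \<Longrightarrow> rho x = y \<longleftrightarrow> x = ir y"
  using rho_inj[of x "ir y"] by simp

lemma RR_cod: assumes "x \<in> elts RR" "k \<in> Fin" shows "cod x k \<longleftrightarrow> rho x = rl k"
  unfolding cod_iff[OF assms(2)] RR_trace[OF assms(1)] cut_eq ..

lemma RR_ex_cod: "x \<in> elts RR \<Longrightarrow> \<exists>k\<in>Fin. cod x k \<and> rho x = rl k"
  using RR_cod rl_surj by metis

text \<open>The sum is defined through codes of the three sets: the relation guesses
  \<open>k\<close>, \<open>l\<close> and \<open>m\<close> and compares them by a formula on natural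
  numbers. The choice of codes is immaterial because by \<open>RR_cod\<close> the codes of
  \<open>x\<close> are exactly those of \<open>rho x\<close>.\<close>

lemma ex_addition: "\<exists>A. binary_op_on RR A \<and> (\<forall>x\<in>elts RR. \<forall>y\<in>elts RR. app A (pair x y) = ir (rho x + rho y))"
proof (rule ex_binary_op[where T = "\<lambda>x y z. \<exists>k\<in>V. \<exists>l\<in>V. \<exists>m\<in>V. cod x k \<and> cod y l \<and> cod z m \<and> (\<forall>e\<in>V. e \<in> SN \<longrightarrow>
    nmult e (nadd k l) \<in> elts (succ (nadd (nmult e (nadd m (nmult MM MM))) MM)) \<and>
    nmult e (nadd m (nmult MM MM)) \<in> elts (succ (nadd (nmult e (nadd k l)) MM)))"], intro defn)
  fix x y z assume R: "x \<in> elts RR" "y \<in> elts RR" "z \<in> elts RR"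
  have "(\<exists>k\<in>V. \<exists>l\<in>V. \<exists>m\<in>V. cod x k \<and> cod y l \<and> cod z m \<and> (\<forall>e\<in>V. e \<in> SN \<longrightarrow>
    nmult e (nadd k l) \<in> elts (succ (nadd (nmult e (nadd m (nmult MM MM))) MM)) \<and>
    nmult e (nadd m (nmult MM MM)) \<in> elts (succ (nadd (nmult e (nadd k l)) MM)))) \<longleftrightarrow>
    (\<exists>k\<in>Fin. \<exists>l\<in>Fin. \<exists>m\<in>Fin. cod x k \<and> cod y l \<and> cod z m \<and> rl m = rl k + rl l)"
    (is "?l \<longleftrightarrow> ?r")
  proof
    assume ?l
    then obtain k l m where h: "cod x k" "cod y l" "cod z m" "\<forall>e\<in>V. e \<in> SN \<longrightarrow>
      nmult e (nadd k l) \<in> elts (succ (nadd (nmult e (nadd m (nmult MM MM))) MM)) \<and>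
      nmult e (nadd m (nmult MM MM)) \<in> elts (succ (nadd (nmult e (nadd k l)) MM))" by (elim bexE conjE)
    have F: "k \<in> Fin" "l \<in> Fin" "m \<in> Fin" using h(1-3) by (simp_all only: cod_def)
    show ?r by (intro bexI[OF _ F(1)] bexI[OF _ F(2)] bexI[OF _ F(3)] conjI h(1-3))
      (use rl_add_iff[OF F] h(4) SN_V in blast)
  next
    assume ?r
    then obtain k l m where F: "k \<in> Fin" "l \<in> Fin" "m \<in> Fin" and h: "cod x k" "cod y l" "cod z m" "rl m = rl k + rl l" by (elim bexE conjE)
    have W: "k \<in> V" "l \<in> V" "m \<in> V" using F NN_V by (auto simp: Fin_def)
    show ?l by (intro bexI[OF _ W(1)] bexI[OF _ W(2)] bexI[OF _ W(3)] conjI h(1-3))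
      (use rl_add_iff[OF F] h(4) in blast)
  qed
  also have "\<dots> \<longleftrightarrow> rho z = rho x + rho y"
    using RR_cod R RR_ex_cod by metis
  also have "\<dots> \<longleftrightarrow> z = ir (rho x + rho y)" by (rule rho_ir[OF R(3)])
  finally show "(\<exists>k\<in>V. \<exists>l\<in>V. \<exists>m\<in>V. cod x k \<and> cod y l \<and> cod z m \<and> (\<forall>e\<in>V. e \<in> SN \<longrightarrow>
    nmult e (nadd k l) \<in> elts (succ (nadd (nmult e (nadd m (nmult MM MM))) MM)) \<and>
    nmult e (nadd m (nmult MM MM)) \<in> elts (succ (nadd (nmult e (nadd k l)) MM)))) \<longleftrightarrow> z = ir (rho x + rho y)" .
qed simp

definition mulrel :: "'c \<Rightarrow> 'c \<Rightarrow> 'c \<Rightarrow> bool" where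
  "mulrel k l m \<longleftrightarrow> (\<forall>e\<in>V. e \<in> SN \<longrightarrow>
    nmult e (nadd (nmult k l) (nadd (nmult (nmult MM MM) (nmult MM MM)) (nmult (nmult MM MM) MM))) \<in>
      elts (succ (nadd (nmult e (nadd (nmult (nmult MM MM) (nadd k l)) (nmult m MM))) (nmult MM MM))) \<and>
    nmult e (nadd (nmult (nmult MM MM) (nadd k l)) (nmult m MM)) \<in>
      elts (succ (nadd (nmult e (nadd (nmult k l) (nadd (nmult (nmult MM MM) (nmult MM MM)) (nmult (nmult MM MM) MM)))) (nmult MM MM))))"

lemma ex_multiplication: "\<exists>A. binary_op_on RR A \<and> (\<forall>x\<in>elts RR. \<forall>y\<in>elts RR. app A (pair x y) = ir (rho x * rho y))"
proof (rule ex_binary_op[where T = "\<lambda>x y z. \<exists>k\<in>V. \<exists>l\<in>V. \<exists>m\<in>V. cod x k \<and> cod y l \<and> cod z m \<and> mulrel k l m"],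
    unfold mulrel_def, intro defn, fold mulrel_def)
  fix x y z assume R: "x \<in> elts RR" "y \<in> elts RR" "z \<in> elts RR"
  have "(\<exists>k\<in>V. \<exists>l\<in>V. \<exists>m\<in>V. cod x k \<and> cod y l \<and> cod z m \<and> mulrel k l m) \<longleftrightarrow>
    (\<exists>k\<in>Fin. \<exists>l\<in>Fin. \<exists>m\<in>Fin. cod x k \<and> cod y l \<and> cod z m \<and> rl m = rl k * rl l)"
    using rl_mult_iff unfolding mulrel_def[symmetric] cod_def Fin_def using NN_V by blast
  also have "\<dots> \<longleftrightarrow> rho z = rho x * rho y"
    using RR_cod R RR_ex_cod by metis
  also have "\<dots> \<longleftrightarrow> z = ir (rho x * rho y)" by (rule rho_ir[OF R(3)])
  finally show "(\<exists>k\<in>V. \<exists>l\<in>V. \<exists>m\<in>V. cod x k \<and> cod y l \<and> cod z m \<and> mulrel k l m) \<longleftrightarrow> z = ir (rho x * rho y)" .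
qed simp

text \<open>The order of reals is inclusion of cuts, and inclusion of traces is a formula in the
  representing sets.\<close>

lemma ex_order: "\<exists>L. is_relation L \<and> graph L = {(x, y). x \<in> elts RR \<and> y \<in> elts RR \<and> rho x \<le> rho y}"
proof -
  let ?T = "\<lambda>x y. \<forall>a\<in>V. \<forall>c\<in>V. a \<in> SN \<longrightarrow> c \<in> SN \<longrightarrow> pair a c \<in> elts x \<longrightarrow> pair a c \<in> elts y"
  have "\<exists>L. is_relation L \<and> graph L = {(x, y). x \<in> elts RR \<and> y \<in> elts RR \<and> ?T x y}"
    by (rule ex_relation, intro defn) simp_all
  moreover have "?T x y \<longleftrightarrow> rho x \<le> rho y" if "x \<in> elts RR" "y \<in> elts RR" for x y
  proof -
    have "?T x y \<longleftrightarrow> elts x \<inter> XX \<subseteq> elts y \<inter> XX" unfolding XX_def using SN_V by blast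
    then show ?thesis unfolding RR_trace[OF that(1)] RR_trace[OF that(2)] cut_mono .
  qed
  then have "{(x, y). x \<in> elts RR \<and> y \<in> elts RR \<and> ?T x y} = {(x, y). x \<in> elts RR \<and> y \<in> elts RR \<and> rho x \<le> rho y}"
    by blast
  ultimately show ?thesis by simp
qed

text \<open>The inequality \<open>drat a c \<le> val k + 1 / MM\<close> cleared of denominators; the
  companion \<open>hi\<close> is \<open>val k \<le> drat a c\<close>. The slack of one mesh width is
  there because a fraction need not lie on the grid.\<close>

definition lo :: "'c \<Rightarrow> 'c \<Rightarrow> 'c \<Rightarrow> bool" where
  "lo a c k \<longleftrightarrow> nadd (nmult a MM) (nmult (nmult MM MM) c) \<in> elts (succ (nadd (nadd (nmult k c) (nmult (nmult c c) MM)) c))"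

definition hi :: "'c \<Rightarrow> 'c \<Rightarrow> 'c \<Rightarrow> bool" where
  "hi a c k \<longleftrightarrow> nadd (nmult k c) (nmult (nmult c c) MM) \<in> elts (succ (nadd (nmult a MM) (nmult (nmult MM MM) c)))"

lemma lo_hi_iff:
  assumes "a \<in> NN" "c \<in> NN" "c \<noteq> emp" "k \<in> NN"
  shows "lo a c k \<longleftrightarrow> drat a c \<le> val k + 1 / qn MM" and "hi a c k \<longleftrightarrow> val k \<le> drat a c"
proof -
  have c0: "0 < qn MM * qn c" using qn_pos assms qM by simp
  have c1: "qn c \<noteq> 0" using qn_pos[of c] assms by simp
  have d: "(qn MM * qn c) * drat a c = qn a * qn MM - qn c * qn c * qn MM"
    unfolding drat_def using c1 by (simp add: field_simps)
  have v: "(qn MM * qn c) * val k = qn k * qn c - qn MM * qn MM * qn c"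
    unfolding val_def using qM by (simp add: field_simps)
  have w: "(qn MM * qn c) * (val k + 1 / qn MM) = qn k * qn c - qn MM * qn MM * qn c + qn c"
    unfolding distrib_left v using qM by simp
  show "lo a c k \<longleftrightarrow> drat a c \<le> val k + 1 / qn MM"
    unfolding qn_cancel(2)[OF c0, of "drat a c"] d w lo_def using assms MM
    by (simp add: qn_le[symmetric] qn_nadd qn_nmult algebra_simps del: elts_succ)
  show "hi a c k \<longleftrightarrow> val k \<le> drat a c"
    unfolding qn_cancel(2)[OF c0, of "val k"] d v hi_def using assms MM
    by (simp add: qn_le[symmetric] qn_nadd qn_nmult algebra_simps del: elts_succ)
qed

lemma infinitesimal_inverse_MM: "infinitesimal (1 / qn (MM :: 'c))"
proof -
  show ?thesis unfolding infinitesimal_iff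
  proof
    fix a assume "a \<in> SN"
    then show "qn a * \<bar>1 / qn MM\<bar> \<le> 1" using SN_qM[of a] qM by (simp add: pos_divide_le_eq less_imp_le)
  qed
qed

text \<open>The union of a bounded family of cuts is realized by a single hyperrational, by saturation.\<close>

lemma cut_Union:
  assumes C: "isclass C" "C = (\<Union>s\<in>Rs. cut s)" and S: "s0 \<in> Rs" "\<And>s. s \<in> Rs \<Longrightarrow> s \<le> b"
  shows "\<exists>r. cut r = C"
proof -
  let ?U = "elts (nadd (nmult MM MM) (nmult MM MM))"
  let ?X = "{w \<in> XX. \<exists>a\<in>V. \<exists>c\<in>V. w = pair a c \<and> c \<noteq> emp}"
  have X: "isclass ?X" by (intro isclass_Collect isclass_XX defn)
  have tX: "thn ?X" by (rule thn_subset[OF thn_XX]) blast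
  \<comment> \<open>A single code has to separate \<open>C\<close> from its complement: fractions in
    \<open>C\<close> lie below it, up to one mesh width, and the others not below it.\<close>
  let ?Q = "\<lambda>w k. \<exists>a\<in>V. \<exists>c\<in>V. w = pair a c \<and> (w \<in> C \<longrightarrow> lo a c k) \<and> (w \<notin> C \<longrightarrow> hi a c k)"
  have Xe: "\<exists>a c. w = pair a c \<and> a \<in> SN \<and> c \<in> SN \<and> c \<noteq> emp" if wX: "w \<in> ?X" for w
  proof -
    obtain a c where ac: "a \<in> V" "c \<in> V" "w = pair a c" "c \<noteq> emp" "w \<in> XX" using wX by blast
    then have "a \<in> SN" "c \<in> SN" using XX_iff by auto
    with ac show ?thesis by blast
  qed
  have Qeq: "?Q (pair a c) k \<longleftrightarrow> (pair a c \<in> C \<longrightarrow> drat a c \<le> val k + 1 / qn MM) \<and> (pair a c \<notin> C \<longrightarrow> val k \<le> drat a c)"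
    if "a \<in> SN" "c \<in> SN" "c \<noteq> emp" "k \<in> NN" for a c k
  proof -
    have "?Q (pair a c) k \<longleftrightarrow> (pair a c \<in> C \<longrightarrow> lo a c k) \<and> (pair a c \<notin> C \<longrightarrow> hi a c k)"
      using SN_V[OF that(1)] SN_V[OF that(2)] by auto
    then show ?thesis using lo_hi_iff[OF SN_NN[OF that(1)] SN_NN[OF that(2)] that(3,4)] by simp
  qed
  have CI: "pair a c \<in> C \<longleftrightarrow> (\<exists>s\<in>Rs. dr a c < s)" if "a \<in> SN" "c \<in> SN" "c \<noteq> emp" for a c
    unfolding C(2) using cut_iff[OF SN_V SN_V] that by blast
  have drle: "dr a c \<le> dr a' c'" if "drat a c \<le> drat a' c'" "a \<in> SN" "c \<in> SN" "c \<noteq> emp" "a' \<in> SN" "c' \<in> SN" "c' \<noteq> emp" for a c a' c'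
    unfolding dr_def using that by (simp add: hreal_le finite_drat)
  \<comment> \<open>\<open>C\<close> is closed downwards as a union of cuts, so a fraction in
    \<open>C\<close> lies strictly below one outside \<open>C\<close>.\<close>
  have sep: "drat a c < drat a' c'" if "pair a c \<in> C" "pair a' c' \<notin> C" "a \<in> SN" "c \<in> SN" "c \<noteq> emp" "a' \<in> SN" "c' \<in> SN" "c' \<noteq> emp" for a c a' c'
  proof (rule ccontr)
    assume "\<not> drat a c < drat a' c'"
    then have le: "dr a' c' \<le> dr a c" using drle that by simp
    have "\<exists>s\<in>Rs. dr a c < s" using CI that by blast
    then obtain s where "s \<in> Rs" "dr a c < s" by blast
    then have "dr a' c' < s" using le by simp
    then show False using CI[of a' c'] that \<open>s \<in> Rs\<close> by blast
  qed
  have "\<exists>k\<in>?U. \<forall>w\<in>?X. ?Q w k"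
  proof (rule saturation[OF X tX])
    show "isset ?U" by simp
    show "Def UNIV (\<lambda>s. ?Q (s 0) (s (Suc 0)))" unfolding lo_def hi_def by (intro defn Def_isclass C)
    show "isset {k \<in> ?U. ?Q w k}" if "w \<in> ?X" for w
    proof -
      obtain a c where ac: "w = pair a c" "a \<in> SN" "c \<in> SN" "c \<noteq> emp" using Xe[OF \<open>w \<in> ?X\<close>] by blast
      note V = SN_V[OF ac(2)] SN_V[OF ac(3)]
      show ?thesis
      proof (cases "w \<in> C")
        case True
        have "isset {k \<in> ?U. lo a c k}" unfolding lo_def by (intro isset_Collect isset_elts defn V NN_V MM nadd_NN)
        moreover have "{k \<in> ?U. ?Q w k} = {k \<in> ?U. lo a c k}" unfolding ac(1) using V True[unfolded ac(1)] by auto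
        ultimately show ?thesis by simp
      next
        case False
        have "isset {k \<in> ?U. hi a c k}" unfolding hi_def by (intro isset_Collect isset_elts defn V NN_V MM nadd_NN)
        moreover have "{k \<in> ?U. ?Q w k} = {k \<in> ?U. hi a c k}" unfolding ac(1) using V False[unfolded ac(1)] by auto
        ultimately show ?thesis by simp
      qed
    qed
    show "\<exists>k\<in>?U. \<forall>w\<in>A. ?Q w k" if A: "isset A" "A \<subseteq> ?X" "sml A" for A
    proof -
      have "\<exists>k\<in>?U. k \<in> Fin \<and> (\<forall>w\<in>A. ?Q w k)"
      proof (rule small_induct[OF A(1,3), where P = "\<lambda>A. \<exists>k\<in>?U. k \<in> Fin \<and> (\<forall>w\<in>A. ?Q w k)"])
        show "Def UNIV (\<lambda>s. \<exists>k\<in>?U. k \<in> Fin \<and> (\<forall>w\<in>elts (s 0). ?Q w k))"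
          unfolding lo_def hi_def by (intro defn Def_isclass C)
        obtain k where "k \<in> Fin" "k \<in> ?U" using grid[OF finite_0] by metis
        then show "\<exists>k\<in>?U. k \<in> Fin \<and> (\<forall>w\<in>{}. ?Q w k)" by blast
        fix B w assume B: "B \<subseteq> A" and w: "w \<in> A" and "\<exists>k\<in>?U. k \<in> Fin \<and> (\<forall>w\<in>B. ?Q w k)"
        then obtain k where k: "k \<in> ?U" "k \<in> Fin" "\<forall>w\<in>B. ?Q w k" by blast
        have wX: "w \<in> ?X" using w A(2) by (rule set_mp[rotated])
        show "\<exists>k\<in>?U. k \<in> Fin \<and> (\<forall>w\<in>insert w B. ?Q w k)"
        proof (cases "?Q w k")
          case True 
          have "\<forall>x\<in>insert w B. ?Q x k"
          proof
            fix x assume "x \<in> insert w B"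
            then consider "x = w" | "x \<in> B" by (rule insertE)
            then show "?Q x k" by cases (simp only: True, rule k(3)[rule_format])
          qed
          with k(2) show ?thesis by (intro bexI[OF _ k(1)] conjI)
        next
          \<comment> \<open>A code that violates the condition for \<open>w\<close> is replaced by
            the grid point just below the fraction of \<open>w\<close> itself. If \<open>w\<close>
            lies in \<open>C\<close> the old code was too low, otherwise too high; the conditions
            already met survive, on one side by comparison with the old code and on the other by
            \<open>sep\<close>.\<close>
          case nQ: False
          obtain a c where ac: "w = pair a c" "a \<in> SN" "c \<in> SN" "c \<noteq> emp" using Xe[OF wX] by blast
          obtain k' where k': "k' \<in> Fin" "val k' \<le> drat a c" "drat a c < val k' + 1 / qn MM" "k' \<in> ?U"
            using grid[OF finite_drat[OF ac(2-4)]] by metis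
          have kN: "k \<in> NN" "k' \<in> NN" using k k' by (auto simp: Fin_def)
          have 1: "?Q w k'" unfolding ac(1) Qeq[OF ac(2-4) kN(2)] using k' by simp
          have 2: "?Q w' k'" if w': "w' \<in> B" for w'
          proof -
            have "w' \<in> ?X" using w' B A(2) by (meson set_mp)
            then obtain a' c' where ac': "w' = pair a' c'" "a' \<in> SN" "c' \<in> SN" "c' \<noteq> emp" using Xe by blast
            have Q': "(pair a' c' \<in> C \<longrightarrow> drat a' c' \<le> val k + 1 / qn MM) \<and> (pair a' c' \<notin> C \<longrightarrow> val k \<le> drat a' c')"
              using k(3)[rule_format, OF w'] unfolding ac'(1) Qeq[OF ac'(2-4) kN(1)] .
            have nQ': "\<not> ((pair a c \<in> C \<longrightarrow> drat a c \<le> val k + 1 / qn MM) \<and> (pair a c \<notin> C \<longrightarrow> val k \<le> drat a c))"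
              using nQ unfolding ac(1) Qeq[OF ac(2-4) kN(1)] .
            have s1: "pair a c \<in> C \<Longrightarrow> pair a' c' \<notin> C \<Longrightarrow> drat a c < drat a' c'" using sep ac ac' by blast
            have s2: "pair a' c' \<in> C \<Longrightarrow> pair a c \<notin> C \<Longrightarrow> drat a' c' < drat a c" using sep ac ac' by blast
            show ?thesis unfolding ac'(1) Qeq[OF ac'(2-4) kN(2)]
            proof (cases "pair a c \<in> C"; cases "pair a' c' \<in> C")
            qed (use Q' nQ' s1 s2 k' in auto)
          qed
          have "\<forall>x\<in>insert w B. ?Q x k'"
          proof
            fix x assume "x \<in> insert w B"
            then consider "x = w" | "x \<in> B" by (rule insertE)
            then show "?Q x k'" by cases (simp only: 1, rule 2)
          qed
          with k'(1) show ?thesis by (intro bexI[OF _ k'(4)] conjI)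
        qed
      qed
      then show ?thesis by blast
    qed
  qed
  then obtain k where k: "k \<in> ?U" "\<forall>w\<in>?X. ?Q w k" by blast
  have kN: "k \<in> NN" using k(1) NN_mem nadd_NN by blast
  have Qk: "(pair a c \<in> C \<longrightarrow> drat a c \<le> val k + 1 / qn MM) \<and> (pair a c \<notin> C \<longrightarrow> val k \<le> drat a c)"
    if ac: "a \<in> SN" "c \<in> SN" "c \<noteq> emp" for a c
  proof -
    have "pair a c \<in> ?X" using ac SN_V XX_iff by blast
    then show ?thesis using k(2)[rule_format, of "pair a c"] unfolding Qeq[OF ac kN] by blast
  qed
  \<comment> \<open>A fraction below a member of the family and one above the bound \<open>b\<close>
    enclose \<open>val k\<close> between finite values; without this the code found by saturation
    might be infinite.\<close>
  obtain a1 c1 where ac1: "a1 \<in> SN" "c1 \<in> SN" "c1 \<noteq> emp" "s0 - 1 < dr a1 c1" "dr a1 c1 < s0" using dr_dense[of "s0 - 1" s0] by auto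
  have l1: "drat a1 c1 \<le> val k + 1 / qn MM" using Qk[OF ac1(1-3)] CI[OF ac1(1-3)] ac1 S by blast
  obtain a2 c2 where ac2: "a2 \<in> SN" "c2 \<in> SN" "c2 \<noteq> emp" "b < dr a2 c2" "dr a2 c2 < b + 1" using dr_dense[of b "b + 1"] by auto
  have "\<not> dr a2 c2 < s" if "s \<in> Rs" for s using S(2)[OF that] ac2(4) by simp
  then have l2: "val k \<le> drat a2 c2" using Qk[OF ac2(1-3)] CI[OF ac2(1-3)] by blast
  have f1: "finite_q (drat a1 c1 - 1 / qn MM)" and f2: "finite_q (drat a2 c2)"
    using finite_diff[OF finite_drat infinitesimal_finite[OF infinitesimal_inverse_MM]] finite_drat ac1 ac2 by simp_all
  have "finite_q (\<bar>drat a1 c1 - 1 / qn MM\<bar> + \<bar>drat a2 c2\<bar>)"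
    using finite_add[OF finite_le[OF f1] finite_le[OF f2]] by simp
  then have fk: "finite_q (val k)"
    by (rule finite_le) (use l1 l2 in linarith)
  then have kF: "k \<in> Fin" using kN by (simp add: Fin_def)
  have "finite_q (val k + 1 / qn MM)" using finite_add[OF fk infinitesimal_finite[OF infinitesimal_inverse_MM]] .
  moreover have "infinitesimal (val k + 1 / qn MM - val k)" using infinitesimal_inverse_MM by simp
  ultimately have rk: "Abs_hreal (val k + 1 / qn MM) = rl k" unfolding rl_def using hreal_eq fk by blast
  have "cut (rl k) = C"
  proof (rule XX_eqI)
    show "C \<subseteq> XX" unfolding C(2) using cut_XX by blast
    fix a c assume ac: "a \<in> SN" "c \<in> SN"
    show "pair a c \<in> cut (rl k) \<longleftrightarrow> pair a c \<in> C"
    proof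
      assume "pair a c \<in> cut (rl k)"
      then have c: "c \<noteq> emp" "dr a c < rl k" using ac SN_V by (auto simp: cut_iff)
      show "pair a c \<in> C"
      proof (rule ccontr)
        assume "pair a c \<notin> C"
        then have "val k \<le> drat a c" using Qk ac c by blast
        then have "rl k \<le> dr a c" unfolding rl_def dr_def using hreal_le[OF fk finite_drat[OF ac c(1)]] by blast
        then show False using c by simp
      qed
    next
      assume inC: "pair a c \<in> C"
      then have c: "c \<noteq> emp" unfolding C(2) using ac SN_V by (auto simp: cut_iff)
      obtain s where s: "s \<in> Rs" "dr a c < s" using inC CI ac c by blast
      \<comment> \<open>The condition on \<open>k\<close> is a weak inequality with slack, whereas
        cuts are strict. A second fraction between \<open>dr a c\<close> and \<open>s\<close>
        absorbs the difference.\<close>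
      obtain a' c' where ac': "a' \<in> SN" "c' \<in> SN" "c' \<noteq> emp" "dr a c < dr a' c'" "dr a' c' < s" using dr_dense[OF s(2)] .
      then have "drat a' c' \<le> val k + 1 / qn MM" using Qk CI s by blast
      then have "dr a' c' \<le> Abs_hreal (val k + 1 / qn MM)" unfolding dr_def
        using hreal_le[OF finite_drat[OF ac'(1-3)] \<open>finite_q (val k + 1 / qn MM)\<close>] by blast
      then show "pair a c \<in> cut (rl k)" using ac' ac c rk SN_V by (simp add: cut_iff)
    qed
  qed (rule cut_XX)
  then show ?thesis by blast
qed

lemma ex_thin_real_field: "\<exists>R A M L. thin R \<and> real_number_field R A M L"
proof -
  obtain A where A: "binary_op_on RR A" "\<And>x y. x \<in> elts RR \<Longrightarrow> y \<in> elts RR \<Longrightarrow> app A (pair x y) = ir (rho x + rho y)"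
    using ex_addition by blast
  obtain M where M: "binary_op_on RR M" "\<And>x y. x \<in> elts RR \<Longrightarrow> y \<in> elts RR \<Longrightarrow> app M (pair x y) = ir (rho x * rho y)"
    using ex_multiplication by blast
  obtain L where L: "is_relation L" "graph L = {(x, y). x \<in> elts RR \<and> y \<in> elts RR \<and> rho x \<le> rho y}"
    using ex_order by blast
  have ir_rho: "ir (rho x) = x" if "x \<in> elts RR" for x using rho_ir[OF that, of "rho x"] by simp
  have zero: "neutral RR A = ir 0"
    unfolding neutral_def
  proof (rule the_equality)
    show "ir 0 \<in> elts RR \<and> (\<forall>x\<in>elts RR. app A (pair (ir 0) x) = x \<and> app A (pair x (ir 0)) = x)"
      using A(2) ir_rho by simp
    fix e assume e: "e \<in> elts RR \<and> (\<forall>x\<in>elts RR. app A (pair e x) = x \<and> app A (pair x e) = x)"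
    then have "app A (pair e (ir 0)) = ir 0" by simp
    then show "e = ir 0" using A(2)[of e "ir 0"] e ir_rho by simp
  qed
  have one: "neutral RR M = ir 1"
    unfolding neutral_def
  proof (rule the_equality)
    show "ir 1 \<in> elts RR \<and> (\<forall>x\<in>elts RR. app M (pair (ir 1) x) = x \<and> app M (pair x (ir 1)) = x)"
      using M(2) ir_rho by simp
    fix e assume e: "e \<in> elts RR \<and> (\<forall>x\<in>elts RR. app M (pair e x) = x \<and> app M (pair x e) = x)"
    then have "app M (pair e (ir 1)) = ir 1" by simp
    then show "e = ir 1" using M(2)[of e "ir 1"] e ir_rho by simp
  qed
  let ?F = "ring_of RR A M"
  have F: "carrier ?F = elts RR" "\<zero>\<^bsub>?F\<^esub> = ir 0" "\<one>\<^bsub>?F\<^esub> = ir 1" "\<And>x y. x \<oplus>\<^bsub>?F\<^esub> y = app A (pair x y)"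
    "\<And>x y. x \<otimes>\<^bsub>?F\<^esub> y = app M (pair x y)"
    by (simp_all add: ring_of_def zero one)
  have "field ?F"
    by (rule field_transfer[where \<rho> = rho]) (simp_all add: F A(2) M(2) rho_bij)
  moreover have "linear_order_on (elts RR) (graph L)"
    unfolding linear_order_on_def partial_order_on_def preorder_on_def L(2) refl_on_def trans_def antisym_def total_on_def
    using rho_inj by auto
  moreover have "order_complete RR L"
    unfolding order_complete_def
  proof (intro allI impI)
    fix X assume X: "elts X \<subseteq> elts RR \<and> elts X \<noteq> {} \<and> upper_bounds RR L X \<noteq> {}"
    obtain x0 where x0: "x0 \<in> elts X" using X by blast
    obtain b where "b \<in> upper_bounds RR L X" using X by blast
    then have b: "b \<in> elts RR" "\<forall>x\<in>elts X. rho x \<le> rho b" unfolding upper_bounds_def L(2) by auto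
    have "isclass {w \<in> XX. \<exists>x\<in>elts X. w \<in> elts x}" by (intro isclass_Collect isclass_XX defn)
    moreover have "{w \<in> XX. \<exists>x\<in>elts X. w \<in> elts x} = (\<Union>s\<in>rho ` elts X. cut s)"
      using RR_trace X by fastforce
    ultimately obtain r where r: "cut r = (\<Union>s\<in>rho ` elts X. cut s)"
      using cut_Union[of "{w \<in> XX. \<exists>x\<in>elts X. w \<in> elts x}" "rho ` elts X" "rho x0" "rho b"] x0 b(2) by auto
    have ub: "rho x \<le> r" if "x \<in> elts X" for x using r that unfolding cut_mono[symmetric] by blast
    have lub: "r \<le> rho y" if "\<forall>x\<in>elts X. rho x \<le> rho y" for y
      using that unfolding cut_mono[symmetric] r by blast
    show "\<exists>s\<in>upper_bounds RR L X. \<forall>b\<in>upper_bounds RR L X. (s, b) \<in> graph L"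
    proof (rule bexI[of _ "ir r"])
      show "ir r \<in> upper_bounds RR L X" unfolding upper_bounds_def L(2) using ub X by auto
      show "\<forall>b\<in>upper_bounds RR L X. (ir r, b) \<in> graph L"
        unfolding upper_bounds_def L(2) using lub by auto
    qed
  qed
  ultimately have "real_number_field RR A M L"
    unfolding real_number_field_def linearly_ordered_field_def using A M L
    by (auto simp: F)
  then show ?thesis using thin_RR by blast
qed

section \<open>Arithmetic of the rationals through their values in the hyperrationals\<close>

lemma qn_eq: "m \<in> NN \<Longrightarrow> n \<in> NN \<Longrightarrow> qn m = qn n \<longleftrightarrow> m = n"
  unfolding qn_def using hN_eq[OF THS] by simp

lemma norm_eq:
  assumes "a \<in> NN" "b \<in> NN" "a' \<in> NN" "b' \<in> NN" "a = emp \<or> b = emp" "a' = emp \<or> b' = emp" "qn a - qn b = qn a' - qn b'"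
  shows "a = a' \<and> b = b'"
proof -
  have "(qn a = 0 \<or> qn b = 0) \<and> (qn a' = 0 \<or> qn b' = 0)" using assms(5,6) qn_emp by auto
  then have "qn a = qn a' \<and> qn b = qn b'"
    using assms(7) qn_nonneg[of a] qn_nonneg[of b] qn_nonneg[of a'] qn_nonneg[of b'] by (elim conjE disjE; simp)
  then show ?thesis using qn_eq assms by simp
qed

lemma int_diff:
  assumes m: "m \<in> NN" and n: "n \<in> NN"
  shows "\<exists>a\<in>NN. \<exists>b\<in>NN. int_diff m n = pair a b \<and> (a = emp \<or> b = emp) \<and> qn a - qn b = qn m - qn n"
proof -
  have "\<exists>a\<in>NN. \<exists>b\<in>NN. (a = emp \<or> b = emp) \<and> qn a - qn b = qn m - qn n"
  proof -
    consider "m = n" | "m \<in> elts n" | "n \<in> elts m" using NN_linear[OF m n] by blast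
    then show ?thesis
    proof cases
      case 1 then show ?thesis by (intro bexI[of _ emp]) auto
    next
      case 2
      then obtain k where k: "k \<in> NN" "n = nadd m (succ k)" using mem_iff_nadd[OF m n] by blast
      then have "qn emp - qn (succ k) = qn m - qn n" using m qn_nadd[of m "succ k"] qn_emp by simp
      then show ?thesis using k succ_NN emp_NN by blast
    next
      case 3
      then obtain k where k: "k \<in> NN" "m = nadd n (succ k)" using mem_iff_nadd[OF n m] by blast
      then have "qn (succ k) - qn emp = qn m - qn n" using n qn_nadd[of n "succ k"] qn_emp by simp
      then show ?thesis using k succ_NN emp_NN by blast
    qed
  qed
  then obtain a b where ab: "a \<in> NN" "b \<in> NN" "a = emp \<or> b = emp" "qn a - qn b = qn m - qn n" by blast
  have iff: "nat_add m v = nat_add n u \<longleftrightarrow> qn u - qn v = qn m - qn n" if "u \<in> NN" "v \<in> NN" for u v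
  proof -
    have "nat_add m v = nat_add n u \<longleftrightarrow> qn (nadd m v) = qn (nadd n u)"
      using that m n by (simp add: nat_add_nadd' qn_eq)
    also have "\<dots> \<longleftrightarrow> qn u - qn v = qn m - qn n" using that m n by (auto simp: qn_nadd algebra_simps)
    finally show ?thesis .
  qed
  have "int_diff m n = pair a b"
    unfolding int_diff_def
  proof (rule the_equality)
    show "pair a b \<in> ZZ \<and> nat_add m (snd_of (pair a b)) = nat_add n (fst_of (pair a b))"
      using ab iff[OF ab(1,2)] unfolding ZZ_def by auto
    fix z assume z: "z \<in> ZZ \<and> nat_add m (snd_of z) = nat_add n (fst_of z)"
    then obtain u v where uv: "z = pair u v" "u \<in> NN" "v \<in> NN" "u = emp \<or> v = emp" unfolding ZZ_def by blast
    then have "qn u - qn v = qn m - qn n" using z iff[OF uv(2,3)] by simp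
    then show "z = pair a b" using norm_eq[OF uv(2,3) ab(1,2) uv(4) ab(3)] ab(4) uv(1) by simp
  qed
  then show ?thesis using ab by blast
qed

lemma int_mult:
  assumes "a \<in> NN" "b \<in> NN" "a' \<in> NN" "b' \<in> NN"
  shows "\<exists>u\<in>NN. \<exists>v\<in>NN. int_mult (pair a b) (pair a' b') = pair u v \<and> (u = emp \<or> v = emp) \<and>
    qn u - qn v = (qn a - qn b) * (qn a' - qn b')"
proof -
  have "int_mult (pair a b) (pair a' b') = int_diff (nadd (nmult a a') (nmult b b')) (nadd (nmult a b') (nmult b a'))"
    unfolding int_mult_def using assms by (simp add: nat_add_nadd' nat_mult_nmult)
  moreover have "qn (nadd (nmult a a') (nmult b b')) - qn (nadd (nmult a b') (nmult b a')) = (qn a - qn b) * (qn a' - qn b')"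
    using assms by (simp add: qn_nadd qn_nmult algebra_simps)
  ultimately show ?thesis using int_diff[OF nadd_NN nadd_NN, of "nmult a a'" "nmult b b'" "nmult a b'" "nmult b a'"] by simp
qed

lemma int_add:
  assumes "a \<in> NN" "b \<in> NN" "a' \<in> NN" "b' \<in> NN"
  shows "\<exists>u\<in>NN. \<exists>v\<in>NN. int_add (pair a b) (pair a' b') = pair u v \<and> (u = emp \<or> v = emp) \<and>
    qn u - qn v = (qn a - qn b) + (qn a' - qn b')"
proof -
  have "int_add (pair a b) (pair a' b') = int_diff (nadd a a') (nadd b b')"
    unfolding int_add_def using assms by (simp add: nat_add_nadd')
  moreover have "qn (nadd a a') - qn (nadd b b') = (qn a - qn b) + (qn a' - qn b')"
    using assms by (simp add: qn_nadd)
  ultimately show ?thesis using int_diff[OF nadd_NN nadd_NN, of a a' b b'] by simp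
qed

lemma nmult_eq_iff: "\<lbrakk>a \<in> NN; b \<in> NN; c \<in> NN; d \<in> NN\<rbrakk> \<Longrightarrow> nmult a b = nmult c d \<longleftrightarrow> qn a * qn b = qn c * qn d"
  using qn_eq[of "nmult a b" "nmult c d"] by (simp add: qn_nmult)

text \<open>The denominators of \<open>x / d\<close> are the multiples of the least one, so the reduced fraction is
  the one with the least denominator.\<close>

lemma reduced_fraction:
  assumes x: "x \<in> NN" and d: "d \<in> NN" "d \<noteq> emp"
  shows "\<exists>j\<in>NN. \<exists>t\<in>NN. t \<noteq> emp \<and> reduced j t \<and> qn x * qn t = qn d * qn j \<and> (x \<in> SN \<and> d \<in> SN \<longrightarrow> j \<in> SN \<and> t \<in> SN) \<and>
    (\<forall>y\<in>NN. \<forall>e\<in>NN. e \<noteq> emp \<longrightarrow> reduced y e \<longrightarrow> qn x * qn e = qn d * qn y \<longrightarrow> y = j \<and> e = t)"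
proof -
  obtain t j where t: "t \<in> NN" "t \<noteq> emp" and j: "j \<in> NN" and tj: "nmult x t = nmult d j"
    and least: "\<And>t' j'. t' \<in> NN \<Longrightarrow> j' \<in> NN \<Longrightarrow> t' \<noteq> emp \<Longrightarrow> nmult x t' = nmult d j' \<Longrightarrow> t = t' \<or> t \<in> elts t'"
    using least_clearing[OF x d] by blast
  have d0: "0 < qn d" and t0: "0 < qn t" using qn_pos d t by auto
  have tj': "qn x * qn t = qn d * qn j" using tj nmult_eq_iff x t d j by simp
  have least': "qn t \<le> qn t'" if "t' \<in> NN" "j' \<in> NN" "t' \<noteq> emp" "qn x * qn t' = qn d * qn j'" for t' j'
  proof -
    have "nmult x t' = nmult d j'" using that nmult_eq_iff x d by simp
    then have "t = t' \<or> t \<in> elts t'" using least that by blast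
    then show ?thesis using qn_less[OF t(1) that(1)] by auto
  qed
  have one: "qn (succ emp) = 1" unfolding qn_def using hN_1[OF THS] by simp
  have ge1: "1 \<le> qn c" if "c \<in> NN" "c \<noteq> emp" for c
    unfolding qn_def using no_between[of "hN c"] hN_eq[OF THS that(1) emp_NN] hN_0[OF THS] that nq_le[of 1 "hN c"] by simp
  \<comment> \<open>A common divisor \<open>c\<close> of \<open>j\<close> and \<open>t\<close>
    leaves \<open>t' = t / c\<close>, which clears \<open>x / d\<close> as well. Minimality of
    \<open>t\<close> forces \<open>c\<close> to be at most 1.\<close>
  have red: "reduced j t"
    unfolding reduced_def
  proof (intro ballI impI)
    fix c assume c: "c \<in> NN" "\<exists>k\<in>NN. nmult c k = j" "\<exists>k\<in>NN. nmult c k = t"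
    then obtain j' t' where j': "j' \<in> NN" "nmult c j' = j" and t': "t' \<in> NN" "nmult c t' = t" by blast
    have ce: "c \<noteq> emp" and t'e: "t' \<noteq> emp" using t' t(2) c(1) by auto
    have qj: "qn j = qn c * qn j'" and qt: "qn t = qn c * qn t'" using j' t' c(1) qn_nmult by auto
    have c0: "0 < qn c" and t'0: "0 < qn t'" using qn_pos c ce t' t'e by auto
    have "qn c * (qn x * qn t') = qn c * (qn d * qn j')" using tj' unfolding qj qt by (simp add: algebra_simps)
    then have "qn x * qn t' = qn d * qn j'" using c0 by simp
    then have "qn c * qn t' \<le> 1 * qn t'" using least' j' t' t'e qt by simp
    then have "qn c \<le> 1" using t'0 mult_le_cancel_right_pos by blast
    then have "qn c = qn (succ emp)" using ge1[OF c(1) ce] one by simp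
    then show "c = succ emp" using qn_eq c(1) by simp
  qed
  have std: "j \<in> SN \<and> t \<in> SN" if "x \<in> SN" "d \<in> SN"
  proof -
    have "qn t \<le> qn d" using least'[OF d(1) x d(2)] by simp
    moreover have le_SN: "k \<in> SN" if "k \<in> NN" "l \<in> SN" "qn k \<le> qn l" for k l
      using that qn_less[of k l] qn_eq[of k l] SN_NN SN_mem by fastforce
    ultimately have tS: "t \<in> SN" using t that by blast
    have "qn d * qn j \<le> qn x * qn d" using \<open>qn t \<le> qn d\<close> tj' mult_left_mono[OF _ qn_nonneg, of "qn t" "qn d" x] by simp
    then have "qn j \<le> qn x" using d0 by (simp add: mult.commute)
    then show ?thesis using le_SN[OF j] that tS by blast
  qed
  have uniq: "y = j \<and> e = t" if y: "y \<in> NN" and e: "e \<in> NN" "e \<noteq> emp" and r: "reduced y e" and eq: "qn x * qn e = qn d * qn y" for y e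
  proof -
    obtain q s where q: "q \<in> NN" and s: "s \<in> elts t" and es: "e = nadd (nmult t q) s" using NN_division[OF t e(1)] by blast
    have sN: "s \<in> NN" using NN_mem t s by blast
    have qe: "qn e = qn t * qn q + qn s" using es t q sN by (simp add: qn_nadd qn_nmult)
    have "qn d * qn y = qn d * (qn j * qn q) + qn x * qn s" using eq tj' unfolding qe by (simp add: algebra_simps)
    then have xs: "qn x * qn s = qn d * (qn y - qn j * qn q)" by (simp add: algebra_simps)
    \<comment> \<open>The remainder of \<open>e\<close> modulo \<open>t\<close> clears
      \<open>x / d\<close> too. If it were positive it would be a denominator smaller than the least
      one; so \<open>e\<close> is a multiple of \<open>t\<close> with the same quotient as
      \<open>y\<close> over \<open>j\<close>, and reducedness makes that quotient 1.\<close>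
    have "s = emp"
    proof (rule ccontr)
      assume se: "s \<noteq> emp"
      have "0 \<le> qn d * (qn y - qn j * qn q)" using xs[symmetric] qn_nonneg by simp
      then have "qn (nmult j q) \<le> qn y" using d0 j q by (simp add: zero_le_mult_iff qn_nmult)
      then have "nmult j q = y \<or> nmult j q \<in> elts y" using qn_less[of "nmult j q" y] qn_eq[of "nmult j q" y] y by auto
      then obtain w where w: "w \<in> NN" "y = nadd (nmult j q) w" using mem_iff_nadd[of "nmult j q" y] y by (metis emp_NN nadd_emp nmult_NN succ_NN)
      then have "qn y - qn j * qn q = qn w" using j q by (simp add: qn_nadd qn_nmult)
      then have "qn t \<le> qn s" using least'[OF sN w(1) se] xs by simp
      then show False using qn_less[OF sN t(1)] s by simp
    qed
    then have qe': "qn e = qn t * qn q" and "qn d * (qn y - qn j * qn q) = 0" using qe xs qn_emp by simp_all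
    then have qy: "qn y = qn j * qn q" using d0 by simp
    have "nmult q j = y" "nmult q t = e" using qn_eq[of "nmult q j" y] qn_eq[of "nmult q t" e] q j t y e qy qe' by (simp_all add: qn_nmult mult.commute)
    then have "q = succ emp" using r q j t unfolding reduced_def by blast
    then have "qn y = qn j" "qn e = qn t" using qy qe' one by simp_all
    then show ?thesis using qn_eq y e j t by simp
  qed
  show ?thesis using t j red tj' std uniq by blast
qed

definition qval :: "'c \<Rightarrow> 'c hn diff fract" where
  "qval q = (qn (fst_of (fst_of q)) - qn (snd_of (fst_of q))) / qn (snd_of q)"

lemma qval_pair: "a \<in> NN \<Longrightarrow> b \<in> NN \<Longrightarrow> e \<in> NN \<Longrightarrow> qval (pair (pair a b) e) = (qn a - qn b) / qn e"
  by (simp add: qval_def)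

lemma qn_abs: "a \<in> NN \<Longrightarrow> b \<in> NN \<Longrightarrow> a = emp \<or> b = emp \<Longrightarrow> qn (nadd a b) = \<bar>qn a - qn b\<bar>"
  using qn_emp qn_nonneg by (auto simp: qn_nadd)

text \<open>The description in \<open>frac\<close> is an equation between integers in normal form,
  and such integers are equal iff the differences they stand for are; so it amounts to an equation
  for \<open>qval\<close>. The absolute value is reduced by \<open>reduced_fraction\<close> and the
  sign is restored afterwards. Reduction only makes numbers smaller, so standard data have a
  standard result.\<close>

lemma frac_unique:
  assumes m: "m \<in> NN" and n: "n \<in> NN" and mn: "m = emp \<or> n = emp" and d: "d \<in> NN" "d \<noteq> emp"
  shows "\<exists>q\<in>QQ. frac (pair m n) d = q \<and> qval q = (qn m - qn n) / qn d \<and> (m \<in> SN \<and> n \<in> SN \<and> d \<in> SN \<longrightarrow> q \<in> S) \<and>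
    (\<forall>r\<in>QQ. qval r = (qn m - qn n) / qn d \<longrightarrow> r = q)"
proof -
  define x where "x = nadd m n"
  have x: "x \<in> NN" "qn x = \<bar>qn m - qn n\<bar>" using qn_abs[OF m n mn] by (simp_all add: x_def)
  obtain j t where j: "j \<in> NN" and t: "t \<in> NN" "t \<noteq> emp" and red: "reduced j t" and jt: "qn x * qn t = qn d * qn j"
    and std: "x \<in> SN \<and> d \<in> SN \<longrightarrow> j \<in> SN \<and> t \<in> SN"
    and uniq: "\<And>y e. y \<in> NN \<Longrightarrow> e \<in> NN \<Longrightarrow> e \<noteq> emp \<Longrightarrow> reduced y e \<Longrightarrow> qn x * qn e = qn d * qn y \<Longrightarrow> y = j \<and> e = t"
    using reduced_fraction[OF x(1) d] by blast
  have d0: "0 < qn d" and t0: "0 < qn t" using qn_pos d t by auto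
  define a where "a = (if n = emp then j else emp)"
  define b where "b = (if n = emp then emp else j)"
  have ab: "a \<in> NN" "b \<in> NN" "a = emp \<or> b = emp" "nadd a b = j" using j by (auto simp: a_def b_def)
  have v: "(qn a - qn b) / qn t = (qn m - qn n) / qn d"
  proof (cases "n = emp")
    case True
    then have "qn x = qn m" using qn_nonneg[of m] x(2) qn_emp by simp
    then show ?thesis using True jt d0 t0 qn_emp by (simp add: a_def b_def field_simps)
  next
    case False
    then have "qn x = qn n" "m = emp" using qn_nonneg[of n] x(2) qn_emp mn by auto
    then show ?thesis using False jt d0 t0 qn_emp by (simp add: a_def b_def field_simps)
  qed
  define q where "q = pair (pair a b) t"
  have qQ: "q \<in> QQ" unfolding q_def using QQ_iff[OF ab(1,2) t(1)] ab red t by simp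
  have qv: "qval q = (qn m - qn n) / qn d" unfolding q_def qval_pair[OF ab(1,2) t(1)] by (rule v)
  have un: "r = q" if r: "r \<in> QQ" "qval r = (qn m - qn n) / qn d" for r
  proof -
    obtain a' b' e where r': "r = pair (pair a' b') e" "a' \<in> NN" "b' \<in> NN" "e \<in> NN" "a' = emp \<or> b' = emp" "e \<noteq> emp" "reduced (nadd a' b') e"
      using QQ_cases[OF r(1)] .
    have e0: "0 < qn e" using qn_pos r' by blast
    have eq: "(qn a' - qn b') * qn d = (qn m - qn n) * qn e"
      using r(2) d0 e0 unfolding r'(1) qval_pair[OF r'(2-4)] by (simp add: field_simps)
    then have "\<bar>qn a' - qn b'\<bar> * qn d = \<bar>qn m - qn n\<bar> * qn e"
      using d0 e0 by (metis abs_mult abs_of_pos)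
    then have "qn x * qn e = qn d * qn (nadd a' b')" unfolding x(2) qn_abs[OF r'(2,3,5)] by (simp add: mult.commute)
    then have e: "e = t" using uniq[OF nadd_NN r'(4,6,7)] by blast
    have "(qn a - qn b) * qn d = (qn m - qn n) * qn t" using v d0 t0 by (simp add: field_simps)
    then have "(qn a' - qn b') * qn d = (qn a - qn b) * qn d" using eq e by simp
    then have "qn a' - qn b' = qn a - qn b" using d0 by simp
    then show ?thesis using norm_eq[OF r'(2,3) ab(1,2) r'(5) ab(3)] e r'(1) q_def by simp
  qed
  have iff: "int_mult (fst_of r) (pair d emp) = int_mult (pair m n) (pair (snd_of r) emp) \<longleftrightarrow> qval r = (qn m - qn n) / qn d"
    if r: "r \<in> QQ" for r
  proof -
    obtain a' b' e where r': "r = pair (pair a' b') e" "a' \<in> NN" "b' \<in> NN" "e \<in> NN" "e \<noteq> emp"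
      using QQ_cases[OF r] .
    have e0: "0 < qn e" using qn_pos r' by blast
    obtain u w where u: "u \<in> NN" "w \<in> NN" "int_mult (pair a' b') (pair d emp) = pair u w" "u = emp \<or> w = emp"
      "qn u - qn w = (qn a' - qn b') * qn d" using int_mult[OF r'(2,3) d(1) emp_NN] qn_emp by auto
    obtain u' w' where u': "u' \<in> NN" "w' \<in> NN" "int_mult (pair m n) (pair e emp) = pair u' w'" "u' = emp \<or> w' = emp"
      "qn u' - qn w' = (qn m - qn n) * qn e" using int_mult[OF m n r'(4) emp_NN] qn_emp by auto
    have "pair u w = pair u' w' \<longleftrightarrow> qn u - qn w = qn u' - qn w'"
      using norm_eq[OF u(1,2) u'(1,2) u(4) u'(4)] u u' by auto
    also have "\<dots> \<longleftrightarrow> (qn a' - qn b') / qn e = (qn m - qn n) / qn d"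
      unfolding u(5) u'(5) using d0 e0 by (simp add: frac_eq_eq)
    finally show ?thesis using r' u(3) u'(3) qval_pair[OF r'(2-4)] by simp
  qed
  have f: "frac (pair m n) d = q"
    unfolding frac_def
  proof (rule the_equality)
    show "q \<in> QQ \<and> int_mult (fst_of q) (pair d emp) = int_mult (pair m n) (pair (snd_of q) emp)"
      using iff[OF qQ] qQ qv by blast
    show "r = q" if "r \<in> QQ \<and> int_mult (fst_of r) (pair d emp) = int_mult (pair m n) (pair (snd_of r) emp)" for r
      using iff[of r] un[of r] that by blast
  qed
  have qS: "q \<in> S" if "m \<in> SN" "n \<in> SN" "d \<in> SN"
  proof -
    have "x \<in> SN" unfolding x_def by (rule SN_nadd[OF that(1,2)])
    then have jt: "j \<in> SN" "t \<in> SN" using std that(3) by blast+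
    then have "a \<in> SN" "b \<in> SN" unfolding a_def b_def by simp_all
    then show ?thesis unfolding q_def QQ_S[OF ab(1,2) t(1)] using jt(2) by blast
  qed
  show ?thesis
  proof (intro bexI[OF _ qQ] conjI ballI impI)
    show "frac (pair m n) d = q" by (rule f)
    show "qval q = (qn m - qn n) / qn d" by (rule qv)
    show "q \<in> S" if "m \<in> SN \<and> n \<in> SN \<and> d \<in> SN" using that qS by blast
    show "r = q" if "r \<in> QQ" "qval r = (qn m - qn n) / qn d" for r by (rule un[OF that])
  qed
qed

lemma qval_inject: assumes "q \<in> QQ" "r \<in> QQ" "qval q = qval r" shows "q = r"
proof -
  obtain a b e where q: "q = pair (pair a b) e" "a \<in> NN" "b \<in> NN" "e \<in> NN" "a = emp \<or> b = emp" "e \<noteq> emp"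
    using QQ_cases[OF assms(1)] .
  have v: "qval q = (qn a - qn b) / qn e" unfolding q(1) by (rule qval_pair[OF q(2-4)])
  obtain t where t: "\<And>r. r \<in> QQ \<Longrightarrow> qval r = (qn a - qn b) / qn e \<Longrightarrow> r = t"
    using frac_unique[OF q(2,3,5,4,6)] by blast
  show ?thesis using t[OF assms(1) v] t[OF assms(2)] v assms(3) by simp
qed

lemma SN_nadd_nmult: "a \<in> SN \<Longrightarrow> b \<in> SN \<Longrightarrow> nadd a b \<in> SN" "a \<in> SN \<Longrightarrow> b \<in> SN \<Longrightarrow> nmult a b \<in> SN"
  using SN_nadd SN_nmult by blast+

lemma int_SN: 
  assumes "u \<in> NN" "v \<in> NN" "u = emp \<or> v = emp" "qn u - qn v = qn m - qn n" "m \<in> SN" "n \<in> SN"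
  shows "u \<in> SN \<and> v \<in> SN"
proof -
  have le: "k \<in> SN" if "k \<in> NN" "l \<in> SN" "qn k \<le> qn l" for k l
    using that qn_less[of k l] qn_eq[of k l] SN_NN SN_mem by fastforce
  from assms(3) show ?thesis
  proof
    assume "u = emp"
    moreover have "qn v \<le> qn n" using assms(4) \<open>u = emp\<close> qn_emp qn_nonneg[of m] by (simp add: algebra_simps)
    ultimately show ?thesis using le assms by auto
  next
    assume "v = emp"
    moreover have "qn u \<le> qn m" using assms(4) \<open>v = emp\<close> qn_emp qn_nonneg[of n] by (simp add: algebra_simps)
    ultimately show ?thesis using le assms by auto
  qed
qed

lemma rat_add:
  assumes "q \<in> QQ" "r \<in> QQ"
  shows "rat_add q r \<in> QQ" "qval (rat_add q r) = qval q + qval r" "q \<in> S \<Longrightarrow> r \<in> S \<Longrightarrow> rat_add q r \<in> S"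
proof -
  obtain a b e where q: "q = pair (pair a b) e" "a \<in> NN" "b \<in> NN" "e \<in> NN" "a = emp \<or> b = emp" "e \<noteq> emp"
    using QQ_cases[OF assms(1)] .
  obtain a' b' e' where r: "r = pair (pair a' b') e'" "a' \<in> NN" "b' \<in> NN" "e' \<in> NN" "a' = emp \<or> b' = emp" "e' \<noteq> emp"
    using QQ_cases[OF assms(2)] .
  obtain u v where u: "u \<in> NN" "v \<in> NN" "int_mult (pair a b) (pair e' emp) = pair u v" "u = emp \<or> v = emp"
    "qn u - qn v = (qn a - qn b) * qn e'" using int_mult[OF q(2,3) r(4) emp_NN] qn_emp by auto
  obtain u' v' where u': "u' \<in> NN" "v' \<in> NN" "int_mult (pair a' b') (pair e emp) = pair u' v'" "u' = emp \<or> v' = emp"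
    "qn u' - qn v' = (qn a' - qn b') * qn e" using int_mult[OF r(2,3) q(4) emp_NN] qn_emp by auto
  obtain w z where w: "w \<in> NN" "z \<in> NN" "int_add (pair u v) (pair u' v') = pair w z" "w = emp \<or> z = emp"
    "qn w - qn z = (qn u - qn v) + (qn u' - qn v')" using int_add[OF u(1,2) u'(1,2)] by auto
  have e0: "0 < qn e" "0 < qn e'" using qn_pos q r by auto
  then have "qn (nmult e e') \<noteq> 0" using q r by (simp add: qn_nmult)
  then have ee: "nmult e e' \<in> NN" "nmult e e' \<noteq> emp" using qn_emp by auto
  obtain t where t: "t \<in> QQ" "frac (pair w z) (nmult e e') = t" "qval t = (qn w - qn z) / qn (nmult e e')"
    "w \<in> SN \<and> z \<in> SN \<and> nmult e e' \<in> SN \<longrightarrow> t \<in> S"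
    using frac_unique[OF w(1,2,4) ee] by blast
  have T: "rat_add q r = t" unfolding rat_add_def q(1) r(1) using q r u u' w t(2) by (simp add: nat_mult_nmult)
  show "rat_add q r \<in> QQ" unfolding T by (rule t)
  show "qval (rat_add q r) = qval q + qval r"
    unfolding T
    unfolding t(3) w(5) u(5) u'(5) q(1) r(1) qval_pair[OF q(2-4)] qval_pair[OF r(2-4)] qn_nmult[OF q(4) r(4)]
    using e0 by (simp add: field_simps)
  show "rat_add q r \<in> S" if "q \<in> S" "r \<in> S"
  proof -
    have s: "a \<in> SN" "b \<in> SN" "e \<in> SN" "a' \<in> SN" "b' \<in> SN" "e' \<in> SN"
      using that QQ_S[OF q(2-4)] QQ_S[OF r(2-4)] q(1) r(1) by auto
    \<comment> \<open>Before reduction the numerator is a difference of two standard numbers; its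
      normal form is bounded by them and hence standard.\<close>
    have "qn w - qn z = qn (nadd (nmult a e') (nmult a' e)) - qn (nadd (nmult b e') (nmult b' e))"
      unfolding w(5) u(5) u'(5) using q r by (simp add: qn_nadd qn_nmult algebra_simps)
    then have "w \<in> SN \<and> z \<in> SN" using int_SN[OF w(1,2,4)] s SN_nadd_nmult by blast
    then show ?thesis using t(4) s SN_nadd_nmult T by simp
  qed
qed

lemma rat_mult:
  assumes "q \<in> QQ" "r \<in> QQ"
  shows "rat_mult q r \<in> QQ" "qval (rat_mult q r) = qval q * qval r" "q \<in> S \<Longrightarrow> r \<in> S \<Longrightarrow> rat_mult q r \<in> S"
proof -
  obtain a b e where q: "q = pair (pair a b) e" "a \<in> NN" "b \<in> NN" "e \<in> NN" "a = emp \<or> b = emp" "e \<noteq> emp"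
    using QQ_cases[OF assms(1)] .
  obtain a' b' e' where r: "r = pair (pair a' b') e'" "a' \<in> NN" "b' \<in> NN" "e' \<in> NN" "a' = emp \<or> b' = emp" "e' \<noteq> emp"
    using QQ_cases[OF assms(2)] .
  obtain w z where w: "w \<in> NN" "z \<in> NN" "int_mult (pair a b) (pair a' b') = pair w z" "w = emp \<or> z = emp"
    "qn w - qn z = (qn a - qn b) * (qn a' - qn b')" using int_mult[OF q(2,3) r(2,3)] by auto
  have e0: "0 < qn e" "0 < qn e'" using qn_pos q r by auto
  then have "qn (nmult e e') \<noteq> 0" using q r by (simp add: qn_nmult)
  then have ee: "nmult e e' \<in> NN" "nmult e e' \<noteq> emp" using qn_emp by auto
  obtain t where t: "t \<in> QQ" "frac (pair w z) (nmult e e') = t" "qval t = (qn w - qn z) / qn (nmult e e')"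
    "w \<in> SN \<and> z \<in> SN \<and> nmult e e' \<in> SN \<longrightarrow> t \<in> S"
    using frac_unique[OF w(1,2,4) ee] by blast
  have T: "rat_mult q r = t" unfolding rat_mult_def q(1) r(1) using q r w t(2) by (simp add: nat_mult_nmult)
  show "rat_mult q r \<in> QQ" unfolding T by (rule t)
  show "qval (rat_mult q r) = qval q * qval r"
    unfolding T
    unfolding t(3) w(5) q(1) r(1) qval_pair[OF q(2-4)] qval_pair[OF r(2-4)] qn_nmult[OF q(4) r(4)] by simp
  show "rat_mult q r \<in> S" if "q \<in> S" "r \<in> S"
  proof -
    have s: "a \<in> SN" "b \<in> SN" "e \<in> SN" "a' \<in> SN" "b' \<in> SN" "e' \<in> SN"
      using that QQ_S[OF q(2-4)] QQ_S[OF r(2-4)] q(1) r(1) by auto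
    have "qn w - qn z = qn (nadd (nmult a a') (nmult b b')) - qn (nadd (nmult a b') (nmult b a'))"
      unfolding w(5) using q r by (simp add: qn_nadd qn_nmult algebra_simps)
    then have "w \<in> SN \<and> z \<in> SN" using int_SN[OF w(1,2,4)] s SN_nadd_nmult by blast
    then show ?thesis using t(4) s SN_nadd_nmult T by simp
  qed
qed

end

lemma goal1: "THS (mem0 :: 'c \<Rightarrow> 'c \<Rightarrow> bool) \<Longrightarrow> goal1 (mem0 :: 'c \<Rightarrow> 'c \<Rightarrow> bool)"
  unfolding goal1_def by (rule ex_thin_real_field)

section \<open>An arbitrary field of real numbers as a type\<close>

context class_structure
begin

text \<open>Agrees with \<open>app\<close> on the domain of a function. Uniqueness is written into
  the description, so \<open>DT_The\<close> applies for arbitrary arguments and application becomes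
  a definable term.\<close>

definition ap :: "'c \<Rightarrow> 'c \<Rightarrow> 'c" where
  "ap F x = (THE y. y \<in> V \<and> pair x y \<in> elts F \<and> (\<forall>z\<in>V. pair x z \<in> elts F \<longrightarrow> z = y))"

end

context THS
begin

lemma DT_ap [defn]: "DT UNIV f \<Longrightarrow> DT UNIV g \<Longrightarrow> DT UNIV (\<lambda>s. ap (f s) (g s))"
proof (rule DT_comp2[where F = ap])
  show "DT UNIV (\<lambda>s. ap (s 0) (s (Suc 0)))"
    unfolding ap_def by (rule DT_The, intro defn) blast
qed

lemma ap_eq: "is_function F \<Longrightarrow> x \<in> Domain (graph F) \<Longrightarrow> ap F x = app F x"
proof -
  assume F: "is_function F" and x: "x \<in> Domain (graph F)"
  have xV: "x \<in> V" using x by (auto simp: graph_iff)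
  have m: "app F x \<in> V" "pair x (app F x) \<in> elts F" using app_mem[OF F x] by auto
  show ?thesis unfolding ap_def
  proof (rule the_equality)
    show "app F x \<in> V \<and> pair x (app F x) \<in> elts F \<and> (\<forall>z\<in>V. pair x z \<in> elts F \<longrightarrow> z = app F x)"
    proof (intro conjI ballI impI m)
      fix z assume "z \<in> V" "pair x z \<in> elts F"
      then show "z = app F x" by (rule app_eq[OF F xV, symmetric])
    qed
  next
    fix y assume y: "y \<in> V \<and> pair x y \<in> elts F \<and> (\<forall>z\<in>V. pair x z \<in> elts F \<longrightarrow> z = y)"
    show "y = app F x" by (rule app_eq[OF F xV conjunct1[OF y] conjunct1[OF conjunct2[OF y]], symmetric])
  qed
qed

end

text \<open>Types cannot depend on a truth value, so the index of the field is carried by a phantom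
  type: one with two distinct elements selects \<open>fields0 True\<close>, a singleton selects
  \<open>fields0 False\<close>. At the end these are \<open>bool\<close> and
  \<open>unit\<close>.\<close>

definition cst :: "'i itself \<Rightarrow> 'c fstruct" where "cst _ = fields0 (\<exists>x y::'i. x \<noteq> y)"

definition cR :: "'i itself \<Rightarrow> 'c" where "cR t = fst (cst t)"
definition cA :: "'i itself \<Rightarrow> 'c" where "cA t = fst (snd (cst t))"
definition cM :: "'i itself \<Rightarrow> 'c" where "cM t = fst (snd (snd (cst t)))"
definition cL :: "'i itself \<Rightarrow> 'c" where "cL t = snd (snd (snd (cst t)))"

definition okf :: "'c itself \<Rightarrow> 'i itself \<Rightarrow> bool" where
  "okf _ i \<longleftrightarrow> THS (mem0 :: 'c \<Rightarrow> 'c \<Rightarrow> bool) \<and>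
     class_structure.real_number_field (mem0 :: 'c \<Rightarrow> 'c \<Rightarrow> bool) (cR i) (cA i) (cM i) (cL i)"

definition cF :: "'i itself \<Rightarrow> 'c ring" where "cF i = class_structure.ring_of mem0 (cR i) (cA i) (cM i)"

lemma okf_field:
  assumes "okf TYPE('c) (i :: 'i itself)"
  shows "THS (mem0 :: 'c \<Rightarrow> 'c \<Rightarrow> bool)" and "field (cF i :: 'c ring)"
    and "carrier (cF i :: 'c ring) = class_structure.elts mem0 (cR i)"
  using assms unfolding okf_def class_structure.real_number_field_def class_structure.linearly_ordered_field_def cF_def
  by (auto simp: class_structure.ring_of_def)

typedef ('c, 'i) rf = "{x :: 'c + rat. if okf TYPE('c) TYPE('i) then x \<in> Inl ` carrier (cF TYPE('i)) else x \<in> range Inr}"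
proof (cases "okf TYPE('c) TYPE('i)")
  case True
  then interpret field "cF TYPE('i) :: 'c ring" by (rule okf_field)
  show ?thesis using True by (intro exI[of _ "Inl \<zero>\<^bsub>cF TYPE('i) :: 'c ring\<^esub>"]) auto
qed auto

definition rN :: "'c \<Rightarrow> ('c, 'i) rf" where "rN a = Abs_rf (Inl a)"
definition rQ :: "rat \<Rightarrow> ('c, 'i) rf" where "rQ a = Abs_rf (Inr a)"

lemma Rep_rN: "okf TYPE('c) TYPE('i) \<Longrightarrow> a \<in> carrier (cF TYPE('i)) \<Longrightarrow> Rep_rf (rN (a::'c) :: ('c, 'i) rf) = Inl a"
  unfolding rN_def by (rule Abs_rf_inverse) auto

lemma Rep_rQ: "\<not> okf TYPE('c) TYPE('i) \<Longrightarrow> Rep_rf (rQ a :: ('c, 'i) rf) = Inr a"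
  unfolding rQ_def by (rule Abs_rf_inverse) auto

lemma rN_cases:
  assumes "okf TYPE('c) TYPE('i)" obtains a where "a \<in> carrier (cF TYPE('i))" "(x :: ('c, 'i) rf) = rN a"
  using assms Rep_rf[of x] Rep_rf_inverse[of x] unfolding rN_def by (metis (no_types, lifting) image_iff mem_Collect_eq)

lemma rQ_cases:
  assumes "\<not> okf TYPE('c) TYPE('i)" obtains a where "(x :: ('c, 'i) rf) = rQ a"
  using assms Rep_rf[of x] Rep_rf_inverse[of x] unfolding rQ_def by (metis (no_types, lifting) image_iff mem_Collect_eq)

instantiation rf :: (type, type) "{zero, one, plus, times, uminus, inverse, ord, minus, abs, sgn}"
begin

definition zero_rf :: "('a, 'b) rf" where
  "zero_rf = (if okf TYPE('a) TYPE('b) then rN \<zero>\<^bsub>cF TYPE('b)\<^esub> else rQ 0)"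
definition one_rf :: "('a, 'b) rf" where
  "one_rf = (if okf TYPE('a) TYPE('b) then rN \<one>\<^bsub>cF TYPE('b)\<^esub> else rQ 1)"
definition plus_rf :: "('a, 'b) rf \<Rightarrow> ('a, 'b) rf \<Rightarrow> ('a, 'b) rf" where
  "plus_rf x y = (case (Rep_rf x, Rep_rf y) of (Inl a, Inl b) \<Rightarrow> rN (a \<oplus>\<^bsub>cF TYPE('b)\<^esub> b) | (Inr m, Inr n) \<Rightarrow> rQ (m + n))"
definition times_rf :: "('a, 'b) rf \<Rightarrow> ('a, 'b) rf \<Rightarrow> ('a, 'b) rf" where
  "times_rf x y = (case (Rep_rf x, Rep_rf y) of (Inl a, Inl b) \<Rightarrow> rN (a \<otimes>\<^bsub>cF TYPE('b)\<^esub> b) | (Inr m, Inr n) \<Rightarrow> rQ (m * n))"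
definition uminus_rf :: "('a, 'b) rf \<Rightarrow> ('a, 'b) rf" where
  "uminus_rf x = (case Rep_rf x of Inl a \<Rightarrow> rN (\<ominus>\<^bsub>cF TYPE('b)\<^esub> a) | Inr m \<Rightarrow> rQ (- m))"
definition inverse_rf :: "('a, 'b) rf \<Rightarrow> ('a, 'b) rf" where
  "inverse_rf x = (case Rep_rf x of Inl a \<Rightarrow> rN (if a = \<zero>\<^bsub>cF TYPE('b)\<^esub> then a else inv\<^bsub>cF TYPE('b)\<^esub> a) | Inr m \<Rightarrow> rQ (inverse m))"
definition less_eq_rf :: "('a, 'b) rf \<Rightarrow> ('a, 'b) rf \<Rightarrow> bool" where
  "less_eq_rf x y = (case (Rep_rf x, Rep_rf y) of (Inl a, Inl b) \<Rightarrow> (a, b) \<in> class_structure.graph mem0 (cL TYPE('b)) | (Inr m, Inr n) \<Rightarrow> m \<le> n)"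
definition less_rf :: "('a, 'b) rf \<Rightarrow> ('a, 'b) rf \<Rightarrow> bool" where "less_rf x y \<longleftrightarrow> x \<le> y \<and> \<not> y \<le> x"
definition minus_rf :: "('a, 'b) rf \<Rightarrow> ('a, 'b) rf \<Rightarrow> ('a, 'b) rf" where "minus_rf x y = x + - y"
definition divide_rf :: "('a, 'b) rf \<Rightarrow> ('a, 'b) rf \<Rightarrow> ('a, 'b) rf" where "divide_rf x y = x * inverse y"
definition abs_rf :: "('a, 'b) rf \<Rightarrow> ('a, 'b) rf" where "abs_rf x = (if x < 0 then - x else x)"
definition sgn_rf :: "('a, 'b) rf \<Rightarrow> ('a, 'b) rf" where "sgn_rf x = (if x = 0 then 0 else if 0 < x then 1 else - 1)"

instance ..

end

context
  fixes i :: "'i itself" and c :: "'c itself"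
  assumes ok: "okf TYPE('c) TYPE('i)"
begin

interpretation THS "mem0 :: 'c \<Rightarrow> 'c \<Rightarrow> bool" by (rule okf_field(1)[OF ok])
interpretation G: field "cF TYPE('i) :: 'c ring" by (rule okf_field(2)[OF ok])

lemma rf_order:
  shows "linear_order_on (carrier (cF TYPE('i))) (graph (cL TYPE('i)))"
    and "\<lbrakk>x \<in> carrier (cF TYPE('i)); y \<in> carrier (cF TYPE('i)); z \<in> carrier (cF TYPE('i)); (x, y) \<in> (graph (cL TYPE('i)))\<rbrakk> \<Longrightarrow> (x \<oplus>\<^bsub>cF TYPE('i)\<^esub> z, y \<oplus>\<^bsub>cF TYPE('i)\<^esub> z) \<in> (graph (cL TYPE('i)))"
    and "\<lbrakk>x \<in> carrier (cF TYPE('i)); y \<in> carrier (cF TYPE('i)); (\<zero>\<^bsub>cF TYPE('i)\<^esub>, x) \<in> (graph (cL TYPE('i))); (\<zero>\<^bsub>cF TYPE('i)\<^esub>, y) \<in> (graph (cL TYPE('i)))\<rbrakk> \<Longrightarrow> (\<zero>\<^bsub>cF TYPE('i)\<^esub>, x \<otimes>\<^bsub>cF TYPE('i)\<^esub> y) \<in> (graph (cL TYPE('i)))"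
  using ok unfolding okf_def real_number_field_def linearly_ordered_field_def okf_field(3)[OF ok] cF_def[symmetric] by blast+

lemma rN_ops:
  shows rN_0: "(rN \<zero>\<^bsub>cF TYPE('i)\<^esub> :: ('c, 'i) rf) = 0"
    and rN_1: "(rN \<one>\<^bsub>cF TYPE('i)\<^esub> :: ('c, 'i) rf) = 1"
    and rN_add: "\<lbrakk>a \<in> carrier (cF TYPE('i)); b \<in> carrier (cF TYPE('i))\<rbrakk> \<Longrightarrow> (rN a :: ('c, 'i) rf) + rN b = rN (a \<oplus>\<^bsub>cF TYPE('i)\<^esub> b)"
    and rN_mult: "\<lbrakk>a \<in> carrier (cF TYPE('i)); b \<in> carrier (cF TYPE('i))\<rbrakk> \<Longrightarrow> (rN a :: ('c, 'i) rf) * rN b = rN (a \<otimes>\<^bsub>cF TYPE('i)\<^esub> b)"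
    and rN_minus: "a \<in> carrier (cF TYPE('i)) \<Longrightarrow> - (rN a :: ('c, 'i) rf) = rN (\<ominus>\<^bsub>cF TYPE('i)\<^esub> a)"
    and rN_inverse: "a \<in> carrier (cF TYPE('i)) \<Longrightarrow> a \<noteq> \<zero>\<^bsub>cF TYPE('i)\<^esub> \<Longrightarrow> inverse (rN a :: ('c, 'i) rf) = rN (inv\<^bsub>cF TYPE('i)\<^esub> a)"
    and rN_inverse_0: "inverse (rN \<zero>\<^bsub>cF TYPE('i)\<^esub> :: ('c, 'i) rf) = rN \<zero>\<^bsub>cF TYPE('i)\<^esub>"
    and rN_le: "\<lbrakk>a \<in> carrier (cF TYPE('i)); b \<in> carrier (cF TYPE('i))\<rbrakk> \<Longrightarrow> (rN a :: ('c, 'i) rf) \<le> rN b \<longleftrightarrow> (a, b) \<in> (graph (cL TYPE('i)))"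
  using ok by (simp_all add: zero_rf_def one_rf_def plus_rf_def times_rf_def uminus_rf_def inverse_rf_def less_eq_rf_def Rep_rN)

lemma rN_eq: "\<lbrakk>a \<in> carrier (cF TYPE('i)); b \<in> carrier (cF TYPE('i))\<rbrakk> \<Longrightarrow> (rN a :: ('c, 'i) rf) = rN b \<longleftrightarrow> a = b"
  using Rep_rN[OF ok] by (metis sum.inject(1))

lemma rf_laws:
  fixes x y z :: "('c, 'i) rf"
  shows "x + y + z = x + (y + z)" "x + y = y + x" "0 + x = x" "- x + x = 0" "x * y * z = x * (y * z)" "x * y = y * x" "1 * x = x"
    "(x + y) * z = x * z + y * z" "(0 :: ('c, 'i) rf) \<noteq> 1" "x \<noteq> 0 \<Longrightarrow> inverse x * x = 1" "inverse (0 :: ('c, 'i) rf) = 0"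
    "x \<le> x" "x \<le> y \<Longrightarrow> y \<le> z \<Longrightarrow> x \<le> z" "x \<le> y \<Longrightarrow> y \<le> x \<Longrightarrow> x = y" "x \<le> y \<or> y \<le> x"
    "x \<le> y \<Longrightarrow> x + z \<le> y + z" "0 \<le> x \<Longrightarrow> 0 \<le> y \<Longrightarrow> 0 \<le> x * y"
proof -
  obtain a where x: "a \<in> carrier (cF TYPE('i))" "x = rN a" using rN_cases[OF ok] .
  obtain b where y: "b \<in> carrier (cF TYPE('i))" "y = rN b" using rN_cases[OF ok] .
  obtain c where z: "c \<in> carrier (cF TYPE('i))" "z = rN c" using rN_cases[OF ok] .
  note C = x y z rN_0[symmetric] rN_1[symmetric] rN_add rN_mult rN_minus rN_le rN_eq
  show "x + y + z = x + (y + z)" by (simp add: C G.a_assoc)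
  show "x + y = y + x" by (simp add: C G.a_comm)
  show "0 + x = x" by (simp add: C)
  show "- x + x = 0" by (simp add: C G.l_neg)
  show "x * y * z = x * (y * z)" by (simp add: C G.m_assoc)
  show "x * y = y * x" by (simp add: C G.m_comm)
  show "1 * x = x" by (simp add: C)
  show "(x + y) * z = x * z + y * z" by (simp add: C G.l_distr)
  show "(0 :: ('c, 'i) rf) \<noteq> 1" by (simp add: C)
  show "inverse x * x = 1" if "x \<noteq> 0"
  proof -
    have "a \<noteq> \<zero>\<^bsub>cF TYPE('i)\<^esub>" using that by (auto simp: C)
    then have "a \<in> Units (cF TYPE('i))" using x G.field_Units by blast
    then show ?thesis using rN_inverse[OF x(1) \<open>a \<noteq> \<zero>\<^bsub>cF TYPE('i)\<^esub>\<close>] G.Units_l_inv by (simp add: C)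
  qed
  show "inverse (0 :: ('c, 'i) rf) = 0" using rN_inverse_0 rN_0 by simp
  note lin = rf_order(1)[unfolded linear_order_on_def partial_order_on_def preorder_on_def]
  have r: "refl_on (carrier (cF TYPE('i))) (graph (cL TYPE('i)))" and t: "trans (graph (cL TYPE('i)))" and an: "antisym (graph (cL TYPE('i)))" and tot: "total_on (carrier (cF TYPE('i))) (graph (cL TYPE('i)))" using lin by auto
  show "x \<le> x" using r x by (simp add: C refl_onD)
  show "x \<le> y \<Longrightarrow> y \<le> z \<Longrightarrow> x \<le> z" using transD[OF t, of a b c] by (simp add: C)
  show "x \<le> y \<Longrightarrow> y \<le> x \<Longrightarrow> x = y" using antisymD[OF an, of a b] by (simp add: C)
  show "x \<le> y \<or> y \<le> x" using tot r x y by (cases "a = b") (auto simp: C total_on_def refl_onD)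
  show "x \<le> y \<Longrightarrow> x + z \<le> y + z" using rf_order(2) x y z by (simp add: C)
  show "0 \<le> x \<Longrightarrow> 0 \<le> y \<Longrightarrow> 0 \<le> x * y" using rf_order(3) x y by (simp add: C)
qed

end

context
  fixes i :: "'i itself" and c :: "'c itself"
  assumes ok: "\<not> okf TYPE('c) TYPE('i)"
begin

lemma rQ_ops:
  shows rQ_0: "(rQ 0 :: ('c, 'i) rf) = 0"
    and rQ_1: "(rQ 1 :: ('c, 'i) rf) = 1"
    and rQ_add: "(rQ m :: ('c, 'i) rf) + rQ n = rQ (m + n)"
    and rQ_mult: "(rQ m :: ('c, 'i) rf) * rQ n = rQ (m * n)"
    and rQ_minus: "- (rQ m :: ('c, 'i) rf) = rQ (- m)"
    and rQ_inverse: "inverse (rQ m :: ('c, 'i) rf) = rQ (inverse m)"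
    and rQ_le: "(rQ m :: ('c, 'i) rf) \<le> rQ n \<longleftrightarrow> m \<le> n"
  using ok by (simp_all add: zero_rf_def one_rf_def plus_rf_def times_rf_def uminus_rf_def inverse_rf_def less_eq_rf_def Rep_rQ)

lemma rQ_eq: "(rQ m :: ('c, 'i) rf) = rQ n \<longleftrightarrow> m = n"
  using Rep_rQ[OF ok] by (metis sum.inject(2))

lemma rf_laws_fallback:
  fixes x y z :: "('c, 'i) rf"
  shows "x + y + z = x + (y + z)" "x + y = y + x" "0 + x = x" "- x + x = 0" "x * y * z = x * (y * z)" "x * y = y * x" "1 * x = x"
    "(x + y) * z = x * z + y * z" "(0 :: ('c, 'i) rf) \<noteq> 1" "x \<noteq> 0 \<Longrightarrow> inverse x * x = 1" "inverse (0 :: ('c, 'i) rf) = 0"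
    "x \<le> x" "x \<le> y \<Longrightarrow> y \<le> z \<Longrightarrow> x \<le> z" "x \<le> y \<Longrightarrow> y \<le> x \<Longrightarrow> x = y" "x \<le> y \<or> y \<le> x"
    "x \<le> y \<Longrightarrow> x + z \<le> y + z" "0 \<le> x \<Longrightarrow> 0 \<le> y \<Longrightarrow> 0 \<le> x * y"
proof -
  obtain a where x: "x = rQ a" using rQ_cases[OF ok] .
  obtain b where y: "y = rQ b" using rQ_cases[OF ok] .
  obtain c where z: "z = rQ c" using rQ_cases[OF ok] .
  note C = x y z rQ_0[symmetric] rQ_1[symmetric] rQ_add rQ_mult rQ_minus rQ_inverse rQ_le rQ_eq
  show "x + y + z = x + (y + z)" "x + y = y + x" "0 + x = x" "- x + x = 0" "x * y * z = x * (y * z)" "x * y = y * x" "1 * x = x"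
    "(x + y) * z = x * z + y * z" "(0 :: ('c, 'i) rf) \<noteq> 1" "x \<noteq> 0 \<Longrightarrow> inverse x * x = 1" "inverse (0 :: ('c, 'i) rf) = 0"
    "x \<le> x" "x \<le> y \<Longrightarrow> y \<le> z \<Longrightarrow> x \<le> z" "x \<le> y \<Longrightarrow> y \<le> x \<Longrightarrow> x = y" "x \<le> y \<or> y \<le> x"
    "x \<le> y \<Longrightarrow> x + z \<le> y + z" "0 \<le> x \<Longrightarrow> 0 \<le> y \<Longrightarrow> 0 \<le> x * y"
    by (simp only: C; auto simp: algebra_simps)+
qed

end

instance rf :: (type, type) ab_group_add
proof
  fix x y z :: "('a, 'b) rf"
  let ?ok = "okf TYPE('a) TYPE('b)"
  show "x + y + z = x + (y + z)" by (cases ?ok, rule rf_laws(1), assumption, rule rf_laws_fallback(1), assumption)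
  show "x + y = y + x" by (cases ?ok, rule rf_laws(2), assumption, rule rf_laws_fallback(2), assumption)
  show "0 + x = x" by (cases ?ok, rule rf_laws(3), assumption, rule rf_laws_fallback(3), assumption)
  show "- x + x = 0" by (cases ?ok, rule rf_laws(4), assumption, rule rf_laws_fallback(4), assumption)
  show "x - y = x + - y" by (rule minus_rf_def)
qed

instance rf :: (type, type) comm_ring
proof
  fix x y z :: "('a, 'b) rf"
  let ?ok = "okf TYPE('a) TYPE('b)"
  show "x * y * z = x * (y * z)" by (cases ?ok, rule rf_laws(5), assumption, rule rf_laws_fallback(5), assumption)
  show "x * y = y * x" by (cases ?ok, rule rf_laws(6), assumption, rule rf_laws_fallback(6), assumption)
  show "(x + y) * z = x * z + y * z" by (cases ?ok, rule rf_laws(8), assumption, rule rf_laws_fallback(8), assumption)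
qed

instance rf :: (type, type) comm_ring_1
proof
  fix x y z :: "('a, 'b) rf"
  let ?ok = "okf TYPE('a) TYPE('b)"
  show "1 * x = x" by (cases ?ok, rule rf_laws(7), assumption, rule rf_laws_fallback(7), assumption)
  show "(0 :: ('a, 'b) rf) \<noteq> 1" by (cases ?ok, rule rf_laws(9), assumption, rule rf_laws_fallback(9), assumption)
qed

instance rf :: (type, type) field
proof
  fix x y z :: "('a, 'b) rf"
  let ?ok = "okf TYPE('a) TYPE('b)"
  show "x \<noteq> 0 \<Longrightarrow> inverse x * x = 1" by (cases ?ok) (blast intro: rf_laws(10) rf_laws_fallback(10))+
  show "x div y = x * inverse y" by (rule divide_rf_def)
  show "inverse (0 :: ('a, 'b) rf) = 0" by (cases ?ok, rule rf_laws(11), assumption, rule rf_laws_fallback(11), assumption)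
qed

instance rf :: (type, type) linordered_field
proof
  fix x y z :: "('a, 'b) rf"
  let ?ok = "okf TYPE('a) TYPE('b)"
  show "x < y \<longleftrightarrow> x \<le> y \<and> \<not> y \<le> x" by (rule less_rf_def)
  show refl: "x \<le> x" for x :: "('a, 'b) rf" by (cases ?ok, rule rf_laws(12), assumption, rule rf_laws_fallback(12), assumption)
  show "x \<le> y \<Longrightarrow> y \<le> z \<Longrightarrow> x \<le> z" by (cases ?ok) (blast intro: rf_laws(13) rf_laws_fallback(13))+
  show antisym: "x \<le> y \<Longrightarrow> y \<le> x \<Longrightarrow> x = y" for x y :: "('a, 'b) rf" by (cases ?ok) (blast intro: rf_laws(14) rf_laws_fallback(14))+
  show "x \<le> y \<or> y \<le> x" by (cases ?ok, rule rf_laws(15), assumption, rule rf_laws_fallback(15), assumption)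
  have mono: "x \<le> y \<Longrightarrow> x + z \<le> y + z" for x y z :: "('a, 'b) rf" by (cases ?ok) (blast intro: rf_laws(16) rf_laws_fallback(16))+
  show "x \<le> y \<Longrightarrow> z + x \<le> z + y" using mono[of x y z] by (simp add: add.commute)
  show "\<bar>x\<bar> = (if x < 0 then - x else x)" by (rule abs_rf_def)
  show "sgn x = (if x = 0 then 0 else if 0 < x then 1 else - 1)" by (rule sgn_rf_def)
  have pos: "0 \<le> x \<Longrightarrow> 0 \<le> y \<Longrightarrow> 0 \<le> x * y" for x y :: "('a, 'b) rf" by (cases ?ok) (blast intro: rf_laws(17) rf_laws_fallback(17))+
  show "z * x < z * y" if xy: "x < y" and z: "0 < z"
  proof -
    have le: "x \<le> y" "0 \<le> z" "x \<noteq> y" "z \<noteq> 0" using xy z refl unfolding less_rf_def by blast+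
    have "x + - x \<le> y + - x" by (rule mono[OF le(1)])
    then have "0 \<le> z * (y - x)" using pos[OF le(2)] by simp
    then have "0 + z * x \<le> z * (y - x) + z * x" by (rule mono)
    moreover have "z * (y - x) + z * x = z * y" by (simp add: algebra_simps)
    ultimately have l: "z * x \<le> z * y" by simp
    have "z * x \<noteq> z * y" using le(3,4) by simp
    then show ?thesis unfolding less_rf_def using l antisym by blast
  qed
qed

section \<open>Standard fractions in an ordered field\<close>

context THS
begin

lemma SN_induct_SN:
  assumes P: "Def UNIV (\<lambda>s. P (s 0))" and "P emp" and step: "\<And>n. n \<in> SN \<Longrightarrow> P n \<Longrightarrow> P (succ n)" and n: "n \<in> SN"
  shows "P n"
proof -
  have "n \<in> SN \<and> P n"
    by (rule SN_induct[where P = "\<lambda>n. n \<in> SN \<and> P n", OF _ _ _ n], intro defn P) (use assms in auto)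
  then show ?thesis ..
qed

text \<open>Meant for claims \<open>Q\<close> about elements of a HOL type, which are not formulas
  of the language. The induction is carried by a definable translation \<open>P\<close> that is
  equivalent on standard numbers.\<close>

lemma SN_induct_via:
  assumes P: "Def UNIV (\<lambda>s. P (s 0))" and PQ: "\<And>n. n \<in> SN \<Longrightarrow> P n \<longleftrightarrow> Q n"
    and "Q emp" and step: "\<And>n. n \<in> SN \<Longrightarrow> Q n \<Longrightarrow> Q (succ n)" and n: "n \<in> SN"
  shows "Q n"
proof -
  have "P n"
    by (rule SN_induct_SN[OF P _ _ n]) (use assms(3) step PQ in auto)
  then show ?thesis using PQ n by simp
qed

text \<open>(DC) has its two arguments in variables 0 and 1, whereas \<open>Def\<close> keeps its
  second variable at position 2 and its first parameter at position 1. Interchanging the indices 1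
  and 2 reconciles them, with \<open>t 0\<close> stored at 2.\<close>

lemma dependent_choice:
  assumes P: "Def UNIV (\<lambda>s. P (s 0) (s (Suc 0)))" and ex: "\<And>x. x \<in> V \<Longrightarrow> \<exists>y\<in>V. P x y" and x: "x \<in> V"
  shows "\<exists>F. is_function F \<and> Domain (graph F) = SN \<and> app F emp = x \<and> (\<forall>n\<in>SN. P (app F n) (app F (succ n)))"
proof -
  have "\<exists>\<phi> t. \<forall>s. P (s 0) (s (Suc 0)) \<longleftrightarrow> sat UNIV \<phi> (join s t)"
    using P unfolding Def_def by (simp only: subset_UNIV simp_thms)
  then obtain \<phi> t where \<phi>: "\<forall>s. P (s 0) (s (Suc 0)) \<longleftrightarrow> sat UNIV \<phi> (join s t)" by (elim exE)
  define f where "f n = (if n = 1 then 2 else if n = 2 then 1 else n)" for n :: nat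
  have "f (f n) = n" for n by (cases "n = 1"; cases "n = 2") (simp_all add: f_def)
  then have f: "inj f" by (rule inj_on_inverseI)
  define s0 where "s0 = (join (\<lambda>_. emp) t)(2 := t 0)"
  have e: "s0(0 := x, 1 := y) \<circ> f = join ((\<lambda>_. emp)(0 := x, Suc 0 := y)) t" for x y
  proof
    fix n
    have h: "n \<ge> 3 \<Longrightarrow> even n \<Longrightarrow> n div 2 \<noteq> 0 \<and> n div 2 \<noteq> Suc 0" by presburger
    consider "n = 0" | "n = 1" | "n = 2" | "n \<ge> 3" by linarith
    then show "(s0(0 := x, 1 := y) \<circ> f) n = join ((\<lambda>_. emp)(0 := x, Suc 0 := y)) t n"
    proof cases
      case 4
      have 1: "(s0(0 := x, 1 := y) \<circ> f) n = join (\<lambda>_. emp) t n" using 4 by (simp add: s0_def f_def)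
      show ?thesis
      proof (cases "even n")
        case True
        have 2: "n div 2 \<noteq> 0" "n div 2 \<noteq> Suc 0" using h[OF 4 True] by blast+
        have "((\<lambda>_. emp)(0 := x, Suc 0 := y)) (n div 2) = emp"
          unfolding fun_upd_other[OF 2(2)] fun_upd_other[OF 2(1)] by (rule refl)
        then show ?thesis unfolding 1 join_def by (simp only: True if_True)
      next
        case False
        then show ?thesis unfolding 1 join_def by (simp only: if_False)
      qed
    qed (simp_all add: s0_def f_def join_def)
  qed
  have sat: "sat UNIV (ren f \<phi>) (s0(0 := x, 1 := y)) \<longleftrightarrow> P x y" for x y
    unfolding sat_ren[OF f] e using \<phi>[THEN spec, of "(\<lambda>_. emp)(0 := x, Suc 0 := y)"] by simp
  have "\<forall>x\<in>V. \<exists>y\<in>V. sat UNIV (ren f \<phi>) (s0(0 := x, 1 := y))" unfolding sat using ex by blast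
  from DC[OF this] show ?thesis unfolding sat using x by blast
qed

text \<open>The triple \<open>(m, n, d)\<close> of standard numbers stands for the fraction \<open>(m - n) / d\<close>.\<close>

definition F3 :: "('c \<times> 'c \<times> 'c) set" where "F3 = SN \<times> SN \<times> (SN - {emp})"

text \<open>Formal operations on numerators and denominators. Together with \<open>lessF\<close>
  they involve natural numbers alone, so they are the same for every field and carry relations
  between fractions from one field to another.\<close>

definition addF :: "'c \<times> 'c \<times> 'c \<Rightarrow> 'c \<times> 'c \<times> 'c \<Rightarrow> 'c \<times> 'c \<times> 'c" where
  "addF = (\<lambda>(m, n, d) (m', n', d'). (nadd (nmult m d') (nmult m' d), nadd (nmult n d') (nmult n' d), nmult d d'))"

definition mulF :: "'c \<times> 'c \<times> 'c \<Rightarrow> 'c \<times> 'c \<times> 'c \<Rightarrow> 'c \<times> 'c \<times> 'c" where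
  "mulF = (\<lambda>(m, n, d) (m', n', d'). (nadd (nmult m m') (nmult n n'), nadd (nmult m n') (nmult n m'), nmult d d'))"

definition lessF :: "'c \<times> 'c \<times> 'c \<Rightarrow> 'c \<times> 'c \<times> 'c \<Rightarrow> bool" where
  "lessF = (\<lambda>(m, n, d) (m', n', d'). nadd (nmult m d') (nmult n' d) \<in> elts (nadd (nmult m' d) (nmult n d')))"

definition zeroF :: "'c \<times> 'c \<times> 'c" where "zeroF = (emp, emp, succ emp)"
definition oneF :: "'c \<times> 'c \<times> 'c" where "oneF = (succ emp, emp, succ emp)"

lemma zeroF_oneF: "zeroF \<in> F3" "oneF \<in> F3"
  using emp_not_succ[OF emp_V] by (simp_all add: F3_def zeroF_def oneF_def)

end

definition fr :: "('c \<Rightarrow> 'a::field) \<Rightarrow> 'c \<times> 'c \<times> 'c \<Rightarrow> 'a" where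
  "fr v = (\<lambda>(m, n, d). (v m - v n) / v d)"

lemma fr_triple: "fr v (m, n, d) = (v m - v n) / v d"
  by (simp add: fr_def)

text \<open>Instantiated by \<open>ev\<close> for each of the fields of real numbers and by
  \<open>qn\<close> for the hyperrationals, in which the arithmetic of \<open>QQ\<close> has been
  computed.\<close>

locale SN_embedding = THS mem for mem :: "'c \<Rightarrow> 'c \<Rightarrow> bool" +
  fixes v :: "'c \<Rightarrow> 'a::linordered_field"
  assumes v_emp: "v emp = 0"
    and v_nadd: "m \<in> SN \<Longrightarrow> n \<in> SN \<Longrightarrow> v (nadd m n) = v m + v n"
    and v_nmult: "m \<in> SN \<Longrightarrow> n \<in> SN \<Longrightarrow> v (nmult m n) = v m * v n"
    and v_less: "m \<in> SN \<Longrightarrow> n \<in> SN \<Longrightarrow> v m < v n \<longleftrightarrow> m \<in> elts n"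
begin

lemma v_pos: assumes "d \<in> SN" "d \<noteq> emp" shows "0 < v d"
  using NN_linear[OF emp_NN SN_NN[OF assms(1)]] assms v_less[OF SN_emp assms(1)] by (auto simp: v_emp)

lemma F3_cases:
  assumes "p \<in> F3" obtains m n d where "p = (m, n, d)" "m \<in> SN" "n \<in> SN" "d \<in> SN" "d \<noteq> emp" "0 < v d"
proof -
  obtain m n d where p: "p = (m, n, d)" by (cases p)
  then have "m \<in> SN" "n \<in> SN" "d \<in> SN" "d \<noteq> emp" using assms by (auto simp: F3_def)
  then show ?thesis using that p v_pos by blast
qed

lemma nmult_ne: "\<lbrakk>d \<in> SN; d \<noteq> emp; e \<in> SN; e \<noteq> emp\<rbrakk> \<Longrightarrow> nmult d e \<noteq> emp"
  using v_nmult[of d e] v_pos[of d] v_pos[of e] v_emp by (metis mult_pos_pos less_irrefl)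

lemma fr_add: assumes "p \<in> F3" "q \<in> F3" shows "addF p q \<in> F3" "fr v (addF p q) = fr v p + fr v q"
proof -
  obtain m n d where p: "p = (m, n, d)" "m \<in> SN" "n \<in> SN" "d \<in> SN" "d \<noteq> emp" "0 < v d" using F3_cases[OF assms(1)] .
  obtain m' n' d' where q: "q = (m', n', d')" "m' \<in> SN" "n' \<in> SN" "d' \<in> SN" "d' \<noteq> emp" "0 < v d'" using F3_cases[OF assms(2)] .
  show "addF p q \<in> F3" using p q nmult_ne by (simp add: F3_def addF_def SN_nadd SN_nmult)
  have z: "v d \<noteq> 0" "v d' \<noteq> 0" using p q by auto
  show "fr v (addF p q) = fr v p + fr v q"
    unfolding p(1) q(1) addF_def fr_def split add_frac_eq[OF z] using p(2-4) q(2-4)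
    by (simp add: v_nadd v_nmult SN_nadd SN_nmult algebra_simps)
qed

lemma fr_mult: assumes "p \<in> F3" "q \<in> F3" shows "mulF p q \<in> F3" "fr v (mulF p q) = fr v p * fr v q"
proof -
  obtain m n d where p: "p = (m, n, d)" "m \<in> SN" "n \<in> SN" "d \<in> SN" "d \<noteq> emp" "0 < v d" using F3_cases[OF assms(1)] .
  obtain m' n' d' where q: "q = (m', n', d')" "m' \<in> SN" "n' \<in> SN" "d' \<in> SN" "d' \<noteq> emp" "0 < v d'" using F3_cases[OF assms(2)] .
  show "mulF p q \<in> F3" using p q nmult_ne by (simp add: F3_def mulF_def SN_nadd SN_nmult)
  show "fr v (mulF p q) = fr v p * fr v q"
    unfolding p(1) q(1) mulF_def fr_def split times_divide_times_eq using p(2-4) q(2-4)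
    by (simp add: v_nadd v_nmult SN_nadd SN_nmult algebra_simps)
qed

lemma fr_less: assumes "p \<in> F3" "q \<in> F3" shows "fr v p < fr v q \<longleftrightarrow> lessF p q"
proof -
  obtain m n d where p: "p = (m, n, d)" "m \<in> SN" "n \<in> SN" "d \<in> SN" "d \<noteq> emp" "0 < v d" using F3_cases[OF assms(1)] .
  obtain m' n' d' where q: "q = (m', n', d')" "m' \<in> SN" "n' \<in> SN" "d' \<in> SN" "d' \<noteq> emp" "0 < v d'" using F3_cases[OF assms(2)] .
  have "fr v p < fr v q \<longleftrightarrow> (v m - v n) * v d' < (v m' - v n') * v d"
    unfolding p(1) q(1) fr_triple using p(6) q(6) by (simp add: pos_divide_less_eq pos_less_divide_eq)
  also have "\<dots> \<longleftrightarrow> v m * v d' + v n' * v d < v m' * v d + v n * v d'" by (simp add: algebra_simps)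
  also have "\<dots> \<longleftrightarrow> v (nadd (nmult m d') (nmult n' d)) < v (nadd (nmult m' d) (nmult n d'))"
    using p q by (simp add: v_nadd v_nmult SN_nadd SN_nmult)
  also have "\<dots> \<longleftrightarrow> lessF p q"
    unfolding p(1) q(1) lessF_def split using p q by (intro v_less SN_nadd SN_nmult)
  finally show ?thesis .
qed

lemma fr_eq: "p \<in> F3 \<Longrightarrow> q \<in> F3 \<Longrightarrow> fr v p = fr v q \<longleftrightarrow> \<not> lessF p q \<and> \<not> lessF q p"
  using fr_less[of p q] fr_less[of q p] by auto

lemma fr_0: "fr v zeroF = 0" by (simp add: fr_def zeroF_def)

lemma fr_1: "fr v oneF = 1"
  using v_pos[of "succ emp"] emp_not_succ[OF emp_V] by (simp add: fr_def oneF_def v_emp)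

lemma fr_minus: assumes "x \<in> fr v ` F3" shows "- x \<in> fr v ` F3"
proof -
  obtain p where "p \<in> F3" "x = fr v p" using assms by blast
  then obtain m n d where p: "x = fr v (m, n, d)" "m \<in> SN" "n \<in> SN" "d \<in> SN" "d \<noteq> emp" using F3_cases[of p] by metis
  have "- x = fr v (n, m, d)" unfolding p(1) fr_triple by (simp add: minus_divide_left)
  moreover have "(n, m, d) \<in> F3" using p by (simp add: F3_def)
  ultimately show ?thesis by blast
qed

lemma v_diff: assumes "m \<in> SN" "n \<in> SN" "n \<in> elts m" obtains k where "k \<in> SN" "k \<noteq> emp" "v k = v m - v n"
proof -
  obtain k where k: "k \<in> NN" "m = nadd n (succ k)"
    using mem_iff_nadd[of n m] assms SN_NN by blast
  have "m = nadd k (succ n)" using k nadd_commute[of n k] SN_NN[OF assms(2)] by simp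
  then have "k \<in> elts m" using mem_nadd[OF k(1) SN_NN[OF assms(2)]] by simp
  then have "succ k \<in> SN" using SN_mem[OF assms(1)] by simp
  moreover have "v m = v n + v (succ k)" using v_nadd[OF assms(2) calculation] k(2) by simp
  ultimately show ?thesis using that[of "succ k"] emp_not_succ[of k] k(1) by simp
qed

lemma fr_inverse: assumes "x \<in> fr v ` F3" "x \<noteq> 0" shows "inverse x \<in> fr v ` F3"
proof -
  obtain p where "p \<in> F3" "x = fr v p" using assms by blast
  then obtain m n d where p: "x = fr v (m, n, d)" "m \<in> SN" "n \<in> SN" "d \<in> SN" "d \<noteq> emp" using F3_cases[of p] by metis
  have inv: "inverse x = v d / (v m - v n)" unfolding p(1) fr_triple by simp
  have "m \<noteq> n" using assms(2) p(1) by (auto simp: fr_triple)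
  then consider "n \<in> elts m" | "m \<in> elts n" using NN_linear[of m n] p SN_NN by blast
  then show ?thesis
  proof cases
    case 1
    obtain k where k: "k \<in> SN" "k \<noteq> emp" "v k = v m - v n" using v_diff[OF p(2,3) 1] .
    have "inverse x = fr v (d, emp, k)" unfolding inv fr_triple k(3) by (simp add: v_emp)
    moreover have "(d, emp, k) \<in> F3" using p k by (simp add: F3_def)
    ultimately show ?thesis by blast
  next
    case 2
    obtain k where k: "k \<in> SN" "k \<noteq> emp" "v k = v n - v m" using v_diff[OF p(3,2) 2] .
    have "inverse x = - v d / v k" unfolding inv k(3) by (metis minus_diff_eq minus_divide_divide minus_minus)
    then have "inverse x = fr v (emp, d, k)" unfolding fr_triple by (simp add: v_emp)
    moreover have "(emp, d, k) \<in> F3" using p k by (simp add: F3_def)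
    ultimately show ?thesis by blast
  qed
qed

end

section \<open>The standard numbers in a field of real numbers: embedding, Archimedean property,
  density\<close>

definition cE :: "'i itself \<Rightarrow> 'c" where
  "cE t = (SOME E. class_structure.is_function mem0 E \<and> Domain (class_structure.graph mem0 E) = class_structure.SN mem0 \<and>
     class_structure.app mem0 E (class_structure.emp mem0) = \<zero>\<^bsub>cF t\<^esub> \<and>
     (\<forall>n\<in>class_structure.SN mem0. class_structure.app mem0 E n \<in> carrier (cF t) \<and>
       class_structure.app mem0 E (class_structure.succ mem0 n) = class_structure.app mem0 E n \<oplus>\<^bsub>cF t\<^esub> \<one>\<^bsub>cF t\<^esub>))"

definition ev :: "'c \<Rightarrow> ('c, 'i) rf" where "ev n = rN (class_structure.ap mem0 (cE TYPE('i)) n)"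

text \<open>The element \<open>x * d + n\<close> of the field, as a definable term. Comparing it
  with \<open>m\<close> compares \<open>x\<close> with the fraction \<open>(m - n) / d\<close>
  without subtraction or division.\<close>

definition tm :: "'i itself \<Rightarrow> 'c \<Rightarrow> 'c \<Rightarrow> 'c \<Rightarrow> 'c" where
  "tm t x d n = class_structure.ap mem0 (cA t) (class_structure.pair mem0
     (class_structure.ap mem0 (cM t) (class_structure.pair mem0 x (class_structure.ap mem0 (cE t) d)))
     (class_structure.ap mem0 (cE t) n))"

context
  fixes i :: "'i itself" and c :: "'c itself"
  assumes ok: "okf TYPE('c) TYPE('i)"
begin

interpretation THS "mem0 :: 'c \<Rightarrow> 'c \<Rightarrow> bool" by (rule okf_field(1)[OF ok])
interpretation G: field "cF TYPE('i) :: 'c ring" by (rule okf_field(2)[OF ok])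

lemma carrier_eq: "carrier (cF TYPE('i)) = elts (cR TYPE('i))" by (rule okf_field(3)[OF ok])

lemma carrier_V: "x \<in> carrier (cF TYPE('i)) \<Longrightarrow> x \<in> V" unfolding carrier_eq by (rule elts_V)

lemma ap_ops:
  assumes "x \<in> carrier (cF TYPE('i))" "y \<in> carrier (cF TYPE('i))"
  shows ap_add: "ap (cA TYPE('i)) (pair x y) = x \<oplus>\<^bsub>cF TYPE('i)\<^esub> y" and ap_mult: "ap (cM TYPE('i)) (pair x y) = x \<otimes>\<^bsub>cF TYPE('i)\<^esub> y"
proof -
  have b: "binary_op_on (cR TYPE('i)) (cA TYPE('i))" "binary_op_on (cR TYPE('i)) (cM TYPE('i))"
    using ok unfolding okf_def real_number_field_def linearly_ordered_field_def by blast+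
  have p: "pair x y \<in> {pair x y | x y. x \<in> elts (cR TYPE('i)) \<and> y \<in> elts (cR TYPE('i))}" using assms carrier_eq by blast
  have f: "is_function F \<and> pair x y \<in> Domain (graph F)" if "binary_op_on (cR TYPE('i)) F" for F
    using that p unfolding binary_op_on_def by (elim conjE) (simp only:)
  show "ap (cA TYPE('i)) (pair x y) = x \<oplus>\<^bsub>cF TYPE('i)\<^esub> y" "ap (cM TYPE('i)) (pair x y) = x \<otimes>\<^bsub>cF TYPE('i)\<^esub> y"
    using ap_eq f[OF b(1)] f[OF b(2)] by (simp_all add: cF_def ring_of_def)
qed

lemma le_iff: "\<lbrakk>x \<in> carrier (cF TYPE('i)); y \<in> carrier (cF TYPE('i))\<rbrakk> \<Longrightarrow> pair x y \<in> elts (cL TYPE('i)) \<longleftrightarrow> (rN x :: ('c, 'i) rf) \<le> rN y"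
  using rN_le[OF ok, of x y] carrier_V by (simp add: graph_iff)

lemma ex_cE: "\<exists>E. is_function E \<and> Domain (graph E) = SN \<and> app E emp = \<zero>\<^bsub>cF TYPE('i)\<^esub> \<and>
  (\<forall>n\<in>SN. app E n \<in> carrier (cF TYPE('i)) \<and> app E (succ n) = app E n \<oplus>\<^bsub>cF TYPE('i)\<^esub> \<one>\<^bsub>cF TYPE('i)\<^esub>)"
proof -
  \<comment> \<open>(DC) wants a successor for every set, so the relation is continued by the
    identity outside the field.\<close>
  let ?P = "\<lambda>x y. (x \<in> elts (cR TYPE('i)) \<longrightarrow> y = ap (cA TYPE('i)) (pair x \<one>\<^bsub>cF TYPE('i)\<^esub>)) \<and> (x \<notin> elts (cR TYPE('i)) \<longrightarrow> y = x)"
  have "\<exists>F. is_function F \<and> Domain (graph F) = SN \<and> app F emp = \<zero>\<^bsub>cF TYPE('i)\<^esub> \<and> (\<forall>n\<in>SN. ?P (app F n) (app F (succ n)))"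
  proof (rule dependent_choice)
    show "Def UNIV (\<lambda>s. ?P (s 0) (s (Suc 0)))" by (intro defn)
    show "\<exists>y\<in>V. ?P x y" if "x \<in> V" for x
    proof (cases "x \<in> elts (cR TYPE('i))")
      case True
      then have x: "x \<in> carrier (cF TYPE('i))" using carrier_eq by simp
      show ?thesis using True ap_add[OF x G.one_closed] carrier_V[OF G.a_closed[OF x G.one_closed]] by auto
    qed (use that in auto)
    show "\<zero>\<^bsub>cF TYPE('i)\<^esub> \<in> V" by (rule carrier_V) simp
  qed
  then obtain E where E: "is_function E" "Domain (graph E) = SN" "app E emp = \<zero>\<^bsub>cF TYPE('i)\<^esub>"
    "\<And>n. n \<in> SN \<Longrightarrow> ?P (app E n) (app E (succ n))" by blast
  have V: "n \<in> SN \<Longrightarrow> app E n \<in> V" for n using app_mem[OF E(1)] E(2) by blast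
  have eq: "app E n = ap E n" if "n \<in> SN" for n using ap_eq[OF E(1)] E(2) that by simp
  have step: "app E (succ n) = app E n \<oplus>\<^bsub>cF TYPE('i)\<^esub> \<one>\<^bsub>cF TYPE('i)\<^esub>" if "n \<in> SN" "app E n \<in> carrier (cF TYPE('i))" for n
    using E(4)[OF that(1)] that(2) ap_add[OF that(2) G.one_closed] carrier_eq by simp
  have C: "app E n \<in> carrier (cF TYPE('i))" if "n \<in> SN" for n
  proof (rule SN_induct_via[where P = "\<lambda>n. ap E n \<in> elts (cR TYPE('i))" and Q = "\<lambda>n. app E n \<in> carrier (cF TYPE('i))", OF _ _ _ _ that])
    show "Def UNIV (\<lambda>s. ap E (s 0) \<in> elts (cR TYPE('i)))" by (intro defn)
    show "app E (succ n) \<in> carrier (cF TYPE('i))" if "n \<in> SN" "app E n \<in> carrier (cF TYPE('i))" for n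
      unfolding step[OF that] using that(2) by (rule G.a_closed) simp
  qed (use eq carrier_eq E(3) in auto)
  then show ?thesis using E(1-3) step by blast
qed

lemma cE:
  shows "is_function (cE TYPE('i) :: 'c)" "Domain (graph (cE TYPE('i))) = SN" "app (cE TYPE('i)) emp = \<zero>\<^bsub>cF TYPE('i)\<^esub>"
    and "n \<in> SN \<Longrightarrow> app (cE TYPE('i)) n \<in> carrier (cF TYPE('i))"
    and "n \<in> SN \<Longrightarrow> app (cE TYPE('i)) (succ n) = app (cE TYPE('i)) n \<oplus>\<^bsub>cF TYPE('i)\<^esub> \<one>\<^bsub>cF TYPE('i)\<^esub>"
  using someI_ex[OF ex_cE] unfolding cE_def[symmetric] by blast+

lemma ap_cE: "n \<in> SN \<Longrightarrow> ap (cE TYPE('i)) n = app (cE TYPE('i)) n"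
  using ap_eq[OF cE(1)] cE(2) by simp

lemma en_carrier: "n \<in> SN \<Longrightarrow> ap (cE TYPE('i)) n \<in> carrier (cF TYPE('i))"
  using ap_cE cE(4) by simp

lemma ev_emp: "(ev emp :: ('c, 'i) rf) = 0"
  unfolding ev_def ap_cE[OF SN_emp] cE(3) by (rule rN_0[OF ok])

lemma ev_succ: assumes n: "n \<in> SN" shows "(ev (succ n) :: ('c, 'i) rf) = ev n + 1"
  unfolding ev_def ap_cE[OF n] ap_cE[OF SN_succ[OF n]] cE(5)[OF n]
  by (simp add: rN_add[OF ok cE(4)[OF n] G.one_closed, symmetric] rN_1[OF ok])

lemma ev_nadd: assumes m: "m \<in> SN" and n: "n \<in> SN" shows "(ev (nadd m n) :: ('c, 'i) rf) = ev m + ev n"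
proof (rule SN_induct_via[where P = "\<lambda>n. ap (cE TYPE('i)) (nadd m n) = ap (cA TYPE('i)) (pair (ap (cE TYPE('i)) m) (ap (cE TYPE('i)) n))"
      and Q = "\<lambda>n. (ev (nadd m n) :: ('c, 'i) rf) = ev m + ev n", OF _ _ _ _ n])
  show "Def UNIV (\<lambda>s. ap (cE TYPE('i)) (nadd m (s 0)) = ap (cA TYPE('i)) (pair (ap (cE TYPE('i)) m) (ap (cE TYPE('i)) (s 0))))"
    by (intro defn)
  show "ap (cE TYPE('i)) (nadd m n) = ap (cA TYPE('i)) (pair (ap (cE TYPE('i)) m) (ap (cE TYPE('i)) n)) \<longleftrightarrow>
    (ev (nadd m n) :: ('c, 'i) rf) = ev m + ev n" if "n \<in> SN" for n
    using that m by (simp add: ev_def ap_add en_carrier rN_add[OF ok] rN_eq[OF ok] SN_nadd)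
qed (simp_all add: ev_emp ev_succ SN_nadd m SN_NN add.assoc)

lemma ev_nmult: assumes m: "m \<in> SN" and n: "n \<in> SN" shows "(ev (nmult m n) :: ('c, 'i) rf) = ev m * ev n"
proof (rule SN_induct_via[where P = "\<lambda>n. ap (cE TYPE('i)) (nmult m n) = ap (cM TYPE('i)) (pair (ap (cE TYPE('i)) m) (ap (cE TYPE('i)) n))"
      and Q = "\<lambda>n. (ev (nmult m n) :: ('c, 'i) rf) = ev m * ev n", OF _ _ _ _ n])
  show "Def UNIV (\<lambda>s. ap (cE TYPE('i)) (nmult m (s 0)) = ap (cM TYPE('i)) (pair (ap (cE TYPE('i)) m) (ap (cE TYPE('i)) (s 0))))"
    by (intro defn)
  show "ap (cE TYPE('i)) (nmult m n) = ap (cM TYPE('i)) (pair (ap (cE TYPE('i)) m) (ap (cE TYPE('i)) n)) \<longleftrightarrow>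
    (ev (nmult m n) :: ('c, 'i) rf) = ev m * ev n" if "n \<in> SN" for n
    using that m by (simp add: ev_def ap_mult en_carrier rN_mult[OF ok] rN_eq[OF ok] SN_nmult)
qed (simp_all add: ev_emp ev_succ ev_nadd SN_nmult m SN_NN distrib_left)

lemma ev_mem: assumes n: "n \<in> SN" shows "\<forall>m\<in>elts n. (ev m :: ('c, 'i) rf) < ev n"
proof (rule SN_induct_via[where P = "\<lambda>n. \<forall>m\<in>elts n. pair (ap (cE TYPE('i)) n) (ap (cE TYPE('i)) m) \<notin> elts (cL TYPE('i))"
      and Q = "\<lambda>n. \<forall>m\<in>elts n. (ev m :: ('c, 'i) rf) < ev n", OF _ _ _ _ n])
  show "Def UNIV (\<lambda>s. \<forall>m\<in>elts (s 0). pair (ap (cE TYPE('i)) (s 0)) (ap (cE TYPE('i)) m) \<notin> elts (cL TYPE('i)))"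
    by (intro defn)
  show "(\<forall>m\<in>elts n. pair (ap (cE TYPE('i)) n) (ap (cE TYPE('i)) m) \<notin> elts (cL TYPE('i))) \<longleftrightarrow>
    (\<forall>m\<in>elts n. (ev m :: ('c, 'i) rf) < ev n)" if n: "n \<in> SN" for n
  proof (rule ball_cong[OF refl])
    fix m assume "m \<in> elts n"
    then have "m \<in> SN" using SN_mem n by blast
    then show "pair (ap (cE TYPE('i)) n) (ap (cE TYPE('i)) m) \<notin> elts (cL TYPE('i)) \<longleftrightarrow> (ev m :: ('c, 'i) rf) < ev n"
      using le_iff[OF en_carrier en_carrier] n by (simp add: ev_def not_le)
  qed
  show "\<forall>m\<in>elts (succ n). (ev m :: ('c, 'i) rf) < ev (succ n)" if n: "n \<in> SN" and IH: "\<forall>m\<in>elts n. (ev m :: ('c, 'i) rf) < ev n" for n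
  proof
    fix m assume "m \<in> elts (succ n)"
    then have "m = n \<or> m \<in> elts n" using SN_V[OF n] by simp
    then have "(ev m :: ('c, 'i) rf) \<le> ev n" using IH by auto
    also have "\<dots> < ev n + 1" by simp
    finally show "(ev m :: ('c, 'i) rf) < ev (succ n)" unfolding ev_succ[OF n] .
  qed
qed simp

lemma ev_embedding: "SN_embedding mem0 (ev :: 'c \<Rightarrow> ('c, 'i) rf)"
proof (rule SN_embedding.intro[OF okf_field(1)[OF ok] SN_embedding_axioms.intro])
  fix m n :: 'c assume mn: "m \<in> SN" "n \<in> SN"
  show "(ev m :: ('c, 'i) rf) < ev n \<longleftrightarrow> m \<in> elts n"
    using NN_linear[OF SN_NN[OF mn(1)] SN_NN[OF mn(2)]] ev_mem[OF mn(1)] ev_mem[OF mn(2)] by (auto dest: less_asym)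
qed (simp_all add: ev_emp ev_nadd ev_nmult)

interpretation e: SN_embedding mem0 "ev :: 'c \<Rightarrow> ('c, 'i) rf" by (rule ev_embedding)

lemma tm:
  assumes "x \<in> carrier (cF TYPE('i))" "d \<in> SN" "n \<in> SN"
  shows "tm TYPE('i) x d n \<in> carrier (cF TYPE('i))" "(rN (tm TYPE('i) x d n) :: ('c, 'i) rf) = rN x * ev d + ev n"
  using assms by (simp_all add: tm_def ap_mult ap_add en_carrier ev_def rN_mult[OF ok] rN_add[OF ok])

lemma tm_fr:
  assumes "x \<in> carrier (cF TYPE('i))" and p: "(m, n, d) \<in> F3"
  shows "tm TYPE('i) x d n = ap (cE TYPE('i)) m \<longleftrightarrow> (rN x :: ('c, 'i) rf) = fr ev (m, n, d)"
    and "pair (tm TYPE('i) x d n) (ap (cE TYPE('i)) m) \<in> elts (cL TYPE('i)) \<longleftrightarrow> (rN x :: ('c, 'i) rf) \<le> fr ev (m, n, d)"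
proof -
  have S: "m \<in> SN" "n \<in> SN" "d \<in> SN" and d0: "0 < (ev d :: ('c, 'i) rf)" using p e.v_pos by (auto simp: F3_def)
  note t = tm[OF assms(1) S(3,2)]
  have "tm TYPE('i) x d n = ap (cE TYPE('i)) m \<longleftrightarrow> (rN x * ev d + ev n :: ('c, 'i) rf) = ev m"
    unfolding rN_eq[OF ok t(1) en_carrier[OF S(1)], symmetric] t(2) unfolding ev_def by (rule refl)
  also have "\<dots> \<longleftrightarrow> rN x * ev d = ev m - (ev n :: ('c, 'i) rf)" by (simp add: eq_diff_eq)
  also have "\<dots> \<longleftrightarrow> (rN x :: ('c, 'i) rf) = fr ev (m, n, d)" unfolding fr_triple using d0 by (simp add: eq_divide_eq)
  finally show "tm TYPE('i) x d n = ap (cE TYPE('i)) m \<longleftrightarrow> (rN x :: ('c, 'i) rf) = fr ev (m, n, d)" .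
  have "pair (tm TYPE('i) x d n) (ap (cE TYPE('i)) m) \<in> elts (cL TYPE('i)) \<longleftrightarrow> (rN x * ev d + ev n :: ('c, 'i) rf) \<le> ev m"
    unfolding le_iff[OF t(1) en_carrier[OF S(1)]] t(2) unfolding ev_def by (rule refl)
  also have "\<dots> \<longleftrightarrow> rN x * ev d \<le> ev m - (ev n :: ('c, 'i) rf)" by (simp add: le_diff_eq)
  also have "\<dots> \<longleftrightarrow> (rN x :: ('c, 'i) rf) \<le> fr ev (m, n, d)" unfolding fr_triple using d0 by (simp add: pos_le_divide_eq)
  finally show "pair (tm TYPE('i) x d n) (ap (cE TYPE('i)) m) \<in> elts (cL TYPE('i)) \<longleftrightarrow> (rN x :: ('c, 'i) rf) \<le> fr ev (m, n, d)" .
qed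

text \<open>Completeness holds for classes of the model only, so each use has to present its set of
  elements as a definable class.\<close>

lemma rf_sup:
  assumes "isclass X" "X \<subseteq> carrier (cF TYPE('i))" "X \<noteq> {}" and ub: "\<forall>x\<in>X. rN x \<le> (b :: ('c, 'i) rf)"
  shows "\<exists>s :: ('c, 'i) rf. (\<forall>x\<in>X. rN x \<le> s) \<and> (\<forall>b. (\<forall>x\<in>X. rN x \<le> b) \<longrightarrow> s \<le> b)"
proof -
  obtain Z where Z: "elts Z = X" using assms(1) unfolding isclass_def by blast
  have U: "u \<in> upper_bounds (cR TYPE('i)) (cL TYPE('i)) Z \<longleftrightarrow> u \<in> carrier (cF TYPE('i)) \<and> (\<forall>x\<in>X. (rN x :: ('c, 'i) rf) \<le> rN u)" for u
    unfolding upper_bounds_def Z mem_Collect_eq carrier_eq[symmetric] using rN_le[OF ok, of _ u] assms(2) by blast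
  obtain b0 where b0: "b0 \<in> carrier (cF TYPE('i))" "b = rN b0" using rN_cases[OF ok] .
  have "b0 \<in> upper_bounds (cR TYPE('i)) (cL TYPE('i)) Z" using U b0 ub by simp
  moreover have "order_complete (cR TYPE('i)) (cL TYPE('i))" using ok unfolding okf_def real_number_field_def by blast
  ultimately obtain s where s: "s \<in> upper_bounds (cR TYPE('i)) (cL TYPE('i)) Z"
    "\<forall>b\<in>upper_bounds (cR TYPE('i)) (cL TYPE('i)) Z. (s, b) \<in> graph (cL TYPE('i))"
    unfolding order_complete_def using assms(2,3) Z carrier_eq by blast
  have sC: "s \<in> carrier (cF TYPE('i))" using s(1) U by blast
  have "rN s \<le> b'" if b': "\<forall>x\<in>X. rN x \<le> (b' :: ('c, 'i) rf)" for b'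
  proof -
    obtain u where u: "u \<in> carrier (cF TYPE('i))" "b' = rN u" using rN_cases[OF ok] .
    then have "(s, u) \<in> graph (cL TYPE('i))" using s(2) U b' by simp
    then show ?thesis using rN_le[OF ok sC u(1)] u(2) by simp
  qed
  then show ?thesis using s(1) U by blast
qed

text \<open>If the standard numbers were bounded they would have a supremum \<open>s\<close>; since
  they are closed under adding one, \<open>s - 1\<close> would be an upper bound too.\<close>

lemma rf_archimedean: "\<exists>n\<in>SN. (x :: ('c, 'i) rf) < ev n"
proof (rule ccontr)
  assume "\<not> (\<exists>n\<in>SN. x < ev n)"
  then have b: "\<forall>n\<in>SN. ev n \<le> x" by (simp add: not_less)
  let ?X = "{y \<in> elts (cR TYPE('i)). \<exists>n\<in>V. n \<in> SN \<and> y = ap (cE TYPE('i)) n}"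
  have X: "?X = ap (cE TYPE('i)) ` SN"
    using en_carrier carrier_eq SN_V by blast
  have eq: "(\<forall>y\<in>?X. rN y \<le> t) \<longleftrightarrow> (\<forall>n\<in>SN. ev n \<le> t)" for t :: "('c, 'i) rf"
    unfolding X ev_def by blast
  have "\<exists>s :: ('c, 'i) rf. (\<forall>x\<in>?X. rN x \<le> s) \<and> (\<forall>b. (\<forall>x\<in>?X. rN x \<le> b) \<longrightarrow> s \<le> b)"
  proof (rule rf_sup)
    show "isclass ?X" by (intro isclass_Collect isclass_elts defn)
    show "?X \<subseteq> carrier (cF TYPE('i))" using carrier_eq by blast
    show "?X \<noteq> {}" unfolding X using SN_emp by blast
    show "\<forall>y\<in>?X. rN y \<le> x" unfolding eq by (rule b)
  qed
  then obtain s :: "('c, 'i) rf" where s: "\<forall>n\<in>SN. ev n \<le> s" "\<And>b. \<forall>n\<in>SN. ev n \<le> b \<Longrightarrow> s \<le> b" unfolding eq by blast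
  have "s \<le> s - 1"
  proof (rule s(2), intro ballI)
    fix n assume "n \<in> SN"
    then have "ev n + 1 \<le> s" using s(1) ev_succ SN_succ by metis
    then show "ev n \<le> s - 1" by (simp add: le_diff_eq)
  qed
  then show False by simp
qed

lemma rf_floor: assumes "0 \<le> (z :: ('c, 'i) rf)" shows "\<exists>a\<in>SN. ev a \<le> z \<and> z < ev (succ a)"
proof -
  obtain z0 where z0: "z0 \<in> carrier (cF TYPE('i))" "z = rN z0" using rN_cases[OF ok] .
  obtain n where n: "n \<in> SN" "z < ev n" using rf_archimedean by blast
  \<comment> \<open>The conclusion does not depend on \<open>n\<close>, so it enters the induction
    formula as a constant truth value, and only \<open>z < ev n\<close> has to be translated into
    the language.\<close>
  define B where "B \<longleftrightarrow> (\<exists>a\<in>SN. ev a \<le> z \<and> z < ev (succ a))"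
  have "z < ev n \<longrightarrow> B"
  proof (rule SN_induct_via[where P = "\<lambda>n. pair (ap (cE TYPE('i)) n) z0 \<notin> elts (cL TYPE('i)) \<longrightarrow> B"
        and Q = "\<lambda>n. z < ev n \<longrightarrow> B", OF _ _ _ _ n(1)])
    show "Def UNIV (\<lambda>s. pair (ap (cE TYPE('i)) (s 0)) z0 \<notin> elts (cL TYPE('i)) \<longrightarrow> B)" by (intro defn)
    show "(pair (ap (cE TYPE('i)) n) z0 \<notin> elts (cL TYPE('i)) \<longrightarrow> B) \<longleftrightarrow> (z < ev n \<longrightarrow> B)" if "n \<in> SN" for n
      using le_iff[OF en_carrier[OF that] z0(1)] z0(2) by (simp add: ev_def not_le)
    show "z < ev emp \<longrightarrow> B" using assms by (simp add: ev_emp not_less)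
    show "z < ev (succ n) \<longrightarrow> B" if "n \<in> SN" "z < ev n \<longrightarrow> B" for n
      using that unfolding B_def by (meson not_le)
  qed
  then show ?thesis using n(2) unfolding B_def by blast
qed

lemma rf_dense: assumes "(x :: ('c, 'i) rf) < y" shows "\<exists>p\<in>F3. x < fr ev p \<and> fr ev p < y"
proof -
  obtain d where d: "d \<in> SN" "1 / (y - x) < ev d" using rf_archimedean by blast
  have d0: "0 < (ev d :: ('c, 'i) rf)" using d(2) assms by (meson diff_gt_0_iff_gt less_trans zero_less_divide_1_iff)
  then have de: "d \<noteq> emp" using ev_emp by auto
  have d1: "1 < ev d * (y - x)" using d(2) assms by (simp add: pos_divide_less_eq)
  \<comment> \<open>Floors are available for nonnegative elements, so \<open>x * ev d\<close> is
    shifted by \<open>ev k\<close>; the shift reappears as the subtrahend of the fraction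
    \<open>(succ a, k, d)\<close>.\<close>
  obtain k where k: "k \<in> SN" "- (x * ev d) < ev k" using rf_archimedean by blast
  have "0 \<le> x * ev d + ev k" using k(2) by (simp add: minus_less_iff less_imp_le)
  then obtain a where a: "a \<in> SN" "ev a \<le> x * ev d + ev k" "x * ev d + ev k < ev (succ a)" using rf_floor by blast
  have "x * ev d < ev (succ a) - ev k" using a(3) by (simp add: less_diff_eq)
  then have 1: "x < fr ev (succ a, k, d)" unfolding fr_triple using d0 by (simp add: pos_less_divide_eq)
  have "ev (succ a) - ev k \<le> x * ev d + 1" using a(2) by (simp add: ev_succ[OF a(1)] algebra_simps)
  also have "\<dots> < x * ev d + ev d * (y - x)" using d1 by simp
  also have "\<dots> = y * ev d" by (simp add: algebra_simps)
  finally have 2: "fr ev (succ a, k, d) < y" unfolding fr_triple using d0 by (simp add: pos_divide_less_eq)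
  have "(succ a, k, d) \<in> F3" using a(1) k(1) d(1) de by (simp add: F3_def)
  then show ?thesis using 1 2 by blast
qed

text \<open>By density a fraction below a sum is at most a sum of fractions below the summands. On
  the right the field enters only through the cuts of \<open>x\<close> and \<open>y\<close>, since
  \<open>\<not> lessF (addF q r) p\<close> is a relation of natural numbers; that makes addition
  transferable between fields.\<close>

lemma less_add_iff:
  fixes x y :: "('c, 'i) rf"
  assumes p: "p \<in> F3"
  shows "fr ev p < x + y \<longleftrightarrow> (\<exists>q\<in>F3. \<exists>r\<in>F3. fr ev q < x \<and> fr ev r < y \<and> \<not> lessF (addF q r) p)"
proof
  assume "fr ev p < x + y"
  then have "fr ev p - y < x" by (simp add: diff_less_eq)
  then obtain q where q: "q \<in> F3" "fr ev p - y < fr ev q" "fr ev q < x" using rf_dense by blast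
  have "fr ev p - fr ev q < y" using q(2) by (simp add: algebra_simps)
  then obtain r where r: "r \<in> F3" "fr ev p - fr ev q < (fr ev r :: ('c, 'i) rf)" "fr ev r < y" using rf_dense by blast
  have "fr ev p < (fr ev (addF q r) :: ('c, 'i) rf)" using r(2) e.fr_add[OF q(1) r(1)] by (simp add: algebra_simps)
  then have "\<not> lessF (addF q r) p" using e.fr_less[OF e.fr_add(1)[OF q(1) r(1)] p] by simp
  then show "\<exists>q\<in>F3. \<exists>r\<in>F3. fr ev q < x \<and> fr ev r < y \<and> \<not> lessF (addF q r) p" using q r by blast
next
  assume "\<exists>q\<in>F3. \<exists>r\<in>F3. fr ev q < x \<and> fr ev r < y \<and> \<not> lessF (addF q r) p"
  then obtain q r where q: "q \<in> F3" "fr ev q < x" and r: "r \<in> F3" "fr ev r < y" and l: "\<not> lessF (addF q r) p" by blast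
  have "fr ev p \<le> (fr ev q + fr ev r :: ('c, 'i) rf)"
    using l e.fr_less[OF e.fr_add(1)[OF q(1) r(1)] p] e.fr_add(2)[OF q(1) r(1)] by (simp add: not_less)
  then show "fr ev p < x + y" using add_strict_mono[OF q(2) r(2)] by simp
qed

lemma less_mult_iff:
  fixes x y :: "('c, 'i) rf"
  assumes p: "p \<in> F3" and x: "0 < x" and y: "0 < y"
  shows "fr ev p < x * y \<longleftrightarrow>
    (\<exists>q\<in>F3. \<exists>r\<in>F3. lessF zeroF q \<and> lessF zeroF r \<and> fr ev q < x \<and> fr ev r < y \<and> \<not> lessF (mulF q r) p)"
proof
  assume *: "fr ev p < x * y"
  \<comment> \<open>The maximum with 0 forces the chosen factor to be positive, so that it may be
    used as a divisor when the second factor is chosen.\<close>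
  have "max 0 (fr ev p / y) < x" using * x y by (simp add: pos_divide_less_eq)
  then obtain q where q: "q \<in> F3" "max 0 (fr ev p / y) < fr ev q" "fr ev q < x" using rf_dense by blast
  have q0: "0 < (fr ev q :: ('c, 'i) rf)" "fr ev p / y < fr ev q" using q(2) by simp_all
  have "fr ev p < y * fr ev q" using q0(2) y by (simp add: pos_divide_less_eq mult.commute)
  then have "max 0 (fr ev p / fr ev q) < y" using q0(1) y by (simp add: pos_divide_less_eq)
  then obtain r where r: "r \<in> F3" "max 0 (fr ev p / fr ev q) < (fr ev r :: ('c, 'i) rf)" "fr ev r < y" using rf_dense by blast
  have r0: "0 < (fr ev r :: ('c, 'i) rf)" "fr ev p / fr ev q < (fr ev r :: ('c, 'i) rf)" using r(2) by simp_all
  have "fr ev p < (fr ev (mulF q r) :: ('c, 'i) rf)"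
    using r0(2) q0(1) e.fr_mult[OF q(1) r(1)] by (simp add: pos_divide_less_eq mult.commute)
  then have "\<not> lessF (mulF q r) p" using e.fr_less[OF e.fr_mult(1)[OF q(1) r(1)] p] by simp
  moreover have "lessF zeroF q" "lessF zeroF r"
    using e.fr_less[OF zeroF_oneF(1) q(1)] e.fr_less[OF zeroF_oneF(1) r(1)] q0 r0 e.fr_0 by simp_all
  ultimately show "\<exists>q\<in>F3. \<exists>r\<in>F3. lessF zeroF q \<and> lessF zeroF r \<and> fr ev q < x \<and> fr ev r < y \<and> \<not> lessF (mulF q r) p"
    using q r by blast
next
  assume "\<exists>q\<in>F3. \<exists>r\<in>F3. lessF zeroF q \<and> lessF zeroF r \<and> fr ev q < x \<and> fr ev r < y \<and> \<not> lessF (mulF q r) p"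
  then obtain q r where q: "q \<in> F3" "fr ev q < x" "lessF zeroF q" and r: "r \<in> F3" "fr ev r < y" "lessF zeroF r"
    and l: "\<not> lessF (mulF q r) p" by blast
  have q0: "0 < (fr ev q :: ('c, 'i) rf)" and r0: "0 < (fr ev r :: ('c, 'i) rf)"
    using e.fr_less[OF zeroF_oneF(1) q(1)] e.fr_less[OF zeroF_oneF(1) r(1)] q(3) r(3) e.fr_0 by simp_all
  have "fr ev p \<le> (fr ev q * fr ev r :: ('c, 'i) rf)"
    using l e.fr_less[OF e.fr_mult(1)[OF q(1) r(1)] p] e.fr_mult(2)[OF q(1) r(1)] by (simp add: not_less)
  also have "\<dots> < x * y" using q r q0 r0 by (intro mult_strict_mono) auto
  finally show "fr ev p < x * y" .
qed

end

section \<open>The prime subfield and its isomorphism with the standard rationals\<close>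

context THS
begin

lemma F3_iff: "(m, n, d) \<in> F3 \<longleftrightarrow> m \<in> SN \<and> n \<in> SN \<and> d \<in> SN \<and> d \<noteq> emp"
  by (auto simp: F3_def)

lemma bex_F3: "(\<exists>m\<in>V. \<exists>n\<in>V. \<exists>d\<in>V. (m \<in> SN \<and> n \<in> SN \<and> d \<in> SN \<and> d \<noteq> emp) \<and> P m n d) \<longleftrightarrow>
    (\<exists>m n d. (m, n, d) \<in> F3 \<and> P m n d)"
  unfolding F3_iff by (blast intro: SN_V)

lemma ball_F3: "(\<forall>m\<in>V. \<forall>n\<in>V. \<forall>d\<in>V. (m \<in> SN \<and> n \<in> SN \<and> d \<in> SN \<and> d \<noteq> emp) \<longrightarrow> P m n d) \<longleftrightarrow>
    (\<forall>m n d. (m, n, d) \<in> F3 \<longrightarrow> P m n d)"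
  unfolding F3_iff by (blast intro: SN_V)

lemma Def_reduced [defn]: "DT UNIV f \<Longrightarrow> DT UNIV g \<Longrightarrow> Def UNIV (\<lambda>s. reduced (f s) (g s))"
proof (rule Def_subst2[where P = reduced])
  have "reduced y e \<longleftrightarrow> (\<forall>c\<in>V. c \<in> NN \<longrightarrow> (\<exists>k\<in>V. k \<in> NN \<and> nmult c k = y) \<longrightarrow> (\<exists>k\<in>V. k \<in> NN \<and> nmult c k = e) \<longrightarrow> c = succ emp)" for y e
    unfolding reduced_def using NN_V by blast
  then show "Def UNIV (\<lambda>s. reduced (s 0) (s (Suc 0)))" by (simp only:) (intro defn)
qed

lemma SQ_cases:
  assumes "q \<in> QQ \<inter> S" obtains a b d where "q = pair (pair a b) d" "(a, b, d) \<in> F3" "a = emp \<or> b = emp" "reduced (nadd a b) d"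
proof -
  obtain a b d where q: "q = pair (pair a b) d" "a \<in> NN" "b \<in> NN" "d \<in> NN" "a = emp \<or> b = emp" "d \<noteq> emp" "reduced (nadd a b) d"
    using QQ_cases[of q] assms by blast
  then have "a \<in> SN \<and> b \<in> SN \<and> d \<in> SN" using QQ_S[OF q(2-4)] assms by simp
  then show ?thesis using that[of a b d] q by (simp add: F3_def)
qed

lemma isclass_SQ: "isclass (QQ \<inter> S)"
proof -
  have "isclass {q \<in> V. \<exists>a\<in>V. \<exists>b\<in>V. \<exists>d\<in>V. a \<in> SN \<and> b \<in> SN \<and> d \<in> SN \<and> q = pair (pair a b) d \<and> (a = emp \<or> b = emp) \<and> d \<noteq> emp \<and> reduced (nadd a b) d}"
    (is "isclass ?A") by (intro isclassI defn)
  moreover have "?A = QQ \<inter> S"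
  proof (intro equalityI subsetI)
    fix q assume "q \<in> ?A"
    then obtain a b d where q: "a \<in> SN" "b \<in> SN" "d \<in> SN" "q = pair (pair a b) d" "a = emp \<or> b = emp" "d \<noteq> emp" "reduced (nadd a b) d" by blast
    have N: "a \<in> NN" "b \<in> NN" "d \<in> NN" using q SN_NN by auto
    show "q \<in> QQ \<inter> S" unfolding q(4) Int_iff QQ_iff[OF N] QQ_S[OF N] using q by simp
  next
    fix q assume "q \<in> QQ \<inter> S"
    then obtain a b d where q: "q = pair (pair a b) d" "(a, b, d) \<in> F3" "a = emp \<or> b = emp" "reduced (nadd a b) d" by (rule SQ_cases)
    then have s: "a \<in> SN" "b \<in> SN" "d \<in> SN" "d \<noteq> emp" by (auto simp: F3_def)
    then have "a \<in> V" "b \<in> V" "d \<in> V" using SN_V by auto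
    then show "q \<in> ?A" using q s by auto
  qed
  ultimately show ?thesis by simp
qed

lemma nmult_one: assumes "c \<in> NN" "k \<in> NN" "nmult c k = succ emp" shows "c = succ emp"
proof -
  have ne: "emp \<noteq> succ emp" using emp_not_succ[OF emp_V] by metis
  have "c \<noteq> emp" using nmult_emp_left[OF assms(2)] assms(3) ne by metis
  then obtain c' where c: "c' \<in> NN" "c = succ c'" using NN_cases[OF assms(1)] by metis
  have "k \<noteq> emp" using nmult_emp[OF assms(1)] assms(3) ne by metis
  then obtain k' where k: "k' \<in> NN" "k = succ k'" using NN_cases[OF assms(2)] by metis
  have "succ (nadd (nmult c k') c') = succ emp" using assms(3) k c by simp
  then have n: "nadd (nmult c k') c' = emp" using NN_V[OF nadd_NN] by simp
  have "c' = emp"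
  proof (rule ccontr)
    assume "c' \<noteq> emp"
    then obtain c'' where "c'' \<in> NN" "c' = succ c''" using NN_cases[OF c(1)] by metis
    then show False using n emp_not_succ[OF NN_V[OF nadd_NN]] by simp
  qed
  then show ?thesis using c by simp
qed

lemma one_SQ: "pair (pair (succ emp) emp) (succ emp) \<in> QQ \<inter> S"
proof -
  have N: "succ emp \<in> NN" "emp \<in> NN" by simp_all
  have "reduced (succ emp) (succ emp)" unfolding reduced_def by (blast intro: nmult_one)
  then have "reduced (nadd (succ emp) emp) (succ emp)" by simp
  then show ?thesis unfolding Int_iff QQ_iff[OF N N(1)] QQ_S[OF N N(1)] using emp_not_succ[OF emp_V] by simp
qed

end

lemma qn_embedding: assumes T: "THS (mem0 :: 'c \<Rightarrow> 'c \<Rightarrow> bool)" shows "SN_embedding mem0 (qn :: 'c \<Rightarrow> 'c hn diff fract)"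
proof -
  interpret THS "mem0 :: 'c \<Rightarrow> 'c \<Rightarrow> bool" by (rule T)
  show ?thesis
    by (rule SN_embedding.intro[OF T SN_embedding_axioms.intro])
      (simp_all add: qn_emp[OF T] qn_nadd[OF T] qn_nmult[OF T] qn_less[OF T] SN_NN)
qed

context
  fixes i :: "'i itself" and c :: "'c itself"
  assumes ok: "okf TYPE('c) TYPE('i)"
begin

interpretation THS "mem0 :: 'c \<Rightarrow> 'c \<Rightarrow> bool" by (rule okf_field(1)[OF ok])
interpretation G: field "cF TYPE('i) :: 'c ring" by (rule okf_field(2)[OF ok])
interpretation e: SN_embedding mem0 "ev :: 'c \<Rightarrow> ('c, 'i) rf" by (rule ev_embedding[OF ok])
interpretation q: SN_embedding mem0 "qn :: 'c \<Rightarrow> 'c hn diff fract" by (rule qn_embedding[OF okf_field(1)[OF ok]])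

lemma ex_prime_class: "\<exists>K. \<forall>x. x \<in> elts K \<longleftrightarrow> x \<in> carrier (cF TYPE('i)) \<and> (rN x :: ('c, 'i) rf) \<in> fr ev ` F3"
proof -
  have "isclass {x \<in> elts (cR TYPE('i)). \<exists>m\<in>V. \<exists>n\<in>V. \<exists>d\<in>V. (m \<in> SN \<and> n \<in> SN \<and> d \<in> SN \<and> d \<noteq> emp) \<and> tm TYPE('i) x d n = ap (cE TYPE('i)) m}"
    (is "isclass ?K") unfolding tm_def by (intro isclass_Collect isclass_elts defn)
  then obtain K where K0: "elts K = ?K" unfolding isclass_def by blast
  have "x \<in> elts K \<longleftrightarrow> x \<in> carrier (cF TYPE('i)) \<and> (rN x :: ('c, 'i) rf) \<in> fr ev ` F3" for x
  proof (cases "x \<in> carrier (cF TYPE('i))")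
    case True
    have "x \<in> elts K \<longleftrightarrow> (\<exists>m n d. (m, n, d) \<in> F3 \<and> tm TYPE('i) x d n = ap (cE TYPE('i)) m)"
      unfolding K0 mem_Collect_eq bex_F3 using True carrier_eq[OF ok] by simp
    also have "\<dots> \<longleftrightarrow> (\<exists>m n d. (m, n, d) \<in> F3 \<and> (rN x :: ('c, 'i) rf) = fr ev (m, n, d))"
      using tm_fr(1)[OF ok True] by blast
    also have "\<dots> \<longleftrightarrow> (rN x :: ('c, 'i) rf) \<in> fr ev ` F3"
      unfolding image_iff Bex_def split_paired_Ex by (rule refl)
    finally show ?thesis using True by simp
  qed (simp add: K0 carrier_eq[OF ok])
  then show ?thesis by blast
qed

context
  fixes K :: 'c
  assumes K: "\<And>x. x \<in> elts K \<longleftrightarrow> x \<in> carrier (cF TYPE('i)) \<and> (rN x :: ('c, 'i) rf) \<in> fr ev ` F3"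
begin

lemma subring_K: "subring (elts K) (cF TYPE('i))"
proof (rule G.subringI)
  have add: "x + y \<in> fr ev ` F3" and mult: "x * y \<in> fr ev ` F3"
    if xy: "x \<in> fr ev ` F3" "y \<in> fr ev ` F3" for x y :: "('c, 'i) rf"
  proof -
    obtain p r where p: "p \<in> F3" "r \<in> F3" "x = fr ev p" "y = fr ev r" using xy by blast
    have "x + y = fr ev (addF p r)" "x * y = fr ev (mulF p r)" using e.fr_add(2) e.fr_mult(2) p by simp_all
    then show "x + y \<in> fr ev ` F3" "x * y \<in> fr ev ` F3" using e.fr_add(1)[OF p(1,2)] e.fr_mult(1)[OF p(1,2)] by blast+
  qed
  show "elts K \<subseteq> carrier (cF TYPE('i))" using K by blast
  have "(1 :: ('c, 'i) rf) \<in> fr ev ` F3" using e.fr_1 zeroF_oneF(2) by (metis imageI)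
  then show "\<one>\<^bsub>cF TYPE('i)\<^esub> \<in> elts K" unfolding K using rN_1[OF ok] by simp
  show "\<ominus>\<^bsub>cF TYPE('i)\<^esub> h \<in> elts K" if "h \<in> elts K" for h
    using that e.fr_minus[of "rN h"] unfolding K by (simp add: rN_minus[OF ok])
  show "h1 \<otimes>\<^bsub>cF TYPE('i)\<^esub> h2 \<in> elts K" if "h1 \<in> elts K" "h2 \<in> elts K" for h1 h2
    using that mult[of "rN h1" "rN h2"] unfolding K by (simp add: rN_mult[OF ok])
  show "h1 \<oplus>\<^bsub>cF TYPE('i)\<^esub> h2 \<in> elts K" if "h1 \<in> elts K" "h2 \<in> elts K" for h1 h2
    using that add[of "rN h1" "rN h2"] unfolding K by (simp add: rN_add[OF ok])
qed

lemma subfield_K: "subfield (elts K) (cF TYPE('i))"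
proof (rule G.subfieldI'[OF subring_K])
  fix k assume "k \<in> elts K - {\<zero>\<^bsub>cF TYPE('i)\<^esub>}"
  then have k: "k \<in> carrier (cF TYPE('i))" "k \<noteq> \<zero>\<^bsub>cF TYPE('i)\<^esub>" "(rN k :: ('c, 'i) rf) \<in> fr ev ` F3" using K by auto
  have kU: "k \<in> Units (cF TYPE('i))" using k G.field_Units by blast
  have "(rN k :: ('c, 'i) rf) \<noteq> 0" using rN_eq[OF ok k(1) G.zero_closed] k(2) rN_0[OF ok] by simp
  then have "inverse (rN k :: ('c, 'i) rf) \<in> fr ev ` F3" using e.fr_inverse k(3) by blast
  then show "inv\<^bsub>cF TYPE('i)\<^esub> k \<in> elts K" unfolding K rN_inverse[OF ok k(1,2)] using G.Units_inv_closed[OF kU] by simp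
qed

text \<open>The competitor \<open>K'\<close> is a class, so containing the image of \<open>n\<close>
  is a formula and induction on \<open>SN\<close> applies; subtraction and inverses in the subfield
  then give all fractions.\<close>

lemma least_K: assumes K': "subfield (elts K') (cF TYPE('i))" shows "elts K \<subseteq> elts K'"
proof
  fix x assume x: "x \<in> elts K"
  let ?e = "ap (cE TYPE('i))"
  note sr = subringE[OF subfieldE(1)[OF K']]
  have en: "?e n \<in> elts K'" if "n \<in> SN" for n
  proof (rule SN_induct_SN[where P = "\<lambda>n. ?e n \<in> elts K'", OF _ _ _ that])
    show "Def UNIV (\<lambda>s. ?e (s 0) \<in> elts K')" by (intro defn)
    show "?e emp \<in> elts K'" using sr(2) ap_cE[OF ok SN_emp] cE(3)[OF ok] by simp
    show "?e (succ n) \<in> elts K'" if "n \<in> SN" "?e n \<in> elts K'" for n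
      using sr(7)[OF that(2) sr(3)] ap_cE[OF ok] cE(5)[OF ok] that(1) by simp
  qed
  obtain p where p0: "p \<in> F3" "(rN x :: ('c, 'i) rf) = fr ev p" using x K by blast
  obtain m n d where p: "p = (m, n, d)" "m \<in> SN" "n \<in> SN" "d \<in> SN" "0 < (ev d :: ('c, 'i) rf)" using e.F3_cases[OF p0(1)] by metis
  have C: "?e m \<in> carrier (cF TYPE('i))" "?e n \<in> carrier (cF TYPE('i))" "?e d \<in> carrier (cF TYPE('i))"
    using en_carrier[OF ok] p by simp_all
  have "(rN (?e d) :: ('c, 'i) rf) \<noteq> 0" using p(5) unfolding ev_def by simp
  then have dz: "?e d \<noteq> \<zero>\<^bsub>cF TYPE('i)\<^esub>" using rN_0[OF ok] by metis
  have iU: "inv\<^bsub>cF TYPE('i)\<^esub> (?e d) \<in> carrier (cF TYPE('i))" using dz C(3) G.field_Units G.Units_inv_closed by blast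
  let ?y = "(?e m \<oplus>\<^bsub>cF TYPE('i)\<^esub> (\<ominus>\<^bsub>cF TYPE('i)\<^esub> ?e n)) \<otimes>\<^bsub>cF TYPE('i)\<^esub> inv\<^bsub>cF TYPE('i)\<^esub> (?e d)"
  have "?e d \<in> elts K' - {\<zero>\<^bsub>cF TYPE('i)\<^esub>}" using en p(4) dz by simp
  then have "inv\<^bsub>cF TYPE('i)\<^esub> (?e d) \<in> elts K'" using G.subfield_m_inv(1)[OF K'] by blast
  then have yK: "?y \<in> elts K'" using en[OF p(2)] en[OF p(3)] sr(5,6,7) by blast
  have mn: "?e m \<oplus>\<^bsub>cF TYPE('i)\<^esub> (\<ominus>\<^bsub>cF TYPE('i)\<^esub> ?e n) \<in> carrier (cF TYPE('i))" using C by simp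
  have "(rN ?y :: ('c, 'i) rf) = (rN (?e m) + - rN (?e n)) * inverse (rN (?e d))"
    unfolding rN_inverse[OF ok C(3) dz] rN_minus[OF ok C(2)] rN_add[OF ok C(1) G.a_inv_closed[OF C(2)]] rN_mult[OF ok mn iU] by (rule refl)
  then have "(rN ?y :: ('c, 'i) rf) = rN x" unfolding p0(2) p(1) fr_triple ev_def by (simp add: divide_inverse)
  then have "?y = x" using rN_eq[OF ok G.m_closed[OF mn iU], of x] x K by simp
  then show "x \<in> elts K'" using yK by simp
qed

lemma dense_K: "dense_in K (cR TYPE('i)) (cL TYPE('i))"
  unfolding dense_in_def
proof (intro ballI impI)
  fix x y assume "x \<in> elts (cR TYPE('i))" "y \<in> elts (cR TYPE('i))" and h: "(x, y) \<in> graph (cL TYPE('i)) \<and> x \<noteq> y"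
  then have xy: "x \<in> carrier (cF TYPE('i))" "y \<in> carrier (cF TYPE('i))" using carrier_eq[OF ok] by auto
  then have "(rN x :: ('c, 'i) rf) < rN y" using h rN_le[OF ok xy] rN_eq[OF ok xy] by (simp add: less_le)
  then obtain p where p: "p \<in> F3" "(rN x :: ('c, 'i) rf) < fr ev p" "fr ev p < (rN y :: ('c, 'i) rf)" using rf_dense[OF ok] by blast
  obtain q where q: "q \<in> carrier (cF TYPE('i))" "(fr ev p :: ('c, 'i) rf) = rN q" using rN_cases[OF ok] .
  have "q \<in> elts K" unfolding K using q p(1) by (metis imageI)
  moreover have "(x, q) \<in> graph (cL TYPE('i)) \<and> x \<noteq> q \<and> (q, y) \<in> graph (cL TYPE('i)) \<and> q \<noteq> y"
    using p(2,3) rN_le[OF ok xy(1) q(1)] rN_le[OF ok q(1) xy(2)] unfolding q(2) by auto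
  ultimately show "\<exists>q\<in>elts K. (x, q) \<in> graph (cL TYPE('i)) \<and> x \<noteq> q \<and> (q, y) \<in> graph (cL TYPE('i)) \<and> q \<noteq> y" by blast
qed

text \<open>A reduced fraction is sent to the value of the same triple in the field. That this
  respects sums and products is known only for the values in the hyperrationals; since equality of
  two fractions is decided by \<open>lessF\<close> alone, such identities hold under
  \<open>qn\<close> iff they hold under \<open>ev\<close>.\<close>

lemma ex_SQ_iso: "\<exists>H. class_ring_iso H SQ ((cF TYPE('i))\<lparr>carrier := elts K\<rparr>)"
proof -
  note T = okf_field(1)[OF ok]
  define qv :: "'c \<Rightarrow> ('c, 'i) rf" where "qv q = fr ev (fst_of (fst_of q), snd_of (fst_of q), snd_of q)" for q
  have qv: "qv (pair (pair a b) d) = fr ev (a, b, d)" "qval (pair (pair a b) d) = fr qn (a, b, d)" if "(a, b, d) \<in> F3" for a b d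
  proof -
    have "a \<in> V" "b \<in> V" "d \<in> V" "a \<in> NN" "b \<in> NN" "d \<in> NN" using that SN_V SN_NN by (auto simp: F3_def)
    then show "qv (pair (pair a b) d) = fr ev (a, b, d)" "qval (pair (pair a b) d) = fr qn (a, b, d)"
      by (simp_all add: qv_def qval_pair[OF T] fr_triple)
  qed
  have SQc: "\<exists>p\<in>F3. qv q = fr ev p \<and> qval q = fr qn p" if q: "q \<in> QQ \<inter> S" for q
  proof -
    obtain a b d where abd: "q = pair (pair a b) d" "(a, b, d) \<in> F3" "a = emp \<or> b = emp" "reduced (nadd a b) d" by (rule SQ_cases[OF q])
    show ?thesis unfolding abd(1) by (rule bexI[OF _ abd(2)]) (rule conjI[OF qv[OF abd(2)]])
  qed
  have transfer: "fr ev p = (fr ev r :: ('c, 'i) rf) \<longleftrightarrow> fr qn p = fr qn r" if "p \<in> F3" "r \<in> F3" for p r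
    using e.fr_eq[OF that] q.fr_eq[OF that] by simp
  define F where "F q = (THE x. x \<in> carrier (cF TYPE('i)) \<and> rN x = qv q)" for q
  have F: "F q \<in> carrier (cF TYPE('i)) \<and> rN (F q) = qv q" for q
  proof -
    obtain x where x: "x \<in> carrier (cF TYPE('i))" "qv q = rN x" using rN_cases[OF ok] .
    have "F q = x" unfolding F_def
    proof (rule the_equality)
      show "y = x" if y: "y \<in> carrier (cF TYPE('i)) \<and> rN y = qv q" for y
        using rN_eq[OF ok conjunct1[OF y] x(1)] conjunct2[OF y] x(2) by simp
    qed (use x in simp)
    then show ?thesis using x by simp
  qed
  have F_eq: "F q = x \<longleftrightarrow> qv q = rN x" if "x \<in> carrier (cF TYPE('i))" for q x
    using rN_eq[OF ok, of "F q" x] F[of q] that by simp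
  have FK: "F q \<in> elts K" if "q \<in> QQ \<inter> S" for q
    unfolding K using SQc[OF that] F[of q] by (metis imageI)
  let ?T = "\<lambda>q x. \<exists>m\<in>V. \<exists>n\<in>V. \<exists>d\<in>V. (m \<in> SN \<and> n \<in> SN \<and> d \<in> SN) \<and> q = pair (pair m n) d \<and> tm TYPE('i) x d n = ap (cE TYPE('i)) m"
  have "\<exists>H. is_function H \<and> Domain (graph H) = QQ \<inter> S \<and> Range (graph H) \<subseteq> elts K \<and> (\<forall>x\<in>QQ \<inter> S. app H x = F x)"
  proof (rule ex_function[where T = ?T])
    show "Def UNIV (\<lambda>s. ?T (s 0) (s (Suc 0)))" unfolding tm_def by (intro defn)
    show "?T q x \<longleftrightarrow> x = F q" if q: "q \<in> QQ \<inter> S" and x: "x \<in> elts K" for q x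
    proof -
      have xC: "x \<in> carrier (cF TYPE('i))" using x K by blast
      obtain a b d where abd: "q = pair (pair a b) d" "(a, b, d) \<in> F3" "a = emp \<or> b = emp" "reduced (nadd a b) d" by (rule SQ_cases[OF q])
      then have s: "a \<in> SN" "b \<in> SN" "d \<in> SN" "a \<in> V" "b \<in> V" "d \<in> V" using SN_V by (auto simp: F3_def)
      have "?T q x \<longleftrightarrow> tm TYPE('i) x d b = ap (cE TYPE('i)) a" unfolding abd(1) using s by auto
      also have "\<dots> \<longleftrightarrow> (rN x :: ('c, 'i) rf) = qv q" unfolding abd(1) qv(1)[OF abd(2)] by (rule tm_fr(1)[OF ok xC abd(2)])
      also have "\<dots> \<longleftrightarrow> x = F q" using F_eq[OF xC, of q] by auto
      finally show ?thesis .
    qed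
  qed (simp_all add: isclass_SQ[unfolded Int_def] FK isclass_SQ)
  then obtain H where H: "is_function H" "Domain (graph H) = QQ \<inter> S" "\<And>q. q \<in> QQ \<inter> S \<Longrightarrow> app H q = F q" by blast
  have add: "rat_add q r \<in> QQ \<inter> S" "F (rat_add q r) = F q \<oplus>\<^bsub>cF TYPE('i)\<^esub> F r"
    and mult: "rat_mult q r \<in> QQ \<inter> S" "F (rat_mult q r) = F q \<otimes>\<^bsub>cF TYPE('i)\<^esub> F r" if q: "q \<in> QQ \<inter> S" and r: "r \<in> QQ \<inter> S" for q r
  proof -
    have qr: "q \<in> QQ" "r \<in> QQ" "q \<in> S" "r \<in> S" using q r by auto
    show cl: "rat_add q r \<in> QQ \<inter> S" "rat_mult q r \<in> QQ \<inter> S"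
      using rat_add[OF T qr(1,2)] rat_mult[OF T qr(1,2)] qr by auto
    obtain p where p: "p \<in> F3" "qv q = fr ev p" "qval q = fr qn p" using SQc[OF q] by blast
    obtain p' where p': "p' \<in> F3" "qv r = fr ev p'" "qval r = fr qn p'" using SQc[OF r] by blast
    obtain s where s: "s \<in> F3" "qv (rat_add q r) = fr ev s" "qval (rat_add q r) = fr qn s" using SQc[OF cl(1)] by blast
    obtain t where t: "t \<in> F3" "qv (rat_mult q r) = fr ev t" "qval (rat_mult q r) = fr qn t" using SQc[OF cl(2)] by blast
    have "fr qn s = fr qn (addF p p')" using rat_add(2)[OF T qr(1,2)] s(3) p(3) p'(3) q.fr_add(2)[OF p(1) p'(1)] by simp
    then have "qv (rat_add q r) = qv q + qv r"
      using transfer[OF s(1) e.fr_add(1)[OF p(1) p'(1)]] e.fr_add(2)[OF p(1) p'(1)] s(2) p(2) p'(2) by simp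
    then show "F (rat_add q r) = F q \<oplus>\<^bsub>cF TYPE('i)\<^esub> F r"
      using F_eq[of "F q \<oplus>\<^bsub>cF TYPE('i)\<^esub> F r"] F[of q] F[of r] rN_add[OF ok, of "F q" "F r"] by simp
    have "fr qn t = fr qn (mulF p p')" using rat_mult(2)[OF T qr(1,2)] t(3) p(3) p'(3) q.fr_mult(2)[OF p(1) p'(1)] by simp
    then have "qv (rat_mult q r) = qv q * qv r"
      using transfer[OF t(1) e.fr_mult(1)[OF p(1) p'(1)]] e.fr_mult(2)[OF p(1) p'(1)] t(2) p(2) p'(2) by simp
    then show "F (rat_mult q r) = F q \<otimes>\<^bsub>cF TYPE('i)\<^esub> F r"
      using F_eq[of "F q \<otimes>\<^bsub>cF TYPE('i)\<^esub> F r"] F[of q] F[of r] rN_mult[OF ok, of "F q" "F r"] by simp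
  qed
  have inj: "q = r" if q: "q \<in> QQ \<inter> S" and r: "r \<in> QQ \<inter> S" and "F q = F r" for q r
  proof -
    have "qv q = qv r" using F[of q] F[of r] \<open>F q = F r\<close> by metis
    moreover obtain p where p: "p \<in> F3" "qv q = fr ev p" "qval q = fr qn p" using SQc[OF q] by blast
    moreover obtain p' where p': "p' \<in> F3" "qv r = fr ev p'" "qval r = fr qn p'" using SQc[OF r] by blast
    ultimately have "qval q = qval r" using transfer[OF p(1) p'(1)] by simp
    then show ?thesis using qval_inject[OF T, of q r] q r by simp
  qed
  have surj: "\<exists>q\<in>QQ \<inter> S. F q = x" if x: "x \<in> elts K" for x
  proof -
    have xC: "x \<in> carrier (cF TYPE('i))" using x K by blast
    obtain p where p0: "p \<in> F3" "(rN x :: ('c, 'i) rf) = fr ev p" using x K by blast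
    obtain m n d where p: "p = (m, n, d)" "m \<in> SN" "n \<in> SN" "d \<in> SN" "d \<noteq> emp" using e.F3_cases[OF p0(1)] by metis
    \<comment> \<open>An element of \<open>K\<close> is given by some triple, neither in normal form
      nor reduced: \<open>int_diff\<close> normalises its numerator and \<open>frac_unique\<close>
      reduces the resulting fraction.\<close>
    obtain a b where ab: "a \<in> NN" "b \<in> NN" "a = emp \<or> b = emp" "qn a - qn b = qn m - qn n"
      using int_diff[OF T SN_NN[OF p(2)] SN_NN[OF p(3)]] by blast
    have s: "a \<in> SN \<and> b \<in> SN" by (rule int_SN[OF T ab p(2,3)])
    obtain q where q: "q \<in> QQ" "qval q = (qn a - qn b) / qn d" "a \<in> SN \<and> b \<in> SN \<and> d \<in> SN \<longrightarrow> q \<in> S"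
      using frac_unique[OF T ab(1-3) SN_NN[OF p(4)] p(5)] by blast
    have qS: "q \<in> QQ \<inter> S" using q s p(4) by simp
    obtain p' where p': "p' \<in> F3" "qv q = fr ev p'" "qval q = fr qn p'" using SQc[OF qS] by blast
    have "fr qn p' = fr qn p" using p'(3) q(2) ab(4) by (simp add: p(1) fr_triple)
    then have "qv q = rN x" using transfer[OF p'(1) p0(1)] p'(2) p0(2) by simp
    then show ?thesis using F_eq[OF xC] qS by blast
  qed
  have "app H \<in> ring_iso SQ ((cF TYPE('i))\<lparr>carrier := elts K\<rparr>)"
  proof (rule ring_iso_memI)
    show "bij_betw (app H) (carrier SQ) (carrier ((cF TYPE('i))\<lparr>carrier := elts K\<rparr>))"
      unfolding bij_betw_def
    proof
      show "inj_on (app H) (carrier SQ)"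
      proof (rule inj_onI)
        fix q r assume "q \<in> carrier SQ" "r \<in> carrier SQ" and e: "app H q = app H r"
        then have qr: "q \<in> QQ \<inter> S" "r \<in> QQ \<inter> S" by (simp_all add: SQ_def)
        show "q = r" using inj[OF qr] e unfolding H(3)[OF qr(1)] H(3)[OF qr(2)] by blast
      qed
      have "app H ` (QQ \<inter> S) = elts K"
      proof (intro equalityI subsetI)
        fix x assume "x \<in> app H ` (QQ \<inter> S)"
        then obtain q where q: "q \<in> QQ \<inter> S" "x = app H q" by blast
        show "x \<in> elts K" unfolding q(2) H(3)[OF q(1)] by (rule FK[OF q(1)])
      next
        fix x assume "x \<in> elts K"
        then obtain q where q: "q \<in> QQ \<inter> S" "F q = x" using surj by blast
        show "x \<in> app H ` (QQ \<inter> S)" using q(1) unfolding q(2)[symmetric] H(3)[OF q(1), symmetric] by (rule imageI)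
      qed
      then show "app H ` carrier SQ = carrier ((cF TYPE('i))\<lparr>carrier := elts K\<rparr>)" by (simp add: SQ_def)
    qed
    have "F (pair (pair (succ emp) emp) (succ emp)) = \<one>\<^bsub>cF TYPE('i)\<^esub>"
      using F_eq[OF G.one_closed] qv(1) e.fr_1 zeroF_oneF(2) rN_1[OF ok] unfolding oneF_def by simp
    then show "app H \<one>\<^bsub>SQ\<^esub> = \<one>\<^bsub>(cF TYPE('i))\<lparr>carrier := elts K\<rparr>\<^esub>" using H(3)[OF one_SQ] by (simp add: SQ_def)
    fix x y assume "x \<in> carrier SQ"
    then have x: "x \<in> QQ \<inter> S" by (simp add: SQ_def)
    then show "app H x \<in> carrier ((cF TYPE('i))\<lparr>carrier := elts K\<rparr>)" using H(3) FK by simp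
    assume "y \<in> carrier SQ"
    then have y: "y \<in> QQ \<inter> S" by (simp add: SQ_def)
    show "app H (x \<otimes>\<^bsub>SQ\<^esub> y) = app H x \<otimes>\<^bsub>(cF TYPE('i))\<lparr>carrier := elts K\<rparr>\<^esub> app H y"
      using H(3)[OF mult(1)[OF x y]] mult(2)[OF x y] H(3)[OF x] H(3)[OF y] by (simp add: SQ_def)
    show "app H (x \<oplus>\<^bsub>SQ\<^esub> y) = app H x \<oplus>\<^bsub>(cF TYPE('i))\<lparr>carrier := elts K\<rparr>\<^esub> app H y"
      using H(3)[OF add(1)[OF x y]] add(2)[OF x y] H(3)[OF x] H(3)[OF y] by (simp add: SQ_def)
  qed
  then have "class_ring_iso H SQ ((cF TYPE('i))\<lparr>carrier := elts K\<rparr>)"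
    unfolding class_ring_iso_def using H(1,2) by (simp add: SQ_def)
  then show ?thesis by blast
qed

end

lemma goal2_rf: "goal2 mem0 (cR TYPE('i)) (cA TYPE('i)) (cM TYPE('i)) (cL TYPE('i) :: 'c)"
proof -
  obtain K where K: "\<And>x. x \<in> elts K \<longleftrightarrow> x \<in> carrier (cF TYPE('i)) \<and> (rN x :: ('c, 'i) rf) \<in> fr ev ` F3"
    using ex_prime_class by blast
  have "prime_subfield K (cF TYPE('i))" unfolding prime_subfield_def using subfield_K[OF K] least_K[OF K] by blast
  then show ?thesis unfolding goal2_def cF_def[symmetric] using ex_SQ_iso[OF K] dense_K[OF K] by blast
qed

end

text \<open>Two elements are related when they cut the standard fractions in the same way; this relation is
  the isomorphism between two fields of real numbers.\<close>

definition rel :: "('c, 'i) rf \<Rightarrow> ('c, 'j) rf \<Rightarrow> bool" where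
  "rel x y \<longleftrightarrow> (\<forall>p\<in>THS.F3 mem0. fr ev p < x \<longleftrightarrow> fr ev p < y)"

lemma rel_sym: "rel x y \<longleftrightarrow> rel y x"
  unfolding rel_def by auto

section \<open>Uniqueness up to isomorphism\<close>

context
  fixes i :: "'i itself" and j :: "'j itself" and c :: "'c itself"
  assumes oki: "okf TYPE('c) TYPE('i)" and okj: "okf TYPE('c) TYPE('j)"
begin

interpretation THS "mem0 :: 'c \<Rightarrow> 'c \<Rightarrow> bool" by (rule okf_field(1)[OF oki])
interpretation e: SN_embedding mem0 "ev :: 'c \<Rightarrow> ('c, 'i) rf" by (rule ev_embedding[OF oki])
interpretation f: SN_embedding mem0 "ev :: 'c \<Rightarrow> ('c, 'j) rf" by (rule ev_embedding[OF okj])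

lemma rel_less:
  fixes x x' :: "('c, 'i) rf" and y y' :: "('c, 'j) rf"
  assumes "rel x y" "rel x' y'" shows "x < x' \<longleftrightarrow> y < y'"
proof
  assume "x < x'"
  then obtain p where p: "p \<in> F3" "x < fr ev p" "fr ev p < x'" using rf_dense[OF oki] by blast
  then have "fr ev p < y'" "\<not> fr ev p < y" using assms unfolding rel_def by auto
  then show "y < y'" by simp
next
  assume "y < y'"
  then obtain p where p: "p \<in> F3" "y < fr ev p" "fr ev p < y'" using rf_dense[OF okj] by blast
  then have "fr ev p < x'" "\<not> fr ev p < x" using assms unfolding rel_def by auto
  then show "x < x'" by simp
qed

lemma rel_eq:
  fixes x x' :: "('c, 'i) rf" and y y' :: "('c, 'j) rf"
  assumes "rel x y" "rel x' y'" shows "x = x' \<longleftrightarrow> y = y'"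
  using rel_less[OF assms] rel_less[OF assms(2,1)] by (auto simp: neq_iff)

text \<open>The partner of \<open>x\<close> is the supremum, in the other field, of the fractions
  that lie below \<open>x\<close>. By density each of these is exceeded by another one, so all of
  them are strictly below the supremum, as the definition of \<open>rel\<close> asks.\<close>

lemma rel_ex: "\<exists>y :: ('c, 'j) rf. rel (x :: ('c, 'i) rf) y"
proof -
  obtain x0 where x0: "x0 \<in> carrier (cF TYPE('i))" "x = rN x0" using rN_cases[OF oki] .
  let ?X = "{y \<in> elts (cR TYPE('j)). \<exists>m\<in>V. \<exists>n\<in>V. \<exists>d\<in>V. (m \<in> SN \<and> n \<in> SN \<and> d \<in> SN \<and> d \<noteq> emp) \<and>
    pair (tm TYPE('i) x0 d n) (ap (cE TYPE('i)) m) \<notin> elts (cL TYPE('i)) \<and> tm TYPE('j) y d n = ap (cE TYPE('j)) m}"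
  have X: "y \<in> ?X \<longleftrightarrow> y \<in> carrier (cF TYPE('j)) \<and> (\<exists>p\<in>F3. fr ev p < x \<and> (rN y :: ('c, 'j) rf) = fr ev p)" for y
  proof (cases "y \<in> carrier (cF TYPE('j))")
    case True
    have "y \<in> ?X \<longleftrightarrow> (\<exists>m n d. (m, n, d) \<in> F3 \<and> pair (tm TYPE('i) x0 d n) (ap (cE TYPE('i)) m) \<notin> elts (cL TYPE('i)) \<and>
        tm TYPE('j) y d n = ap (cE TYPE('j)) m)"
      unfolding mem_Collect_eq bex_F3 using True carrier_eq[OF okj] by simp
    also have "\<dots> \<longleftrightarrow> (\<exists>m n d. (m, n, d) \<in> F3 \<and> fr ev (m, n, d) < x \<and> (rN y :: ('c, 'j) rf) = fr ev (m, n, d))"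
      using tm_fr(2)[OF oki x0(1)] tm_fr(1)[OF okj True] by (simp add: x0(2) not_le cong: conj_cong)
    also have "\<dots> \<longleftrightarrow> (\<exists>p\<in>F3. fr ev p < x \<and> (rN y :: ('c, 'j) rf) = fr ev p)"
      unfolding Bex_def split_paired_Ex by (rule refl)
    finally show ?thesis using True by simp
  qed (simp add: carrier_eq[OF okj])
  have ub: "(\<forall>y\<in>?X. rN y \<le> t) \<longleftrightarrow> (\<forall>p\<in>F3. fr ev p < x \<longrightarrow> fr ev p \<le> t)" for t :: "('c, 'j) rf"
  proof
    assume l: "\<forall>y\<in>?X. rN y \<le> t"
    show "\<forall>p\<in>F3. fr ev p < x \<longrightarrow> fr ev p \<le> t"
    proof (intro ballI impI)
      fix p assume p: "p \<in> F3" "fr ev p < x"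
      obtain y where y: "y \<in> carrier (cF TYPE('j))" "(fr ev p :: ('c, 'j) rf) = rN y" using rN_cases[OF okj] .
      have yX: "y \<in> ?X" unfolding X by (intro conjI bexI[OF _ p(1)] y(1) p(2) y(2)[symmetric])
      show "fr ev p \<le> t" unfolding y(2) by (rule bspec[OF l yX])
    qed
  next
    assume r: "\<forall>p\<in>F3. fr ev p < x \<longrightarrow> fr ev p \<le> t"
    show "\<forall>y\<in>?X. rN y \<le> t"
    proof
      fix y assume "y \<in> ?X"
      then obtain p where "p \<in> F3" "fr ev p < x" "(rN y :: ('c, 'j) rf) = fr ev p" unfolding X by blast
      then show "rN y \<le> t" using r by simp
    qed
  qed
  obtain p0 where p0: "p0 \<in> F3" "x < fr ev p0" using rf_dense[OF oki, of x "x + 1"] by auto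
  obtain p1 where p1: "p1 \<in> F3" "fr ev p1 < x" using rf_dense[OF oki, of "x - 1" x] by auto
  obtain y1 where y1: "y1 \<in> carrier (cF TYPE('j))" "(fr ev p1 :: ('c, 'j) rf) = rN y1" using rN_cases[OF okj] .
  have less: "(fr ev p :: ('c, 'i) rf) < fr ev q \<longleftrightarrow> (fr ev p :: ('c, 'j) rf) < fr ev q" if "p \<in> F3" "q \<in> F3" for p q
    using e.fr_less[OF that] f.fr_less[OF that] by simp
  have "\<exists>s :: ('c, 'j) rf. (\<forall>y\<in>?X. rN y \<le> s) \<and> (\<forall>b. (\<forall>y\<in>?X. rN y \<le> b) \<longrightarrow> s \<le> b)"
  proof (rule rf_sup[OF okj])
    show "isclass ?X" unfolding tm_def by (intro isclass_Collect isclass_elts defn)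
    show "?X \<subseteq> carrier (cF TYPE('j))" using carrier_eq[OF okj] by blast
    have "y1 \<in> ?X" unfolding X by (intro conjI bexI[OF _ p1(1)] y1(1) p1(2) y1(2)[symmetric])
    then show "?X \<noteq> {}" by blast
    show "\<forall>y\<in>?X. rN y \<le> (fr ev p0 :: ('c, 'j) rf)" unfolding ub
    proof (intro ballI impI)
      fix p assume "p \<in> F3" "fr ev p < x"
      then have "(fr ev p :: ('c, 'j) rf) < fr ev p0" using less[of p p0] p0 by simp
      then show "(fr ev p :: ('c, 'j) rf) \<le> fr ev p0" by simp
    qed
  qed
  then obtain s :: "('c, 'j) rf" where s: "\<forall>p\<in>F3. fr ev p < x \<longrightarrow> fr ev p \<le> s"
    "\<And>b. \<forall>p\<in>F3. fr ev p < x \<longrightarrow> fr ev p \<le> b \<Longrightarrow> s \<le> b" unfolding ub by blast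
  have "rel x s" unfolding rel_def
  proof (intro ballI iffI)
    fix p assume p: "p \<in> F3" "fr ev p < x"
    then obtain q where q: "q \<in> F3" "fr ev p < (fr ev q :: ('c, 'i) rf)" "fr ev q < x" using rf_dense[OF oki] by blast
    then have "fr ev p < (fr ev q :: ('c, 'j) rf)" using less p(1) by blast
    then show "fr ev p < s" using s(1) q by fastforce
  next
    fix p assume p: "p \<in> F3" "fr ev p < s"
    then have "\<not> s \<le> fr ev p" by simp
    then obtain q where q: "q \<in> F3" "fr ev q < x" "\<not> fr ev q \<le> (fr ev p :: ('c, 'j) rf)" using s(2) by blast
    then have "(fr ev p :: ('c, 'i) rf) < fr ev q" using less[OF p(1) q(1)] by simp
    then show "fr ev p < x" using q(2) by simp
  qed
  then show ?thesis by blast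
qed

end

context
  fixes i :: "'i itself" and j :: "'j itself" and c :: "'c itself"
  assumes oki: "okf TYPE('c) TYPE('i)" and okj: "okf TYPE('c) TYPE('j)"
begin

interpretation THS "mem0 :: 'c \<Rightarrow> 'c \<Rightarrow> bool" by (rule okf_field(1)[OF oki])
interpretation e: SN_embedding mem0 "ev :: 'c \<Rightarrow> ('c, 'i) rf" by (rule ev_embedding[OF oki])
interpretation f: SN_embedding mem0 "ev :: 'c \<Rightarrow> ('c, 'j) rf" by (rule ev_embedding[OF okj])

lemma rel_0: "rel (0 :: ('c, 'i) rf) (0 :: ('c, 'j) rf)"
  unfolding rel_def using e.fr_less[OF _ zeroF_oneF(1)] f.fr_less[OF _ zeroF_oneF(1)] by (simp add: e.fr_0 f.fr_0)

lemma rel_1: "rel (1 :: ('c, 'i) rf) (1 :: ('c, 'j) rf)"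
  unfolding rel_def using e.fr_less[OF _ zeroF_oneF(2)] f.fr_less[OF _ zeroF_oneF(2)] by (simp add: e.fr_1 f.fr_1)

lemma rel_add:
  fixes x x' :: "('c, 'i) rf" and y y' :: "('c, 'j) rf"
  assumes "rel x y" "rel x' y'" shows "rel (x + x') (y + y')"
  unfolding rel_def
proof
  fix p :: "'c \<times> 'c \<times> 'c" assume p: "p \<in> F3"
  show "fr ev p < x + x' \<longleftrightarrow> fr ev p < y + y'"
    unfolding less_add_iff[OF oki p] less_add_iff[OF okj p] using assms unfolding rel_def by (intro bex_cong refl) auto
qed

text \<open>Lower cuts do not pass directly to negatives. Instead a partner \<open>z\<close> of
  \<open>- x\<close> is taken; \<open>z + y\<close> is then a partner of 0, and partners are
  unique.\<close>

lemma rel_minus: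
  fixes x :: "('c, 'i) rf" and y :: "('c, 'j) rf"
  assumes "rel x y" shows "rel (- x) (- y)"
proof -
  obtain z :: "('c, 'j) rf" where z: "rel (- x) z" using rel_ex[OF oki okj] by blast
  have "rel (0 :: ('c, 'i) rf) (z + y)" using rel_add[OF z assms] by simp
  from rel_eq[OF oki okj this rel_0] have "z + y = 0" by simp
  then have "z = - y" by (simp add: eq_neg_iff_add_eq_0)
  then show ?thesis using z by simp
qed

lemma rel_mult_pos:
  fixes x x' :: "('c, 'i) rf" and y y' :: "('c, 'j) rf"
  assumes "rel x y" "rel x' y'" "0 < x" "0 < x'" shows "rel (x * x') (y * y')"
  unfolding rel_def
proof
  have y: "0 < y" "0 < y'" using rel_less[OF oki okj rel_0] assms by simp_all
  fix p :: "'c \<times> 'c \<times> 'c" assume p: "p \<in> F3"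
  show "fr ev p < x * x' \<longleftrightarrow> fr ev p < y * y'"
    unfolding less_mult_iff[OF oki p assms(3,4)] less_mult_iff[OF okj p y] using assms(1,2) unfolding rel_def by (intro bex_cong refl) auto
qed

text \<open>\<open>rel_mult_pos\<close> covers positive factors; zero and negative factors reduce to
  it through \<open>rel_minus\<close>, one factor at a time.\<close>

lemma rel_mult:
  fixes x x' :: "('c, 'i) rf" and y y' :: "('c, 'j) rf"
  assumes "rel x y" "rel x' y'" shows "rel (x * x') (y * y')"
proof -
  have zero: "y = 0" if "rel (0 :: ('c, 'i) rf) y" for y :: "('c, 'j) rf"
    using rel_eq[OF oki okj rel_0 that] by simp
  have gen: "rel (x * x') (y * y')" if x: "0 < x" "rel x y" and x': "rel x' y'" for x x' :: "('c, 'i) rf" and y y' :: "('c, 'j) rf"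
  proof -
    consider "0 < x'" | "x' = 0" | "0 < - x'" by (metis neg_0_less_iff_less linorder_cases)
    then show ?thesis
    proof cases
      case 1
      show ?thesis by (rule rel_mult_pos[OF x(2) x' x(1) 1])
    next
      case 2
      then have "y' = 0" using zero[of y'] x' by simp
      then show ?thesis using 2 rel_0 by simp
    next
      case 3
      have "rel (x * - x') (y * - y')" by (rule rel_mult_pos[OF x(2) rel_minus[OF x'] x(1) 3])
      from rel_minus[OF this] show ?thesis by simp
    qed
  qed
  consider "0 < x" | "x = 0" | "0 < - x" by (metis neg_0_less_iff_less linorder_cases)
  then show ?thesis
  proof cases
    case 1
    show ?thesis by (rule gen[OF 1 assms])
  next
    case 2
    then have "y = 0" using zero[of y] assms(1) by simp
    then show ?thesis using 2 rel_0 by simp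
  next
    case 3
    have "rel (- x * x') (- y * y')" by (rule gen[OF 3 rel_minus[OF assms(1)] assms(2)])
    from rel_minus[OF this] show ?thesis by simp
  qed
qed

lemma ex_isomorphism: "isomorphic_ordered_fields (cR TYPE('i)) (cA TYPE('i)) (cM TYPE('i)) (cL TYPE('i) :: 'c)
  (cR TYPE('j)) (cA TYPE('j)) (cM TYPE('j)) (cL TYPE('j))"
proof -
  interpret Gi: field "cF TYPE('i) :: 'c ring" by (rule okf_field(2)[OF oki])
  interpret Gj: field "cF TYPE('j) :: 'c ring" by (rule okf_field(2)[OF okj])
  let ?r = "\<lambda>x y. rel (rN x :: ('c, 'i) rf) (rN y :: ('c, 'j) rf)"
  \<comment> \<open>The membership in \<open>cL\<close> says that \<open>x\<close> is at most the
    fraction, the negation of the comparison in \<open>rel\<close>; equivalence of the negations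
    amounts to the same.\<close>
  let ?T = "\<lambda>x y. \<forall>m\<in>V. \<forall>n\<in>V. \<forall>d\<in>V. (m \<in> SN \<and> n \<in> SN \<and> d \<in> SN \<and> d \<noteq> emp) \<longrightarrow>
    (pair (tm TYPE('i) x d n) (ap (cE TYPE('i)) m) \<in> elts (cL TYPE('i)) \<longleftrightarrow>
     pair (tm TYPE('j) y d n) (ap (cE TYPE('j)) m) \<in> elts (cL TYPE('j)))"
  have T: "?T x y \<longleftrightarrow> ?r x y" if x: "x \<in> carrier (cF TYPE('i))" and y: "y \<in> carrier (cF TYPE('j))" for x y
  proof -
    have "?T x y \<longleftrightarrow> (\<forall>m n d. (m, n, d) \<in> F3 \<longrightarrow> (pair (tm TYPE('i) x d n) (ap (cE TYPE('i)) m) \<in> elts (cL TYPE('i)) \<longleftrightarrow>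
     pair (tm TYPE('j) y d n) (ap (cE TYPE('j)) m) \<in> elts (cL TYPE('j))))"
      by (rule ball_F3)
    also have "\<dots> \<longleftrightarrow> (\<forall>m n d. (m, n, d) \<in> F3 \<longrightarrow> (fr ev (m, n, d) < (rN x :: ('c, 'i) rf) \<longleftrightarrow> fr ev (m, n, d) < (rN y :: ('c, 'j) rf)))"
      using tm_fr(2)[OF oki x] tm_fr(2)[OF okj y] by (simp add: not_le[symmetric] cong: imp_cong)
    also have "\<dots> \<longleftrightarrow> ?r x y" unfolding rel_def Ball_def split_paired_All by (rule refl)
    finally show ?thesis .
  qed
  define h where "h x = (THE y. y \<in> carrier (cF TYPE('j)) \<and> ?r x y)" for x
  have h_eq: "y = h x" if "y \<in> carrier (cF TYPE('j))" "?r x y" for x y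
    unfolding h_def
  proof (rule the_equality[symmetric])
    show "y' = y" if y': "y' \<in> carrier (cF TYPE('j)) \<and> ?r x y'" for y'
      using rel_eq[OF oki okj conjunct2[OF y'] \<open>?r x y\<close>] rN_eq[OF okj conjunct1[OF y'] \<open>y \<in> carrier (cF TYPE('j))\<close>] by simp
  qed (use that in blast)
  have h: "h x \<in> carrier (cF TYPE('j)) \<and> ?r x (h x)" for x
  proof -
    obtain z :: "('c, 'j) rf" where z: "rel (rN x :: ('c, 'i) rf) z" using rel_ex[OF oki okj] by blast
    obtain y where y: "y \<in> carrier (cF TYPE('j))" "z = rN y" using rN_cases[OF okj] .
    then show ?thesis using h_eq[of y x] z by simp
  qed
  have "\<exists>H. is_function H \<and> Domain (graph H) = elts (cR TYPE('i)) \<and> Range (graph H) \<subseteq> elts (cR TYPE('j)) \<and> (\<forall>x\<in>elts (cR TYPE('i)). app H x = h x)"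
  proof (rule ex_function[where T = ?T])
    show "Def UNIV (\<lambda>s. ?T (s 0) (s (Suc 0)))" unfolding tm_def by (intro defn)
    show "?T x y \<longleftrightarrow> y = h x" if "x \<in> elts (cR TYPE('i))" "y \<in> elts (cR TYPE('j))" for x y
    proof -
      have xy: "x \<in> carrier (cF TYPE('i))" "y \<in> carrier (cF TYPE('j))" using that carrier_eq[OF oki] carrier_eq[OF okj] by simp_all
      show ?thesis unfolding T[OF xy] using h_eq[OF xy(2), of x] h[of x] by auto
    qed
  qed (use h carrier_eq[OF okj] in simp_all)
  then obtain H where H: "is_function H" "Domain (graph H) = carrier (cF TYPE('i))" "\<And>x. x \<in> carrier (cF TYPE('i)) \<Longrightarrow> app H x = h x"
    unfolding carrier_eq[OF oki] by blast
  have "app H \<in> ring_iso (cF TYPE('i)) (cF TYPE('j))"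
  proof (rule ring_iso_memI)
    show "app H \<one>\<^bsub>cF TYPE('i)\<^esub> = \<one>\<^bsub>cF TYPE('j)\<^esub>"
      using h_eq[OF Gj.one_closed, of "\<one>\<^bsub>cF TYPE('i)\<^esub>"] rel_1 H(3)[OF Gi.one_closed] rN_1[OF oki] rN_1[OF okj] by simp
    fix x y :: 'c assume x: "x \<in> carrier (cF TYPE('i))"
    show "app H x \<in> carrier (cF TYPE('j))" using H(3)[OF x] h by simp
    assume y: "y \<in> carrier (cF TYPE('i))"
    have hC: "h x \<in> carrier (cF TYPE('j))" "h y \<in> carrier (cF TYPE('j))" and r: "?r x (h x)" "?r y (h y)" using h by simp_all
    have "?r (x \<otimes>\<^bsub>cF TYPE('i)\<^esub> y) (h x \<otimes>\<^bsub>cF TYPE('j)\<^esub> h y)"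
      unfolding rN_mult[OF oki x y, symmetric] rN_mult[OF okj hC, symmetric] by (rule rel_mult[OF r])
    from h_eq[OF Gj.m_closed[OF hC] this] show "app H (x \<otimes>\<^bsub>cF TYPE('i)\<^esub> y) = app H x \<otimes>\<^bsub>cF TYPE('j)\<^esub> app H y"
      using H(3)[OF Gi.m_closed[OF x y]] H(3)[OF x] H(3)[OF y] by simp
    have "?r (x \<oplus>\<^bsub>cF TYPE('i)\<^esub> y) (h x \<oplus>\<^bsub>cF TYPE('j)\<^esub> h y)"
      unfolding rN_add[OF oki x y, symmetric] rN_add[OF okj hC, symmetric] by (rule rel_add[OF r])
    from h_eq[OF Gj.a_closed[OF hC] this] show "app H (x \<oplus>\<^bsub>cF TYPE('i)\<^esub> y) = app H x \<oplus>\<^bsub>cF TYPE('j)\<^esub> app H y"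
      using H(3)[OF Gi.a_closed[OF x y]] H(3)[OF x] H(3)[OF y] by simp
  next
    show "bij_betw (app H) (carrier (cF TYPE('i))) (carrier (cF TYPE('j)))"
      unfolding bij_betw_def
    proof
      show "inj_on (app H) (carrier (cF TYPE('i)))"
      proof (rule inj_onI)
        fix x y :: 'c assume xy: "x \<in> carrier (cF TYPE('i))" "y \<in> carrier (cF TYPE('i))" and "app H x = app H y"
        then have e: "h x = h y" using H(3) by simp
        have "?r x (h y)" using conjunct2[OF h[of x]] unfolding e .
        from rel_eq[OF oki okj this conjunct2[OF h[of y]]] have "(rN x :: ('c, 'i) rf) = rN y" by simp
        then show "x = y" using rN_eq[OF oki xy] by simp
      qed
      show "app H ` carrier (cF TYPE('i)) = carrier (cF TYPE('j))"
      proof (intro equalityI subsetI)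
        fix y assume "y \<in> app H ` carrier (cF TYPE('i))"
        then show "y \<in> carrier (cF TYPE('j))" using H(3) h by auto
      next
        fix y :: 'c assume y: "y \<in> carrier (cF TYPE('j))"
        obtain z :: "('c, 'i) rf" where z: "rel (rN y :: ('c, 'j) rf) z" using rel_ex[OF okj oki] by blast
        obtain x where x: "x \<in> carrier (cF TYPE('i))" "z = rN x" using rN_cases[OF oki] .
        have "?r x y" using z unfolding x(2) by (subst rel_sym)
        then have "y = app H x" using h_eq[OF y] H(3)[OF x(1)] by simp
        then show "y \<in> app H ` carrier (cF TYPE('i))" using x(1) by blast
      qed
    qed
  qed
  then have iso: "class_ring_iso H (cF TYPE('i)) (cF TYPE('j))" unfolding class_ring_iso_def using H(1,2) by simp
  have "(x, y) \<in> graph (cL TYPE('i)) \<longleftrightarrow> (app H x, app H y) \<in> graph (cL TYPE('j))"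
    if x: "x \<in> carrier (cF TYPE('i))" and y: "y \<in> carrier (cF TYPE('i))" for x y
  proof -
    have hC: "h x \<in> carrier (cF TYPE('j))" "h y \<in> carrier (cF TYPE('j))" and r: "?r x (h x)" "?r y (h y)" using h by simp_all
    have "(x, y) \<in> graph (cL TYPE('i)) \<longleftrightarrow> \<not> (rN y :: ('c, 'i) rf) < rN x" using rN_le[OF oki x y] by (simp add: not_less)
    also have "\<dots> \<longleftrightarrow> \<not> (rN (h y) :: ('c, 'j) rf) < rN (h x)" using rel_less[OF oki okj r(2,1)] by simp
    also have "\<dots> \<longleftrightarrow> (h x, h y) \<in> graph (cL TYPE('j))" using rN_le[OF okj hC] by (simp add: not_less)
    finally show ?thesis using H(3) x y by simp
  qed
  then show ?thesis
    unfolding isomorphic_ordered_fields_def cF_def[symmetric] carrier_eq[OF oki, symmetric] using iso by blast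
qed

end

section \<open>Conclusion\<close>

lemma no_counterex: "\<not> counterex (x :: ('c \<Rightarrow> 'c \<Rightarrow> bool) \<times> (bool \<Rightarrow> 'c fstruct))"
proof
  assume "counterex x"
  then have "counterex (SOME x :: ('c \<Rightarrow> 'c \<Rightarrow> bool) \<times> (bool \<Rightarrow> 'c fstruct). counterex x)" by (rule someI)
  then have c: "counterex (mem0 :: 'c \<Rightarrow> 'c \<Rightarrow> bool, fields0)" unfolding mem0_def fields0_def by simp
  then have T: "THS (mem0 :: 'c \<Rightarrow> 'c \<Rightarrow> bool)" by (simp add: counterex_def)
  have F: "\<forall>i. is_real_field mem0 (fields0 i :: 'c fstruct)" and no: "\<not> goal3 (mem0 :: 'c \<Rightarrow> 'c \<Rightarrow> bool) fields0"
    using c goal1[OF T] by (simp_all add: counterex_def)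
  have b: "\<exists>x y :: bool. x \<noteq> y" and u: "\<not> (\<exists>x y :: unit. x \<noteq> y)" by auto
  have t: "cst TYPE(bool) = (fields0 True :: 'c fstruct)" "cst TYPE(unit) = (fields0 False :: 'c fstruct)"
    unfolding cst_def using b u by (simp_all only: simp_thms)
  have okb: "okf TYPE('c) TYPE(bool)" and oku: "okf TYPE('c) TYPE(unit)"
    using T F[rule_format, of True] F[rule_format, of False]
    by (simp_all add: okf_def is_real_field_def cR_def cA_def cM_def cL_def t split_def)
  have "goal3 (mem0 :: 'c \<Rightarrow> 'c \<Rightarrow> bool) fields0"
    using goal2_rf[OF okb] ex_isomorphism[OF okb oku] unfolding goal3_def cR_def cA_def cM_def cL_def t by (simp add: split_def)
  then show False using no by contradiction
qed

theorem theorem5: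
  fixes mem :: "'c \<Rightarrow> 'c \<Rightarrow> bool"
  assumes "THS mem"
  shows "(\<exists>R A M L. class_structure.thin mem R \<and> class_structure.real_number_field mem R A M L)
    \<and> (\<forall>R A M L. class_structure.real_number_field mem R A M L \<longrightarrow>
         (\<exists>K. class_structure.prime_subfield mem K (class_structure.ring_of mem R A M)
            \<and> (\<exists>H. class_structure.class_ring_iso mem H (class_structure.SQ mem)
                 ((class_structure.ring_of mem R A M)\<lparr>carrier := class_structure.elts mem K\<rparr>))
            \<and> class_structure.dense_in mem K R L))
    \<and> (\<forall>R A M L R' A' M' L'.
         class_structure.real_number_field mem R A M L \<and>
         class_structure.real_number_field mem R' A' M' L' \<longrightarrow>
         class_structure.isomorphic_ordered_fields mem R A M L R' A' M' L')"
proof (intro conjI allI impI)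
  \<comment> \<open>A failure of the first part makes \<open>mem\<close> a counterexample with any
    pair of fields, so \<open>undefined\<close> may stand for them.\<close>
  show "\<exists>R A M L. class_structure.thin mem R \<and> class_structure.real_number_field mem R A M L"
    using no_counterex[of "(mem, undefined)"] assms by (simp add: counterex_def goal1_def)
next
  fix R A M L assume "class_structure.real_number_field mem R A M L"
  \<comment> \<open>The constant pair: both fields are the given one, and the statement about the
    first of them is extracted.\<close>
  then have "goal3 mem (\<lambda>_. (R, A, M, L))"
    using no_counterex[of "(mem, \<lambda>_. (R, A, M, L))"] assms by (simp add: counterex_def is_real_field_def)
  then show "\<exists>K. class_structure.prime_subfield mem K (class_structure.ring_of mem R A M)
            \<and> (\<exists>H. class_structure.class_ring_iso mem H (class_structure.SQ mem)
                 ((class_structure.ring_of mem R A M)\<lparr>carrier := class_structure.elts mem K\<rparr>))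
            \<and> class_structure.dense_in mem K R L"
    unfolding goal3_def goal2_def by simp
next
  fix R A M L R' A' M' L'
  assume "class_structure.real_number_field mem R A M L \<and> class_structure.real_number_field mem R' A' M' L'"
  then have "\<forall>b. is_real_field mem (if b then (R, A, M, L) else (R', A', M', L'))" by (simp add: is_real_field_def)
  then have "goal3 mem (\<lambda>b. if b then (R, A, M, L) else (R', A', M', L'))"
    using no_counterex[of "(mem, \<lambda>b. if b then (R, A, M, L) else (R', A', M', L'))"] assms
    unfolding counterex_def case_prod_conv by blast
  then show "class_structure.isomorphic_ordered_fields mem R A M L R' A' M' L'"
    unfolding goal3_def by simp
qed

end
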